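(* Let $(\Omega,\mathbb{P}_1)$ be a probability space and let $(\theta_t)_{t\in\mathbb{N}}$ be real random variables on $\Omega$ with compact support, symmetric, identically distributed and independent. When $L\in\mathscr{S}_2$ is distributed according to $\mu_2$ and $\omega\in\Omega$ according to $\mathbb{P}_1$ (that is, $(\omega,L)$ has law $\mathbb{P}_1\otimes\mu_2$), the random variable $$S(\omega,L,T)=\frac1T\sum_{t=0}^{T-1}\frac{\theta_t(\omega)}{\lVert\delta_t L\rVert^{2}}$$ converges in law, as $T\to\infty$ ($T$ a positive integer), to a centered Cauchy law.
   Context: $\mathscr{S}_2=SL_2(\mathbb{R})/SL_2(\mathbb{Z})$ is the space of unimodular lattices of $\mathbb{R}^2$ and $\mu_2$ is its Haar probability measure. $\delta_t=\begin{pmatrix}e^t&0\\0&e^{-t}\end{pmatrix}$. For a lattice $L$, $\lVert L\rVert=\inf\{\lVert l\rVert : l\in L\setminus\{0\}\}$, where $\lVert\cdot\rVert$ is the Euclidean norm on $\mathbb{R}^2$. A real random variable $\theta$ is symmetric if $\theta$ and $-\theta$ have the same law; it has compact support if its law does. *)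

theory Defs
  imports "HOL-Probability.Probability"
begin

section \<open>Unimodular lattices of the plane\<close>

definition SL2R :: "(real^2^2) set" where
  "SL2R = {g. det g = 1}"

definition SL2Z :: "(real^2^2) set" where
  "SL2Z = {g \<in> SL2R. \<forall>i j. g $ i $ j \<in> \<int>}"

definition Z2 :: "(real^2) set" where
  "Z2 = {v. \<forall>i. v $ i \<in> \<int>}"

definition act :: "real^2^2 \<Rightarrow> (real^2) set \<Rightarrow> (real^2) set" where
  "act g L = (\<lambda>v. g *v v) ` L"

text \<open>
  The class of \<open>g\<close> in \<open>SL\<^sub>2(R)/SL\<^sub>2(Z)\<close> is represented by the lattice \<open>g Z\<^sup>2\<close>;
  lemma \<open>act_Z2_eq_iff\<close> below shows that this identifies the set of cosets with \<open>unimodular_lattices\<close>.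
\<close>

definition unimodular_lattices :: "(real^2) set set" where
  "unimodular_lattices = (\<lambda>g. act g Z2) ` SL2R"

lemma act_mult: "act (g ** h) L = act g (act h L)"
  by (simp add: act_def image_image matrix_vector_mul_assoc)

lemma SL2Z_inverse:
  assumes "c \<in> SL2Z"
  obtains d where "d \<in> SL2Z" "c ** d = mat 1" "d ** c = mat 1"
proof -
  define d :: "real^2^2" where
    "d = vector [vector [c$2$2, - c$1$2], vector [- c$2$1, c$1$1]]"
  have c: "c$1$1 * c$2$2 - c$1$2 * c$2$1 = 1" "\<And>i j. c$i$j \<in> \<int>"
    using assms by (auto simp: SL2Z_def SL2R_def det_2)
  have "d \<in> SL2Z"
    using c by (auto simp: SL2Z_def SL2R_def det_2 d_def forall_2 algebra_simps)
  moreover have "c ** d = mat 1"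
    using c(1) by (auto simp: vec_eq_iff forall_2 matrix_matrix_mult_def sum_2 d_def mat_def algebra_simps)
  moreover have "d ** c = mat 1"
    using c(1) by (auto simp: vec_eq_iff forall_2 matrix_matrix_mult_def sum_2 d_def mat_def algebra_simps)
  ultimately show ?thesis using that by blast
qed

lemma act_SL2Z_Z2: "c \<in> SL2Z \<Longrightarrow> act c Z2 = Z2"
proof -
  have sub: "act c Z2 \<subseteq> Z2" if "c \<in> SL2Z" for c
    using that by (auto simp: SL2Z_def act_def Z2_def matrix_vector_mult_def sum_2)
  assume c: "c \<in> SL2Z"
  then obtain d where d: "d \<in> SL2Z" "c ** d = mat 1" by (rule SL2Z_inverse)
  have "Z2 = act c (act d Z2)"
    using d(2) by (simp flip: act_mult) (simp add: act_def)
  also have "\<dots> \<subseteq> act c Z2"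
    using sub[OF d(1)] by (auto simp: act_def)
  finally show ?thesis using sub[OF c] by blast
qed

lemma act_Z2_eq_iff:
  assumes "g \<in> SL2R" "h \<in> SL2R"
  shows "act g Z2 = act h Z2 \<longleftrightarrow> (\<exists>c\<in>SL2Z. h = g ** c)"
proof
  assume "\<exists>c\<in>SL2Z. h = g ** c"
  then show "act g Z2 = act h Z2" by (auto simp: act_mult act_SL2Z_Z2)
next
  assume eq: "act g Z2 = act h Z2"
  have "invertible g" using assms by (simp add: SL2R_def invertible_det_nz)
  then obtain k where k: "g ** k = mat 1" "k ** g = mat 1" by (auto simp: invertible_def)
  define c where "c = k ** h"
  have h: "h = g ** c" by (simp add: c_def matrix_mul_assoc k)
  have "c \<in> SL2R" using assms h by (auto simp: SL2R_def det_mul)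
  moreover have "c $ i $ j \<in> \<int>" for i j
  proof -
    have "axis j 1 \<in> Z2" by (auto simp: Z2_def axis_def)
    then have "h *v axis j 1 \<in> act g Z2" unfolding eq by (auto simp: act_def)
    then obtain z where z: "z \<in> Z2" "h *v axis j 1 = g *v z" by (auto simp: act_def)
    have "c *v axis j 1 = k *v (g *v z)"
      unfolding c_def using z(2) by (simp flip: matrix_vector_mul_assoc)
    then have "c *v axis j 1 = z" by (simp add: matrix_vector_mul_assoc k)
    then have "column j c = z" by (simp add: matrix_vector_mult_basis)
    then show ?thesis using z(1) by (auto simp: Z2_def column_def)
  qed
  ultimately show "\<exists>c\<in>SL2Z. h = g ** c" using h by (auto simp: SL2Z_def)
qed

text \<open>The quotient topology of \<open>SL\<^sub>2(R)/SL\<^sub>2(Z)\<close>.\<close>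

definition lattice_open :: "(real^2) set set \<Rightarrow> bool" where
  "lattice_open U \<longleftrightarrow>
     U \<subseteq> unimodular_lattices \<and> openin (top_of_set SL2R) {g \<in> SL2R. act g Z2 \<in> U}"

definition lattice_borel :: "(real^2) set measure" where
  "lattice_borel = sigma unimodular_lattices (Collect lattice_open)"

text \<open>
  The Haar probability measure is the unique Borel probability measure on the quotient
  that is invariant under left translations.
\<close>

definition is_haar_prob :: "(real^2) set measure \<Rightarrow> bool" where
  "is_haar_prob \<mu> \<longleftrightarrow>
     prob_space \<mu> \<and> space \<mu> = unimodular_lattices \<and> sets \<mu> = sets lattice_borel \<and>
     (\<forall>g\<in>SL2R. \<forall>A\<in>sets \<mu>. emeasure \<mu> (act g ` A) = emeasure \<mu> A)"

definition \<delta> :: "real \<Rightarrow> real^2^2" where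
  "\<delta> t = vector [vector [exp t, 0], vector [0, exp (- t)]]"

definition lattice_norm :: "(real^2) set \<Rightarrow> real" where
  "lattice_norm L = Inf (norm ` (L - {0}))"

section \<open>Laws on the real line\<close>

definition symmetric_rv :: "'a measure \<Rightarrow> ('a \<Rightarrow> real) \<Rightarrow> bool" where
  "symmetric_rv P X \<longleftrightarrow> distr P borel (\<lambda>\<omega>. - X \<omega>) = distr P borel X"

definition measure_support :: "real measure \<Rightarrow> real set" where
  "measure_support M = {x. \<forall>U. open U \<longrightarrow> x \<in> U \<longrightarrow> emeasure M U > 0}"

definition compact_support_rv :: "'a measure \<Rightarrow> ('a \<Rightarrow> real) \<Rightarrow> bool" where
  "compact_support_rv P X \<longleftrightarrow> compact (measure_support (distr P borel X))"

text \<open>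
  The centered Cauchy law of scale \<open>c \<ge> 0\<close>, with characteristic function
  \<open>u \<mapsto> exp (- c \<bar>u\<bar>)\<close>; for \<open>c = 0\<close> it degenerates to the Dirac mass at 0.
\<close>

definition centered_cauchy :: "real \<Rightarrow> real measure" where
  "centered_cauchy c =
     (if c = 0 then return borel 0
      else density lborel (\<lambda>x. ennreal (c / (pi * (c\<^sup>2 + x\<^sup>2)))))"

section \<open>The random averages\<close>

definition S :: "(nat \<Rightarrow> 'a \<Rightarrow> real) \<Rightarrow> 'a \<Rightarrow> (real^2) set \<Rightarrow> nat \<Rightarrow> real" where
  "S \<theta> \<omega> L T = (1 / real T) * (\<Sum>t<T. \<theta> t \<omega> / (lattice_norm (act (\<delta> (real t)) L))\<^sup>2)"

end

theory Submission
  imports Defs "HOL-Computational_Algebra.Squarefree" "HOL-Real_Asymp.Real_Asymp"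
begin

text \<open>
  Conditioning on \<open>L\<close>, the characteristic function of \<open>S\<close> at \<open>u\<close> is the mean over \<open>L\<close> of a product of
  \<open>\<phi> (u X\<^sub>t / T)\<close>, where \<open>X\<^sub>t = \<parallel>\<delta>\<^sub>t L\<parallel>\<^sup>-\<^sup>2\<close> and \<open>\<phi>\<close> is the characteristic function of \<open>\<theta>\<^sub>0\<close>. A factor is far from 1 only
  during an excursion of \<open>\<delta>\<^sub>t L\<close> to the cusp, and each excursion is caused by one primitive vector of
  \<open>L\<close> up to sign, so that the contribution of an excursion is a function of that vector.

  Let \<open>a\<^sub>t\<close> be the mean of the product of the first \<open>t\<close> factors. The increment \<open>a\<^sub>t - a\<^sub>t\<^sub>+\<^sub>1\<close> is localized near
  time \<open>t\<close>: the product up to time \<open>t - (5/8) ln T\<close> is almost invariant under those unipotent matrices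
  along which the rest can be averaged. That average is a sum over primitive vectors, and counting them (lattice
  points by Riemann sums, primitive ones by Moebius inversion) gives \<open>a\<^sub>t\<^sub>+\<^sub>1 = (1 - \<kappa> / T + o(1 / T)) a\<^sub>t\<close>,
  whence \<open>a\<^sub>T\<close> tends to \<open>exp (- \<kappa>)\<close>. Replacing \<open>\<phi> s\<close> by \<open>\<phi> (u s)\<close> multiplies \<open>\<kappa>\<close> by \<open>\<bar>u\<bar>\<close>, so the
  limit is the characteristic function of a Cauchy law.
\<close>

text \<open>There are T steps, so each step may only cost o(1/T), although the increments are
  themselves of order 1/T. Every error made in the past is therefore kept multiplied by an average
  of the nonnegative increment \<open>onset T 0\<close>, whose mean is at most of order 1/T; then an
  o(1) error in the past suffices. What is known of \<open>\<mu>\<close> is its invariance: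
  replacing L by \<open>act (ut y) L\<close> and averaging over y in [0, 1] changes no integral.
  Past matrices \<open>\<delta> (- i)\<close> contract this shift by \<open>exp (- 2 * i)\<close>,
  whereas \<open>\<delta> s\<close> stretches it to a horocycle piece of length
  \<open>exp (2 * s)\<close>, along which primitive vectors can be counted at every single lattice.
  The same count gives the mean value formula for sums over primitive vectors, which bounds all
  remaining errors. The scale comes from the excursions: the argument
  \<open>1 / (T * (norm v)\<^sup>2)\<close> is of order 1 for vectors of norm about
  \<open>1 / sqrt T\<close>, so test functions are evaluated at \<open>sqrt T *\<^sub>R v\<close>,
  and \<open>exp s\<close> has to be large compared with \<open>sqrt T\<close>.\<close>

section \<open>Primitive vectors of plane lattices\<close>

text \<open>Vectors are pairs here rather than elements of \<open>real^2\<close>: Lebesgue measure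
  on pairs is a product measure, so that Fubini and substitutions in single coordinates
  apply.\<close>

definition lact :: "real^2^2 \<Rightarrow> real \<times> real \<Rightarrow> real \<times> real" where
  "lact g v = (g$1$1 * fst v + g$1$2 * snd v, g$2$1 * fst v + g$2$2 * snd v)"

definition emb :: "real^2^2 \<Rightarrow> int \<times> int \<Rightarrow> real \<times> real" where
  "emb g m = lact g (of_int (fst m), of_int (snd m))"

definition coprime_pairs :: "(int \<times> int) set" where
  "coprime_pairs = {m. coprime (fst m) (snd m)}"

text \<open>Primitivity refers to the lattice alone, not to a basis, so \<open>prims\<close> is a
  function on the quotient; \<open>prims_act_Z2\<close> gives it in coordinates.\<close>

definition prims :: "(real^2) set \<Rightarrow> (real \<times> real) set" where
  "prims L = {(v$1, v$2) | v. v \<in> L \<and> v \<noteq> 0 \<and> \<not> (\<exists>w\<in>L. \<exists>k::nat. 1 < k \<and> v = real k *\<^sub>R w)}"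

definition wedge :: "real \<times> real \<Rightarrow> real \<times> real \<Rightarrow> real" where
  "wedge v w = fst v * snd w - snd v * fst w"

lemma SL2R_det: "g \<in> SL2R \<longleftrightarrow> g$1$1 * g$2$2 - g$1$2 * g$2$1 = 1"
  by (simp add: SL2R_def det_2)

lemma SL2R_mult: "g \<in> SL2R \<Longrightarrow> h \<in> SL2R \<Longrightarrow> g ** h \<in> SL2R"
  by (simp add: SL2R_def det_mul)

lemma lact_mult: "lact (g ** h) v = lact g (lact h v)"
  by (simp add: lact_def matrix_matrix_mult_def sum_2 algebra_simps)

lemma emb_mult: "emb (g ** h) m = lact g (emb h m)"
  by (simp add: emb_def lact_mult)

lemma lact_scaleR: "lact g (c *\<^sub>R v) = c *\<^sub>R lact g v"
  by (simp add: lact_def algebra_simps)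

lemma wedge_lact:
  assumes "g \<in> SL2R" shows "wedge (lact g v) (lact g w) = wedge v w"
proof -
  have "wedge (lact g v) (lact g w) = (g$1$1 * g$2$2 - g$1$2 * g$2$1) * wedge v w"
    unfolding wedge_def lact_def by (simp add: algebra_simps)
  then show ?thesis using assms by (simp add: SL2R_det)
qed

text \<open>Cramer's rule with determinant 1. It yields injectivity of the action and, in
  \<open>emb_bound\<close>, a bound of a vector by its image.\<close>

lemma lact_inverse:
  assumes "g \<in> SL2R"
  shows "fst v = g$2$2 * fst (lact g v) - g$1$2 * snd (lact g v)"
    "snd v = g$1$1 * snd (lact g v) - g$2$1 * fst (lact g v)"
proof -
  have 1: "g$1$1 * g$2$2 - g$1$2 * g$2$1 = 1" using assms by (simp add: SL2R_det)
  have "g$2$2 * fst (lact g v) - g$1$2 * snd (lact g v) = (g$1$1 * g$2$2 - g$1$2 * g$2$1) * fst v"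
    by (simp add: lact_def algebra_simps)
  then show "fst v = g$2$2 * fst (lact g v) - g$1$2 * snd (lact g v)" using 1 by simp
  have "g$1$1 * snd (lact g v) - g$2$1 * fst (lact g v) = (g$1$1 * g$2$2 - g$1$2 * g$2$1) * snd v"
    by (simp add: lact_def algebra_simps)
  then show "snd v = g$1$1 * snd (lact g v) - g$2$1 * fst (lact g v)" using 1 by simp
qed

lemma inj_lact: "g \<in> SL2R \<Longrightarrow> inj (lact g)"
  by (rule injI, rule prod_eqI) (metis lact_inverse)+

lemma inj_emb: "g \<in> SL2R \<Longrightarrow> inj (emb g)"
proof (rule injI)
  fix x y assume g: "g \<in> SL2R" and "emb g x = emb g y"
  then have "(of_int (fst x), of_int (snd x)) = ((of_int (fst y), of_int (snd y)) :: real \<times> real)"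
    unfolding emb_def using inj_lact[OF g] by (metis injD)
  then show "x = y" by (simp add: prod_eq_iff)
qed

lemma act_Z2_eq: "act g Z2 = {v. \<exists>m. (v$1, v$2) = emb g m}"
proof (intro set_eqI iffI)
  fix v :: "real^2" assume "v \<in> act g Z2"
  then obtain z where z: "z \<in> Z2" "v = g *v z" by (auto simp: act_def)
  then obtain a b where ab: "z$1 = of_int a" "z$2 = of_int b"
    unfolding Z2_def by (auto elim!: Ints_cases) (metis Ints_cases)
  then have "(v$1, v$2) = emb g (a, b)"
    using z by (simp add: emb_def lact_def matrix_vector_mult_def sum_2)
  then show "v \<in> {v. \<exists>m. (v$1, v$2) = emb g m}" by blast
next
  fix v :: "real^2" assume "v \<in> {v. \<exists>m. (v$1, v$2) = emb g m}"
  then obtain m where m: "(v$1, v$2) = emb g m" by blast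
  define z :: "real^2" where "z = vector [of_int (fst m), of_int (snd m)]"
  have "z \<in> Z2" by (auto simp: Z2_def z_def forall_2)
  moreover have "v = g *v z"
    using m by (simp add: vec_eq_iff forall_2 emb_def lact_def matrix_vector_mult_def sum_2 z_def)
  ultimately show "v \<in> act g Z2" by (auto simp: act_def)
qed

text \<open>As \<open>emb g\<close> is injective and linear, a lattice vector is a proper multiple
  exactly when its coordinate pair is: a non-coprime pair is divided by its gcd, and a factor
  \<open>k\<close> of the vector divides both coordinates.\<close>

lemma prims_act_Z2:
  assumes g: "g \<in> SL2R" shows "prims (act g Z2) = emb g ` coprime_pairs"
proof (intro set_eqI iffI)
  have emb0: "emb g m = 0 \<longleftrightarrow> m = 0" for m
    using inj_emb[OF g] by (metis emb_def lact_scaleR fst_zero snd_zero injD of_int_0 scaleR_zero_left scale_zero_left zero_prod_def)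
  fix p assume "p \<in> prims (act g Z2)"
  then obtain v where v: "p = (v$1, v$2)" "v \<in> act g Z2" "v \<noteq> 0"
    "\<And>w k. w \<in> act g Z2 \<Longrightarrow> 1 < (k::nat) \<Longrightarrow> v \<noteq> real k *\<^sub>R w"
    unfolding prims_def by blast
  then obtain m where m: "p = emb g m" by (auto simp: act_Z2_eq)
  have "p \<noteq> 0" using v(1,3) by (auto simp: vec_eq_iff forall_2 zero_prod_def)
  then have m0: "m \<noteq> 0" using emb0 m by auto
  have "coprime (fst m) (snd m)"
  proof (rule ccontr)
    assume nc: "\<not> coprime (fst m) (snd m)"
    define d where "d = gcd (fst m) (snd m)"
    have "d \<noteq> 1" "d \<ge> 0" "d \<noteq> 0" using nc m0 by (auto simp: d_def coprime_iff_gcd_eq_1 prod_eq_iff)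
    then have d: "d > 1" by linarith
    define m' where "m' = (fst m div d, snd m div d)"
    have mm: "fst m = d * fst m'" "snd m = d * snd m'" by (auto simp: m'_def d_def)
    define w :: "real^2" where "w = vector [fst (emb g m'), snd (emb g m')]"
    have "w \<in> act g Z2" unfolding act_Z2_eq by (simp add: w_def) (metis prod.collapse)
    moreover have "1 < nat d" using d by linarith
    moreover have "v = real (nat d) *\<^sub>R w"
    proof -
      have "p = of_int d *\<^sub>R emb g m'" unfolding m emb_def lact_scaleR[symmetric] by (simp add: mm)
      then show ?thesis using d v(1) by (simp add: vec_eq_iff forall_2 w_def prod_eq_iff)
    qed
    ultimately show False using v(4) by blast
  qed
  then show "p \<in> emb g ` coprime_pairs" using m by (auto simp: coprime_pairs_def)
next
  fix p assume "p \<in> emb g ` coprime_pairs"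
  then obtain m where m: "p = emb g m" "coprime (fst m) (snd m)" by (auto simp: coprime_pairs_def)
  define v :: "real^2" where "v = vector [fst p, snd p]"
  have p: "p = (v$1, v$2)" by (simp add: v_def)
  have "(v$1, v$2) = emb g m" using m(1) p by simp
  then have "v \<in> act g Z2" unfolding act_Z2_eq by blast
  moreover have "v \<noteq> 0"
  proof
    assume "v = 0"
    then have "emb g m = 0" using m p by (simp add: zero_prod_def)
    then have "emb g m = emb g 0" by (simp add: emb_def lact_def zero_prod_def)
    then have "m = 0" using inj_emb[OF g] by (auto dest: injD)
    then show False using m by simp
  qed
  moreover have False if "w \<in> act g Z2" "1 < (k::nat)" "v = real k *\<^sub>R w" for w k
  proof -
    have "\<exists>n. (w$1, w$2) = emb g n" using that(1) unfolding act_Z2_eq by blast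
    then obtain n where n: "(w$1, w$2) = emb g n" by blast
    have "p = real k *\<^sub>R emb g n" using that(3) p n by (simp flip: n)
    also have "\<dots> = emb g (int k * fst n, int k * snd n)"
      by (simp add: emb_def flip: lact_scaleR)
    finally have "m = (int k * fst n, int k * snd n)" using m inj_emb[OF g] by (auto dest: injD)
    then have "int k dvd 1" using m(2) by (metis coprime_common_divisor dvd_triv_left fst_conv snd_conv)
    then show False using that(2) by auto
  qed
  ultimately show "p \<in> prims (act g Z2)" unfolding prims_def p by blast
qed

lemma unimodular_latticesE:
  assumes "L \<in> unimodular_lattices"
  obtains g where "g \<in> SL2R" "L = act g Z2"
  using assms by (auto simp: unimodular_lattices_def)

lemma unimodular_latticesI: "g \<in> SL2R \<Longrightarrow> act g Z2 \<in> unimodular_lattices"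
  by (auto simp: unimodular_lattices_def)

lemma act_in_lattices: "g \<in> SL2R \<Longrightarrow> L \<in> unimodular_lattices \<Longrightarrow> act g L \<in> unimodular_lattices"
  by (metis act_mult SL2R_mult unimodular_latticesE unimodular_latticesI)

lemma prims_act:
  assumes "g \<in> SL2R" "L \<in> unimodular_lattices"
  shows "prims (act g L) = lact g ` prims L"
proof -
  obtain h where h: "h \<in> SL2R" "L = act h Z2" using assms by (auto elim: unimodular_latticesE)
  have "act g L = act (g ** h) Z2" using h by (simp add: act_mult)
  then show ?thesis using h assms by (auto simp: prims_act_Z2 SL2R_mult emb_mult image_image)
qed

lemma prims_minus: "L \<in> unimodular_lattices \<Longrightarrow> v \<in> prims L \<Longrightarrow> - v \<in> prims L"
proof (elim unimodular_latticesE)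
  fix g assume "v \<in> prims L" "g \<in> SL2R" "L = act g Z2"
  then obtain m where m: "v = emb g m" "m \<in> coprime_pairs" "prims L = emb g ` coprime_pairs"
    by (auto simp: prims_act_Z2)
  have "- v = emb g (- m)" by (simp add: m emb_def lact_def)
  moreover have "- m \<in> coprime_pairs" using m by (auto simp: coprime_pairs_def)
  ultimately show ?thesis using m by auto
qed

lemma abs_le_norm_Pair: "\<bar>fst v\<bar> \<le> norm (v :: real \<times> real)" "\<bar>snd v\<bar> \<le> norm v"
  by (metis norm_fst_le prod.collapse real_norm_def, metis norm_snd_le prod.collapse real_norm_def)

text \<open>Lagrange's identity: the squares of the wedge and of the inner product add up to the
  product of the squared norms.\<close>

lemma wedge_le_norm: "\<bar>wedge v w\<bar> \<le> norm v * norm w"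
proof -
  obtain a b where v: "v = (a, b)" by fastforce
  obtain c d where w: "w = (c, d)" by fastforce
  have "(a*d - b*c)\<^sup>2 + (a*c + b*d)\<^sup>2 = (a\<^sup>2 + b\<^sup>2) * (c\<^sup>2 + d\<^sup>2)" by (simp add: power2_eq_square algebra_simps)
  then have "(a*d - b*c)\<^sup>2 \<le> (a\<^sup>2 + b\<^sup>2) * (c\<^sup>2 + d\<^sup>2)" by (metis le_add_same_cancel1 zero_le_power2)
  then show ?thesis unfolding v w wedge_def norm_Pair
    by (simp add: real_sqrt_mult[symmetric] real_le_rsqrt)
qed

text \<open>By invariance the wedge is the determinant of the two integer coordinate pairs, hence an
  integer. If it vanishes, coprimality makes corresponding coordinates divide each other, and the
  vectors agree up to sign.\<close>

lemma prims_wedge: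
  assumes L: "L \<in> unimodular_lattices" and v: "v \<in> prims L" "w \<in> prims L" and ne: "v \<noteq> w" "v \<noteq> - w"
  shows "1 \<le> \<bar>wedge v w\<bar>"
proof -
  obtain g where g: "g \<in> SL2R" "L = act g Z2" using L by (auto elim: unimodular_latticesE)
  obtain m n where m: "v = emb g m" "m \<in> coprime_pairs" "w = emb g n" "n \<in> coprime_pairs"
    using v g by (auto simp: prims_act_Z2)
  define k where "k = fst m * snd n - snd m * fst n"
  have "wedge v w = of_int k" using wedge_lact[OF g(1)] unfolding m emb_def k_def by (simp add: wedge_def)
  moreover have "k \<noteq> 0"
  proof
    assume "k = 0"
    then have eq: "fst m * snd n = snd m * fst n" by (simp add: k_def)
    have c: "coprime (fst m) (snd m)" "coprime (fst n) (snd n)" using m by (auto simp: coprime_pairs_def)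
    have "fst m dvd snd m * fst n" "fst n dvd fst m * snd n" "snd m dvd fst m * snd n" "snd n dvd snd m * fst n"
      using eq by (metis dvd_triv_left dvd_triv_right)+
    moreover have "coprime (snd m) (fst m)" "coprime (snd n) (fst n)" using c by (simp_all add: coprime_commute)
    ultimately have "fst m dvd fst n" "fst n dvd fst m" "snd m dvd snd n" "snd n dvd snd m"
      using c by (metis coprime_dvd_mult_left_iff coprime_dvd_mult_right_iff)+
    then have 1: "\<bar>fst m\<bar> = \<bar>fst n\<bar>" and 2: "\<bar>snd m\<bar> = \<bar>snd n\<bar>"
      by (auto intro: zdvd_antisym_abs)
    have "m = n \<or> m = - n"
    proof (cases "fst n = 0 \<or> snd n = 0")
      case True then show ?thesis using 1 2 by (auto simp: prod_eq_iff abs_eq_iff)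
    next
      case False then show ?thesis using 1 2 eq by (auto simp: prod_eq_iff abs_eq_iff)
    qed
    then have "v = w \<or> v = - w" by (auto simp: m emb_def lact_def)
    then show False using ne by auto
  qed
  then have "1 \<le> \<bar>k\<bar>" by linarith
  ultimately show ?thesis by (metis of_int_1_le_iff of_int_abs)
qed

lemma prims_norm_mult:
  assumes "L \<in> unimodular_lattices" "v \<in> prims L" "w \<in> prims L" "v \<noteq> w" "v \<noteq> - w"
  shows "1 \<le> norm v * norm w"
  using prims_wedge[OF assms] wedge_le_norm[of v w] by linarith

lemma emb_bound:
  assumes g: "g \<in> SL2R"
  obtains c where "c > 0"
    "\<And>m. \<bar>fst m\<bar> \<le> c * norm (lact g m)" "\<And>m. \<bar>snd m\<bar> \<le> c * norm (lact g m)"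
proof -
  define c where "c = \<bar>g$1$1\<bar> + \<bar>g$1$2\<bar> + \<bar>g$2$1\<bar> + \<bar>g$2$2\<bar> + 1"
  have *: "\<bar>a * x - b * y\<bar> \<le> c * n" if "\<bar>a\<bar> + \<bar>b\<bar> \<le> c" "\<bar>x\<bar> \<le> n" "\<bar>y\<bar> \<le> n" for a b x y n :: real
  proof -
    have "\<bar>a * x - b * y\<bar> \<le> \<bar>a\<bar> * \<bar>x\<bar> + \<bar>b\<bar> * \<bar>y\<bar>" by (metis abs_mult abs_triangle_ineq4)
    also have "\<dots> \<le> \<bar>a\<bar> * n + \<bar>b\<bar> * n" using that by (intro add_mono mult_left_mono) auto
    also have "\<dots> = (\<bar>a\<bar> + \<bar>b\<bar>) * n" by (simp add: algebra_simps)
    also have "\<dots> \<le> c * n" using that by (intro mult_right_mono) auto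
    finally show ?thesis .
  qed
  have "\<bar>fst m\<bar> \<le> c * norm (lact g m)" for m
    using *[of "g$2$2" "g$1$2" "fst (lact g m)" "norm (lact g m)" "snd (lact g m)"]
    by (simp add: abs_le_norm_Pair flip: lact_inverse(1)[OF g]) (simp add: c_def)
  moreover have "\<bar>snd m\<bar> \<le> c * norm (lact g m)" for m
    using *[of "g$1$1" "g$2$1" "snd (lact g m)" "norm (lact g m)" "fst (lact g m)"]
    by (simp add: abs_le_norm_Pair flip: lact_inverse(2)[OF g]) (simp add: c_def)
  moreover have "c > 0" by (auto simp: c_def)
  ultimately show ?thesis using that by blast
qed

lemma finite_emb:
  assumes g: "g \<in> SL2R" shows "finite {m. norm (emb g m) \<le> r}"
proof -
  obtain c where c: "c > 0" "\<And>m. \<bar>fst m\<bar> \<le> c * norm (lact g m)" "\<And>m. \<bar>snd m\<bar> \<le> c * norm (lact g m)"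
    using emb_bound[OF g] by blast
  define N where "N = \<lceil>c * r\<rceil>"
  have "{m. norm (emb g m) \<le> r} \<subseteq> {-N..N} \<times> {-N..N}"
  proof
    fix m assume "m \<in> {m. norm (emb g m) \<le> r}"
    then have "c * norm (emb g m) \<le> c * r" using c(1) by simp
    then have "\<bar>of_int (fst m)\<bar> \<le> c * r" "\<bar>of_int (snd m)\<bar> \<le> c * r"
      using c(2,3)[of "(of_int (fst m), of_int (snd m))"] by (auto simp: emb_def)
    then have "\<bar>fst m\<bar> \<le> N" "\<bar>snd m\<bar> \<le> N" unfolding N_def by linarith+
    then show "m \<in> {-N..N} \<times> {-N..N}" by (cases m) auto
  qed
  then show ?thesis by (rule finite_subset) auto
qed

lemma finite_prims:
  assumes "L \<in> unimodular_lattices" shows "finite {v \<in> prims L. norm v \<le> r}"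
proof -
  obtain g where g: "g \<in> SL2R" "L = act g Z2" using assms by (auto elim: unimodular_latticesE)
  have "{v \<in> prims L. norm v \<le> r} \<subseteq> emb g ` {m. norm (emb g m) \<le> r}"
    using g by (auto simp: prims_act_Z2)
  then show ?thesis using finite_emb[OF g(1)] by (meson finite_imageI finite_subset)
qed

lemma prims_nonzero: "v \<in> prims L \<Longrightarrow> v \<noteq> 0"
  by (auto simp: prims_def vec_eq_iff forall_2 zero_prod_def)

text \<open>Dividing a lattice vector by the gcd of its coordinates gives a primitive vector that is
  not longer, so the infimum may be taken over primitive vectors; by discreteness it is
  attained.\<close>

lemma lattice_norm_prims:
  assumes L: "L \<in> unimodular_lattices"
  shows "\<exists>v\<in>prims L. norm v = lattice_norm L" and "v \<in> prims L \<Longrightarrow> lattice_norm L \<le> norm v"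
proof -
  obtain g where g: "g \<in> SL2R" "L = act g Z2" using L by (auto elim: unimodular_latticesE)
  have P: "prims L = emb g ` coprime_pairs" using g by (simp add: prims_act_Z2)
  \<comment> \<open>Any primitive vector will do: it confines the search for a minimum to the finite
    set \<open>F\<close>.\<close>
  define v0 where "v0 = emb g (1, 0)"
  have v0: "v0 \<in> prims L" by (auto simp: P v0_def coprime_pairs_def)
  define F where "F = {v \<in> prims L. norm v \<le> norm v0}"
  have F: "finite F" unfolding F_def by (rule finite_prims[OF L])
  have "v0 \<in> F" using v0 by (simp add: F_def)
  then have F: "finite F" "F \<noteq> {}" using F by auto
  define v where "v = arg_min_on norm F"
  have v: "v \<in> F" "\<And>w. w \<in> F \<Longrightarrow> norm v \<le> norm w"
    unfolding v_def using F arg_min_if_finite(1)[OF F] arg_min_least[OF F] by auto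
  have vm: "norm v \<le> norm w" if "w \<in> prims L" for w
    using v(2)[of w] v(1) that by (cases "norm w \<le> norm v0") (auto simp: F_def)
  have nv: "norm ((x::real^2)) = norm (x$1, x$2)" for x
    by (simp add: norm_vec_def L2_set_def sum_2 norm_Pair)
  have low: "norm v \<le> norm x" if "x \<in> L - {0}" for x
  proof -
    have "\<exists>m. (x$1, x$2) = emb g m" using that unfolding g(2) act_Z2_eq by blast
    then obtain m where m: "(x$1, x$2) = emb g m" by blast
    have m0: "m \<noteq> 0"
      using that m by (auto simp: emb_def lact_def vec_eq_iff forall_2)
    define d where "d = gcd (fst m) (snd m)"
    have d: "d \<ge> 1" using m0 unfolding d_def
      by (metis gcd_eq_0_iff gcd_ge_0_int int_one_le_iff_zero_less order_le_less prod.collapse zero_prod_def)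
    define m' where "m' = (fst m div d, snd m div d)"
    have "coprime (fst m') (snd m')" unfolding m'_def d_def fst_conv snd_conv
      using m0 by (intro div_gcd_coprime) (auto simp: prod_eq_iff)
    then have 1: "emb g m' \<in> prims L" by (auto simp: P coprime_pairs_def)
    have "emb g m = of_int d *\<^sub>R emb g m'"
      unfolding emb_def lact_scaleR[symmetric] by (simp add: m'_def d_def flip: of_int_mult)
    then have "norm x = of_int d * norm (emb g m')" using d by (simp add: nv m)
    also have "\<dots> \<ge> 1 * norm (emb g m')" using d by (intro mult_right_mono) auto
    finally show ?thesis using vm[OF 1] by linarith
  qed
  obtain x where x: "v = (x$1, x$2)" "x \<in> L" "x \<noteq> 0" using v(1) by (auto simp: F_def prims_def)
  have "lattice_norm L = norm v" unfolding lattice_norm_def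
  proof (rule cInf_eq_minimum)
    show "norm v \<in> norm ` (L - {0})" using x by (auto simp: nv intro!: rev_image_eqI[of x])
    show "\<And>y. y \<in> norm ` (L - {0}) \<Longrightarrow> norm v \<le> y" using low by auto
  qed
  then show "\<exists>v\<in>prims L. norm v = lattice_norm L" and "v \<in> prims L \<Longrightarrow> lattice_norm L \<le> norm v" for v
    using v(1) vm by (auto simp: F_def)
qed

lemma lattice_norm_pos: "L \<in> unimodular_lattices \<Longrightarrow> 0 < lattice_norm L"
  using lattice_norm_prims(1)[of L] prims_nonzero[of _ L] by (metis zero_less_norm_iff)

lemma lattice_norm_act_le:
  assumes g: "g \<in> SL2R" and L: "L \<in> unimodular_lattices" and c: "\<And>v. norm (lact g v) \<le> c * norm v"
  shows "lattice_norm (act g L) \<le> c * lattice_norm L"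
proof -
  obtain v where v: "v \<in> prims L" "norm v = lattice_norm L" using lattice_norm_prims(1)[OF L] by blast
  have "lact g v \<in> prims (act g L)" using v by (simp add: prims_act[OF g L])
  then have "lattice_norm (act g L) \<le> norm (lact g v)"
    by (rule lattice_norm_prims(2)[OF act_in_lattices[OF g L]])
  then show ?thesis using c[of v] v by simp
qed

subsection \<open>Unipotent and diagonal matrices\<close>

definition ut :: "real \<Rightarrow> real^2^2" where
  "ut x = vector [vector [1, x], vector [0, 1]]"

lemma ut_in: "ut x \<in> SL2R" by (simp add: SL2R_det ut_def)

lemma delta_in: "\<delta> t \<in> SL2R" by (simp add: SL2R_det \<delta>_def flip: exp_add)

lemma lact_ut: "lact (ut x) v = (fst v + x * snd v, snd v)"
  by (simp add: lact_def ut_def)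

lemma lact_delta: "lact (\<delta> t) v = (exp t * fst v, exp (- t) * snd v)"
  by (simp add: lact_def \<delta>_def)

lemma mat2_eqI:
  "(A::real^2^2)$1$1 = B$1$1 \<Longrightarrow> A$1$2 = B$1$2 \<Longrightarrow> A$2$1 = B$2$1 \<Longrightarrow> A$2$2 = B$2$2 \<Longrightarrow> A = B"
  by (simp add: vec_eq_iff forall_2)

lemma ut_add: "ut x ** ut y = ut (x + y)"
  by (rule mat2_eqI) (simp_all add: ut_def matrix_matrix_mult_def sum_2)

lemma ut_0: "ut 0 = mat 1"
  by (rule mat2_eqI) (simp_all add: ut_def mat_def)

lemma delta_0: "\<delta> 0 = mat 1"
  by (rule mat2_eqI) (simp_all add: \<delta>_def mat_def)

lemma delta_add: "\<delta> s ** \<delta> t = \<delta> (s + t)"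
  by (rule mat2_eqI) (simp_all add: \<delta>_def matrix_matrix_mult_def sum_2 flip: exp_add)

text \<open>The separation of times rests on this relation: unipotent shifts are stretched by
  \<open>exp (2 * t)\<close> for positive t and contracted for negative t.\<close>

lemma delta_ut: "\<delta> t ** ut x = ut (exp (2 * t) * x) ** \<delta> t"
proof -
  have "exp t = exp (2 * t) * exp (- t)" by (simp flip: exp_add)
  then show ?thesis
    by (intro mat2_eqI) (simp_all add: \<delta>_def ut_def matrix_matrix_mult_def sum_2)
qed

lemma act_mat1: "act (mat 1) L = L" by (simp add: act_def)

lemma norm_ut_le: "norm (lact (ut x) v) \<le> (1 + \<bar>x\<bar>) * norm v"
proof -
  have "lact (ut x) v = v + (x * snd v, 0)" by (simp add: lact_ut prod_eq_iff)
  then have "norm (lact (ut x) v) \<le> norm v + norm (x * snd v, 0::real)" by (metis norm_triangle_ineq)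
  also have "\<dots> \<le> norm v + \<bar>x\<bar> * norm v"
    by (simp add: norm_Pair abs_mult mult_left_mono abs_le_norm_Pair)
  finally show ?thesis by (simp add: algebra_simps)
qed

lemma norm_delta_le: "norm (lact (\<delta> t) v) \<le> exp \<bar>t\<bar> * norm v"
proof -
  have "norm (lact (\<delta> t) v) \<le> norm (exp \<bar>t\<bar> *\<^sub>R v)"
  proof -
    have "(exp t * fst v)\<^sup>2 \<le> (exp \<bar>t\<bar> * fst v)\<^sup>2" "(exp (- t) * snd v)\<^sup>2 \<le> (exp \<bar>t\<bar> * snd v)\<^sup>2"
      unfolding power_mult_distrib by (intro mult_right_mono power_mono; simp)+
    then show ?thesis by (cases v) (auto simp: lact_delta norm_Pair)
  qed
  then show ?thesis by simp
qed

text \<open>The second bound is the first one for the inverse shift. Together they control the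
  relative variation of the norm along a unipotent orbit.\<close>

lemma lattice_norm_ut:
  assumes L: "L \<in> unimodular_lattices"
  shows "lattice_norm (act (ut x) L) \<le> (1 + \<bar>x\<bar>) * lattice_norm L"
    "lattice_norm L \<le> (1 + \<bar>x\<bar>) * lattice_norm (act (ut x) L)"
proof -
  show *: "lattice_norm (act (ut x) L) \<le> (1 + \<bar>x\<bar>) * lattice_norm L"
    by (rule lattice_norm_act_le[OF ut_in L norm_ut_le])
  have "act (ut (- x)) (act (ut x) L) = L" by (simp add: ut_add ut_0 act_mat1 flip: act_mult)
  then show "lattice_norm L \<le> (1 + \<bar>x\<bar>) * lattice_norm (act (ut x) L)"
    using lattice_norm_act_le[OF ut_in[of "- x"] act_in_lattices[OF ut_in[of x] L] norm_ut_le] by simp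
qed

section \<open>Haar probability measure on the space of lattices\<close>

text \<open>The Siegel transform restricted to primitive vectors. As \<open>sum\<close> over an
  infinite set is 0, the index set is cut down to the support, which is finite for functions of
  bounded support.\<close>

definition psum :: "(real \<times> real \<Rightarrow> real) \<Rightarrow> (real^2) set \<Rightarrow> real" where
  "psum \<Phi> L = sum \<Phi> {v \<in> prims L. \<Phi> v \<noteq> 0}"

definition bsupp :: "real \<Rightarrow> (real \<times> real \<Rightarrow> real) \<Rightarrow> bool" where
  "bsupp r \<Phi> \<longleftrightarrow> (\<forall>v. \<Phi> v \<noteq> 0 \<longrightarrow> norm v \<le> r)"

lemma psum_eq:
  assumes "finite F" "F \<subseteq> prims L" "\<And>v. v \<in> prims L \<Longrightarrow> \<Phi> v \<noteq> 0 \<Longrightarrow> v \<in> F"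
  shows "psum \<Phi> L = sum \<Phi> F"
  unfolding psum_def using assms by (intro sum.mono_neutral_left) auto

lemma psum_ball:
  assumes "L \<in> unimodular_lattices" "bsupp r \<Phi>"
  shows "psum \<Phi> L = sum \<Phi> {v \<in> prims L. norm v \<le> r}"
  using assms by (intro psum_eq) (auto simp: finite_prims bsupp_def)

lemma psum_act:
  assumes "g \<in> SL2R" "L \<in> unimodular_lattices"
  shows "psum \<Phi> (act g L) = psum (\<lambda>v. \<Phi> (lact g v)) L"
proof -
  have "{v \<in> prims (act g L). \<Phi> v \<noteq> 0} = lact g ` {v \<in> prims L. \<Phi> (lact g v) \<noteq> 0}"
    using assms by (auto simp: prims_act)
  then show ?thesis unfolding psum_def
    using inj_lact[OF assms(1)] by (simp add: sum.reindex inj_on_subset o_def)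
qed

lemma emb_continuous: "continuous_on A (\<lambda>g. emb g m)"
  unfolding emb_def lact_def by (intro continuous_intros)

lemma continuous_on_UNIV_comp:
  assumes "continuous_on UNIV \<Phi>" "continuous_on A f"
  shows "continuous_on A (\<lambda>x. \<Phi> (f x))"
  using continuous_on_compose2[OF assms] by simp

lemma openin_less:
  fixes f :: "'a::topological_space \<Rightarrow> real"
  assumes "continuous_on A f" shows "openin (top_of_set A) {x \<in> A. a < f x}"
proof -
  have "openin (top_of_set A) (A \<inter> f -` {a<..})"
    using assms by (rule continuous_openin_preimage_gen) simp
  also have "A \<inter> f -` {a<..} = {x \<in> A. a < f x}" by auto
  finally show ?thesis .
qed

lemma lattice_open_act:
  "g \<in> SL2R \<Longrightarrow> lattice_open U \<Longrightarrow> lattice_open {L \<in> unimodular_lattices. act g L \<in> U}"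
proof -
  assume g: "g \<in> SL2R" and U: "lattice_open U"
  have "openin (top_of_set SL2R) (SL2R \<inter> (\<lambda>h. g ** h) -` {h \<in> SL2R. act h Z2 \<in> U})"
  proof (rule continuous_openin_preimage[where T=SL2R])
    show "continuous_on SL2R (\<lambda>h. g ** h)"
      unfolding matrix_matrix_mult_def by (intro continuous_intros)
    show "(\<lambda>h. g ** h) \<in> SL2R \<rightarrow> SL2R" using g by (auto simp: SL2R_mult)
    show "openin (top_of_set SL2R) {h \<in> SL2R. act h Z2 \<in> U}" using U by (simp add: lattice_open_def)
  qed
  also have "SL2R \<inter> (\<lambda>h. g ** h) -` {h \<in> SL2R. act h Z2 \<in> U}
      = {h \<in> SL2R. act h Z2 \<in> {L \<in> unimodular_lattices. act g L \<in> U}}"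
    using g by (auto simp: SL2R_mult act_mult unimodular_latticesI)
  finally show ?thesis by (simp add: lattice_open_def)
qed

lemma SL2R_inverse:
  assumes "g \<in> SL2R" obtains k where "k \<in> SL2R" "k ** g = mat 1" "g ** k = mat 1"
proof -
  have "invertible g" using assms by (simp add: SL2R_def invertible_det_nz)
  then obtain k where k: "g ** k = mat 1" "k ** g = mat 1" by (auto simp: invertible_def)
  have "det g * det k = 1" using k by (metis det_I det_mul)
  then have "k \<in> SL2R" using assms by (simp add: SL2R_def)
  then show ?thesis using k that by blast
qed

text \<open>Rounding \<open>y\<close> down to a multiple of \<open>1 / Suc n\<close> leaves
  countably many sections, each of them measurable, and continuity in \<open>y\<close> recovers
  \<open>F\<close> in the limit.\<close>

lemma measurable_Caratheodory:
  fixes F :: "real \<Rightarrow> 'b \<Rightarrow> real"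
  assumes c: "\<And>L. L \<in> space M \<Longrightarrow> continuous_on UNIV (\<lambda>y. F y L)"
    and m[measurable]: "\<And>y. F y \<in> borel_measurable M"
  shows "(\<lambda>(y, L). F y L) \<in> borel_measurable (borel \<Otimes>\<^sub>M M)"
proof (rule borel_measurable_LIMSEQ_real)
  define r where "r n y = of_int \<lfloor>real (Suc n) * y\<rfloor> / real (Suc n)" for n :: nat and y :: real
  show "(\<lambda>(y, L). F (r n y) L) \<in> borel_measurable (borel \<Otimes>\<^sub>M M)" for n
  proof -
    have "(\<lambda>yL. F (of_int (\<lfloor>real (Suc n) * fst yL\<rfloor>) / real (Suc n)) (snd yL)) \<in> borel_measurable (borel \<Otimes>\<^sub>M M)"
      by (rule measurable_compose_countable[where g="\<lambda>yL. \<lfloor>real (Suc n) * fst yL\<rfloor>"]) measurable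
    then show ?thesis by (simp add: r_def case_prod_beta)
  qed
  fix yL :: "real \<times> 'b" assume "yL \<in> space (borel \<Otimes>\<^sub>M M)"
  then obtain y L where yL: "yL = (y, L)" "L \<in> space M" by (auto simp: space_pair_measure)
  have "(\<lambda>n. r n y) \<longlonglongrightarrow> y"
  proof (rule LIMSEQ_I)
    fix e :: real assume "e > 0"
    then obtain N where N: "1 / real (Suc N) < e" using nat_approx_posE by (metis inverse_eq_divide)
    have "norm (r n y - y) < e" if "n \<ge> N" for n
    proof -
      have "\<bar>r n y - y\<bar> = \<bar>of_int \<lfloor>real (Suc n) * y\<rfloor> - real (Suc n) * y\<bar> / real (Suc n)"
        by (simp add: r_def field_simps abs_divide flip: abs_mult)
      also have "\<dots> \<le> 1 / real (Suc n)" by (intro divide_right_mono) linarith+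
      also have "\<dots> \<le> 1 / real (Suc N)" using that by (intro divide_left_mono) auto
      finally show ?thesis using N by simp
    qed
    then show "\<exists>N. \<forall>n\<ge>N. norm (r n y - y) < e" by blast
  qed
  then have "(\<lambda>n. F (r n y) L) \<longlonglongrightarrow> F y L"
    using c[OF yL(2)] by (intro isCont_tendsto_compose[of _ "\<lambda>y. F y L"]) (auto simp: continuous_on_eq_continuous_at)
  then show "(\<lambda>n. case yL of (y, L) \<Rightarrow> F (r n y) L) \<longlonglongrightarrow> (case yL of (y, L) \<Rightarrow> F y L)"
    by (simp add: yL)
qed

subsection \<open>A uniform bound for the number of primitive vectors in a sector\<close>

text \<open>The slopes of primitive vectors of height at most \<open>b\<close> are \<open>1/b\<^sup>2\<close>-separated.\<close>

lemma card_prims_sector: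
  assumes L: "L \<in> unimodular_lattices" and b: "b > 0" and s: "s \<ge> 0"
  defines "F \<equiv> {v \<in> prims L. 0 < snd v \<and> snd v \<le> b \<and> \<bar>fst v\<bar> \<le> s * snd v}"
  shows "finite F" "real (card F) \<le> 2 * s * b\<^sup>2 + 2"
proof -
  define f where "f v = \<lfloor>b\<^sup>2 * (fst v / snd v)\<rfloor>" for v :: "real \<times> real"
  have sub: "f ` F \<subseteq> {\<lfloor>- (s * b\<^sup>2)\<rfloor>..\<lfloor>s * b\<^sup>2\<rfloor>}"
  proof
    fix k assume "k \<in> f ` F"
    then obtain v where v: "v \<in> F" "k = f v" by auto
    then have "\<bar>fst v / snd v\<bar> \<le> s" by (auto simp: F_def abs_divide divide_le_eq)
    then have "\<bar>b\<^sup>2 * (fst v / snd v)\<bar> \<le> s * b\<^sup>2"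
      unfolding abs_mult by (metis abs_ge_zero abs_power2 mult.commute mult_right_mono)
    then show "k \<in> {\<lfloor>- (s * b\<^sup>2)\<rfloor>..\<lfloor>s * b\<^sup>2\<rfloor>}"
      unfolding v f_def by (simp only: atLeastAtMost_iff, intro conjI floor_mono) linarith+
  qed
  have inj: "inj_on f F"
  proof (rule inj_onI, rule ccontr)
    fix v w assume v: "v \<in> F" "w \<in> F" "f v = f w" "v \<noteq> w"
    have pos: "0 < snd v" "0 < snd w" "snd v \<le> b" "snd w \<le> b" using v by (auto simp: F_def)
    have "v \<noteq> - w" using pos by auto
    then have 1: "1 \<le> \<bar>wedge v w\<bar>" using prims_wedge[OF L] v by (auto simp: F_def)
    have "\<bar>b\<^sup>2 * (fst v / snd v) - b\<^sup>2 * (fst w / snd w)\<bar> = b\<^sup>2 * (\<bar>wedge v w\<bar> / (snd v * snd w))"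
    proof -
      have "b\<^sup>2 * (fst v / snd v) - b\<^sup>2 * (fst w / snd w) = b\<^sup>2 * (wedge v w / (snd v * snd w))"
        using pos by (simp add: wedge_def field_simps)
      then show ?thesis using pos by (simp add: abs_mult)
    qed
    also have "\<dots> \<ge> b\<^sup>2 * (1 / b\<^sup>2)"
    proof (intro mult_left_mono frac_le)
      show "snd v * snd w \<le> b\<^sup>2" unfolding power2_eq_square using pos by (intro mult_mono) auto
    qed (use pos 1 in auto)
    finally have "\<bar>b\<^sup>2 * (fst v / snd v) - b\<^sup>2 * (fst w / snd w)\<bar> \<ge> 1" using b by simp
    then show False using v(3) unfolding f_def by linarith
  qed
  show fin: "finite F" using finite_subset[OF sub] inj by (auto dest: finite_imageD)
  have "card F = card (f ` F)" using inj by (simp add: card_image)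
  also have "\<dots> \<le> card {\<lfloor>- (s * b\<^sup>2)\<rfloor>..\<lfloor>s * b\<^sup>2\<rfloor>}" by (intro card_mono sub) auto
  also have "\<dots> = nat (\<lfloor>s * b\<^sup>2\<rfloor> - \<lfloor>- (s * b\<^sup>2)\<rfloor> + 1)" by simp
  finally have "real (card F) \<le> of_int (\<lfloor>s * b\<^sup>2\<rfloor> - \<lfloor>- (s * b\<^sup>2)\<rfloor> + 1)"
  proof -
    have "0 \<le> s * b\<^sup>2" using s by simp
    then have "\<lfloor>- (s * b\<^sup>2)\<rfloor> \<le> \<lfloor>s * b\<^sup>2\<rfloor>" by (intro floor_mono) linarith
    moreover assume "card F \<le> nat (\<lfloor>s * b\<^sup>2\<rfloor> - \<lfloor>- (s * b\<^sup>2)\<rfloor> + 1)"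
    ultimately have "int (card F) \<le> \<lfloor>s * b\<^sup>2\<rfloor> - \<lfloor>- (s * b\<^sup>2)\<rfloor> + 1" by linarith
    then show ?thesis by linarith
  qed
  also have "\<dots> \<le> 2 * s * b\<^sup>2 + 2" by linarith
  finally show "real (card F) \<le> 2 * s * b\<^sup>2 + 2" .
qed

section \<open>Measurability of lattice functionals and invariance of their integrals\<close>

locale haar =
  fixes \<mu> :: "(real^2) set measure"
  assumes haar: "is_haar_prob \<mu>"
begin

sublocale prob_space \<mu> using haar by (simp add: is_haar_prob_def)

lemma space_mu: "space \<mu> = unimodular_lattices" using haar by (simp add: is_haar_prob_def)

lemma lattice_open_sets: "lattice_open U \<Longrightarrow> U \<in> sets \<mu>"
proof -
  assume "lattice_open U"
  moreover have "Collect lattice_open \<subseteq> Pow unimodular_lattices" by (auto simp: lattice_open_def)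
  moreover have "sets \<mu> = sets lattice_borel" using haar by (simp add: is_haar_prob_def)
  ultimately show ?thesis by (auto simp: lattice_borel_def sets_measure_of)
qed

text \<open>The sigma-algebra is generated by the quotient topology, so lower semicontinuity in the
  matrix \<open>g\<close> is enough. This fits functionals that are suprema of continuous functions
  of finitely many primitive vectors.\<close>

lemma measurable_lsc:
  fixes F :: "(real^2) set \<Rightarrow> real"
  assumes "\<And>a. openin (top_of_set SL2R) {g \<in> SL2R. a < F (act g Z2)}"
  shows "F \<in> borel_measurable \<mu>"
  unfolding borel_measurable_iff_greater
proof
  fix a
  have "{g \<in> SL2R. act g Z2 \<in> {L \<in> space \<mu>. a < F L}} = {g \<in> SL2R. a < F (act g Z2)}"
    by (auto simp: space_mu unimodular_latticesI)
  then have "lattice_open {L \<in> space \<mu>. a < F L}"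
    unfolding lattice_open_def using assms[of a] by (auto simp: space_mu)
  then show "{L \<in> space \<mu>. a < F L} \<in> sets \<mu>" by (rule lattice_open_sets)
qed

lemma act_measurable[measurable]:
  assumes "g \<in> SL2R" shows "act g \<in> measurable \<mu> \<mu>"
proof -
  have "sets \<mu> = sigma_sets unimodular_lattices (Collect lattice_open)"
    using haar by (auto simp: is_haar_prob_def lattice_borel_def lattice_open_def intro!: sets_measure_of)
  moreover have "act g -` U \<inter> space \<mu> = {L \<in> unimodular_lattices. act g L \<in> U}" for U
    by (auto simp: space_mu)
  ultimately show ?thesis
    using assms by (intro measurable_sigma_sets[where \<Omega>=unimodular_lattices and A="Collect lattice_open"])
      (auto simp: space_mu act_in_lattices lattice_open_sets lattice_open_act, auto simp: lattice_open_def)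
qed

text \<open>\<open>is_haar_prob\<close> states invariance for direct images of sets; the preimage
  under \<open>act g\<close> is the direct image under the inverse matrix.\<close>

lemma distr_act: assumes g: "g \<in> SL2R" shows "distr \<mu> \<mu> (act g) = \<mu>"
proof (rule measure_eqI)
  fix A assume A: "A \<in> sets (distr \<mu> \<mu> (act g))"
  then have A: "A \<in> sets \<mu>" by simp
  obtain k where k: "k \<in> SL2R" "k ** g = mat 1" "g ** k = mat 1" using SL2R_inverse[OF g] by blast
  have "act g -` A \<inter> space \<mu> = act k ` A"
  proof (intro set_eqI iffI)
    fix L assume "L \<in> act g -` A \<inter> space \<mu>"
    then have "act g L \<in> A" "act k (act g L) = L" using k by (auto simp: act_mat1 simp flip: act_mult)
    then show "L \<in> act k ` A" by (metis image_eqI)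
  next
    fix L assume "L \<in> act k ` A"
    then obtain M where M: "M \<in> A" "L = act k M" by auto
    then have "act g L = M" using k by (auto simp: act_mat1 simp flip: act_mult)
    moreover have "M \<in> space \<mu>" using A M sets.sets_into_space by blast
    ultimately show "L \<in> act g -` A \<inter> space \<mu>" using M k by (auto simp: space_mu act_in_lattices)
  qed
  then have "emeasure (distr \<mu> \<mu> (act g)) A = emeasure \<mu> (act k ` A)"
    using g A by (simp add: emeasure_distr)
  also have "\<dots> = emeasure \<mu> A" using haar k A by (auto simp: is_haar_prob_def)
  finally show "emeasure (distr \<mu> \<mu> (act g)) A = emeasure \<mu> A" .
qed simp

lemma integral_act:
  fixes F :: "(real^2) set \<Rightarrow> real"
  assumes "g \<in> SL2R" "F \<in> borel_measurable \<mu>"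
  shows "(\<integral>L. F (act g L) \<partial>\<mu>) = (\<integral>L. F L \<partial>\<mu>)"
proof -
  have "(\<integral>L. F L \<partial>\<mu>) = (\<integral>L. F L \<partial>(distr \<mu> \<mu> (act g)))" using distr_act[OF assms(1)] by simp
  also have "\<dots> = (\<integral>L. F (act g L) \<partial>\<mu>)" using assms by (intro integral_distr) auto
  finally show ?thesis by simp
qed

text \<open>The negated norm is the supremum over coprime pairs of functions continuous in the
  matrix, hence lower semicontinuous.\<close>

lemma measurable_lattice_norm[measurable]: "lattice_norm \<in> borel_measurable \<mu>"
proof -
  have "(\<lambda>L. - lattice_norm L) \<in> borel_measurable \<mu>"
  proof (rule measurable_lsc)
    fix a :: real
    have "{g \<in> SL2R. a < - lattice_norm (act g Z2)} = (\<Union>m\<in>coprime_pairs. {g \<in> SL2R. a < - norm (emb g m)})"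
    proof -
      have "a < - lattice_norm (act g Z2) \<longleftrightarrow> (\<exists>m\<in>coprime_pairs. a < - norm (emb g m))" if g: "g \<in> SL2R" for g
      proof -
        note L = unimodular_latticesI[OF g]
        obtain v where v: "v \<in> prims (act g Z2)" "norm v = lattice_norm (act g Z2)"
          using lattice_norm_prims(1)[OF L] by blast
        obtain m0 where m0: "m0 \<in> coprime_pairs" "v = emb g m0" using v prims_act_Z2[OF g] by auto
        have "lattice_norm (act g Z2) \<le> norm (emb g m)" if "m \<in> coprime_pairs" for m
          using lattice_norm_prims(2)[OF L] prims_act_Z2[OF g] that by auto
        then show ?thesis using m0 v(2) by (metis neg_le_iff_le order_less_le_trans)
      qed
      then show ?thesis by auto
    qed
    moreover have "openin (top_of_set SL2R) (\<Union>m\<in>coprime_pairs. {g \<in> SL2R. a < - norm (emb g m)})"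
      by (intro openin_Union) (auto intro!: openin_less continuous_intros emb_continuous)
    ultimately show "openin (top_of_set SL2R) {g \<in> SL2R. a < - lattice_norm (act g Z2)}" by simp
  qed
  then show ?thesis using borel_measurable_uminus by fastforce
qed

text \<open>For nonnegative \<open>\<Phi>\<close> the sum is the supremum of its partial sums over
  finite sets of coprime pairs, each continuous in the matrix, hence it is lower
  semicontinuous.\<close>

lemma measurable_psum_nonneg:
  assumes c: "continuous_on UNIV \<Phi>" and b: "bsupp r \<Phi>" and p: "\<And>v. 0 \<le> \<Phi> v"
  shows "psum \<Phi> \<in> borel_measurable \<mu>"
proof (rule measurable_lsc)
  fix a :: real
  have "a < psum \<Phi> (act g Z2) \<longleftrightarrow> (\<exists>M\<in>{M. finite M \<and> M \<subseteq> coprime_pairs}. a < (\<Sum>m\<in>M. \<Phi> (emb g m)))"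
    if g: "g \<in> SL2R" for g
  proof -
    define M0 where "M0 = {m \<in> coprime_pairs. norm (emb g m) \<le> r}"
    have fin: "finite {m. norm (emb g m) \<le> r'}" for r' by (rule finite_emb[OF g])
    have inj: "inj_on (emb g) A" for A using inj_emb[OF g] by (rule inj_on_subset) simp
    have P: "prims (act g Z2) = emb g ` coprime_pairs" using g by (rule prims_act_Z2)
    have eq: "psum \<Phi> (act g Z2) = (\<Sum>m\<in>M. \<Phi> (emb g m))"
      if "finite M" "M \<subseteq> coprime_pairs" "M0 \<subseteq> M" for M
    proof -
      have "psum \<Phi> (act g Z2) = sum \<Phi> (emb g ` M)"
      proof (intro psum_eq)
        fix v assume "v \<in> prims (act g Z2)" "\<Phi> v \<noteq> 0"
        then obtain m where "v = emb g m" "m \<in> coprime_pairs" "norm v \<le> r"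
          using b unfolding P bsupp_def by blast
        then show "v \<in> emb g ` M" using that(3) by (auto simp: M0_def)
      qed (use that P in auto)
      then show ?thesis by (simp add: sum.reindex inj)
    qed
    have M0: "finite M0" "M0 \<subseteq> coprime_pairs" using finite_subset[OF _ fin[of r]] by (auto simp: M0_def)
    have "(\<Sum>m\<in>M. \<Phi> (emb g m)) \<le> psum \<Phi> (act g Z2)" if "finite M" "M \<subseteq> coprime_pairs" for M
    proof -
      have "(\<Sum>m\<in>M. \<Phi> (emb g m)) \<le> (\<Sum>m\<in>M \<union> M0. \<Phi> (emb g m))"
        using that M0 p by (intro sum_mono2) auto
      also have "\<dots> = psum \<Phi> (act g Z2)" using that M0 by (intro eq[symmetric]) auto
      finally show ?thesis .
    qed
    then show ?thesis using eq[OF M0] M0 by fastforce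
  qed
  then have "{g \<in> SL2R. a < psum \<Phi> (act g Z2)}
      = (\<Union>M\<in>{M. finite M \<and> M \<subseteq> coprime_pairs}. {g \<in> SL2R. a < (\<Sum>m\<in>M. \<Phi> (emb g m))})"
    by auto
  moreover have "openin (top_of_set SL2R) \<dots>"
    by (intro openin_Union)
      (auto intro!: openin_less continuous_intros continuous_on_UNIV_comp[OF c] emb_continuous)
  ultimately show "openin (top_of_set SL2R) {g \<in> SL2R. a < psum \<Phi> (act g Z2)}" by simp
qed

lemma measurable_psum:
  assumes c: "continuous_on UNIV \<Phi>" and b: "bsupp r \<Phi>"
  shows "psum \<Phi> \<in> borel_measurable \<mu>"
proof -
  have 1: "psum (\<lambda>v. max 0 (\<Phi> v)) \<in> borel_measurable \<mu>"
    using b by (intro measurable_psum_nonneg[of _ r] continuous_intros c) (auto simp: bsupp_def max_def)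
  have 2: "psum (\<lambda>v. max 0 (- \<Phi> v)) \<in> borel_measurable \<mu>"
    using b by (intro measurable_psum_nonneg[of _ r] continuous_intros c) (auto simp: bsupp_def max_def)
  have "psum \<Phi> L = psum (\<lambda>v. max 0 (\<Phi> v)) L - psum (\<lambda>v. max 0 (- \<Phi> v)) L" if L: "L \<in> space \<mu>" for L
  proof -
    have L: "L \<in> unimodular_lattices" using L by (simp add: space_mu)
    have b': "bsupp r (\<lambda>v. max 0 (\<Phi> v))" "bsupp r (\<lambda>v. max 0 (- \<Phi> v))" using b by (auto simp: bsupp_def max_def)
    show ?thesis unfolding psum_ball[OF L b] psum_ball[OF L b'(1)] psum_ball[OF L b'(2)]
      by (simp flip: sum_subtractf) (intro sum.cong; auto)
  qed
  then have "psum \<Phi> \<in> borel_measurable \<mu> \<longleftrightarrow>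
      (\<lambda>L. psum (\<lambda>v. max 0 (\<Phi> v)) L - psum (\<lambda>v. max 0 (- \<Phi> v)) L) \<in> borel_measurable \<mu>"
    by (intro measurable_cong)
  then show ?thesis using 1 2 by simp
qed

subsection \<open>Almost every lattice has no horizontal vector\<close>

text \<open>Diagonal matrices rescale horizontal vectors, so by invariance all the sets
  \<open>D r\<close> have the same measure; they decrease to the empty set as r tends to 0, so this
  measure is 0. Almost surely, then, exactly one of each pair v, -v lies in the upper half
  plane.\<close>

lemma AE_no_horizontal: "AE L in \<mu>. \<forall>v\<in>prims L. snd v \<noteq> 0"
proof -
  define D where "D r = {L \<in> space \<mu>. \<exists>v\<in>prims L. snd v = 0 \<and> \<bar>fst v\<bar> < r}" for r :: real
  have D_meas: "D r \<in> sets \<mu>" for r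
  proof -
    \<comment> \<open>\<open>D r\<close> need not be open; thickening the condition
      \<open>snd v = 0\<close> exhibits it as a countable intersection of open sets.\<close>
    define O' where "O' n = {L \<in> space \<mu>. \<exists>v\<in>prims L. \<bar>snd v\<bar> < 1 / real (Suc n) \<and> \<bar>fst v\<bar> < r}" for n
    have "O' n \<in> sets \<mu>" for n
    proof (rule lattice_open_sets)
      have "{g \<in> SL2R. act g Z2 \<in> O' n} = (\<Union>m\<in>coprime_pairs.
          {g \<in> SL2R. 0 < 1 / real (Suc n) - \<bar>snd (emb g m)\<bar>} \<inter> {g \<in> SL2R. 0 < r - \<bar>fst (emb g m)\<bar>})"
      proof -
        have "act g Z2 \<in> O' n \<longleftrightarrow> (\<exists>m\<in>coprime_pairs. \<bar>snd (emb g m)\<bar> < 1 / real (Suc n) \<and> \<bar>fst (emb g m)\<bar> < r)"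
          if "g \<in> SL2R" for g
          unfolding O'_def using that by (simp add: prims_act_Z2 space_mu unimodular_latticesI)
        then show ?thesis by auto
      qed
      moreover have "openin (top_of_set SL2R) \<dots>"
        by (rule openin_Union, elim imageE, hypsubst, intro openin_Int openin_less continuous_intros emb_continuous)
      ultimately show "lattice_open (O' n)" by (auto simp: lattice_open_def O'_def space_mu)
    qed
    moreover have "D r = (\<Inter>n. O' n)"
    proof
      show "D r \<subseteq> (\<Inter>n. O' n)" unfolding D_def O'_def by force
      show "(\<Inter>n. O' n) \<subseteq> D r"
      proof
        fix L assume "L \<in> (\<Inter>n. O' n)"
        then have LO: "L \<in> O' n" for n by auto
        then have L: "L \<in> unimodular_lattices" using LO[of 0] by (simp add: O'_def space_mu)
        \<comment> \<open>The vectors found for the different n all lie in this finite set, so one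
          of them has second coordinate exactly 0.\<close>
        define F where "F = {v \<in> prims L. norm v \<le> r + 1 \<and> \<bar>fst v\<bar> < r}"
        have F: "finite F" by (rule finite_subset[OF _ finite_prims[OF L, of "r + 1"]]) (auto simp: F_def)
        have ex: "\<exists>v\<in>F. \<bar>snd v\<bar> < 1 / real (Suc n)" for n
        proof -
          obtain v where v: "v \<in> prims L" "\<bar>snd v\<bar> < 1 / real (Suc n)" "\<bar>fst v\<bar> < r"
            using LO[of n] by (auto simp: O'_def)
          have "norm v \<le> \<bar>fst v\<bar> + \<bar>snd v\<bar>" by (metis norm_Pair_le prod.collapse real_norm_def)
          moreover have "1 / real (Suc n) \<le> 1" by simp
          ultimately have "norm v \<le> r + 1" using v by linarith
          then have "v \<in> F" using v unfolding F_def by simp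
          then show ?thesis using v by blast
        qed
        have "\<exists>v\<in>F. snd v = 0"
        proof (rule ccontr)
          assume c: "\<not> (\<exists>v\<in>F. snd v = 0)"
          have ne: "F \<noteq> {}" using ex[of 0] by auto
          define e where "e = Min ((\<lambda>v. \<bar>snd v\<bar>) ` F)"
          have "e \<in> (\<lambda>v. \<bar>snd v\<bar>) ` F" unfolding e_def using F ne by (intro Min_in) auto
          then have "e > 0" using c by auto
          then obtain n where n: "1 / real (Suc n) < e" using nat_approx_posE by (metis inverse_eq_divide)
          obtain v where v: "v \<in> F" "\<bar>snd v\<bar> < 1 / real (Suc n)" using ex by blast
          have "e \<le> \<bar>snd v\<bar>" unfolding e_def using F v by (intro Min_le) auto
          then show False using n v by linarith
        qed
        then show "L \<in> D r" using L unfolding D_def F_def space_mu by blast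
      qed
    qed
    ultimately show ?thesis by auto
  qed
  \<comment> \<open>\<open>\<delta> (ln r)\<close> multiplies first coordinates by r and keeps
    horizontal vectors horizontal.\<close>
  have inv: "measure \<mu> (D r) = measure \<mu> (D 1)" if r: "r > 0" for r
  proof -
    have "act (\<delta> (ln r)) -` D r \<inter> space \<mu> = D 1"
    proof (rule set_eqI)
      fix L
      show "L \<in> act (\<delta> (ln r)) -` D r \<inter> space \<mu> \<longleftrightarrow> L \<in> D 1"
      proof (cases "L \<in> unimodular_lattices")
        case True
        then show ?thesis using r
          by (simp add: D_def space_mu act_in_lattices delta_in prims_act lact_delta abs_mult)
      qed (simp add: D_def space_mu)
    qed
    then have "measure (distr \<mu> \<mu> (act (\<delta> (ln r)))) (D r) = measure \<mu> (D 1)"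
      using D_meas[of r] by (simp add: measure_distr delta_in)
    then show ?thesis by (simp add: distr_act delta_in)
  qed
  have "(\<lambda>n. measure \<mu> (D (1 / real (Suc n)))) \<longlonglongrightarrow> measure \<mu> (\<Inter>n. D (1 / real (Suc n)))"
  proof (rule finite_Lim_measure_decseq)
    show "range (\<lambda>n. D (1 / real (Suc n))) \<subseteq> sets \<mu>" using D_meas by auto
    show "decseq (\<lambda>n. D (1 / real (Suc n)))"
    proof (rule decseq_SucI)
      fix n show "D (1 / real (Suc (Suc n))) \<subseteq> D (1 / real (Suc n))"
      proof -
        have "1 / real (Suc (Suc n)) \<le> 1 / real (Suc n)" by (intro divide_left_mono) auto
        then show ?thesis unfolding D_def by (blast intro: order_less_le_trans)
      qed
    qed
  qed
  moreover have "(\<Inter>n. D (1 / real (Suc n))) = {}"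
  proof (rule ccontr)
    assume "(\<Inter>n. D (1 / real (Suc n))) \<noteq> {}"
    then obtain L where LD: "\<And>n. L \<in> D (1 / real (Suc n))" by blast
    then have L: "L \<in> unimodular_lattices" by (auto simp: D_def space_mu)
    obtain n where n: "1 / real (Suc n) < lattice_norm L"
      using nat_approx_posE[OF lattice_norm_pos[OF L]] by (metis inverse_eq_divide)
    obtain v where v: "v \<in> prims L" "snd v = 0" "\<bar>fst v\<bar> < 1 / real (Suc n)" using LD[of n] by (auto simp: D_def)
    have "norm v = \<bar>fst v\<bar>" using v(2) by (cases v) (simp add: norm_Pair)
    then show False using lattice_norm_prims(2)[OF L v(1)] v(3) n by linarith
  qed
  moreover have "measure \<mu> (D (1 / real (Suc n))) = measure \<mu> (D 1)" for n by (intro inv) auto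
  ultimately have D1: "measure \<mu> (D 1) = 0" by (simp add: LIMSEQ_const_iff)
  have "AE L in \<mu>. L \<notin> D (real (Suc n))" for n
  proof -
    have "measure \<mu> (D (real (Suc n))) = 0" using inv[of "real (Suc n)"] D1 by simp
    then have "emeasure \<mu> (D (real (Suc n))) = 0" by (simp add: emeasure_eq_measure)
    then have "D (real (Suc n)) \<in> null_sets \<mu>" using D_meas by auto
    then show ?thesis by (rule AE_not_in)
  qed
  then have "AE L in \<mu>. \<forall>n. L \<notin> D (real (Suc n))" by (simp add: AE_all_countable)
  with AE_space show ?thesis
  proof (eventually_elim, intro ballI notI)
    fix L v assume D: "\<forall>n. L \<notin> D (real (Suc n))" and v: "v \<in> prims L" "snd v = 0" "L \<in> space \<mu>"
    obtain n where n: "\<bar>fst v\<bar> < real n" using reals_Archimedean2 by blast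
    then have "\<bar>fst v\<bar> < real (Suc n)" by simp
    then show False using D v unfolding D_def by blast
  qed
qed

end

section \<open>Lebesgue measure and linear maps of the plane\<close>

lemma borel_lact[measurable]: "lact g \<in> borel_measurable borel"
  unfolding lact_def by (intro borel_measurable_continuous_onI continuous_intros)

lemma borel_fst_snd[measurable]:
  "fst \<in> borel_measurable (borel :: (real \<times> real) measure)"
  "snd \<in> borel_measurable (borel :: (real \<times> real) measure)"
  by (intro borel_measurable_continuous_onI continuous_intros)+

lemma nn_integral_lborel_pair:
  fixes F :: "real \<times> real \<Rightarrow> ennreal"
  assumes [measurable]: "F \<in> borel_measurable borel"
  shows "(\<integral>\<^sup>+v. F v \<partial>lborel) = (\<integral>\<^sup>+x. \<integral>\<^sup>+y. F (x, y) \<partial>lborel \<partial>lborel)"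
    "(\<integral>\<^sup>+v. F v \<partial>lborel) = (\<integral>\<^sup>+y. \<integral>\<^sup>+x. F (x, y) \<partial>lborel \<partial>lborel)"
proof -
  have [measurable]: "F \<in> borel_measurable (lborel \<Otimes>\<^sub>M lborel)"
    by (simp add: lborel_prod)
  show "(\<integral>\<^sup>+v. F v \<partial>lborel) = (\<integral>\<^sup>+x. \<integral>\<^sup>+y. F (x, y) \<partial>lborel \<partial>lborel)"
    by (subst lborel.nn_integral_fst) (simp_all add: lborel_prod)
  show "(\<integral>\<^sup>+v. F v \<partial>lborel) = (\<integral>\<^sup>+y. \<integral>\<^sup>+x. F (x, y) \<partial>lborel \<partial>lborel)"
    by (subst lborel_pair.nn_integral_snd) (simp_all add: lborel_prod)
qed

lemma nn_integral_diag:
  fixes F :: "real \<times> real \<Rightarrow> ennreal"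
  assumes F[measurable]: "F \<in> borel_measurable borel" and ab: "a \<noteq> 0" "b \<noteq> 0"
  shows "(\<integral>\<^sup>+v. F v \<partial>lborel) = ennreal (\<bar>a\<bar> * \<bar>b\<bar>) * (\<integral>\<^sup>+v. F (a * fst v, b * snd v) \<partial>lborel)"
proof -
  have "(\<integral>\<^sup>+v. F v \<partial>lborel) = (\<integral>\<^sup>+x. \<integral>\<^sup>+y. F (x, y) \<partial>lborel \<partial>lborel)"
    by (rule nn_integral_lborel_pair) fact
  also have "\<dots> = (\<integral>\<^sup>+x. \<bar>b\<bar> * (\<integral>\<^sup>+y. F (x, b * y) \<partial>lborel) \<partial>lborel)"
    using ab by (subst nn_integral_real_affine[where c=b and t=0]) auto
  also have "\<dots> = \<bar>a\<bar> * (\<integral>\<^sup>+x. \<bar>b\<bar> * (\<integral>\<^sup>+y. F (a * x, b * y) \<partial>lborel) \<partial>lborel)"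
    using ab by (subst nn_integral_real_affine[where c=a and t=0]) auto
  also have "\<dots> = \<bar>a\<bar> * (\<bar>b\<bar> * (\<integral>\<^sup>+x. \<integral>\<^sup>+y. F (a * x, b * y) \<partial>lborel \<partial>lborel))"
    by (subst nn_integral_cmult) auto
  also have "(\<integral>\<^sup>+x. \<integral>\<^sup>+y. F (a * x, b * y) \<partial>lborel \<partial>lborel) = (\<integral>\<^sup>+v. F (a * fst v, b * snd v) \<partial>lborel)"
    by (subst nn_integral_lborel_pair(1)) auto
  finally show ?thesis by (simp add: ennreal_mult mult.assoc)
qed

lemma nn_integral_shear1:
  fixes F :: "real \<times> real \<Rightarrow> ennreal"
  assumes F[measurable]: "F \<in> borel_measurable borel"
  shows "(\<integral>\<^sup>+v. F (fst v, snd v + k * fst v) \<partial>lborel) = (\<integral>\<^sup>+v. F v \<partial>lborel)"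
proof -
  have "(\<integral>\<^sup>+y. F (x, y) \<partial>lborel) = (\<integral>\<^sup>+y. F (x, y + k * x) \<partial>lborel)" for x
    by (subst nn_integral_real_affine[where c=1 and t="k * x"]) (auto simp: add.commute)
  then show ?thesis by (subst (1 2) nn_integral_lborel_pair(1)) auto
qed

lemma nn_integral_shear2:
  fixes F :: "real \<times> real \<Rightarrow> ennreal"
  assumes F[measurable]: "F \<in> borel_measurable borel"
  shows "(\<integral>\<^sup>+v. F (fst v + k * snd v, snd v) \<partial>lborel) = (\<integral>\<^sup>+v. F v \<partial>lborel)"
proof -
  have "(\<integral>\<^sup>+x. F (x, y) \<partial>lborel) = (\<integral>\<^sup>+x. F (x + k * y, y) \<partial>lborel)" for y
    by (subst nn_integral_real_affine[where c=1 and t="k * y"]) (auto simp: add.commute)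
  then show ?thesis by (subst (1 2) nn_integral_lborel_pair(2)) auto
qed

text \<open>If the upper left entry \<open>a\<close> is nonzero, the matrix is a product of a lower
  shear, the diagonal matrix with entries a and 1/a, and an upper shear, each preserving Lebesgue
  measure.\<close>

lemma nn_integral_lact:
  fixes F :: "real \<times> real \<Rightarrow> ennreal"
  assumes F[measurable]: "F \<in> borel_measurable borel" and g: "g \<in> SL2R"
  shows "(\<integral>\<^sup>+v. F (lact g v) \<partial>lborel) = (\<integral>\<^sup>+v. F v \<partial>lborel)"
proof -
  have main: "(\<integral>\<^sup>+v. F (lact g v) \<partial>lborel) = (\<integral>\<^sup>+v. F v \<partial>lborel)"
    if g: "g \<in> SL2R" and a: "g$1$1 \<noteq> 0" for g
  proof -
    define a b c d where abcd: "a = g$1$1" "b = g$1$2" "c = g$2$1" "d = g$2$2"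
    have d: "d = 1 / a + c * b / a" using g a by (simp add: SL2R_det abcd field_simps)
    have "(\<integral>\<^sup>+v. F v \<partial>lborel) = (\<integral>\<^sup>+v. F (fst v, snd v + (c / a) * fst v) \<partial>lborel)"
      by (rule nn_integral_shear1[symmetric]) fact
    also have "\<dots> = (\<integral>\<^sup>+v. F (a * fst v, (1 / a) * snd v + (c / a) * (a * fst v)) \<partial>lborel)"
      using a by (subst nn_integral_diag[of _ a "1 / a"]) (auto simp: abcd)
    also have "\<dots> = (\<integral>\<^sup>+v. F (a * (fst v + b / a * snd v), (1 / a) * snd v + (c / a) * (a * (fst v + b / a * snd v))) \<partial>lborel)"
      by (subst nn_integral_shear2[symmetric, where k="b / a"]) auto
    also have "\<dots> = (\<integral>\<^sup>+v. F (lact g v) \<partial>lborel)"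
    proof (intro nn_integral_cong arg_cong[of _ _ F])
      fix v :: "real \<times> real"
      have "1 / a * snd v + c / a * (a * (fst v + b / a * snd v)) = c * fst v + d * snd v"
        using a unfolding d by (simp add: abcd field_simps)
      then show "(a * (fst v + b / a * snd v), 1 / a * snd v + c / a * (a * (fst v + b / a * snd v))) = lact g v"
        using a by (simp add: lact_def abcd field_simps)
    qed
    finally show ?thesis by simp
  qed
  show ?thesis
  proof (cases "g$1$1 = 0")
    case False then show ?thesis using main g by simp
  next
    case True
    \<comment> \<open>Multiplying by this lower shear moves the entry \<open>g$1$2\<close>, which is
      nonzero here, into the upper left corner.\<close>
    define e :: "real^2^2" where "e = vector [vector [1, 0], vector [1, 1]]"
    have e: "e \<in> SL2R" by (simp add: SL2R_det e_def)
    have "g$1$2 \<noteq> 0" using True g by (auto simp: SL2R_det)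
    then have "(g ** e)$1$1 \<noteq> 0" using True by (simp add: matrix_matrix_mult_def sum_2 e_def)
    then have "(\<integral>\<^sup>+v. F v \<partial>lborel) = (\<integral>\<^sup>+v. F (lact (g ** e) v) \<partial>lborel)"
      using main[OF SL2R_mult[OF g e]] by simp
    also have "\<dots> = (\<integral>\<^sup>+v. F (lact g (fst v, snd v + 1 * fst v)) \<partial>lborel)"
      unfolding lact_mult by (simp add: lact_def e_def add.commute)
    also have "\<dots> = (\<integral>\<^sup>+v. F (lact g v) \<partial>lborel)" by (rule nn_integral_shear1) simp
    finally show ?thesis by simp
  qed
qed

lemma distr_lact:
  assumes g: "g \<in> SL2R" shows "distr lborel lborel (lact g) = lborel"
proof (rule measure_eqI)
  fix A assume "A \<in> sets (distr lborel lborel (lact g))"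
  then have A[measurable]: "A \<in> sets borel" by simp
  have "emeasure (distr lborel lborel (lact g)) A = (\<integral>\<^sup>+v. indicator A v \<partial>(distr lborel lborel (lact g)))"
    by simp
  also have "\<dots> = (\<integral>\<^sup>+v. indicator A (lact g v) \<partial>lborel)" by (rule nn_integral_distr) measurable
  also have "\<dots> = (\<integral>\<^sup>+v. indicator A v \<partial>lborel)" by (rule nn_integral_lact[OF _ g]) measurable
  also have "\<dots> = emeasure lborel A" by simp
  finally show "emeasure (distr lborel lborel (lact g)) A = emeasure lborel A" .
qed simp

lemma integral_scale_plane:
  fixes F :: "real \<times> real \<Rightarrow> real"
  assumes F[measurable]: "F \<in> borel_measurable borel" and Q: "Q > 0"
  shows "(\<integral>v. F v \<partial>lborel) = Q\<^sup>2 * (\<integral>v. F (Q *\<^sub>R v) \<partial>lborel)"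
    "integrable lborel (\<lambda>v. F (Q *\<^sub>R v)) \<longleftrightarrow> integrable lborel F"
proof -
  have L: "lborel = density (distr lborel borel (\<lambda>x::real \<times> real. 0 + Q *\<^sub>R x)) (\<lambda>_. \<bar>Q\<bar>^2)"
    using lborel_affine[where 'a="real \<times> real" and c=Q and t=0] Q by (simp add: power2_eq_square)
  show "(\<integral>v. F v \<partial>lborel) = Q\<^sup>2 * (\<integral>v. F (Q *\<^sub>R v) \<partial>lborel)"
    by (subst L, subst integral_density) (simp_all add: integral_distr)
  show "integrable lborel (\<lambda>v. F (Q *\<^sub>R v)) \<longleftrightarrow> integrable lborel F"
    using Q by (subst (2) L, subst integrable_density) (simp_all add: integrable_distr_eq)
qed

section \<open>Counting lattice points\<close>

definition floor2 :: "real \<times> real \<Rightarrow> int \<times> int" where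
  "floor2 v = (\<lfloor>fst v\<rfloor>, \<lfloor>snd v\<rfloor>)"

definition zsum :: "(int \<times> int \<Rightarrow> real) \<Rightarrow> real" where
  "zsum G = (\<Sum>m\<in>{m. G m \<noteq> 0}. G m)"

lemma zsum_eq: "finite A \<Longrightarrow> (\<And>m. G m \<noteq> 0 \<Longrightarrow> m \<in> A) \<Longrightarrow> zsum G = sum G A"
  unfolding zsum_def by (intro sum.mono_neutral_left) auto

lemma measurable_floor2[measurable]: "floor2 \<in> borel \<rightarrow>\<^sub>M count_space UNIV"
proof (rule measurableI)
  fix A :: "(int \<times> int) set"
  have "floor2 -` A = (\<Union>m\<in>A. {v. \<lfloor>fst v\<rfloor> = fst m \<and> \<lfloor>snd v\<rfloor> = snd m})"
    by (auto simp: floor2_def)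
  moreover have "{v :: real \<times> real. \<lfloor>fst v\<rfloor> = fst m \<and> \<lfloor>snd v\<rfloor> = snd m} \<in> sets borel" for m by measurable
  ultimately show "floor2 -` A \<inter> space borel \<in> sets borel" by (auto intro!: sets.countable_UN')
qed simp

text \<open>Unit cells have area 1, so a lattice sum is the integral of a step function. Riemann
  sums become integrals, to which dominated convergence applies.\<close>

lemma zsum_integral:
  assumes fin: "finite {m. G m \<noteq> 0}"
  shows "(\<integral>v. G (floor2 v) \<partial>lborel) = zsum G"
proof -
  define S where "S = {m. G m \<noteq> 0}"
  define B where "B m = {of_int (fst m)..<of_int (fst m) + (1::real)} \<times> {of_int (snd m)..<of_int (snd m) + (1::real)}" for m :: "int \<times> int"
  have B: "floor2 v = m \<longleftrightarrow> v \<in> B m" for v :: "real \<times> real" and m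
    by (cases v; cases m) (auto simp: floor2_def B_def floor_eq_iff)
  have mB: "emeasure lborel (B m) = 1" for m
    unfolding B_def lborel_prod[symmetric] by (subst lborel.emeasure_pair_measure_Times) auto
  have sB[measurable]: "B m \<in> sets borel" for m unfolding B_def by (intro borel_Times) auto
  have "(\<integral>v. G (floor2 v) \<partial>lborel) = (\<integral>v. (\<Sum>m\<in>S. G m * indicator (B m) v) \<partial>lborel)"
  proof (intro Bochner_Integration.integral_cong refl)
    fix v
    have "(\<Sum>m\<in>S. G m * indicator (B m) v) = (\<Sum>m\<in>S. if m = floor2 v then G m else 0)"
      by (intro sum.cong refl) (auto simp: indicator_def simp flip: B)
    also have "\<dots> = G (floor2 v)" using fin by (auto simp: S_def sum.delta')
    finally show "G (floor2 v) = (\<Sum>m\<in>S. G m * indicator (B m) v)" by simp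
  qed
  also have "\<dots> = (\<Sum>m\<in>S. G m * measure lborel (B m))"
    using mB by (subst Bochner_Integration.integral_sum) (auto simp: integrable_real_indicator)
  also have "\<dots> = zsum G" using mB by (simp add: measure_def zsum_def S_def)
  finally show ?thesis .
qed

lemma lact_scaled_floor_tendsto:
  assumes Q: "filterlim Q at_top sequentially"
  shows "(\<lambda>n. (1 / Q n) *\<^sub>R emb g (floor2 (Q n *\<^sub>R v))) \<longlonglongrightarrow> lact g v"
proof -
  have 1: "(\<lambda>n. of_int \<lfloor>Q n * x\<rfloor> / Q n) \<longlonglongrightarrow> x" for x
  proof (rule tendsto_sandwich[of "\<lambda>n. x - 1 / Q n" _ _ "\<lambda>n. x"])
    have pos: "\<forall>\<^sub>F n in sequentially. Q n > 0" using Q by (simp add: filterlim_at_top_dense)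
    show "\<forall>\<^sub>F n in sequentially. x - 1 / Q n \<le> of_int \<lfloor>Q n * x\<rfloor> / Q n" using pos
    proof eventually_elim
      case (elim n)
      have "x - 1 / Q n = (Q n * x - 1) / Q n" using elim by (simp add: field_simps)
      also have "\<dots> \<le> of_int \<lfloor>Q n * x\<rfloor> / Q n" using elim by (intro divide_right_mono) linarith+
      finally show ?case .
    qed
    show "\<forall>\<^sub>F n in sequentially. of_int \<lfloor>Q n * x\<rfloor> / Q n \<le> x" using pos
    proof eventually_elim
      case (elim n)
      have "of_int \<lfloor>Q n * x\<rfloor> / Q n \<le> (Q n * x) / Q n" using elim by (intro divide_right_mono) linarith+
      then show ?case using elim by simp
    qed
    show "(\<lambda>n. x - 1 / Q n) \<longlonglongrightarrow> x"
      using tendsto_diff[OF tendsto_const tendsto_divide_0[OF tendsto_const filterlim_at_top_imp_at_infinity[OF Q]], of x 1] by simp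
  qed simp
  have "(\<lambda>n. lact g (of_int \<lfloor>Q n * fst v\<rfloor> / Q n, of_int \<lfloor>Q n * snd v\<rfloor> / Q n)) \<longlonglongrightarrow> lact g (fst v, snd v)"
    unfolding lact_def fst_conv snd_conv by (intro tendsto_intros 1)
  then show ?thesis by (simp add: emb_def floor2_def flip: lact_scaleR)
qed

lemma finite_emb_scaled:
  assumes g: "g \<in> SL2R" and q: "q > 0" and R: "\<And>v. F v \<noteq> 0 \<Longrightarrow> norm v \<le> R"
  shows "finite {m. F ((1 / q) *\<^sub>R emb g m) \<noteq> (0::real)}"
proof (rule finite_subset)
  show "finite {m. norm (emb g m) \<le> q * R}" by (rule finite_emb[OF g])
  show "{m. F ((1 / q) *\<^sub>R emb g m) \<noteq> 0} \<subseteq> {m. norm (emb g m) \<le> q * R}"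
    using q by (auto dest!: R simp: field_simps)
qed

text \<open>The sum is the integral of \<open>F n\<close> at rounded and rescaled points; dominated
  convergence gives the integral of \<open>F'\<close> composed with \<open>lact g\<close>, and
  \<open>g\<close> preserves area. Both the function and the rounded point vary with n, so
  convergence is required along every sequence \<open>w\<close> tending to \<open>v\<close>.\<close>

lemma lattice_riemann:
  fixes F :: "nat \<Rightarrow> real \<times> real \<Rightarrow> real"
  assumes g: "g \<in> SL2R" and Q: "filterlim Q at_top sequentially"
    and F[measurable]: "\<And>n. F n \<in> borel_measurable borel" and F'[measurable]: "F' \<in> borel_measurable borel"
    and B: "\<And>n v. \<bar>F n v\<bar> \<le> B" and R: "\<And>n v. F n v \<noteq> 0 \<Longrightarrow> norm v \<le> R"
    and lim: "AE v in lborel. \<forall>w. w \<longlonglongrightarrow> v \<longrightarrow> (\<lambda>n. F n (w n)) \<longlonglongrightarrow> F' v"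
  shows "(\<lambda>n. (1 / (Q n)\<^sup>2) * zsum (\<lambda>m. F n ((1 / Q n) *\<^sub>R emb g m))) \<longlonglongrightarrow> (\<integral>v. F' v \<partial>lborel)"
proof -
  have Q1: "\<forall>\<^sub>F n in sequentially. Q n \<ge> 1" using Q by (simp add: filterlim_at_top)
  obtain c where c: "c > 0" "\<And>v. \<bar>fst v\<bar> \<le> c * norm (lact g v)" "\<And>v. \<bar>snd v\<bar> \<le> c * norm (lact g v)"
    using emb_bound[OF g] by blast
  have g_inv: "(\<integral>v. F' (lact g v) \<partial>lborel) = (\<integral>v. F' v \<partial>lborel)"
  proof -
    have "(\<integral>v. F' v \<partial>lborel) = (\<integral>v. F' v \<partial>(distr lborel lborel (lact g)))" by (simp add: distr_lact[OF g])
    also have "\<dots> = (\<integral>v. F' (lact g v) \<partial>lborel)" by (rule integral_distr) auto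
    finally show ?thesis by simp
  qed
  have eq: "(1 / (Q n)\<^sup>2) * zsum (\<lambda>m. F n ((1 / Q n) *\<^sub>R emb g m))
      = (\<integral>v. F n ((1 / Q n) *\<^sub>R emb g (floor2 (Q n *\<^sub>R v))) \<partial>lborel)" if "Q n \<ge> 1" for n
  proof -
    have [measurable]: "(\<lambda>v. F n ((1 / Q n) *\<^sub>R emb g (floor2 v))) \<in> borel_measurable borel"
      unfolding emb_def floor2_def by measurable
    have "zsum (\<lambda>m. F n ((1 / Q n) *\<^sub>R emb g m)) = (\<integral>v. F n ((1 / Q n) *\<^sub>R emb g (floor2 v)) \<partial>lborel)"
      using that by (intro zsum_integral[symmetric] finite_emb_scaled[OF g _ R]) auto
    also have "\<dots> = (Q n)\<^sup>2 * (\<integral>v. F n ((1 / Q n) *\<^sub>R emb g (floor2 (Q n *\<^sub>R v))) \<partial>lborel)"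
      using that by (intro integral_scale_plane(1)) auto
    finally show ?thesis using that by simp
  qed
  have "AE v in distr lborel lborel (lact g). \<forall>w. w \<longlonglongrightarrow> v \<longrightarrow> (\<lambda>n. F n (w n)) \<longlonglongrightarrow> F' v"
    unfolding distr_lact[OF g] by (rule lim)
  then have lim': "AE v in lborel. \<forall>w. w \<longlonglongrightarrow> lact g v \<longrightarrow> (\<lambda>n. F n (w n)) \<longlonglongrightarrow> F' (lact g v)"
    by (rule AE_distrD[rotated]) simp
  \<comment> \<open>A square containing every \<open>v\<close> whose rounded image meets the
    support: \<open>c * R\<close> bounds the rounded coordinates, and rounding at scale at least 1
    moves them by at most 1.\<close>
  define D where "D = {- (c * R + 1)..c * R + 1} \<times> {- (c * R + 1)..c * R + 1}"
  \<comment> \<open>Replacing \<open>Q n\<close> by \<open>max 1 (Q n)\<close> makes the domination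
    valid for every n and alters only finitely many terms.\<close>
  have "(\<lambda>n. \<integral>v. F n ((1 / max 1 (Q n)) *\<^sub>R emb g (floor2 (max 1 (Q n) *\<^sub>R v))) \<partial>lborel)
      \<longlonglongrightarrow> (\<integral>v. F' (lact g v) \<partial>lborel)"
  proof (rule integral_dominated_convergence)
    show "integrable lborel (\<lambda>v. \<bar>B\<bar> * indicator D v)"
    proof -
      have "emeasure lborel D = ennreal (2 * (c * R + 1)) * ennreal (2 * (c * R + 1))"
        if "c * R + 1 \<ge> 0"
      proof -
        have "emeasure lborel {- (c * R + 1)..c * R + 1} = ennreal (2 * (c * R + 1))"
          using that emeasure_lborel_Icc[of "- (c * R + 1)" "c * R + 1"] by (simp add: algebra_simps)
        then show ?thesis unfolding D_def lborel_prod[symmetric]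
          by (subst lborel.emeasure_pair_measure_Times) (simp_all only: borel_closed closed_atLeastAtMost sets_lborel)
      qed
      moreover have "D = {}" if "\<not> c * R + 1 \<ge> 0" using that by (auto simp: D_def algebra_simps)
      ultimately have "emeasure lborel D < \<infinity>"
        by (cases "c * R + 1 \<ge> 0") (auto simp: ennreal_mult_less_top)
      moreover have "D \<in> sets borel" unfolding D_def by (intro borel_Times) auto
      ultimately show ?thesis by (intro integrable_mult_right integrable_real_indicator) auto
    qed
    show "(\<lambda>v. F' (lact g v)) \<in> borel_measurable lborel" by measurable
    show "(\<lambda>v. F n ((1 / max 1 (Q n)) *\<^sub>R emb g (floor2 (max 1 (Q n) *\<^sub>R v)))) \<in> borel_measurable lborel" for n
      unfolding emb_def floor2_def by measurable
    show "AE v in lborel. norm (F n ((1 / max 1 (Q n)) *\<^sub>R emb g (floor2 (max 1 (Q n) *\<^sub>R v)))) \<le> \<bar>B\<bar> * indicator D v" for n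
    proof (rule AE_I2)
      fix v :: "real \<times> real"
      define q where "q = max 1 (Q n)"
      have q: "q \<ge> 1" by (simp add: q_def)
      define u where "u = ((1 / q) *\<^sub>R emb g (floor2 (q *\<^sub>R v)))"
      show "norm (F n ((1 / max 1 (Q n)) *\<^sub>R emb g (floor2 (max 1 (Q n) *\<^sub>R v)))) \<le> \<bar>B\<bar> * indicator D v"
      proof (cases "F n u = 0")
        case True then show ?thesis by (simp add: u_def q_def)
      next
        case False
        then have "norm u \<le> R" by (rule R)
        define x where "x = (of_int \<lfloor>q * fst v\<rfloor> / q, of_int \<lfloor>q * snd v\<rfloor> / q)"
        have u: "u = lact g x" by (simp add: u_def x_def emb_def floor2_def flip: lact_scaleR)
        have "\<bar>fst x\<bar> \<le> c * R" "\<bar>snd x\<bar> \<le> c * R"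
          using c(2,3)[of x] mult_left_mono[OF \<open>norm u \<le> R\<close>, of c] c(1) unfolding u by linarith+
        moreover have "\<bar>of_int \<lfloor>q * t\<rfloor> / q - t\<bar> \<le> 1" for t
        proof -
          have "\<bar>of_int \<lfloor>q * t\<rfloor> / q - t\<bar> = \<bar>of_int \<lfloor>q * t\<rfloor> - q * t\<bar> / q"
            using q by (simp add: field_simps abs_divide flip: abs_mult)
          also have "\<dots> \<le> 1 / q" using q by (intro divide_right_mono) linarith+
          also have "\<dots> \<le> 1" using q by simp
          finally show ?thesis .
        qed
        from this[of "fst v"] this[of "snd v"] have "\<bar>fst x - fst v\<bar> \<le> 1" "\<bar>snd x - snd v\<bar> \<le> 1"
          by (auto simp: x_def)
        ultimately have "v \<in> D" unfolding D_def by (cases v) auto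
        then show ?thesis using B[of n u] by (simp add: u_def q_def)
      qed
    qed
    have Qm: "filterlim (\<lambda>n. max 1 (Q n)) at_top sequentially"
      using Q1 by (intro filterlim_cong[THEN iffD1, OF refl refl _ Q]) (auto elim!: eventually_mono)
    show "AE v in lborel. (\<lambda>n. F n ((1 / max 1 (Q n)) *\<^sub>R emb g (floor2 (max 1 (Q n) *\<^sub>R v)))) \<longlonglongrightarrow> F' (lact g v)"
      using lim'
    proof eventually_elim
      case (elim v)
      then show ?case using lact_scaled_floor_tendsto[OF Qm, of g v] by blast
    qed
  qed
  moreover have "\<forall>\<^sub>F n in sequentially. (\<integral>v. F n ((1 / max 1 (Q n)) *\<^sub>R emb g (floor2 (max 1 (Q n) *\<^sub>R v))) \<partial>lborel)
     = (1 / (Q n)\<^sup>2) * zsum (\<lambda>m. F n ((1 / Q n) *\<^sub>R emb g m))"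
    using Q1 by eventually_elim (simp only: eq max_absorb2)
  ultimately show ?thesis unfolding g_inv by (rule Lim_transform_eventually)
qed

text \<open>The support holds \<open>O(q\<^sup>2)\<close> integer points. Uniformity in all
  \<open>q > 0\<close>, small ones included, is what Tannery's theorem asks for in
  \<open>primitive_riemann\<close>, where the scale is divided by every d.\<close>

lemma zsum_bound:
  assumes g: "g \<in> SL2R"
  obtains C where "C \<ge> 0" "\<And>F B R q. 0 < q \<Longrightarrow> 0 \<le> B \<Longrightarrow> 0 \<le> R \<Longrightarrow> F 0 = 0 \<Longrightarrow> (\<And>v. \<bar>F v\<bar> \<le> B) \<Longrightarrow>
     (\<And>v. F v \<noteq> 0 \<Longrightarrow> norm v \<le> R) \<Longrightarrow> \<bar>(1 / q\<^sup>2) * zsum (\<lambda>m. F ((1 / q) *\<^sub>R emb g m))\<bar> \<le> C * B * R\<^sup>2"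
proof -
  obtain c where c: "c > 0" "\<And>v. \<bar>fst v\<bar> \<le> c * norm (lact g v)" "\<And>v. \<bar>snd v\<bar> \<le> c * norm (lact g v)"
    using emb_bound[OF g] by blast
  have "\<bar>(1 / q\<^sup>2) * zsum (\<lambda>m. F ((1 / q) *\<^sub>R emb g m))\<bar> \<le> (9 * c\<^sup>2) * B * R\<^sup>2"
    if q: "0 < q" and B0: "0 \<le> B" and R0: "0 \<le> R" and F0: "F 0 = 0" and B: "\<And>v. \<bar>F v\<bar> \<le> B"
      and R: "\<And>v. F v \<noteq> 0 \<Longrightarrow> norm v \<le> R" for F B R q
  proof -
    define M where "M = {m. F ((1 / q) *\<^sub>R emb g m) \<noteq> 0}"
    define x where "x = c * q * R"
    have bd: "\<bar>of_int (fst m)\<bar> \<le> x" "\<bar>of_int (snd m)\<bar> \<le> x" if "m \<in> M" for m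
    proof -
      have "norm ((1 / q) *\<^sub>R emb g m) \<le> R" using that unfolding M_def by (intro R) simp
      then have "norm (emb g m) \<le> q * R" using q by (simp add: field_simps)
      then have "c * norm (emb g m) \<le> x" using c(1) by (simp add: x_def mult.assoc)
      then show "\<bar>of_int (fst m)\<bar> \<le> x" "\<bar>of_int (snd m)\<bar> \<le> x"
        using c(2,3)[of "(of_int (fst m), of_int (snd m))"] by (auto simp: emb_def)
    qed
    have "real (card M) \<le> 9 * x\<^sup>2"
    proof (cases "M = {}")
      case False
      then obtain m where m: "m \<in> M" by auto
      have "m \<noteq> 0" using m F0 by (auto simp: M_def emb_def lact_def zero_prod_def)
      then have "fst m \<noteq> 0 \<or> snd m \<noteq> 0" by (auto simp: prod_eq_iff)
      then have "1 \<le> \<bar>fst m\<bar> \<or> 1 \<le> \<bar>snd m\<bar>" by linarith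
      then have "1 \<le> \<bar>real_of_int (fst m)\<bar> \<or> 1 \<le> \<bar>real_of_int (snd m)\<bar>" by linarith
      \<comment> \<open>Here \<open>F 0 = 0\<close> matters: a nonzero integer point in the support
        forces \<open>x \<ge> 1\<close>, which gives \<open>2 * x + 1 \<le> 3 * x\<close>. The
        origin alone would break a bound of order \<open>x\<^sup>2\<close> for small x.\<close>
      then have x1: "x \<ge> 1" using bd[OF m] by linarith
      have "M \<subseteq> {-\<lfloor>x\<rfloor>..\<lfloor>x\<rfloor>} \<times> {-\<lfloor>x\<rfloor>..\<lfloor>x\<rfloor>}"
      proof
        fix m assume "m \<in> M"
        then have "\<bar>fst m\<bar> \<le> \<lfloor>x\<rfloor>" "\<bar>snd m\<bar> \<le> \<lfloor>x\<rfloor>" using bd[of m] by (auto simp: le_floor_iff)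
        then show "m \<in> {-\<lfloor>x\<rfloor>..\<lfloor>x\<rfloor>} \<times> {-\<lfloor>x\<rfloor>..\<lfloor>x\<rfloor>}" by (cases m) auto
      qed
      then have "card M \<le> card ({-\<lfloor>x\<rfloor>..\<lfloor>x\<rfloor>} \<times> {-\<lfloor>x\<rfloor>..\<lfloor>x\<rfloor>})" by (intro card_mono) auto
      also have "\<dots> = nat (2 * \<lfloor>x\<rfloor> + 1) * nat (2 * \<lfloor>x\<rfloor> + 1)" by (simp add: card_cartesian_product)
      finally have "real (card M) \<le> real (nat (2 * \<lfloor>x\<rfloor> + 1)) * real (nat (2 * \<lfloor>x\<rfloor> + 1))"
        by (metis of_nat_le_iff of_nat_mult)
      also have "\<dots> \<le> (3 * x) * (3 * x)" using x1 by (intro mult_mono) linarith+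
      finally show ?thesis by (simp add: power2_eq_square)
    qed simp
    have "\<bar>zsum (\<lambda>m. F ((1 / q) *\<^sub>R emb g m))\<bar> \<le> (\<Sum>m\<in>M. \<bar>F ((1 / q) *\<^sub>R emb g m)\<bar>)"
      unfolding zsum_def M_def by (rule sum_abs)
    also have "\<dots> \<le> (\<Sum>m\<in>M. B)" by (intro sum_mono B)
    also have "\<dots> = real (card M) * B" by simp
    also have "\<dots> \<le> 9 * x\<^sup>2 * B" using \<open>real (card M) \<le> 9 * x\<^sup>2\<close> B0 by (intro mult_right_mono)
    finally have "\<bar>(1 / q\<^sup>2) * zsum (\<lambda>m. F ((1 / q) *\<^sub>R emb g m))\<bar> \<le> (1 / q\<^sup>2) * (9 * x\<^sup>2 * B)"
      unfolding abs_mult by (intro mult_mono) auto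
    also have "\<dots> = (9 * c\<^sup>2) * B * R\<^sup>2" using q by (simp add: x_def power_mult_distrib)
    finally show ?thesis .
  qed
  then show ?thesis by (intro that[of "9 * c\<^sup>2"]) auto
qed

section \<open>Counting primitive vectors\<close>

definition mob :: "nat \<Rightarrow> real" where
  "mob n = (if squarefree n then (- 1) ^ card (prime_factors n) else 0)"

lemma abs_mob_le: "\<bar>mob n\<bar> \<le> 1" by (simp add: mob_def power_abs)

lemma mob_div_le: "norm (mob d / (real d)\<^sup>2) \<le> inverse (real d ^ 2)"
  using mult_right_mono[OF abs_mob_le[of d], of "inverse ((real d)\<^sup>2)"] by (simp add: divide_inverse abs_mult)

lemma mob_1: "mob (Suc 0) = 1" by (simp add: mob_def)

lemma mob_0: "mob 0 = 0" by (simp add: mob_def)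

text \<open>For a prime \<open>p\<close> dividing n, multiplication by \<open>p\<close> pairs the
  squarefree divisors prime to p with those divisible by p and flips the sign of
  \<open>mob\<close>.\<close>

lemma sum_mob:
  assumes n: "n > 0" shows "(\<Sum>d | d dvd n. mob d) = (if n = 1 then 1 else 0)"
proof (cases "n = 1")
  case True then show ?thesis by (simp add: mob_1)
next
  case False
  then obtain p where p: "prime p" "p dvd n" using prime_factor_nat by blast
  define A where "A = {d. d dvd n \<and> squarefree d \<and> \<not> p dvd d}"
  define B where "B = {d. d dvd n \<and> squarefree d \<and> p dvd d}"
  have fin: "finite A" "finite B" using n by (auto simp: A_def B_def)
  have bij: "bij_betw (\<lambda>d. p * d) A B"
  proof (rule bij_betwI')
    fix x y show "(p * x = p * y) = (x = y)" using p by auto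
  next
    fix d assume d: "d \<in> A"
    then have c: "coprime p d" using p by (simp add: A_def prime_imp_coprime)
    have "squarefree (p * d)" using c d p by (intro squarefree_mult_coprime) (auto simp: A_def squarefree_prime)
    moreover have "p * d dvd n" using c d p by (auto simp: A_def divides_mult)
    ultimately show "p * d \<in> B" by (simp add: B_def)
  next
    fix b assume b: "b \<in> B"
    then obtain d where d: "b = p * d" by (auto simp: B_def)
    have "\<not> p dvd d"
    proof
      assume "p dvd d"
      then have "p\<^sup>2 dvd b" by (simp add: d power2_eq_square)
      then show False using b p by (auto simp: B_def dest: squarefreeD)
    qed
    moreover have "d dvd n" using b unfolding B_def d by (auto intro: dvd_mult_right)
    moreover have "squarefree d" using b squarefree_mono[of d b] by (simp add: B_def d)
    ultimately show "\<exists>d\<in>A. b = p * d" using d by (auto simp: A_def)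
  qed
  have neg: "mob (p * d) = - mob d" if d: "d \<in> A" for d
  proof -
    have "d \<noteq> 0" using d n by (auto simp: A_def)
    then have "prime_factors (p * d) = insert p (prime_factors d)"
      using p by (simp add: prime_factors_product prime_prime_factors prime_gt_0_nat)
    moreover have "p \<notin> prime_factors d" using d by (auto simp: A_def)
    moreover have "squarefree (p * d)" using bij d by (auto simp: bij_betw_def B_def)
    moreover have "squarefree d" using d by (simp add: A_def)
    ultimately show ?thesis by (simp add: mob_def)
  qed
  have "(\<Sum>d | d dvd n. mob d) = sum mob (A \<union> B)"
    using n by (intro sum.mono_neutral_right) (auto simp: A_def B_def mob_def)
  also have "\<dots> = sum mob A + sum mob B" using fin by (intro sum.union_disjoint) (auto simp: A_def B_def)
  also have "sum mob B = (\<Sum>d\<in>A. mob (p * d))" using sum.reindex_bij_betw[OF bij] by metis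
  also have "\<dots> = - sum mob A" by (simp add: neg sum_negf)
  finally show ?thesis using False by simp
qed

text \<open>This is 1 / zeta(2), the density of primitive points among all integer points of the
  plane.\<close>

definition czeta :: real where "czeta = (\<Sum>d. mob d / (real d)\<^sup>2)"

lemma summable_mob: "summable (\<lambda>d. mob d / (real d)\<^sup>2)"
proof (rule summable_comparison_test')
  show "summable (\<lambda>d. inverse (real d ^ 2))" by (rule inverse_power_summable) simp
  show "norm (mob d / (real d)\<^sup>2) \<le> inverse (real d ^ 2)" for d by (rule mob_div_le)
qed

lemma czeta_pos: "czeta > 0"
proof -
  define f where "f d = mob d / (real d)\<^sup>2" for d
  have "czeta = (\<Sum>n. f (n + 2)) + (\<Sum>i<2. f i)"
    unfolding czeta_def f_def[symmetric] using summable_mob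
    by (intro suminf_split_initial_segment) (simp add: f_def)
  moreover have "(\<Sum>i<2. f i) = 1" by (simp add: f_def mob_1 numeral_2_eq_2)
  moreover have "\<bar>\<Sum>n. f (n + 2)\<bar> \<le> 2 / 3"
  proof -
    \<comment> \<open>\<open>(n + 2)\<^sup>2\<close> exceeds \<open>(n + 3/2) * (n + 5/2)\<close> by
      1/4, and the reciprocals of the latter telescope with total 2/3, which is less than the
      leading term 1.\<close>
    define h where "h n = - (1 / (real n + 3 / 2))" for n
    have "(\<lambda>n. h (Suc n) - h n) sums (0 - h 0)"
      unfolding h_def by (rule telescope_sums) real_asymp
    moreover have "h (Suc n) - h n = 1 / ((real n + 3 / 2) * (real n + 5 / 2))" for n
      unfolding h_def by (simp add: field_simps)
    ultimately have s: "(\<lambda>n. 1 / ((real n + 3 / 2) * (real n + 5 / 2))) sums (2 / 3)" by (simp add: h_def)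
    have le: "norm (f (n + 2)) \<le> 1 / ((real n + 3 / 2) * (real n + 5 / 2))" for n
    proof -
      have "norm (f (n + 2)) \<le> 1 / (real (n + 2))\<^sup>2"
        unfolding f_def by (auto simp: abs_divide intro!: divide_right_mono abs_mob_le)
      also have "\<dots> \<le> 1 / ((real n + 3 / 2) * (real n + 5 / 2))"
        by (intro divide_left_mono mult_pos_pos zero_less_power) (auto simp: power2_eq_square algebra_simps)
      finally show ?thesis .
    qed
    have "norm (\<Sum>n. f (n + 2)) \<le> (\<Sum>n. 1 / ((real n + 3 / 2) * (real n + 5 / 2)))"
      by (rule norm_suminf_le[OF le]) (use s in \<open>auto simp: sums_iff\<close>)
    then show ?thesis using s by (simp add: sums_iff)
  qed
  ultimately show ?thesis by linarith
qed

text \<open>Moebius inversion: the condition gcd = 1 is replaced by the sum of \<open>mob d\<close>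
  over the divisors d of the gcd, and the points whose gcd is a multiple of d are d times integer
  points. \<open>\<Phi> 0 = 0\<close> removes the origin, which every d divides; then only finitely
  many terms are nonzero.\<close>

lemma psum_mob:
  assumes g: "g \<in> SL2R" and b: "bsupp R \<Phi>" and z: "\<Phi> 0 = 0"
  shows "(\<lambda>d. mob d * zsum (\<lambda>m. \<Phi> (real d *\<^sub>R emb g m))) sums psum \<Phi> (act g Z2)"
proof -
  define B where "B = {m. norm (emb g m) \<le> R \<and> m \<noteq> 0}"
  have fB: "finite B" by (rule finite_subset[OF _ finite_emb[OF g, of R]]) (auto simp: B_def)
  define gc where "gc m = nat (gcd (fst m) (snd m))" for m :: "int \<times> int"
  have gc_pos: "gc m > 0" if "m \<noteq> 0" for m using that by (auto simp: gc_def prod_eq_iff)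
  obtain D where D: "\<And>m. m \<in> B \<Longrightarrow> gc m \<le> D"
    using finite_imageI[OF fB, of gc] by (metis finite_nat_set_iff_bounded_le imageI)
  have inj: "inj_on (emb g) A" for A using inj_emb[OF g] by (rule inj_on_subset) simp
  have supp: "m \<in> B" if "\<Phi> (emb g m) \<noteq> 0" for m
  proof -
    have "m \<noteq> 0" using that z by (auto simp: emb_def lact_def zero_prod_def)
    then show ?thesis using that b unfolding B_def bsupp_def by blast
  qed
  have scal: "real d *\<^sub>R emb g m = emb g (int d * fst m, int d * snd m)" for d m
    by (simp add: emb_def flip: lact_scaleR)
  have zs: "zsum (\<lambda>m. \<Phi> (real d *\<^sub>R emb g m)) = (\<Sum>m\<in>{m\<in>B. d dvd gc m}. \<Phi> (emb g m))" if d: "d > 0" for d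
  proof -
    define h where "h m = (int d * fst m, int d * snd m)" for m :: "int \<times> int"
    have hinj: "inj h" using d by (auto simp: inj_def h_def prod_eq_iff)
    have "(\<Sum>m\<in>{m\<in>B. d dvd gc m}. \<Phi> (emb g m)) = (\<Sum>m\<in>h ` (h -` {m\<in>B. d dvd gc m}). \<Phi> (emb g m))"
    proof -
      have "m \<in> range h" if "d dvd gc m" for m
      proof -
        have "int d dvd gcd (fst m) (snd m)" using that unfolding gc_def
          by (metis gcd_ge_0_int int_nat_eq of_nat_dvd_iff)
        then obtain a b where "fst m = int d * a" "snd m = int d * b" by (metis dvdE gcd_dvd1 gcd_dvd2 dvd_trans)
        then have "m = h (a, b)" by (simp add: h_def prod_eq_iff)
        then show ?thesis by blast
      qed
      then have "h ` (h -` {m\<in>B. d dvd gc m}) = {m\<in>B. d dvd gc m}" unfolding image_vimage_eq by blast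
      then show ?thesis by simp
    qed
    also have "\<dots> = (\<Sum>m\<in>h -` {m\<in>B. d dvd gc m}. \<Phi> (emb g (h m)))"
      using hinj by (subst sum.reindex) (auto intro: inj_on_subset)
    also have "\<dots> = zsum (\<lambda>m. \<Phi> (real d *\<^sub>R emb g m))"
    proof -
      have "finite (h -` {m\<in>B. d dvd gc m})" using fB hinj by (intro finite_vimageI) auto
      moreover have "m \<in> h -` {m\<in>B. d dvd gc m}" if "\<Phi> (real d *\<^sub>R emb g m) \<noteq> 0" for m
      proof -
        have "h m \<in> B" using that unfolding scal h_def by (rule supp)
        moreover have "d dvd gc (h m)" unfolding gc_def h_def
          by (metis fst_conv snd_conv dvd_triv_left gcd_greatest gcd_ge_0_int int_nat_eq of_nat_dvd_iff)
        ultimately show ?thesis by simp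
      qed
      ultimately have "zsum (\<lambda>m. \<Phi> (real d *\<^sub>R emb g m)) = (\<Sum>m\<in>h -` {m\<in>B. d dvd gc m}. \<Phi> (real d *\<^sub>R emb g m))"
        by (rule zsum_eq)
      then show ?thesis unfolding scal h_def by simp
    qed
    finally show ?thesis by simp
  qed
  have "psum \<Phi> (act g Z2) = sum \<Phi> (emb g ` (B \<inter> coprime_pairs))"
  proof (rule psum_eq)
    fix v assume "v \<in> prims (act g Z2)" "\<Phi> v \<noteq> 0"
    then obtain m where "v = emb g m" "m \<in> coprime_pairs" "m \<in> B"
      using supp unfolding prims_act_Z2[OF g] by blast
    then show "v \<in> emb g ` (B \<inter> coprime_pairs)" by blast
  qed (use fB in \<open>auto simp: prims_act_Z2[OF g]\<close>)
  also have "\<dots> = (\<Sum>m\<in>B \<inter> coprime_pairs. \<Phi> (emb g m))" by (simp add: sum.reindex inj)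
  also have "\<dots> = (\<Sum>m\<in>B. (if gc m = 1 then 1 else 0) * \<Phi> (emb g m))"
  proof (rule sum.mono_neutral_cong_left)
    show "\<forall>i\<in>B - B \<inter> coprime_pairs. (if gc i = 1 then 1 else 0) * \<Phi> (emb g i) = 0"
      by (auto simp: coprime_pairs_def gc_def coprime_iff_gcd_eq_1)
    show "\<And>x. x \<in> B \<inter> coprime_pairs \<Longrightarrow> \<Phi> (emb g x) = (if gc x = 1 then 1 else 0) * \<Phi> (emb g x)"
      by (auto simp: coprime_pairs_def gc_def coprime_iff_gcd_eq_1)
  qed (use fB in auto)
  also have "\<dots> = (\<Sum>m\<in>B. (\<Sum>d | d dvd gc m. mob d) * \<Phi> (emb g m))"
    by (intro sum.cong refl) (simp add: sum_mob gc_pos B_def)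
  also have "\<dots> = (\<Sum>m\<in>B. \<Sum>d\<in>{1..D}. if d dvd gc m then mob d * \<Phi> (emb g m) else 0)"
  proof (intro sum.cong refl)
    fix m assume m: "m \<in> B"
    have eq: "{d. d dvd gc m} = {d \<in> {1..D}. d dvd gc m}"
    proof -
      have "gc m > 0" using gc_pos[of m] m by (simp add: B_def)
      then have "x \<in> {1..D}" if "x dvd gc m" for x
        using dvd_imp_le[OF that] dvd_pos_nat[OF _ that] D[OF m] by auto
      then show ?thesis by blast
    qed
    then show "(\<Sum>d | d dvd gc m. mob d) * \<Phi> (emb g m) = (\<Sum>d\<in>{1..D}. if d dvd gc m then mob d * \<Phi> (emb g m) else 0)"
      unfolding sum_distrib_right by (subst eq) (simp only: sum.inter_filter finite_atLeastAtMost)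
  qed
  also have "\<dots> = (\<Sum>d\<in>{1..D}. \<Sum>m\<in>B. if d dvd gc m then mob d * \<Phi> (emb g m) else 0)" by (rule sum.swap)
  also have "\<dots> = (\<Sum>d\<in>{1..D}. mob d * zsum (\<lambda>m. \<Phi> (real d *\<^sub>R emb g m)))"
    using fB by (intro sum.cong refl) (simp add: zs sum_distrib_left sum.inter_filter if_distrib cong: if_cong)
  finally have "psum \<Phi> (act g Z2) = (\<Sum>d\<in>{1..D}. mob d * zsum (\<lambda>m. \<Phi> (real d *\<^sub>R emb g m)))" .
  then have eq: "psum \<Phi> (act g Z2) = (\<Sum>d\<in>{1..D}. mob d * zsum (\<lambda>m. \<Phi> (real d *\<^sub>R emb g m)))" .
  have "mob d * zsum (\<lambda>m. \<Phi> (real d *\<^sub>R emb g m)) = 0" if "d \<notin> {1..D}" for d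
  proof (cases "d = 0")
    case False
    then have "{m\<in>B. d dvd gc m} = {}"
      using that D gc_pos by (auto simp: B_def dest!: dvd_imp_le) (metis (no_types, lifting) le_trans not_less_eq_eq not_less0 gr0I)
    then show ?thesis using False by (simp only: zs) simp
  qed (simp add: mob_0)
  then show ?thesis unfolding eq by (intro sums_finite) auto
qed

text \<open>Term d of the Moebius sum is \<open>mob d / d\<^sup>2\<close> times a Riemann sum at
  scale \<open>Q / d\<close>. All these Riemann sums have the same limit and a common bound, so
  Tannery's theorem lets the limit pass inside.\<close>

lemma primitive_riemann:
  fixes F :: "nat \<Rightarrow> real \<times> real \<Rightarrow> real"
  assumes g: "g \<in> SL2R" and Q: "filterlim Q at_top sequentially"
    and F: "\<And>n. F n \<in> borel_measurable borel" and F': "F' \<in> borel_measurable borel"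
    and B: "\<And>n v. \<bar>F n v\<bar> \<le> B" and R: "\<And>n v. F n v \<noteq> 0 \<Longrightarrow> norm v \<le> R" and z: "\<And>n. F n 0 = 0"
    and lim: "AE v in lborel. \<forall>w. w \<longlonglongrightarrow> v \<longrightarrow> (\<lambda>n. F n (w n)) \<longlonglongrightarrow> F' v"
  shows "(\<lambda>n. (1 / (Q n)\<^sup>2) * psum (\<lambda>v. F n ((1 / Q n) *\<^sub>R v)) (act g Z2)) \<longlonglongrightarrow> czeta * (\<integral>v. F' v \<partial>lborel)"
proof -
  define q where "q n = max 1 (Q n)" for n
  have q: "q n \<ge> 1" "q n > 0" for n by (auto simp: q_def)
  have Q1: "\<forall>\<^sub>F n in sequentially. Q n \<ge> 1" using Q by (simp add: filterlim_at_top)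
  have ql: "filterlim q at_top sequentially"
    using Q1 unfolding q_def by (intro filterlim_cong[THEN iffD1, OF refl refl _ Q]) (auto elim!: eventually_mono)
  define M where "M d n = (1 / (q n / real d)\<^sup>2) * zsum (\<lambda>m. F n ((1 / (q n / real d)) *\<^sub>R emb g m))" for d n
  obtain C where C: "C \<ge> 0" "\<And>F B R q. 0 < q \<Longrightarrow> 0 \<le> B \<Longrightarrow> 0 \<le> R \<Longrightarrow> F 0 = 0 \<Longrightarrow> (\<And>v. \<bar>F v\<bar> \<le> B) \<Longrightarrow>
     (\<And>v. F v \<noteq> 0 \<Longrightarrow> norm v \<le> R) \<Longrightarrow> \<bar>(1 / q\<^sup>2) * zsum (\<lambda>m. F ((1 / q) *\<^sub>R emb g m))\<bar> \<le> C * B * R\<^sup>2"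
    using zsum_bound[OF g] by blast
  have B0: "B \<ge> 0" using B[of 0 0] by linarith
  have R': "norm v \<le> \<bar>R\<bar>" if "F n v \<noteq> 0" for n v using R[OF that] by simp
  have Mlim: "(\<lambda>n. M d n) \<longlonglongrightarrow> (\<integral>v. F' v \<partial>lborel)" if "d > 0" for d
  proof -
    have "filterlim (\<lambda>n. q n / real d) at_top sequentially"
      using filterlim_tendsto_pos_mult_at_top[OF tendsto_const _ ql, of "inverse (real d)"] that
      by (simp add: divide_inverse mult.commute)
    then show ?thesis unfolding M_def by (intro lattice_riemann[OF g _ F F' B R lim])
  qed
  have Mb: "\<bar>M d n\<bar> \<le> C * B * \<bar>R\<bar>\<^sup>2" if "d > 0" for d n
    unfolding M_def using q[of n] that by (intro C(2) B0 z B R') auto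
  have eq: "(1 / (q n)\<^sup>2) * psum (\<lambda>v. F n ((1 / q n) *\<^sub>R v)) (act g Z2) = (\<Sum>d. (mob d / (real d)\<^sup>2) * M d n)" for n
  proof -
    have bs: "bsupp (q n * R) (\<lambda>v. F n ((1 / q n) *\<^sub>R v))"
      unfolding bsupp_def
    proof (intro allI impI)
      fix v assume "F n ((1 / q n) *\<^sub>R v) \<noteq> 0"
      then have "norm ((1 / q n) *\<^sub>R v) \<le> R" by (rule R)
      then show "norm v \<le> q n * R" using q[of n] by (simp add: field_simps)
    qed
    have "(\<lambda>d. (1 / (q n)\<^sup>2) * (mob d * zsum (\<lambda>m. F n ((1 / q n) *\<^sub>R real d *\<^sub>R emb g m))))
      sums ((1 / (q n)\<^sup>2) * psum (\<lambda>v. F n ((1 / q n) *\<^sub>R v)) (act g Z2))"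
      using psum_mob[OF g bs] z by (intro sums_mult) simp
    moreover have "(1 / (q n)\<^sup>2) * (mob d * zsum (\<lambda>m. F n ((1 / q n) *\<^sub>R real d *\<^sub>R emb g m))) = (mob d / (real d)\<^sup>2) * M d n" for d
      by (cases "d = 0") (auto simp: mob_0 M_def power_divide)
    ultimately show ?thesis by (simp add: sums_iff)
  qed
  have "((\<lambda>n. \<Sum>d. (mob d / (real d)\<^sup>2) * M d n) \<longlongrightarrow> (\<Sum>d. (mob d / (real d)\<^sup>2) * (\<integral>v. F' v \<partial>lborel))) sequentially"
  proof (rule tannerys_theorem[THEN conjunct2, THEN conjunct2])
    show "((\<lambda>n. (mob d / (real d)\<^sup>2) * M d n) \<longlongrightarrow> (mob d / (real d)\<^sup>2) * (\<integral>v. F' v \<partial>lborel)) sequentially" for d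
      using tendsto_mult[OF tendsto_const Mlim[of d], of "mob d / (real d)\<^sup>2"] by (cases "d = 0") auto
    show "\<forall>\<^sub>F (d, n) in at_top \<times>\<^sub>F sequentially. norm ((mob d / (real d)\<^sup>2) * M d n) \<le> inverse (real d ^ 2) * (C * B * \<bar>R\<bar>\<^sup>2)"
    proof (intro always_eventually allI, clarify)
      fix d n
      show "norm ((mob d / (real d)\<^sup>2) * M d n) \<le> inverse (real d ^ 2) * (C * B * \<bar>R\<bar>\<^sup>2)"
      proof (cases "d = 0")
        case False
        show ?thesis using mob_div_le[of d] Mb[of d n] False unfolding real_norm_def abs_mult by (intro mult_mono) auto
      qed simp
    qed
    show "summable (\<lambda>d. inverse (real d ^ 2) * (C * B * \<bar>R\<bar>\<^sup>2))"
      by (intro summable_mult2 inverse_power_summable) simp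
  qed simp
  also have "(\<Sum>d. (mob d / (real d)\<^sup>2) * (\<integral>v. F' v \<partial>lborel)) = czeta * (\<integral>v. F' v \<partial>lborel)"
    unfolding czeta_def by (rule suminf_mult2[symmetric, OF summable_mob])
  finally have "(\<lambda>n. (1 / (q n)\<^sup>2) * psum (\<lambda>v. F n ((1 / q n) *\<^sub>R v)) (act g Z2)) \<longlonglongrightarrow> czeta * (\<integral>v. F' v \<partial>lborel)"
    unfolding eq .
  moreover have "\<forall>\<^sub>F n in sequentially. (1 / (q n)\<^sup>2) * psum (\<lambda>v. F n ((1 / q n) *\<^sub>R v)) (act g Z2)
      = (1 / (Q n)\<^sup>2) * psum (\<lambda>v. F n ((1 / Q n) *\<^sub>R v)) (act g Z2)"
    using Q1 by eventually_elim (simp only: q_def max_absorb2)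
  ultimately show ?thesis by (rule Lim_transform_eventually)
qed

section \<open>Horocycle averages of primitive sums\<close>

definition nu :: "real measure" where "nu = uniform_measure lborel {0..1}"

interpretation nu: prob_space nu
  unfolding nu_def by (rule prob_space_uniform_measure) auto

lemma sets_nu[measurable_cong]: "sets nu = sets borel" by (simp add: nu_def)

lemma space_nu: "space nu = UNIV" by (simp add: nu_def)

lemma AE_nu: "AE y in nu. y \<in> {0..1}"
  unfolding nu_def by (rule AE_uniform_measureI) auto

lemma integral_nu:
  fixes f :: "real \<Rightarrow> real"
  assumes [measurable]: "f \<in> borel_measurable borel"
  shows "(\<integral>y. f y \<partial>nu) = (\<integral>y. indicator {0..1} y * f y \<partial>lborel)"
proof -
  have nu: "nu = density lborel (\<lambda>y. ennreal (indicator {0..1} y))"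
    unfolding nu_def uniform_measure_def by (intro density_cong) (auto split: split_indicator)
  show ?thesis unfolding nu by (subst integral_density) auto
qed

text \<open>Continuity with compact support inside the open upper half plane; the half plane selects
  one vector of each pair v, -v. One number \<open>R\<close> bounds width, height and inverse
  height.\<close>

definition hsupp :: "real \<Rightarrow> (real \<times> real \<Rightarrow> real) \<Rightarrow> bool" where
  "hsupp R \<Phi> \<longleftrightarrow> R \<ge> 1 \<and> continuous_on UNIV \<Phi> \<and> (\<forall>v. \<Phi> v \<noteq> 0 \<longrightarrow> \<bar>fst v\<bar> \<le> R \<and> 1 / R \<le> snd v \<and> snd v \<le> R)"

lemma hsupp_bounded:
  assumes "hsupp R \<Phi>" obtains B where "B \<ge> 0" "\<And>v. \<bar>\<Phi> v\<bar> \<le> B"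
proof -
  have "compact ({-R..R} \<times> {1/R..R})" by (intro compact_Times) auto
  moreover have "continuous_on ({-R..R} \<times> {1/R..R}) \<Phi>"
    using assms continuous_on_subset unfolding hsupp_def by blast
  ultimately have "bounded (\<Phi> ` ({-R..R} \<times> {1/R..R}))" by (intro compact_imp_bounded compact_continuous_image)
  then obtain B where B: "\<And>v. v \<in> {-R..R} \<times> {1/R..R} \<Longrightarrow> norm (\<Phi> v) \<le> B" by (auto simp: bounded_iff)
  have "\<bar>\<Phi> v\<bar> \<le> \<bar>B\<bar>" for v
  proof (cases "\<Phi> v = 0")
    case False
    then have "\<bar>fst v\<bar> \<le> R \<and> 1 / R \<le> snd v \<and> snd v \<le> R" using assms unfolding hsupp_def by blast
    then have "v \<in> {-R..R} \<times> {1/R..R}" by (cases v) auto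
    from B[OF this] show ?thesis by simp
  qed simp
  then show ?thesis using that[of "\<bar>B\<bar>"] by auto
qed

lemma hsupp_borel: "hsupp R \<Phi> \<Longrightarrow> \<Phi> \<in> borel_measurable borel"
  by (auto simp: hsupp_def intro: borel_measurable_continuous_onI)

lemma hsupp_zero: "hsupp R \<Phi> \<Longrightarrow> \<not> (\<bar>fst v\<bar> \<le> R \<and> 1 / R \<le> snd v \<and> snd v \<le> R) \<Longrightarrow> \<Phi> v = 0"
  by (auto simp: hsupp_def simp del: split_paired_All)

lemma hsupp_bsupp: "hsupp R \<Phi> \<Longrightarrow> bsupp (2 * R) \<Phi>"
  unfolding bsupp_def
proof (intro allI impI)
  fix v assume "hsupp R \<Phi>" "\<Phi> v \<noteq> 0"
  then have v: "\<bar>fst v\<bar> \<le> R" "1 / R \<le> snd v" "snd v \<le> R" "R \<ge> 1" unfolding hsupp_def by blast+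
  have "1 / R \<ge> 0" using v by simp
  then have "\<bar>snd v\<bar> \<le> R" using v by linarith
  moreover have "norm v \<le> \<bar>fst v\<bar> + \<bar>snd v\<bar>" by (metis norm_Pair_le prod.collapse real_norm_def)
  ultimately show "norm v \<le> 2 * R" using v by linarith
qed

lemma integrable_bounded_interval:
  fixes f :: "real \<Rightarrow> real"
  assumes [measurable]: "f \<in> borel_measurable borel" and B: "\<And>x. \<bar>f x\<bar> \<le> B" and R: "\<And>x. f x \<noteq> 0 \<Longrightarrow> \<bar>x\<bar> \<le> R" and "R \<ge> 0"
  shows "integrable lborel f" "\<bar>\<integral>x. f x \<partial>lborel\<bar> \<le> B * (2 * R)"
proof -
  have le: "\<bar>f x\<bar> \<le> B * indicator {-R..R} x" for x
    using B[of x] R[of x] by (cases "f x = 0") (auto split: split_indicator)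
  have int: "integrable lborel (\<lambda>x. B * indicator {-R..R} x)"
    using \<open>R \<ge> 0\<close> by (intro integrable_mult_right integrable_real_indicator) auto
  show 1: "integrable lborel f"
    by (rule Bochner_Integration.integrable_bound[OF int]) (use le in \<open>auto intro!: AE_I2 intro: order_trans[OF _ abs_ge_self]\<close>)
  have "\<bar>\<integral>x. f x \<partial>lborel\<bar> \<le> (\<integral>x. \<bar>f x\<bar> \<partial>lborel)" by (rule integral_abs_bound)
  also have "\<dots> \<le> (\<integral>x. B * indicator {-R..R} x \<partial>lborel)"
    by (intro integral_mono int integrable_abs 1 le)
  also have "\<dots> = B * (2 * R)" using \<open>R \<ge> 0\<close> by simp
  finally show "\<bar>\<integral>x. f x \<partial>lborel\<bar> \<le> B * (2 * R)" .
qed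

text \<open>The average of \<open>\<Phi>\<close> along a horocycle piece, in the coordinates of
  \<open>avg_psum\<close> with \<open>N = exp (2 * s)\<close>. The factor N in front keeps the mass
  bounded while the first coordinate is stretched by N.\<close>

definition horo_mean :: "real \<Rightarrow> (real \<times> real \<Rightarrow> real) \<Rightarrow> real \<times> real \<Rightarrow> real" where
  "horo_mean N \<Phi> v = N * (\<integral>y. \<Phi> (N * (fst v + y * snd v), snd v) \<partial>nu)"

text \<open>For large N the integrand concentrates at the zero of \<open>fst v + y * snd v\<close>
  in y, which lies inside the unit interval under the stated inequalities.\<close>

definition horo_mean_lim :: "(real \<times> real \<Rightarrow> real) \<Rightarrow> real \<times> real \<Rightarrow> real" where
  "horo_mean_lim \<Phi> v = (if - snd v < fst v \<and> fst v < 0 then (1 / snd v) * (\<integral>z. \<Phi> (z, snd v) \<partial>lborel) else 0)"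

context
  fixes R \<Phi> assumes h: "hsupp R \<Phi>"
begin

lemma hR: "R \<ge> 1" using h by (simp add: hsupp_def)

lemma h_borel[measurable]: "\<Phi> \<in> borel_measurable borel" by (rule hsupp_borel[OF h])

lemma h_line: "(\<lambda>z. \<Phi> (z, q)) \<in> borel_measurable borel" by measurable

lemma h_integrable_line: "integrable lborel (\<lambda>z. \<Phi> (z, q))"
  and h_line_bound: "(\<And>v. \<bar>\<Phi> v\<bar> \<le> B) \<Longrightarrow> \<bar>\<integral>z. \<Phi> (z, q) \<partial>lborel\<bar> \<le> B * (2 * R)"
proof -
  obtain B0 where B0: "\<And>v. \<bar>\<Phi> v\<bar> \<le> B0" using hsupp_bounded[OF h] by blast
  have s: "\<Phi> (z, q) \<noteq> 0 \<Longrightarrow> \<bar>z\<bar> \<le> R" for z using hsupp_zero[OF h, of "(z, q)"] by auto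
  show "integrable lborel (\<lambda>z. \<Phi> (z, q))"
    by (rule integrable_bounded_interval(1)[OF h_line B0 s]) (use hR in auto)
  show "\<bar>\<integral>z. \<Phi> (z, q) \<partial>lborel\<bar> \<le> B * (2 * R)" if "\<And>v. \<bar>\<Phi> v\<bar> \<le> B" for B
    by (rule integrable_bounded_interval(2)[OF h_line that s]) (use hR in auto)
qed

lemma borel_horo_mean[measurable]: "horo_mean N \<Phi> \<in> borel_measurable borel"
proof -
  have "(\<lambda>v. \<integral>y. (\<lambda>(v, y). \<Phi> (N * (fst v + y * snd v), snd v)) (v, y) \<partial>nu) \<in> borel_measurable borel"
    by (rule nu.borel_measurable_lebesgue_integral) measurable
  then show ?thesis unfolding horo_mean_def by simp
qed

text \<open>The substitution \<open>z = N * (fst v + y * snd v)\<close> writes the limit value, for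
  every N, as the same integral over the whole line. The two sides thus differ only by the y outside
  the unit interval.\<close>

lemma horo_mean_eq:
  assumes N: "N > 0" and q: "snd v > 0"
  shows "horo_mean N \<Phi> v = N * (\<integral>y. indicator {0..1} y * \<Phi> (N * fst v + (N * snd v) * y, snd v) \<partial>lborel)"
    "(1 / snd v) * (\<integral>z. \<Phi> (z, snd v) \<partial>lborel) = N * (\<integral>y. \<Phi> (N * fst v + (N * snd v) * y, snd v) \<partial>lborel)"
proof -
  show "horo_mean N \<Phi> v = N * (\<integral>y. indicator {0..1} y * \<Phi> (N * fst v + (N * snd v) * y, snd v) \<partial>lborel)"
    unfolding horo_mean_def by (subst integral_nu) (auto simp: algebra_simps)
  show "(1 / snd v) * (\<integral>z. \<Phi> (z, snd v) \<partial>lborel) = N * (\<integral>y. \<Phi> (N * fst v + (N * snd v) * y, snd v) \<partial>lborel)"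
    using lborel_integral_real_affine[of "N * snd v" "\<lambda>z. \<Phi> (z, snd v)" "N * fst v"] N q
    by (simp add: abs_mult)
qed

lemma horo_mean_zero:
  assumes "\<And>y. 0 \<le> y \<Longrightarrow> y \<le> 1 \<Longrightarrow> \<Phi> (N * (fst v + y * snd v), snd v) = 0"
  shows "horo_mean N \<Phi> v = 0"
proof -
  have "(\<integral>y. indicator {0..1} y * \<Phi> (N * (fst v + y * snd v), snd v) \<partial>lborel) = (\<integral>y. 0 \<partial>(lborel :: real measure))"
    using assms by (intro Bochner_Integration.integral_cong refl) (auto split: split_indicator)
  then show ?thesis unfolding horo_mean_def by (subst integral_nu) auto
qed

lemma horo_mean_supp:
  assumes N: "N \<ge> 1" and nz: "horo_mean N \<Phi> v \<noteq> 0"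
  shows "1 / R \<le> snd v" "snd v \<le> R" "\<bar>fst v\<bar> \<le> 2 * R"
proof -
  obtain y where y: "0 \<le> y" "y \<le> 1" "\<Phi> (N * (fst v + y * snd v), snd v) \<noteq> 0" using horo_mean_zero nz by blast
  then have *: "\<bar>N * (fst v + y * snd v)\<bar> \<le> R" "1 / R \<le> snd v" "snd v \<le> R"
    using hsupp_zero[OF h, of "(N * (fst v + y * snd v), snd v)"] by auto
  show "1 / R \<le> snd v" "snd v \<le> R" using * by auto
  have "0 < 1 / R" using hR by simp
  then have q: "snd v > 0" using * by linarith
  have "\<bar>fst v + y * snd v\<bar> \<le> \<bar>N * (fst v + y * snd v)\<bar>"
    using N by (simp add: abs_mult mult_le_cancel_right1)
  then have "\<bar>fst v + y * snd v\<bar> \<le> R" using * by linarith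
  moreover have "0 \<le> y * snd v" "y * snd v \<le> 1 * snd v" using y q by (auto intro!: mult_right_mono)
  moreover have "snd v \<le> R" using * by simp
  ultimately show "\<bar>fst v\<bar> \<le> 2 * R" by linarith
qed

text \<open>The factor N cancels against the Jacobian \<open>1 / (N * snd v)\<close> of the
  substitution, and \<open>snd v\<close> is at least 1/R on the support; hence a bound uniform in
  N.\<close>

lemma horo_mean_bound:
  assumes N: "N > 0" and B: "\<And>v. \<bar>\<Phi> v\<bar> \<le> B"
  shows "\<bar>horo_mean N \<Phi> v\<bar> \<le> R * (B * (2 * R))"
proof -
  have R0: "0 < 1 / R" using hR by simp
  have B0: "B \<ge> 0" using B[of 0] by linarith
  show ?thesis
  proof (cases "snd v < 1 / R")
    case True
    then have "horo_mean N \<Phi> v = 0" by (intro horo_mean_zero hsupp_zero[OF h]) auto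
    then show ?thesis using B0 hR by simp
  next
    case False
    then have q: "snd v > 0" using R0 by linarith
    define f where "f y = \<Phi> (N * fst v + (N * snd v) * y, snd v)" for y
    have fm[measurable]: "f \<in> borel_measurable borel" unfolding f_def by measurable
    have "integrable lborel (\<lambda>y. f y)"
      unfolding f_def using lborel_integrable_real_affine[OF h_integrable_line, of "N * snd v" "N * fst v" "snd v"] N q by simp
    then have fi: "integrable lborel (\<lambda>y. \<bar>f y\<bar>)" by (rule integrable_abs)
    have "\<bar>horo_mean N \<Phi> v\<bar> = N * \<bar>\<integral>y. indicator {0..1} y * f y \<partial>lborel\<bar>"
      using N horo_mean_eq(1)[OF N q] by (simp add: f_def abs_mult)
    also have "\<dots> \<le> N * (\<integral>y. \<bar>f y\<bar> \<partial>lborel)"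
    proof (intro mult_left_mono)
      have "\<bar>\<integral>y. indicator {0..1} y * f y \<partial>lborel\<bar> \<le> (\<integral>y. \<bar>indicator {0..1} y * f y\<bar> \<partial>lborel)" by (rule integral_abs_bound)
      also have "\<dots> \<le> (\<integral>y. \<bar>f y\<bar> \<partial>lborel)"
        by (rule integral_mono'[OF fi]) (auto simp: abs_mult split: split_indicator)
      finally show "\<bar>\<integral>y. indicator {0..1} y * f y \<partial>lborel\<bar> \<le> (\<integral>y. \<bar>f y\<bar> \<partial>lborel)" .
    qed (use N in auto)
    also have "\<dots> = (1 / snd v) * (\<integral>z. \<bar>\<Phi> (z, snd v)\<bar> \<partial>lborel)"
      using lborel_integral_real_affine[of "N * snd v" "\<lambda>z. \<bar>\<Phi> (z, snd v)\<bar>" "N * fst v"] N q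
      by (simp add: abs_mult f_def)
    also have "\<dots> \<le> R * (B * (2 * R))"
    proof (intro mult_mono)
      show "1 / snd v \<le> R" using False q hR by (simp add: field_simps)
      have "hsupp R (\<lambda>v. \<bar>\<Phi> v\<bar>)" using h by (auto simp: hsupp_def intro: continuous_intros)
      have "\<bar>\<integral>z. \<bar>\<Phi> (z, snd v)\<bar> \<partial>lborel\<bar> \<le> B * (2 * R)"
      proof (rule integrable_bounded_interval(2))
        show "\<bar>\<Phi> (x, snd v)\<bar> \<noteq> 0 \<Longrightarrow> \<bar>x\<bar> \<le> R" for x using hsupp_zero[OF h, of "(x, snd v)"] by auto
      qed (use B hR in auto)
      then show "(\<integral>z. \<bar>\<Phi> (z, snd v)\<bar> \<partial>lborel) \<le> B * (2 * R)" by linarith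
    qed (use hR in auto)
    finally show ?thesis .
  qed
qed

lemma line_integral_continuous:
  assumes w: "w \<longlonglongrightarrow> q" shows "(\<lambda>n. \<integral>z. \<Phi> (z, w n) \<partial>lborel) \<longlonglongrightarrow> (\<integral>z. \<Phi> (z, q) \<partial>lborel)"
proof -
  obtain B where B: "B \<ge> 0" "\<And>v. \<bar>\<Phi> v\<bar> \<le> B" using hsupp_bounded[OF h] by blast
  have c: "continuous_on UNIV \<Phi>" using h by (simp add: hsupp_def)
  show ?thesis
  proof (rule integral_dominated_convergence[where w="\<lambda>x. B * indicator {-R..R} x"])
    show "integrable lborel (\<lambda>x. B * indicator {-R..R} x)"
      using hR by (intro integrable_mult_right integrable_real_indicator) auto
    show "AE x in lborel. (\<lambda>n. \<Phi> (x, w n)) \<longlonglongrightarrow> \<Phi> (x, q)"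
      using c by (intro AE_I2 isCont_tendsto_compose[of _ \<Phi>] tendsto_intros w)
        (auto simp: continuous_on_eq_continuous_at simp del: split_paired_All)
    show "AE x in lborel. norm (\<Phi> (x, w n)) \<le> B * indicator {-R..R} x" for n
    proof (rule AE_I2)
      fix x show "norm (\<Phi> (x, w n)) \<le> B * indicator {-R..R} x"
        using B(2)[of "(x, w n)"] hsupp_zero[OF h, of "(x, w n)"] by (cases "\<bar>x\<bar> \<le> R") (auto simp: indicator_def abs_le_iff)
    qed
  qed measurable
qed

text \<open>Away from the two excluded lines, where the limit function may jump, the mean eventually
  vanishes or equals its full line integral.\<close>

lemma horo_mean_tendsto:
  assumes N: "filterlim N at_top sequentially" and v: "fst v \<noteq> 0" "fst v + snd v \<noteq> 0" and w: "w \<longlonglongrightarrow> v"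
  shows "(\<lambda>n. horo_mean (N n) \<Phi> (w n)) \<longlonglongrightarrow> horo_mean_lim \<Phi> v"
proof -
  define p q where "p = fst v" and "q = snd v"
  have wp: "(\<lambda>n. fst (w n)) \<longlonglongrightarrow> p" and wq: "(\<lambda>n. snd (w n)) \<longlonglongrightarrow> q"
    using w unfolding p_def q_def by (auto intro: tendsto_intros)
  have R0: "0 < 1 / R" using hR by simp
  have N0: "\<forall>\<^sub>F n in sequentially. N n > 0" using N by (simp add: filterlim_at_top_dense)
  have big: "\<forall>\<^sub>F n in sequentially. R < N n * x n" if "x \<longlonglongrightarrow> l" "l > 0" for x l
  proof -
    have "filterlim (\<lambda>n. x n * N n) at_top sequentially"
      by (rule filterlim_tendsto_pos_mult_at_top[OF that N])
    then show ?thesis by (simp add: filterlim_at_top_dense mult.commute)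
  qed
  have wpq: "(\<lambda>n. fst (w n) + snd (w n)) \<longlonglongrightarrow> p + q" by (intro tendsto_add wp wq)
  \<comment> \<open>Below height 1/R there is no support. Otherwise the zero - p / q of the affine
    function \<open>p + y * q\<close> of y lies below 0, above 1 or strictly between them.\<close>
  consider "q < 1 / R" | "q \<ge> 1 / R" "p > 0" | "q \<ge> 1 / R" "p + q < 0" | "q \<ge> 1 / R" "p < 0" "p + q > 0"
    using v R0 unfolding p_def q_def by linarith
  then show ?thesis
  proof cases
    case 1
    have "\<forall>\<^sub>F n in sequentially. snd (w n) < 1 / R" using order_tendstoD(2)[OF wq 1] .
    then have "\<forall>\<^sub>F n in sequentially. horo_mean_lim \<Phi> v = horo_mean (N n) \<Phi> (w n)"
    proof eventually_elim
      case (elim n)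
      have "horo_mean (N n) \<Phi> (w n) = 0" using elim by (intro horo_mean_zero hsupp_zero[OF h]) auto
      moreover have "\<Phi> (z, snd v) = 0" for z using 1 by (intro hsupp_zero[OF h]) (auto simp: q_def)
      ultimately show ?case by (simp add: horo_mean_lim_def)
    qed
    then show ?thesis by (rule Lim_transform_eventually[OF tendsto_const])
  next
    case 2
    have q0: "q > 0" using 2 R0 by linarith
    have "\<forall>\<^sub>F n in sequentially. horo_mean_lim \<Phi> v = horo_mean (N n) \<Phi> (w n)"
      using big[OF wp 2(2)] order_tendstoD(1)[OF wq q0] N0
    proof eventually_elim
      case (elim n)
      have "horo_mean (N n) \<Phi> (w n) = 0"
      proof (intro horo_mean_zero hsupp_zero[OF h])
        fix y :: real assume "0 \<le> y" "y \<le> 1"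
        then have "0 \<le> N n * (y * snd (w n))" using elim by (intro mult_nonneg_nonneg) auto
        then have "N n * (fst (w n) + y * snd (w n)) > R" using elim by (simp add: algebra_simps)
        then show "\<not> (\<bar>fst (N n * (fst (w n) + y * snd (w n)), snd (w n))\<bar> \<le> R \<and>
            1 / R \<le> snd (N n * (fst (w n) + y * snd (w n)), snd (w n)) \<and> snd (N n * (fst (w n) + y * snd (w n)), snd (w n)) \<le> R)"
          by auto
      qed
      then show ?case using 2 by (simp add: horo_mean_lim_def p_def)
    qed
    then show ?thesis by (rule Lim_transform_eventually[OF tendsto_const])
  next
    case 3
    have m: "(\<lambda>n. - (fst (w n) + snd (w n))) \<longlonglongrightarrow> - (p + q)" by (intro tendsto_minus wpq)
    have q0: "q > 0" and l0: "- (p + q) > 0" using 3 R0 by linarith+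
    have "\<forall>\<^sub>F n in sequentially. horo_mean_lim \<Phi> v = horo_mean (N n) \<Phi> (w n)"
      using big[OF m l0] order_tendstoD(1)[OF wq q0] N0
    proof eventually_elim
      case (elim n)
      have "horo_mean (N n) \<Phi> (w n) = 0"
      proof (intro horo_mean_zero hsupp_zero[OF h])
        fix y :: real assume y: "0 \<le> y" "y \<le> 1"
        have "y * snd (w n) \<le> 1 * snd (w n)" using y elim by (intro mult_right_mono) auto
        then have "N n * (fst (w n) + y * snd (w n)) \<le> N n * (fst (w n) + snd (w n))" using elim by (intro mult_left_mono) auto
        then have "N n * (fst (w n) + y * snd (w n)) < - R" using elim(1) unfolding mult_minus_right by linarith
        then show "\<not> (\<bar>fst (N n * (fst (w n) + y * snd (w n)), snd (w n))\<bar> \<le> R \<and>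
            1 / R \<le> snd (N n * (fst (w n) + y * snd (w n)), snd (w n)) \<and> snd (N n * (fst (w n) + y * snd (w n)), snd (w n)) \<le> R)"
          by auto
      qed
      then show ?case using \<open>p + q < 0\<close> by (simp add: horo_mean_lim_def p_def q_def)
    qed
    then show ?thesis by (rule Lim_transform_eventually[OF tendsto_const])
  next
    case 4
    have m: "(\<lambda>n. - fst (w n)) \<longlonglongrightarrow> - p" by (intro tendsto_minus wp)
    have q0: "q > 0" and l0: "- p > 0" using 4 R0 by linarith+
    have "\<forall>\<^sub>F n in sequentially. (1 / snd (w n)) * (\<integral>z. \<Phi> (z, snd (w n)) \<partial>lborel) = horo_mean (N n) \<Phi> (w n)"
      using big[OF m l0] big[OF wpq 4(3)] order_tendstoD(1)[OF wq q0] N0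
    proof eventually_elim
      case (elim n)
      have "(\<integral>y. indicator {0..1} y * \<Phi> (N n * fst (w n) + (N n * snd (w n)) * y, snd (w n)) \<partial>lborel)
         = (\<integral>y. \<Phi> (N n * fst (w n) + (N n * snd (w n)) * y, snd (w n)) \<partial>lborel)"
      proof (intro Bochner_Integration.integral_cong refl)
        fix y :: real
        have "\<Phi> (N n * fst (w n) + (N n * snd (w n)) * y, snd (w n)) = 0" if y: "y \<notin> {0..1}"
        proof (cases "y < 0")
          case True
          then have "(N n * snd (w n)) * y \<le> 0" using elim by (intro mult_nonneg_nonpos) auto
          then have "N n * fst (w n) + (N n * snd (w n)) * y < - R" using elim by simp
          then show ?thesis by (intro hsupp_zero[OF h]) auto
        next
          case False
          then have "(N n * snd (w n)) * 1 \<le> (N n * snd (w n)) * y" using elim y by (intro mult_left_mono) auto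
          moreover have "N n * (fst (w n) + snd (w n)) = N n * fst (w n) + N n * snd (w n)" by (simp add: distrib_left)
          ultimately have "N n * fst (w n) + (N n * snd (w n)) * y > R" using elim by linarith
          then show ?thesis by (intro hsupp_zero[OF h]) auto
        qed
        then show "indicator {0..1} y * \<Phi> (N n * fst (w n) + (N n * snd (w n)) * y, snd (w n)) = \<Phi> (N n * fst (w n) + (N n * snd (w n)) * y, snd (w n))"
          by (auto split: split_indicator)
      qed
      then show ?case using horo_mean_eq[of "N n" "w n"] elim by simp
    qed
    moreover have "(\<lambda>n. (1 / snd (w n)) * (\<integral>z. \<Phi> (z, snd (w n)) \<partial>lborel)) \<longlonglongrightarrow> (1 / q) * (\<integral>z. \<Phi> (z, q) \<partial>lborel)"
      using q0 by (intro tendsto_intros line_integral_continuous wq) auto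
    ultimately have "(\<lambda>n. horo_mean (N n) \<Phi> (w n)) \<longlonglongrightarrow> (1 / q) * (\<integral>z. \<Phi> (z, q) \<partial>lborel)"
      by (rule Lim_transform_eventually[rotated])
    then show ?thesis using 4 by (simp add: horo_mean_lim_def p_def q_def)
  qed
qed

lemma borel_horo_mean_lim[measurable]: "horo_mean_lim \<Phi> \<in> borel_measurable borel"
proof -
  have "(\<lambda>q. \<integral>z. (\<lambda>(q, z). \<Phi> (z, q)) (q, z) \<partial>lborel) \<in> borel_measurable borel"
    by (rule lborel.borel_measurable_lebesgue_integral) measurable
  then have [measurable]: "(\<lambda>q. \<integral>z. \<Phi> (z, q) \<partial>lborel) \<in> borel_measurable borel" by simp
  show ?thesis unfolding horo_mean_lim_def by measurable
qed

lemma integrable_box: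
  fixes f :: "real \<times> real \<Rightarrow> real"
  assumes [measurable]: "f \<in> borel_measurable borel" and B: "\<And>x. \<bar>f x\<bar> \<le> B" and s: "\<And>x. f x \<noteq> 0 \<Longrightarrow> norm x \<le> r"
  shows "integrable lborel f"
proof (rule Bochner_Integration.integrable_bound)
  have "emeasure lborel (cball 0 r :: (real \<times> real) set) < \<infinity>" by (rule emeasure_lborel_cball_finite)
  then show "integrable lborel (\<lambda>x::real \<times> real. B * indicator (cball 0 r) x)"
    by (intro integrable_mult_right integrable_real_indicator) auto
  show "AE x in lborel. norm (f x) \<le> norm (B * indicator (cball 0 r) x)"
  proof (rule AE_I2)
    fix x show "norm (f x) \<le> norm (B * indicator (cball 0 r) x)"
      using B[of x] s[of x] by (cases "f x = 0") (auto simp: indicator_def intro: order_trans[OF _ abs_ge_self])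
  qed
qed simp

lemma h_integrable: "integrable lborel \<Phi>"
proof -
  obtain B where B: "B \<ge> 0" "\<And>v. \<bar>\<Phi> v\<bar> \<le> B" using hsupp_bounded[OF h] by blast
  show ?thesis using hsupp_bsupp[OF h] unfolding bsupp_def by (intro integrable_box[of _ B "2 * R"] B) auto
qed

lemma integral_plane:
  fixes f :: "real \<times> real \<Rightarrow> real"
  assumes "integrable lborel f"
  shows "(\<integral>v. f v \<partial>lborel) = (\<integral>q. \<integral>z. f (z, q) \<partial>lborel \<partial>lborel)"
proof -
  have "integrable (lborel \<Otimes>\<^sub>M lborel) (\<lambda>(x, y). f (x, y))" using assms by (simp add: lborel_prod)
  from lborel_pair.integral_snd[OF this] show ?thesis by (simp add: lborel_prod)
qed

text \<open>On the line of height q > 0 the limit function is the line integral of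
  \<open>\<Phi>\<close> divided by q, on an interval of length q; Fubini then gives equal
  integrals.\<close>

lemma integral_horo_mean_lim: "(\<integral>v. horo_mean_lim \<Phi> v \<partial>lborel) = (\<integral>v. \<Phi> v \<partial>lborel)"
proof -
  obtain B where B: "B \<ge> 0" "\<And>v. \<bar>\<Phi> v\<bar> \<le> B" using hsupp_bounded[OF h] by blast
  have R0: "0 < 1 / R" using hR by simp
  have zero: "(\<integral>z. \<Phi> (z, q) \<partial>lborel) = 0" if "\<not> (1 / R \<le> q \<and> q \<le> R)" for q
  proof -
    have "\<Phi> (z, q) = 0" for z using that by (intro hsupp_zero[OF h]) auto
    then show ?thesis by simp
  qed
  have nz: "1 / R \<le> snd v \<and> snd v \<le> R \<and> \<bar>fst v\<bar> \<le> R" if "horo_mean_lim \<Phi> v \<noteq> 0" for v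
  proof -
    have "- snd v < fst v" "fst v < 0" "1 / R \<le> snd v" "snd v \<le> R"
      using that zero[of "snd v"] by (auto simp: horo_mean_lim_def split: if_splits)
    then show ?thesis by auto
  qed
  have "integrable lborel (horo_mean_lim \<Phi>)"
  proof (rule integrable_box)
    show "\<bar>horo_mean_lim \<Phi> v\<bar> \<le> R * (B * (2 * R))" for v
    proof (cases "horo_mean_lim \<Phi> v = 0")
      case True then show ?thesis using B hR by simp
    next
      case False
      then have v: "1 / R \<le> snd v" using nz by blast
      then have q: "snd v > 0" using R0 by linarith
      have "\<bar>horo_mean_lim \<Phi> v\<bar> = (1 / snd v) * \<bar>\<integral>z. \<Phi> (z, snd v) \<partial>lborel\<bar>"
        using False q by (auto simp: horo_mean_lim_def abs_mult split: if_splits)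
      also have "\<dots> \<le> R * (B * (2 * R))"
        using v q hR by (intro mult_mono h_line_bound B) (auto simp: field_simps)
      finally show ?thesis .
    qed
    show "norm v \<le> 2 * R" if "horo_mean_lim \<Phi> v \<noteq> 0" for v
    proof -
      have "norm v \<le> \<bar>fst v\<bar> + \<bar>snd v\<bar>" by (metis norm_Pair_le prod.collapse real_norm_def)
      then show ?thesis using nz[OF that] R0 by linarith
    qed
  qed simp
  then have "(\<integral>v. horo_mean_lim \<Phi> v \<partial>lborel) = (\<integral>q. \<integral>z. horo_mean_lim \<Phi> (z, q) \<partial>lborel \<partial>lborel)" by (rule integral_plane)
  also have "\<dots> = (\<integral>q. \<integral>z. \<Phi> (z, q) \<partial>lborel \<partial>lborel)"
  proof (rule Bochner_Integration.integral_cong[OF refl])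
    fix q :: real
    show "(\<integral>z. horo_mean_lim \<Phi> (z, q) \<partial>lborel) = (\<integral>z. \<Phi> (z, q) \<partial>lborel)"
    proof (cases "q > 0")
      case True
      define I where "I = (\<integral>z. \<Phi> (z, q) \<partial>lborel)"
      have "horo_mean_lim \<Phi> (z, q) = (I / q) * indicator {-q<..<0} z" for z
        by (auto simp: horo_mean_lim_def I_def split: split_indicator)
      then have "(\<integral>z. horo_mean_lim \<Phi> (z, q) \<partial>lborel) = (I / q) * measure lborel {-q<..<0}" by simp
      also have "\<dots> = I" using True by simp
      finally show ?thesis by (simp add: I_def)
    next
      case False
      then have "horo_mean_lim \<Phi> (z, q) = 0" for z by (auto simp: horo_mean_lim_def)
      then show ?thesis using False zero[of q] R0 by simp
    qed
  qed
  also have "\<dots> = (\<integral>v. \<Phi> v \<partial>lborel)" by (rule integral_plane[OF h_integrable, symmetric])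
  finally show ?thesis .
qed

end

lemma AE_line: "AE v in lborel. fst v + k * snd v \<noteq> (0::real)"
proof (rule AE_I)
  show "{v \<in> space lborel. \<not> fst v + k * snd v \<noteq> 0} \<subseteq> {v. fst v + k * snd v = 0}" by auto
  show m: "{v. fst v + k * snd v = 0} \<in> sets lborel" by measurable
  have "emeasure lborel {v. fst v + k * snd v = 0} = (\<integral>\<^sup>+v. indicator {v. fst v + k * snd v = 0} v \<partial>lborel)"
    using m by simp
  also have "\<dots> = (\<integral>\<^sup>+q. \<integral>\<^sup>+z. indicator {v. fst v + k * snd v = 0} (z, q) \<partial>lborel \<partial>lborel)"
    by (rule nn_integral_lborel_pair(2)) measurable
  also have "\<dots> = (\<integral>\<^sup>+q. \<integral>\<^sup>+z. indicator {- k * q} z \<partial>lborel \<partial>lborel)"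
    by (intro nn_integral_cong) (auto simp: indicator_def)
  also have "\<dots> = 0" by simp
  finally show "emeasure lborel {v. fst v + k * snd v = (0::real)} = 0" .
qed

section \<open>Sums over primitive vectors along unipotent orbits\<close>

lemma psum_bound:
  assumes L: "L \<in> unimodular_lattices" and b: "b > 0" and s: "s \<ge> 0" and B: "\<And>v. \<bar>\<Phi> v\<bar> \<le> B"
    and supp: "\<And>v. \<Phi> v \<noteq> 0 \<Longrightarrow> 0 < snd v \<and> snd v \<le> b \<and> \<bar>fst v\<bar> \<le> s * snd v"
  shows "\<bar>psum \<Phi> L\<bar> \<le> B * (2 * s * b\<^sup>2 + 2)"
proof -
  define F where "F = {v \<in> prims L. 0 < snd v \<and> snd v \<le> b \<and> \<bar>fst v\<bar> \<le> s * snd v}"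
  have F: "finite F" "real (card F) \<le> 2 * s * b\<^sup>2 + 2"
    unfolding F_def using card_prims_sector[OF L b s] by auto
  have B0: "B \<ge> 0" using B[of 0] by linarith
  have "psum \<Phi> L = sum \<Phi> F"
    using supp by (intro psum_eq F) (auto simp: F_def simp del: split_paired_All)
  then have "\<bar>psum \<Phi> L\<bar> \<le> (\<Sum>v\<in>F. \<bar>\<Phi> v\<bar>)" by (simp add: sum_abs)
  also have "\<dots> \<le> (\<Sum>v\<in>F. B)" by (intro sum_mono B)
  also have "\<dots> = real (card F) * B" by simp
  also have "\<dots> \<le> (2 * s * b\<^sup>2 + 2) * B" using F B0 by (intro mult_right_mono)
  finally show ?thesis by (simp add: mult.commute)
qed

lemma act_delta_ut: "act (\<delta> s) (act (ut y) L) = act (ut (exp (2 * s) * y)) (act (\<delta> s) L)"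
  by (simp add: delta_ut flip: act_mult)

lemma norm_le_delta_ut: "norm v \<le> (1 + \<bar>y\<bar>) * (exp \<bar>s\<bar> * norm (lact (\<delta> s) (lact (ut y) v)))"
proof -
  have "v = lact (ut (- y)) (lact (ut y) v)" by (simp add: lact_ut)
  then have "norm v \<le> (1 + \<bar>y\<bar>) * norm (lact (ut y) v)" by (metis norm_ut_le abs_minus_cancel)
  moreover have "lact (ut y) v = lact (\<delta> (- s)) (lact (\<delta> s) (lact (ut y) v))"
    by (simp add: lact_delta lact_ut mult.assoc[symmetric] flip: exp_add)
  then have "norm (lact (ut y) v) \<le> exp \<bar>s\<bar> * norm (lact (\<delta> s) (lact (ut y) v))"
    by (metis norm_delta_le abs_minus_cancel)
  ultimately show ?thesis by (meson abs_ge_zero add_nonneg_nonneg mult_left_mono order_trans zero_le_one)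
qed

text \<open>For y in a bounded interval all contributing vectors belong to one finite set, so
  locally the functional is a finite sum of continuous functions.\<close>

lemma continuous_psum_ut:
  assumes L: "L \<in> unimodular_lattices" and c: "continuous_on UNIV \<Phi>" and b: "bsupp r \<Phi>"
  shows "continuous_on UNIV (\<lambda>y. psum \<Phi> (act (ut y) L))"
proof -
  have "isCont (\<lambda>y. psum \<Phi> (act (ut y) L)) y0" for y0
  proof -
    define B where "B = \<bar>y0\<bar> + 1"
    define F where "F = {v \<in> prims L. norm v \<le> (1 + B) * \<bar>r\<bar>}"
    have "psum \<Phi> (act (ut y) L) = (\<Sum>v\<in>F. \<Phi> (lact (ut y) v))" if y: "\<bar>y\<bar> < B" for y
    proof -
      have "psum \<Phi> (act (ut y) L) = psum (\<lambda>v. \<Phi> (lact (ut y) v)) L" by (rule psum_act[OF ut_in L])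
      also have "\<dots> = (\<Sum>v\<in>F. \<Phi> (lact (ut y) v))"
      proof (rule psum_eq)
        fix v assume v: "v \<in> prims L" "\<Phi> (lact (ut y) v) \<noteq> 0"
        have "norm (lact (ut y) v) \<le> r" using b v(2) unfolding bsupp_def by blast
        then have "norm (lact (ut y) v) \<le> \<bar>r\<bar>" by linarith
        moreover have "norm v \<le> (1 + \<bar>y\<bar>) * norm (lact (ut y) v)"
          using norm_le_delta_ut[of v y 0] by (simp add: lact_delta)
        moreover have "(1 + \<bar>y\<bar>) * norm (lact (ut y) v) \<le> (1 + B) * \<bar>r\<bar>"
          using y calculation by (intro mult_mono) auto
        ultimately show "v \<in> F" using v unfolding F_def by auto
      qed (use finite_prims[OF L] in \<open>auto simp: F_def\<close>)
      finally show ?thesis .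
    qed
    then have "\<forall>\<^sub>F y in nhds y0. psum \<Phi> (act (ut y) L) = (\<Sum>v\<in>F. \<Phi> (lact (ut y) v))"
      unfolding eventually_nhds by (intro exI[of _ "{y. \<bar>y\<bar> < B}"]) (auto simp: B_def intro!: open_Collect_less continuous_intros)
    moreover have "isCont (\<lambda>y. \<Sum>v\<in>F. \<Phi> (lact (ut y) v)) y0"
    proof -
      have "continuous_on UNIV (\<lambda>y. \<Sum>v\<in>F. \<Phi> (lact (ut y) v))"
        unfolding lact_ut by (intro continuous_intros continuous_on_UNIV_comp[OF c])
      then show ?thesis by (simp add: continuous_on_eq_continuous_at)
    qed
    ultimately show ?thesis using isCont_cong by fast
  qed
  then show ?thesis by (simp add: continuous_on_eq_continuous_at)
qed

lemma continuous_lattice_norm_ut: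
  assumes L: "L \<in> unimodular_lattices"
  shows "continuous_on UNIV (\<lambda>y. lattice_norm (act (ut y) L))"
proof -
  define N where "N y = lattice_norm (act (ut y) L)" for y
  have 1: "N y \<le> (1 + \<bar>y - x\<bar>) * N x" for x y
    using lattice_norm_ut(1)[OF act_in_lattices[OF ut_in[of x] L], of "y - x"]
    by (simp add: N_def ut_add flip: act_mult)
  have "(N \<longlongrightarrow> N x) (at x)" for x
  proof (rule tendsto_sandwich[of "\<lambda>y. N x / (1 + \<bar>y - x\<bar>)" _ _ "\<lambda>y. (1 + \<bar>y - x\<bar>) * N x"])
    show "\<forall>\<^sub>F y in at x. N x / (1 + \<bar>y - x\<bar>) \<le> N y"
    proof (intro always_eventually allI)
      fix y show "N x / (1 + \<bar>y - x\<bar>) \<le> N y"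
        using 1[of x y] by (subst pos_divide_le_eq) (auto simp: mult.commute abs_minus_commute)
    qed
    show "\<forall>\<^sub>F y in at x. N y \<le> (1 + \<bar>y - x\<bar>) * N x" using 1 by (intro always_eventually allI)
    have "((\<lambda>y. N x / (1 + \<bar>y - x\<bar>)) \<longlongrightarrow> N x / (1 + \<bar>x - x\<bar>)) (at x)" by (intro tendsto_intros) auto
    then show "((\<lambda>y. N x / (1 + \<bar>y - x\<bar>)) \<longlongrightarrow> N x) (at x)" by simp
    have "((\<lambda>y. (1 + \<bar>y - x\<bar>) * N x) \<longlongrightarrow> (1 + \<bar>x - x\<bar>) * N x) (at x)" by (intro tendsto_intros)
    then show "((\<lambda>y. (1 + \<bar>y - x\<bar>) * N x) \<longlongrightarrow> N x) (at x)" by simp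
  qed
  then show ?thesis unfolding N_def[symmetric] by (simp add: continuous_on_def)
qed

text \<open>By \<open>act_delta_ut\<close> this is the average over the piece of length
  \<open>exp (2 * s)\<close> of the horocycle that starts at
  \<open>act (\<delta> s) L\<close>.\<close>

definition avg :: "real \<Rightarrow> ((real^2) set \<Rightarrow> real) \<Rightarrow> (real^2) set \<Rightarrow> real" where
  "avg s F L = (\<integral>y. F (act (\<delta> s) (act (ut y) L)) \<partial>nu)"

section \<open>Averages over horocycle pieces\<close>

context haar
begin

text \<open>
  Continuity along the unipotent orbits replaces continuity on the space of lattices: together with
  measurability it gives joint measurability in \<open>(y, L)\<close>, which is what exchanging the averages needs.
\<close>

definition ucont :: "((real^2) set \<Rightarrow> real) \<Rightarrow> bool" where
  "ucont F \<longleftrightarrow> F \<in> borel_measurable \<mu> \<and> (\<forall>L\<in>unimodular_lattices. continuous_on UNIV (\<lambda>y. F (act (ut y) L)))"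

lemma ucont_psum: "continuous_on UNIV \<Phi> \<Longrightarrow> bsupp r \<Phi> \<Longrightarrow> ucont (psum \<Phi>)"
  by (simp add: ucont_def measurable_psum continuous_psum_ut)

lemma ucont_act: "ucont F \<Longrightarrow> ucont (\<lambda>L. F (act (\<delta> s) L))"
  unfolding ucont_def
proof (elim conjE, intro conjI ballI)
  fix L assume F: "F \<in> borel_measurable \<mu>" "\<forall>L\<in>unimodular_lattices. continuous_on UNIV (\<lambda>y. F (act (ut y) L))"
    and L: "L \<in> unimodular_lattices"
  show "continuous_on UNIV (\<lambda>y. F (act (\<delta> s) (act (ut y) L)))"
  proof -
    have c: "continuous_on UNIV (\<lambda>y. F (act (ut y) (act (\<delta> s) L)))" using F(2) act_in_lattices[OF delta_in L] by blast
    show ?thesis unfolding act_delta_ut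
      by (rule continuous_on_UNIV_comp[OF c, of UNIV "\<lambda>y. exp (2 * s) * y"]) (intro continuous_intros)
  qed
qed (rule measurable_compose[OF act_measurable[OF delta_in]])

lemma ucont_comp:
  assumes F: "ucont F" and f: "continuous_on UNIV (f :: real \<Rightarrow> real)" shows "ucont (\<lambda>L. f (F L))"
  unfolding ucont_def
proof (intro conjI ballI)
  show "(\<lambda>L. f (F L)) \<in> borel_measurable \<mu>"
    using F unfolding ucont_def by (intro measurable_compose[OF _ borel_measurable_continuous_onI[OF f]]) simp
  show "continuous_on UNIV (\<lambda>y. f (F (act (ut y) L)))" if "L \<in> unimodular_lattices" for L
    using F that unfolding ucont_def by (intro continuous_on_UNIV_comp[OF f]) simp
qed

lemma ucont_diff: "ucont F \<Longrightarrow> ucont G \<Longrightarrow> ucont (\<lambda>L. F L - G L)"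
  unfolding ucont_def by (auto intro: continuous_intros)

lemma ucont_mult: "ucont F \<Longrightarrow> ucont G \<Longrightarrow> ucont (\<lambda>L. F L * G L)"
  unfolding ucont_def by (auto intro: continuous_intros)

lemma ucont_const: "ucont (\<lambda>L. c)" by (simp add: ucont_def)

lemma ucont_prod: "(\<And>i. i \<in> I \<Longrightarrow> ucont (F i)) \<Longrightarrow> ucont (\<lambda>L. \<Prod>i\<in>I. F i L)"
  unfolding ucont_def by (auto intro!: continuous_intros borel_measurable_prod)

lemma ucont_joint:
  assumes "ucont F" shows "(\<lambda>(y, L). F (act (\<delta> s) (act (ut y) L))) \<in> borel_measurable (borel \<Otimes>\<^sub>M \<mu>)"
proof (rule measurable_Caratheodory)
  have u: "ucont (\<lambda>L. F (act (\<delta> s) L))" using assms by (rule ucont_act)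
  show "continuous_on UNIV (\<lambda>y. F (act (\<delta> s) (act (ut y) L)))" if "L \<in> space \<mu>" for L
    using u that by (auto simp: ucont_def space_mu)
  show "(\<lambda>L. F (act (\<delta> s) (act (ut y) L))) \<in> borel_measurable \<mu>" for y
    using u measurable_compose[OF act_measurable[OF ut_in[of y]]] by (auto simp: ucont_def)
qed

lemma ucont_line: "ucont F \<Longrightarrow> L \<in> unimodular_lattices \<Longrightarrow> (\<lambda>y. F (act (\<delta> s) (act (ut y) L))) \<in> borel_measurable borel"
  using ucont_act[of F s] by (auto simp: ucont_def intro: borel_measurable_continuous_onI)

lemma integrable_line:
  assumes F: "ucont F" and B: "\<And>L. L \<in> unimodular_lattices \<Longrightarrow> \<bar>F L\<bar> \<le> B" and L: "L \<in> unimodular_lattices"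
  shows "integrable nu (\<lambda>y. F (act (\<delta> s) (act (ut y) L)))"
  using ucont_line[OF F L, of s] L
  by (intro nu.integrable_const_bound[of _ B]) (auto intro!: AE_I2 B act_in_lattices delta_in ut_in)

lemma borel_avg[measurable]: assumes "ucont F" shows "avg s F \<in> borel_measurable \<mu>"
proof -
  have "(\<lambda>(L, y). F (act (\<delta> s) (act (ut y) L))) \<in> borel_measurable (\<mu> \<Otimes>\<^sub>M nu)"
    using ucont_joint[OF assms, of s] by (subst measurable_pair_swap_iff) (simp cong: measurable_cong_sets)
  from nu.borel_measurable_lebesgue_integral[OF this] show ?thesis unfolding avg_def by simp
qed

lemma integrable_weighted:
  assumes F: "ucont F" and G: "G \<in> borel_measurable (borel \<Otimes>\<^sub>M \<mu>)"
    and B: "\<And>L. L \<in> unimodular_lattices \<Longrightarrow> \<bar>F L\<bar> \<le> B" and GB: "\<And>x. \<bar>G x\<bar> \<le> C"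
  shows "integrable (nu \<Otimes>\<^sub>M \<mu>) (\<lambda>(y, L). G (y, L) * F (act (\<delta> s) (act (ut y) L)))"
proof -
  interpret pair_prob_space nu \<mu> ..
  have mean_inverse_norm: "C \<ge> 0" using GB[of undefined] by linarith
  have m: "(\<lambda>(y, L). F (act (\<delta> s) (act (ut y) L))) \<in> borel_measurable (nu \<Otimes>\<^sub>M \<mu>)"
    using ucont_joint[OF F, of s] by (simp cong: measurable_cong_sets)
  have mG: "G \<in> borel_measurable (nu \<Otimes>\<^sub>M \<mu>)" using G by (simp cong: measurable_cong_sets)
  show ?thesis
  proof (rule P.integrable_const_bound[of _ "C * B"])
    show "AE x in nu \<Otimes>\<^sub>M \<mu>. norm (case x of (y, L) \<Rightarrow> G (y, L) * F (act (\<delta> s) (act (ut y) L))) \<le> C * B"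
      using mean_inverse_norm GB B by (intro AE_I2) (auto simp: space_pair_measure space_mu abs_mult act_in_lattices delta_in ut_in intro!: mult_mono)
    show "(\<lambda>(y, L). G (y, L) * F (act (\<delta> s) (act (ut y) L))) \<in> borel_measurable (nu \<Otimes>\<^sub>M \<mu>)"
      using borel_measurable_times[OF mG m] by (simp add: case_prod_beta')
  qed
qed

text \<open>Fubini. The weight \<open>G\<close> makes room for the past, which stays at L while the
  rest is averaged.\<close>

lemma integral_avg_weighted:
  assumes F: "ucont F" and G: "G \<in> borel_measurable (borel \<Otimes>\<^sub>M \<mu>)"
    and B: "\<And>L. L \<in> unimodular_lattices \<Longrightarrow> \<bar>F L\<bar> \<le> B" and GB: "\<And>x. \<bar>G x\<bar> \<le> C"
  shows "(\<integral>L. (\<integral>y. G (y, L) * F (act (\<delta> s) (act (ut y) L)) \<partial>nu) \<partial>\<mu>)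
       = (\<integral>y. (\<integral>L. G (y, L) * F (act (\<delta> s) (act (ut y) L)) \<partial>\<mu>) \<partial>nu)"
    "integrable nu (\<lambda>y. \<integral>L. G (y, L) * F (act (\<delta> s) (act (ut y) L)) \<partial>\<mu>)"
    "integrable \<mu> (\<lambda>L. \<integral>y. G (y, L) * F (act (\<delta> s) (act (ut y) L)) \<partial>nu)"
proof -
  interpret pair_prob_space nu \<mu> ..
  note i = integrable_weighted[OF assms, of s]
  show "(\<integral>L. (\<integral>y. G (y, L) * F (act (\<delta> s) (act (ut y) L)) \<partial>nu) \<partial>\<mu>)
       = (\<integral>y. (\<integral>L. G (y, L) * F (act (\<delta> s) (act (ut y) L)) \<partial>\<mu>) \<partial>nu)"
    by (rule Fubini_integral[OF i])
  show "integrable nu (\<lambda>y. \<integral>L. G (y, L) * F (act (\<delta> s) (act (ut y) L)) \<partial>\<mu>)" by (rule integrable_fst[OF i])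
  show "integrable \<mu> (\<lambda>L. \<integral>y. G (y, L) * F (act (\<delta> s) (act (ut y) L)) \<partial>nu)" by (rule integrable_snd[OF i])
qed

text \<open>Each single shift by \<open>ut y\<close> and \<open>\<delta> s\<close> preserves
  \<open>\<mu>\<close>, so the mean over y changes nothing.\<close>

lemma integral_avg:
  assumes F: "ucont F" and B: "\<And>L. L \<in> unimodular_lattices \<Longrightarrow> \<bar>F L\<bar> \<le> B"
  shows "(\<integral>L. avg s F L \<partial>\<mu>) = (\<integral>L. F L \<partial>\<mu>)"
proof -
  have "(\<integral>L. avg s F L \<partial>\<mu>) = (\<integral>y. (\<integral>L. F (act (\<delta> s) (act (ut y) L)) \<partial>\<mu>) \<partial>nu)"
    using integral_avg_weighted(1)[OF F, of "\<lambda>_. 1" B 1 s] B by (simp add: avg_def)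
  also have "\<dots> = (\<integral>y. (\<integral>L. F L \<partial>\<mu>) \<partial>nu)"
  proof (rule Bochner_Integration.integral_cong[OF refl])
    fix y
    have 1: "F \<in> borel_measurable \<mu>" using F by (simp add: ucont_def)
    have 2: "(\<lambda>L. F (act (\<delta> s) L)) \<in> borel_measurable \<mu>" using ucont_act[OF F] by (simp add: ucont_def)
    show "(\<integral>L. F (act (\<delta> s) (act (ut y) L)) \<partial>\<mu>) = (\<integral>L. F L \<partial>\<mu>)"
      using integral_act[OF ut_in 2, of y] integral_act[OF delta_in 1, of s] by simp
  qed
  also have "\<dots> = (\<integral>L. F L \<partial>\<mu>)" by (simp add: nu.prob_space[unfolded space_nu] space_nu)
  finally show ?thesis .
qed

lemma avg_abs_le: "\<bar>avg s F L\<bar> \<le> avg s (\<lambda>L. \<bar>F L\<bar>) L"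
  unfolding avg_def by (rule integral_abs_bound)

lemma avg_diff:
  assumes "ucont F" "\<And>L. L \<in> unimodular_lattices \<Longrightarrow> \<bar>F L\<bar> \<le> B" "ucont G" "\<And>L. L \<in> unimodular_lattices \<Longrightarrow> \<bar>G L\<bar> \<le> C"
    "L \<in> unimodular_lattices"
  shows "avg s (\<lambda>L. F L - G L) L = avg s F L - avg s G L"
  unfolding avg_def using assms by (intro Bochner_Integration.integral_diff integrable_line)

lemma abs_avg_le:
  assumes F: "ucont F" and B: "\<And>L. L \<in> unimodular_lattices \<Longrightarrow> \<bar>F L\<bar> \<le> B" and L: "L \<in> unimodular_lattices"
  shows "\<bar>avg s F L\<bar> \<le> B"
proof -
  have "\<bar>avg s F L\<bar> \<le> (\<integral>y. \<bar>F (act (\<delta> s) (act (ut y) L))\<bar> \<partial>nu)" unfolding avg_def by (rule integral_abs_bound)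
  also have "\<dots> \<le> (\<integral>y. B \<partial>nu)"
    using L B by (intro integral_mono integrable_abs integrable_line[OF F B]) (auto simp: act_in_lattices delta_in ut_in)
  also have "\<dots> = B" using nu.prob_space by (simp add: space_nu)
  finally show ?thesis .
qed

lemma integrable_bounded:
  assumes "F \<in> borel_measurable \<mu>" "\<And>L. L \<in> unimodular_lattices \<Longrightarrow> \<bar>F L\<bar> \<le> (B::real)"
  shows "integrable \<mu> F"
  using assms by (intro integrable_const_bound[of _ B] AE_I2) (auto simp: space_mu)

end

section \<open>Equidistribution of long horocycle pieces and the mean value formula\<close>

lemma hsupp_scaled:
  assumes h: "hsupp R \<Phi>" and t: "\<tau> \<ge> 1"
  shows "continuous_on UNIV (\<lambda>v. \<Phi> (sqrt \<tau> *\<^sub>R v))" "bsupp (2 * R) (\<lambda>v. \<Phi> (sqrt \<tau> *\<^sub>R v))"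
proof -
  show "continuous_on UNIV (\<lambda>v. \<Phi> (sqrt \<tau> *\<^sub>R v))"
  proof -
    have c: "continuous_on UNIV \<Phi>" using h by (simp add: hsupp_def)
    show ?thesis by (rule continuous_on_UNIV_comp[OF c, of UNIV "\<lambda>v. sqrt \<tau> *\<^sub>R v"]) (intro continuous_intros)
  qed
  show "bsupp (2 * R) (\<lambda>v. \<Phi> (sqrt \<tau> *\<^sub>R v))" unfolding bsupp_def
  proof (intro allI impI)
    fix v assume "\<Phi> (sqrt \<tau> *\<^sub>R v) \<noteq> 0"
    then have "norm (sqrt \<tau> *\<^sub>R v) \<le> 2 * R" using hsupp_bsupp[OF h] unfolding bsupp_def by blast
    moreover have "1 * norm v \<le> sqrt \<tau> * norm v" using t by (intro mult_right_mono) auto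
    moreover have "\<bar>sqrt \<tau>\<bar> = sqrt \<tau>" using t by simp
    ultimately show "norm v \<le> 2 * R" by (metis norm_scaleR mult_1 order_trans)
  qed
qed

lemma hsupp_scaled_bound:
  assumes h: "hsupp R \<Phi>" and t: "\<tau> \<ge> 1"
  obtains B where "\<And>L. L \<in> unimodular_lattices \<Longrightarrow> \<bar>psum (\<lambda>v. \<Phi> (sqrt \<tau> *\<^sub>R v)) L\<bar> \<le> B"
proof -
  obtain B where B: "B \<ge> 0" "\<And>v. \<bar>\<Phi> v\<bar> \<le> B" using hsupp_bounded[OF h] by blast
  have R: "R \<ge> 1" using h by (simp add: hsupp_def)
  \<comment> \<open>Width at most R and height at least 1/R bound the slope by
    \<open>R\<^sup>2\<close>, and the scaling by \<open>sqrt \<tau>\<close> leaves slopes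
    alone.\<close>
  have "0 < snd v \<and> snd v \<le> R \<and> \<bar>fst v\<bar> \<le> R\<^sup>2 * snd v" if "\<Phi> (sqrt \<tau> *\<^sub>R v) \<noteq> 0" for v
  proof -
    have st: "sqrt \<tau> \<ge> 1" using t by simp
    have *: "\<bar>sqrt \<tau> * fst v\<bar> \<le> R" "1 / R \<le> sqrt \<tau> * snd v" "sqrt \<tau> * snd v \<le> R"
      using hsupp_zero[OF h, of "sqrt \<tau> *\<^sub>R v"] that by auto
    have "0 < 1 / R" using R by simp
    then have "0 < sqrt \<tau> * snd v" using * by linarith
    then have q: "snd v > 0" using st by (simp add: zero_less_mult_iff)
    have "1 * snd v \<le> sqrt \<tau> * snd v" using q st by (intro mult_right_mono) auto
    then have qR: "snd v \<le> R" using * by linarith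
    have "sqrt \<tau> * \<bar>fst v\<bar> \<le> R * (R * (1 / R))" using * st R by (simp add: abs_mult)
    moreover have "R * (R * (1 / R)) \<le> R * (R * (sqrt \<tau> * snd v))"
      using R * by (intro mult_left_mono) auto
    ultimately have "sqrt \<tau> * \<bar>fst v\<bar> \<le> R * (R * (sqrt \<tau> * snd v))" by linarith
    then have "sqrt \<tau> * \<bar>fst v\<bar> \<le> sqrt \<tau> * (R\<^sup>2 * snd v)" by (simp add: power2_eq_square algebra_simps)
    then have "\<bar>fst v\<bar> \<le> R\<^sup>2 * snd v" using st by simp
    then show ?thesis using q qR by blast
  qed
  then have "\<bar>psum (\<lambda>v. \<Phi> (sqrt \<tau> *\<^sub>R v)) L\<bar> \<le> B * (2 * R\<^sup>2 * R\<^sup>2 + 2)" if "L \<in> unimodular_lattices" for L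
    using that B R by (intro psum_bound) auto
  then show ?thesis using that by blast
qed

text \<open>Measured in units of Q, the map
  \<open>sqrt \<tau> *\<^sub>R lact (\<delta> s) (lact (ut y) v)\<close> keeps the second coordinate
  and sends the first to N times the sheared one. The averaged sum is thus a Riemann sum at scale Q,
  with mass factor \<open>N / Q\<^sup>2 = \<tau>\<close>.\<close>

lemma avg_psum:
  fixes s :: real
  assumes h: "hsupp R \<Phi>" and t: "\<tau> \<ge> 1" and L: "L \<in> unimodular_lattices"
  defines "N \<equiv> exp (2 * s)" and "Q \<equiv> exp s / sqrt \<tau>"
  shows "\<tau> * avg s (psum (\<lambda>v. \<Phi> (sqrt \<tau> *\<^sub>R v))) L = (1 / Q\<^sup>2) * psum (\<lambda>v. horo_mean N \<Phi> ((1 / Q) *\<^sub>R v)) L"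
proof -
  note [measurable] = hsupp_borel[OF h]
  define G where "G y v = \<Phi> (sqrt \<tau> *\<^sub>R lact (\<delta> s) (lact (ut y) v))" for y v
  \<comment> \<open>A finite set containing the vectors that contribute for some y in the unit
    interval, so that sum and average can be exchanged.\<close>
  define F where "F = {v \<in> prims L. norm v \<le> 2 * (exp \<bar>s\<bar> * (2 * R))}"
  have fF: "finite F" unfolding F_def by (rule finite_prims[OF L])
  obtain B where B: "B \<ge> 0" "\<And>v. \<bar>\<Phi> v\<bar> \<le> B" using hsupp_bounded[OF h] by blast
  have Gint: "integrable nu (\<lambda>y. G y v)" for v
    by (rule nu.integrable_const_bound[of _ B]) (auto simp: G_def B lact_ut lact_delta)
  have GF: "v \<in> F" if "v \<in> prims L" "G y v \<noteq> 0" "y \<in> {0..1}" for y v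
  proof -
    have "norm (lact (\<delta> s) (lact (ut y) v)) \<le> 2 * R"
      using that hsupp_scaled(2)[OF h t] unfolding G_def bsupp_def by blast
    then have "(1 + \<bar>y\<bar>) * (exp \<bar>s\<bar> * norm (lact (\<delta> s) (lact (ut y) v))) \<le> 2 * (exp \<bar>s\<bar> * (2 * R))"
      using that by (intro mult_mono mult_left_mono) auto
    then have "norm v \<le> 2 * (exp \<bar>s\<bar> * (2 * R))" using norm_le_delta_ut[of v y s] by linarith
    then show ?thesis using that unfolding F_def by blast
  qed
  have GL: "\<tau> * (\<integral>y. G y v \<partial>nu) = (1 / Q\<^sup>2) * horo_mean N \<Phi> ((1 / Q) *\<^sub>R v)" for v
  proof -
    have t0: "\<tau> > 0" "sqrt \<tau> > 0" using t by auto
    have 1: "N * (1 / Q) = sqrt \<tau> * exp s" using t0 by (simp add: N_def Q_def field_simps flip: exp_add)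
    have 2: "N * (1 / Q * a + y * (1 / Q * b)) = sqrt \<tau> * (exp s * (a + y * b))" for a b y
    proof -
      have "N * (1 / Q * a + y * (1 / Q * b)) = (N * (1 / Q)) * (a + y * b)" by (simp add: algebra_simps)
      then show ?thesis unfolding 1 by simp
    qed
    have 3: "1 / Q * b = sqrt \<tau> * (exp (- s) * b)" for b
      by (simp add: Q_def exp_minus field_simps)
    have "(N * (1 / Q * a + y * (1 / Q * b)), 1 / Q * b) = sqrt \<tau> *\<^sub>R lact (\<delta> s) (lact (ut y) (a, b))" for a b y
      unfolding 2 unfolding 3 by (simp add: lact_ut lact_delta)
    from this[of "fst v" _ "snd v"]
    have "G y v = \<Phi> (N * (fst ((1 / Q) *\<^sub>R v) + y * snd ((1 / Q) *\<^sub>R v)), snd ((1 / Q) *\<^sub>R v))" for y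
      by (simp add: G_def)
    then have "horo_mean N \<Phi> ((1 / Q) *\<^sub>R v) = N * (\<integral>y. G y v \<partial>nu)" by (simp add: horo_mean_def)
    moreover have "(1 / Q\<^sup>2) * N = \<tau>"
      using t0 by (simp add: N_def Q_def power_divide exp_double)
    ultimately show ?thesis by (metis mult.assoc)
  qed
  have "avg s (psum (\<lambda>v. \<Phi> (sqrt \<tau> *\<^sub>R v))) L = (\<integral>y. (\<Sum>v\<in>F. G y v) \<partial>nu)"
    unfolding avg_def
  proof (rule integral_cong_AE)
    have "continuous_on UNIV (\<lambda>y. psum (\<lambda>v. \<Phi> (sqrt \<tau> *\<^sub>R v)) (act (\<delta> s) (act (ut y) L)))"
      unfolding act_delta_ut
      by (rule continuous_on_UNIV_comp[OF continuous_psum_ut[OF act_in_lattices[OF delta_in L] hsupp_scaled[OF h t]], of UNIV "\<lambda>y. exp (2 * s) * y"])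
        (intro continuous_intros)
    then show "(\<lambda>y. psum (\<lambda>v. \<Phi> (sqrt \<tau> *\<^sub>R v)) (act (\<delta> s) (act (ut y) L))) \<in> borel_measurable nu"
      unfolding measurable_cong_sets[OF sets_nu refl] by (rule borel_measurable_continuous_onI)
    show "(\<lambda>y. \<Sum>v\<in>F. G y v) \<in> borel_measurable nu"
      using Gint by (intro borel_measurable_sum) auto
    show "AE y in nu. psum (\<lambda>v. \<Phi> (sqrt \<tau> *\<^sub>R v)) (act (\<delta> s) (act (ut y) L)) = (\<Sum>v\<in>F. G y v)"
      using AE_nu
    proof eventually_elim
      case (elim y)
      have "psum (\<lambda>v. \<Phi> (sqrt \<tau> *\<^sub>R v)) (act (\<delta> s) (act (ut y) L)) = psum (G y) L"
        by (simp add: psum_act delta_in ut_in act_in_lattices L G_def[abs_def])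
      also have "\<dots> = (\<Sum>v\<in>F. G y v)" using GF elim by (intro psum_eq fF) (auto simp: F_def)
      finally show ?case .
    qed
  qed
  also have "\<dots> = (\<Sum>v\<in>F. \<integral>y. G y v \<partial>nu)" using Gint by (intro Bochner_Integration.integral_sum)
  also have "\<tau> * \<dots> = (\<Sum>v\<in>F. (1 / Q\<^sup>2) * horo_mean N \<Phi> ((1 / Q) *\<^sub>R v))" by (simp only: sum_distrib_left GL)
  also have "\<dots> = (1 / Q\<^sup>2) * (\<Sum>v\<in>F. horo_mean N \<Phi> ((1 / Q) *\<^sub>R v))" by (simp add: sum_distrib_left)
  also have "(\<Sum>v\<in>F. horo_mean N \<Phi> ((1 / Q) *\<^sub>R v)) = psum (\<lambda>v. horo_mean N \<Phi> ((1 / Q) *\<^sub>R v)) L"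
  proof (rule psum_eq[symmetric, OF fF])
    show "F \<subseteq> prims L" by (auto simp: F_def)
    fix v assume v: "v \<in> prims L" "horo_mean N \<Phi> ((1 / Q) *\<^sub>R v) \<noteq> 0"
    have "(\<integral>y. G y v \<partial>nu) \<noteq> 0"
    proof
      assume "(\<integral>y. G y v \<partial>nu) = 0"
      then have "(1 / Q\<^sup>2) * horo_mean N \<Phi> ((1 / Q) *\<^sub>R v) = 0" using GL[of v] by simp
      then show False using v t by (auto simp: Q_def)
    qed
    moreover have "(\<integral>y. G y v \<partial>nu) = 0" if "\<forall>y\<in>{0..1}. G y v = 0"
    proof (rule integral_eq_zero_AE)
      show "AE y in nu. G y v = 0" using AE_nu by eventually_elim (use that in auto)
    qed
    ultimately have "\<not> (\<forall>y\<in>{0..1}. G y v = 0)" by metis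
    then show "v \<in> F" using GF v by blast
  qed
  finally show ?thesis .
qed

text \<open>Equidistribution at each lattice: \<open>primitive_riemann\<close> applied to
  \<open>horo_mean\<close>, whose limit has the same integral as \<open>\<Phi>\<close>. The scale
  that has to diverge is \<open>exp s / sqrt \<tau>\<close>.\<close>

lemma avg_psum_tendsto:
  assumes h: "hsupp R \<Phi>" and L: "L \<in> unimodular_lattices"
    and t: "\<And>n. \<tau> n \<ge> 1" and s: "\<And>n. s n \<ge> 0" and Q: "filterlim (\<lambda>n. exp (s n) / sqrt (\<tau> n)) at_top sequentially"
  shows "(\<lambda>n. \<tau> n * avg (s n) (psum (\<lambda>v. \<Phi> (sqrt (\<tau> n) *\<^sub>R v))) L) \<longlonglongrightarrow> czeta * (\<integral>v. \<Phi> v \<partial>lborel)"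
proof -
  define N where "N n = exp (2 * s n)" for n
  obtain g where g: "g \<in> SL2R" "L = act g Z2" using L by (auto elim: unimodular_latticesE)
  obtain B where B: "B \<ge> 0" "\<And>v. \<bar>\<Phi> v\<bar> \<le> B" using hsupp_bounded[OF h] by blast
  have R: "R \<ge> 1" "1 / R > 0" using h by (auto simp: hsupp_def)
  have N1: "N n \<ge> 1" for n using s[of n] by (simp add: N_def)
  have Nlim: "filterlim N at_top sequentially"
  proof (rule filterlim_at_top_mono[OF Q])
    have "exp (s n) / sqrt (\<tau> n) \<le> N n" for n
    proof -
      have "exp (s n) / sqrt (\<tau> n) \<le> exp (s n) / 1" using t[of n] by (intro divide_left_mono) auto
      also have "\<dots> \<le> N n" using s[of n] by (simp add: N_def)
      finally show ?thesis .
    qed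
    then show "\<forall>\<^sub>F n in sequentially. exp (s n) / sqrt (\<tau> n) \<le> N n" by simp
  qed
  have "(\<lambda>n. (1 / (exp (s n) / sqrt (\<tau> n))\<^sup>2) * psum (\<lambda>v. horo_mean (N n) \<Phi> ((1 / (exp (s n) / sqrt (\<tau> n))) *\<^sub>R v)) (act g Z2))
      \<longlonglongrightarrow> czeta * (\<integral>v. horo_mean_lim \<Phi> v \<partial>lborel)"
  proof (rule primitive_riemann[OF g(1) Q])
    show "horo_mean (N n) \<Phi> \<in> borel_measurable borel" for n by (rule borel_horo_mean[OF h])
    show "horo_mean_lim \<Phi> \<in> borel_measurable borel" by (rule borel_horo_mean_lim[OF h])
    show "\<bar>horo_mean (N n) \<Phi> v\<bar> \<le> R * (B * (2 * R))" for n v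
      using N1[of n] by (intro horo_mean_bound[OF h _ B(2)]) auto
    show "norm v \<le> 3 * R" if "horo_mean (N n) \<Phi> v \<noteq> 0" for n v
    proof -
      have "norm v \<le> \<bar>fst v\<bar> + \<bar>snd v\<bar>" by (metis norm_Pair_le prod.collapse real_norm_def)
      then show ?thesis using horo_mean_supp[OF h N1 that] R by linarith
    qed
    show "horo_mean (N n) \<Phi> 0 = 0" for n using horo_mean_supp(1)[OF h N1, of n 0] R by force
    \<comment> \<open>The lines \<open>fst v = 0\<close> and \<open>fst v + snd v = 0\<close>, where
      the zero hits an endpoint of the unit interval, are null sets.\<close>
    show "AE v in lborel. \<forall>w. w \<longlonglongrightarrow> v \<longrightarrow> (\<lambda>n. horo_mean (N n) \<Phi> (w n)) \<longlonglongrightarrow> horo_mean_lim \<Phi> v"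
      using AE_line[of 0] AE_line[of 1]
      by eventually_elim (use horo_mean_tendsto[OF h Nlim] in auto)
  qed
  then show ?thesis
    unfolding integral_horo_mean_lim[OF h] g(2)[symmetric] N_def using avg_psum[OF h t L] by simp
qed

text \<open>The support lies in a sector of bounded slope and height at most \<open>R * Q\<close>,
  which holds \<open>O(Q\<^sup>2)\<close> primitive vectors of any lattice; for
  \<open>Q \<ge> 1\<close> this is absorbed by the factor \<open>1 / Q\<^sup>2\<close>.\<close>

lemma avg_psum_bound:
  assumes h: "hsupp R \<Phi>"
  obtains C where "\<And>L \<tau> s. L \<in> unimodular_lattices \<Longrightarrow> \<tau> \<ge> 1 \<Longrightarrow> s \<ge> 0 \<Longrightarrow> exp s / sqrt \<tau> \<ge> 1 \<Longrightarrow>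
     \<bar>\<tau> * avg s (psum (\<lambda>v. \<Phi> (sqrt \<tau> *\<^sub>R v))) L\<bar> \<le> C"
proof -
  obtain B where B: "B \<ge> 0" "\<And>v. \<bar>\<Phi> v\<bar> \<le> B" using hsupp_bounded[OF h] by blast
  have R: "R \<ge> 1" "1 / R > 0" using h by (auto simp: hsupp_def)
  define K where "K = R * (B * (2 * R))"
  have K0: "K \<ge> 0" using B R by (simp add: K_def)
  have "\<bar>\<tau> * avg s (psum (\<lambda>v. \<Phi> (sqrt \<tau> *\<^sub>R v))) L\<bar> \<le> K * (4 * R ^ 4 + 2)"
    if L: "L \<in> unimodular_lattices" and t: "\<tau> \<ge> 1" and s: "s \<ge> 0" and Q1: "exp s / sqrt \<tau> \<ge> 1" for L \<tau> s
  proof -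
    define Q where "Q = exp s / sqrt \<tau>"
    have Q: "Q \<ge> 1" using Q1 by (simp add: Q_def)
    have N: "exp (2 * s) \<ge> 1" using s by simp
    have "\<bar>psum (\<lambda>v. horo_mean (exp (2 * s)) \<Phi> ((1 / Q) *\<^sub>R v)) L\<bar> \<le> K * (2 * (2 * R\<^sup>2) * (R * Q)\<^sup>2 + 2)"
    proof (rule psum_bound[OF L])
      show "\<bar>horo_mean (exp (2 * s)) \<Phi> ((1 / Q) *\<^sub>R v)\<bar> \<le> K" for v unfolding K_def by (intro horo_mean_bound[OF h _ B(2)]) auto
      fix v assume "horo_mean (exp (2 * s)) \<Phi> ((1 / Q) *\<^sub>R v) \<noteq> 0"
      from horo_mean_supp[OF h N this] have *: "1 / R \<le> snd v / Q" "snd v / Q \<le> R" "\<bar>fst v / Q\<bar> \<le> 2 * R" by auto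
      have "0 < snd v / Q" using * R by linarith
      then have q: "0 < snd v" using Q by (simp add: zero_less_divide_iff)
      have "snd v \<le> R * Q" using * Q by (simp add: field_simps)
      moreover have "\<bar>fst v\<bar> \<le> 2 * R\<^sup>2 * snd v"
      proof -
        have "\<bar>fst v\<bar> \<le> 2 * R * Q" using * Q by (simp add: abs_divide field_simps)
        also have "Q \<le> R * snd v" using * Q R by (simp add: field_simps)
        then have "2 * R * Q \<le> 2 * R * (R * snd v)" using R by (intro mult_left_mono) auto
        finally show ?thesis by (simp add: power2_eq_square mult.assoc)
      qed
      ultimately show "0 < snd v \<and> snd v \<le> R * Q \<and> \<bar>fst v\<bar> \<le> 2 * R\<^sup>2 * snd v" using q by blast
    qed (use R Q in auto)
    then have "\<bar>(1 / Q\<^sup>2) * psum (\<lambda>v. horo_mean (exp (2 * s)) \<Phi> ((1 / Q) *\<^sub>R v)) L\<bar> \<le> (1 / Q\<^sup>2) * (K * (2 * (2 * R\<^sup>2) * (R * Q)\<^sup>2 + 2))"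
      unfolding abs_mult by (intro mult_mono) auto
    also have "\<dots> = K * (4 * R ^ 4 + 2 / Q\<^sup>2)"
      using Q by (simp add: field_simps power_mult_distrib flip: power_add)
    also have "\<dots> \<le> K * (4 * R ^ 4 + 2)"
      using K0 Q by (intro mult_left_mono) (auto simp: divide_le_eq)
    finally show ?thesis using avg_psum[OF h t L, of s] by (simp add: Q_def)
  qed
  then show ?thesis using that by blast
qed

context haar
begin

text \<open>Pointwise convergence at every lattice and a bound uniform in the lattice, combined by
  dominated convergence.\<close>

theorem equidistribution:
  assumes h: "hsupp R \<Phi>"
    and t: "\<And>n. \<tau> n \<ge> 1" and s: "\<And>n. s n \<ge> 0" and Q: "filterlim (\<lambda>n. exp (s n) / sqrt (\<tau> n)) at_top sequentially"
  shows "(\<lambda>n. \<integral>L. \<bar>\<tau> n * avg (s n) (psum (\<lambda>v. \<Phi> (sqrt (\<tau> n) *\<^sub>R v))) L - czeta * (\<integral>v. \<Phi> v \<partial>lborel)\<bar> \<partial>\<mu>) \<longlonglongrightarrow> 0"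
proof -
  define c where "c = czeta * (\<integral>v. \<Phi> v \<partial>lborel)"
  define J where "J n L = \<tau> n * avg (s n) (psum (\<lambda>v. \<Phi> (sqrt (\<tau> n) *\<^sub>R v))) L" for n L
  \<comment> \<open>The uniform bound holds once the scale is at least 1; the finitely many earlier
    terms are replaced by the limit itself.\<close>
  define J' where "J' n L = (if exp (s n) / sqrt (\<tau> n) \<ge> 1 then J n L else c)" for n L
  have Q1: "\<forall>\<^sub>F n in sequentially. exp (s n) / sqrt (\<tau> n) \<ge> 1" using Q by (simp add: filterlim_at_top)
  obtain C where C: "\<And>L \<tau> s. L \<in> unimodular_lattices \<Longrightarrow> \<tau> \<ge> 1 \<Longrightarrow> s \<ge> 0 \<Longrightarrow> exp s / sqrt \<tau> \<ge> 1 \<Longrightarrow>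
     \<bar>\<tau> * avg s (psum (\<lambda>v. \<Phi> (sqrt \<tau> *\<^sub>R v))) L\<bar> \<le> C" using avg_psum_bound[OF h] by blast
  have Jm: "J n \<in> borel_measurable \<mu>" for n
    unfolding J_def using borel_avg[OF ucont_psum[OF hsupp_scaled[OF h t[of n]]], of "s n"] by simp
  have "(\<lambda>n. \<integral>L. \<bar>J' n L - c\<bar> \<partial>\<mu>) \<longlonglongrightarrow> (\<integral>L. 0 \<partial>\<mu>)"
  proof (rule integral_dominated_convergence[where w="\<lambda>_. \<bar>C\<bar> + \<bar>c\<bar>"])
    show "(\<lambda>L. \<bar>J' n L - c\<bar>) \<in> borel_measurable \<mu>" for n
      using Jm[of n] unfolding J'_def by (cases "exp (s n) / sqrt (\<tau> n) \<ge> 1") auto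
    show "AE L in \<mu>. (\<lambda>n. \<bar>J' n L - c\<bar>) \<longlonglongrightarrow> 0"
    proof (rule AE_I2)
      fix L assume "L \<in> space \<mu>"
      then have L: "L \<in> unimodular_lattices" by (simp add: space_mu)
      have "(\<lambda>n. J n L) \<longlonglongrightarrow> c" unfolding J_def c_def by (rule avg_psum_tendsto[OF h L t s Q])
      moreover have "\<forall>\<^sub>F n in sequentially. J n L = J' n L" using Q1 by eventually_elim (simp add: J'_def)
      ultimately have "(\<lambda>n. J' n L) \<longlonglongrightarrow> c" by (rule Lim_transform_eventually)
      from tendsto_rabs[OF tendsto_diff[OF this tendsto_const[of c]]] show "(\<lambda>n. \<bar>J' n L - c\<bar>) \<longlonglongrightarrow> 0" by simp
    qed
    show "AE L in \<mu>. norm \<bar>J' n L - c\<bar> \<le> \<bar>C\<bar> + \<bar>c\<bar>" for n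
    proof (rule AE_I2)
      fix L assume "L \<in> space \<mu>"
      then have L: "L \<in> unimodular_lattices" by (simp add: space_mu)
      have "\<bar>J' n L\<bar> \<le> \<bar>C\<bar> \<or> J' n L = c"
        using C[OF L t s, of n n] by (auto simp: J'_def J_def)
      then show "norm \<bar>J' n L - c\<bar> \<le> \<bar>C\<bar> + \<bar>c\<bar>" by auto
    qed
  qed auto
  moreover have "\<forall>\<^sub>F n in sequentially. (\<integral>L. \<bar>J' n L - c\<bar> \<partial>\<mu>) = (\<integral>L. \<bar>J n L - c\<bar> \<partial>\<mu>)"
    using Q1 by eventually_elim (simp add: J'_def)
  ultimately have "(\<lambda>n. \<integral>L. \<bar>J n L - c\<bar> \<partial>\<mu>) \<longlonglongrightarrow> (\<integral>L. 0 \<partial>\<mu>)"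
    by (rule Lim_transform_eventually)
  then show ?thesis by (simp add: J_def c_def)
qed

text \<open>At \<open>\<tau> = 1\<close> all averages have the same expectation, which their limit in \<open>L\<^sup>1\<close> determines.\<close>

theorem siegel:
  assumes h: "hsupp R \<Phi>"
  shows "(\<integral>L. psum \<Phi> L \<partial>\<mu>) = czeta * (\<integral>v. \<Phi> v \<partial>lborel)"
proof -
  define c where "c = czeta * (\<integral>v. \<Phi> v \<partial>lborel)"
  have t1: "(1::real) \<ge> 1" by simp
  obtain B where B: "\<And>L. L \<in> unimodular_lattices \<Longrightarrow> \<bar>psum \<Phi> L\<bar> \<le> B"
    using hsupp_scaled_bound[OF h t1] by auto
  have u: "ucont (psum \<Phi>)" using ucont_psum[OF hsupp_scaled[OF h t1]] by simp
  have E: "(\<integral>L. avg (real n) (psum \<Phi>) L \<partial>\<mu>) = (\<integral>L. psum \<Phi> L \<partial>\<mu>)" for n by (rule integral_avg[OF u B])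
  have "\<bar>(\<integral>L. psum \<Phi> L \<partial>\<mu>) - c\<bar> \<le> (\<integral>L. \<bar>avg (real n) (psum \<Phi>) L - c\<bar> \<partial>\<mu>)" for n
  proof -
    have i: "integrable \<mu> (avg (real n) (psum \<Phi>))"
      by (rule integrable_bounded[OF borel_avg[OF u] abs_avg_le[OF u B]])
    have "(\<integral>L. psum \<Phi> L \<partial>\<mu>) - c = (\<integral>L. avg (real n) (psum \<Phi>) L - c \<partial>\<mu>)"
      using i by (subst Bochner_Integration.integral_diff) (auto simp: E prob_space)
    then show ?thesis by (simp add: integral_abs_bound)
  qed
  moreover have "(\<lambda>n. \<integral>L. \<bar>avg (real n) (psum \<Phi>) L - c\<bar> \<partial>\<mu>) \<longlonglongrightarrow> 0"
  proof -
    have "filterlim (\<lambda>n. exp (real n) / sqrt 1) at_top sequentially"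
      using filterlim_compose[OF exp_at_top filterlim_real_sequentially] by simp
    from equidistribution[OF h _ _ this] show ?thesis by (simp add: c_def)
  qed
  ultimately have "\<bar>(\<integral>L. psum \<Phi> L \<partial>\<mu>) - c\<bar> \<le> 0" by (intro LIMSEQ_le_const) auto
  then show ?thesis by (simp add: c_def)
qed

end

subsection \<open>Cut-off functions\<close>

definition clamp01 :: "real \<Rightarrow> real" where "clamp01 x = max 0 (min 1 x)"

definition cut :: "real \<Rightarrow> real \<times> real \<Rightarrow> real" where
  "cut R v = clamp01 (R * snd v - 1) * clamp01 (R + 1 - \<bar>fst v\<bar>) * clamp01 (R + 1 - snd v)"

lemma clamp01: "0 \<le> clamp01 x" "clamp01 x \<le> 1" "clamp01 x = 0 \<longleftrightarrow> x \<le> 0" "x \<ge> 1 \<Longrightarrow> clamp01 x = 1"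
  by (auto simp: clamp01_def)

lemma cut_range: "0 \<le> cut R v" "cut R v \<le> 1"
proof -
  show "0 \<le> cut R v" unfolding cut_def by (intro mult_nonneg_nonneg clamp01)
  have "clamp01 (R * snd v - 1) * clamp01 (R + 1 - \<bar>fst v\<bar>) \<le> 1 * 1" by (intro mult_mono clamp01) auto
  then have "cut R v \<le> (1 * 1) * 1" unfolding cut_def by (intro mult_mono clamp01) (auto intro: mult_nonneg_nonneg clamp01)
  then show "cut R v \<le> 1" by simp
qed

lemma continuous_cut: "continuous_on A (cut R)"
  unfolding cut_def clamp01_def by (intro continuous_intros)

lemma cut_tendsto: assumes "snd v > 0" shows "(\<lambda>n. cut (real (Suc n)) v) \<longlonglongrightarrow> 1"
proof (rule tendsto_eventually)
  obtain n0 where n0: "2 / snd v < real n0" using reals_Archimedean2 by blast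
  obtain n1 where n1: "\<bar>fst v\<bar> + \<bar>snd v\<bar> < real n1" using reals_Archimedean2 by blast
  have "cut (real (Suc n)) v = 1" if "n \<ge> max n0 n1" for n
  proof -
    have "2 / snd v < real (Suc n)" using n0 that by linarith
    then have "2 < real (Suc n) * snd v" using assms by (simp add: field_simps)
    moreover have "\<bar>fst v\<bar> + \<bar>snd v\<bar> < real (Suc n)" using n1 that by linarith
    ultimately show ?thesis unfolding cut_def using assms by (subst (1 2 3) clamp01(4)) auto
  qed
  then show "\<forall>\<^sub>F n in sequentially. cut (real (Suc n)) v = 1" unfolding eventually_sequentially by blast
qed

text \<open>The product vanishes where \<open>R * snd v < 1\<close>. This open set and the open
  upper half plane cover the plane, so continuity up to the boundary is not asked of
  \<open>k\<close>.\<close>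

lemma hsupp_cut:
  assumes k: "continuous_on {v. 0 < snd v} k" and n: "R \<ge> 1"
  shows "hsupp (R + 1) (\<lambda>v. k v * cut R v)"
proof -
  have nz: "1 < R * snd v \<and> \<bar>fst v\<bar> < R + 1 \<and> snd v < R + 1" if "cut R v \<noteq> 0" for v
    using that clamp01(3)[of "R * snd v - 1"] clamp01(3)[of "R + 1 - \<bar>fst v\<bar>"] clamp01(3)[of "R + 1 - snd v"]
    unfolding cut_def by fastforce
  have "continuous_on ({v. 0 < snd v} \<union> {v. R * snd v < 1}) (\<lambda>v. k v * cut R v)"
  proof (rule continuous_on_open_Un)
    show "continuous_on {v. 0 < snd v} (\<lambda>v. k v * cut R v)" by (intro continuous_intros k continuous_cut)
    have "k v * cut R v = 0" if "v \<in> {v. R * snd v < 1}" for v using nz[of v] that by auto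
    then show "continuous_on {v. R * snd v < 1} (\<lambda>v. k v * cut R v)"
      by (intro continuous_on_eq[OF continuous_on_const[of _ 0]]) simp
  qed (auto intro!: open_Collect_less continuous_intros)
  moreover have "{v. 0 < snd v} \<union> {v. R * snd v < 1} = (UNIV :: (real \<times> real) set)"
  proof -
    have "R * snd v < 1" if "\<not> 0 < snd v" for v :: "real \<times> real"
      using mult_nonneg_nonpos[of R "snd v"] that n by linarith
    then show ?thesis by auto
  qed
  moreover have "\<bar>fst v\<bar> \<le> R + 1 \<and> 1 / (R + 1) \<le> snd v \<and> snd v \<le> R + 1" if "k v * cut R v \<noteq> 0" for v
  proof -
    have *: "1 < R * snd v" "\<bar>fst v\<bar> < R + 1" "snd v < R + 1" using nz[of v] that by auto
    have "0 < snd v" using * n zero_less_mult_pos[of R "snd v"] by linarith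
    then have "1 \<le> (R + 1) * snd v" using * by (simp add: algebra_simps)
    then show ?thesis using * n by (simp add: field_simps)
  qed
  ultimately show ?thesis unfolding hsupp_def using n by auto
qed

text \<open>The regularity that \<open>Psi b\<close> has: in general it jumps across the horizontal
  axis, and its support need not be compact, so the counting reaches it only through
  cut-offs.\<close>

definition half_cont :: "(real \<times> real \<Rightarrow> real) \<Rightarrow> bool" where
  "half_cont k \<longleftrightarrow> continuous_on {v. 0 < snd v} k \<and> (\<forall>v. snd v \<le> 0 \<longrightarrow> k v = 0)"

lemma half_cont_borel: "half_cont k \<Longrightarrow> k \<in> borel_measurable borel"
proof -
  assume k: "half_cont k"
  have "(\<lambda>v. if v \<in> {v. 0 < snd v} then k v else 0) \<in> borel_measurable borel"
    using k unfolding half_cont_def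
    by (intro borel_measurable_continuous_on_if) (auto intro!: borel_open open_Collect_less continuous_intros)
  also have "(\<lambda>v. if v \<in> {v. 0 < snd v} then k v else 0) = k"
    using k by (auto simp: half_cont_def fun_eq_iff)
  finally show ?thesis .
qed

lemma half_cont_cut_tendsto:
  assumes "half_cont k" shows "(\<lambda>n. k v * cut (real (Suc n)) v) \<longlonglongrightarrow> k v"
proof (cases "0 < snd v")
  case True
  from tendsto_mult[OF tendsto_const cut_tendsto[OF this]] show ?thesis by simp
next
  case False
  then have "k v = 0" using assms unfolding half_cont_def by (metis not_less)
  then show ?thesis by simp
qed

lemma cut_L1:
  assumes k: "half_cont k" and i: "integrable lborel k"
  shows "(\<lambda>n. \<integral>v. \<bar>k v - k v * cut (real (Suc n)) v\<bar> \<partial>lborel) \<longlonglongrightarrow> 0"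
proof -
  have [measurable]: "k \<in> borel_measurable borel" by (rule half_cont_borel[OF k])
  have [measurable]: "cut R \<in> borel_measurable borel" for R by (intro borel_measurable_continuous_onI continuous_cut)
  have "(\<lambda>n. \<integral>v. \<bar>k v - k v * cut (real (Suc n)) v\<bar> \<partial>lborel) \<longlonglongrightarrow> (\<integral>v. 0 \<partial>(lborel :: (real \<times> real) measure))"
  proof (rule integral_dominated_convergence[where w="\<lambda>v. \<bar>k v\<bar>"])
    show "integrable lborel (\<lambda>v. \<bar>k v\<bar>)" using i by simp
    show "AE v in lborel. (\<lambda>n. \<bar>k v - k v * cut (real (Suc n)) v\<bar>) \<longlonglongrightarrow> 0"
    proof (rule AE_I2)
      fix v from tendsto_rabs[OF tendsto_diff[OF tendsto_const[of "k v"] half_cont_cut_tendsto[OF k, of v]]]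
      show "(\<lambda>n. \<bar>k v - k v * cut (real (Suc n)) v\<bar>) \<longlonglongrightarrow> 0" by simp
    qed
    show "AE v in lborel. norm \<bar>k v - k v * cut (real (Suc n)) v\<bar> \<le> \<bar>k v\<bar>" for n
    proof (rule AE_I2)
      fix v
      have "\<bar>k v - k v * cut (real (Suc n)) v\<bar> = \<bar>k v\<bar> * (1 - cut (real (Suc n)) v)"
      proof -
        have "k v - k v * cut (real (Suc n)) v = k v * (1 - cut (real (Suc n)) v)" by (simp add: algebra_simps)
        then show ?thesis using cut_range[of "real (Suc n)" v] by (simp add: abs_mult)
      qed
      also have "\<dots> \<le> \<bar>k v\<bar> * 1" using cut_range[of "real (Suc n)" v] by (intro mult_left_mono) auto
      finally show "norm \<bar>k v - k v * cut (real (Suc n)) v\<bar> \<le> \<bar>k v\<bar>" by simp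
    qed
  qed measurable
  then show ?thesis by simp
qed

context haar
begin

text \<open>Fatou's lemma along cut-offs, for each of which \<open>siegel\<close> is exact. An upper
  bound is all that error terms require, and bounded support lets the cut-off sums converge at each
  lattice.\<close>

lemma siegel_le:
  assumes k: "half_cont k" and k0: "\<And>v. 0 \<le> k v" and b: "bsupp r k"
  shows "psum k \<in> borel_measurable \<mu>" "(\<integral>\<^sup>+L. psum k L \<partial>\<mu>) \<le> czeta * (\<integral>\<^sup>+v. k v \<partial>lborel)"
proof -
  define kn where "kn n v = k v * cut (real (Suc n)) v" for n v
  have h: "hsupp (real (Suc n) + 1) (kn n)" for n
    unfolding kn_def using k by (intro hsupp_cut) (auto simp: half_cont_def)
  have kb: "bsupp r (kn n)" for n using b by (auto simp: bsupp_def kn_def simp del: split_paired_All)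
  have km: "psum (kn n) \<in> borel_measurable \<mu>" for n
    using h[of n] by (intro measurable_psum[OF _ kb]) (auto simp: hsupp_def)
  have kn0: "0 \<le> kn n v" "kn n v \<le> k v" for n v
    using cut_range[of "real (Suc n)" v] k0[of v] by (auto simp: kn_def mult_left_le)
  have lim: "(\<lambda>n. psum (kn n) L) \<longlonglongrightarrow> psum k L" if "L \<in> space \<mu>" for L
  proof -
    have L: "L \<in> unimodular_lattices" using that by (simp add: space_mu)
    show ?thesis unfolding psum_ball[OF L b] psum_ball[OF L kb] kn_def
      by (intro tendsto_sum half_cont_cut_tendsto k)
  qed
  show 1: "psum k \<in> borel_measurable \<mu>" by (rule borel_measurable_LIMSEQ_real[OF lim km])
  have [measurable]: "k \<in> borel_measurable borel" "kn n \<in> borel_measurable borel" for n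
    using half_cont_borel[OF k] hsupp_borel[OF h] by auto
  have psum0: "0 \<le> psum (kn n) L" for n L unfolding psum_def using kn0 by (intro sum_nonneg) auto
  have step: "(\<integral>\<^sup>+L. psum (kn n) L \<partial>\<mu>) \<le> czeta * (\<integral>\<^sup>+v. k v \<partial>lborel)" for n
  proof -
    obtain B where B: "\<And>L. L \<in> unimodular_lattices \<Longrightarrow> \<bar>psum (kn n) L\<bar> \<le> B"
      using hsupp_scaled_bound[OF h[of n], of 1] by auto
    have "(\<integral>\<^sup>+L. psum (kn n) L \<partial>\<mu>) = ennreal (\<integral>L. psum (kn n) L \<partial>\<mu>)"
      by (intro nn_integral_eq_integral integrable_bounded[OF km B]) (auto simp: psum0)
    also have "\<dots> = ennreal (czeta * (\<integral>v. kn n v \<partial>lborel))" by (simp add: siegel[OF h])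
    also have "\<dots> = ennreal czeta * ennreal (\<integral>v. kn n v \<partial>lborel)" using czeta_pos by (intro ennreal_mult') auto
    also have "ennreal (\<integral>v. kn n v \<partial>lborel) = (\<integral>\<^sup>+v. kn n v \<partial>lborel)"
      using kn0 by (intro nn_integral_eq_integral[symmetric] h_integrable[OF h]) auto
    also have "\<dots> \<le> (\<integral>\<^sup>+v. k v \<partial>lborel)" using kn0 by (intro nn_integral_mono ennreal_leI) auto
    finally show ?thesis by (simp add: mult_left_mono)
  qed
  have "(\<integral>\<^sup>+L. psum k L \<partial>\<mu>) = (\<integral>\<^sup>+L. liminf (\<lambda>n. ennreal (psum (kn n) L)) \<partial>\<mu>)"
  proof (intro nn_integral_cong)
    fix L assume "L \<in> space \<mu>"
    from tendsto_ennrealI[OF lim[OF this]] show "ennreal (psum k L) = liminf (\<lambda>n. ennreal (psum (kn n) L))"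
      by (simp add: lim_imp_Liminf)
  qed
  also have "\<dots> \<le> liminf (\<lambda>n. \<integral>\<^sup>+L. psum (kn n) L \<partial>\<mu>)"
    using km by (intro nn_integral_liminf) auto
  also have "\<dots> \<le> czeta * (\<integral>\<^sup>+v. k v \<partial>lborel)"
    by (intro Liminf_le always_eventually allI step) simp
  finally show "(\<integral>\<^sup>+L. psum k L \<partial>\<mu>) \<le> czeta * (\<integral>\<^sup>+v. k v \<partial>lborel)" .
qed

end

section \<open>Multiplicative functionals of the geodesic flow\<close>

definition Xc :: "(real^2) set \<Rightarrow> real" where "Xc L = 1 / (lattice_norm L)\<^sup>2"

lemma Xc_nonneg: "0 \<le> Xc L" by (simp add: Xc_def)

text \<open>What is retained of the characteristic function of \<open>\<theta> 0\<close>: the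
  quadratic bound makes factors with small argument negligible, the Lipschitz bound controls small
  moves of the lattice. The class is stable under \<open>s \<mapsto> \<phi> (u * s)\<close> and
  under squaring, so the limit theorem can be reused for these functions.\<close>

locale test_fun =
  fixes \<phi> :: "real \<Rightarrow> real" and K :: real
  assumes phi_le: "\<And>s. \<bar>\<phi> s\<bar> \<le> 1"
    and phi_sq: "\<And>s. 1 - \<phi> s \<le> K * s\<^sup>2"
    and phi_lip: "\<And>s t. \<bar>\<phi> s - \<phi> t\<bar> \<le> K * \<bar>s - t\<bar>"
    and K1: "K \<ge> 1"
begin

lemma phi_le1: "\<phi> s \<le> 1" using phi_le[of s] by linarith

lemma continuous_phi: "continuous_on UNIV \<phi>"
proof (rule continuous_onI)
  fix x e :: real assume "e > 0"
  then show "\<exists>d>0. \<forall>x'\<in>UNIV. dist x' x < d \<longrightarrow> dist (\<phi> x') (\<phi> x) \<le> e"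
  proof (intro exI[of _ "e / K"] conjI ballI impI)
    fix y assume "dist y x < e / K"
    then have "K * \<bar>y - x\<bar> \<le> e" using K1 by (simp add: dist_real_def field_simps)
    then show "dist (\<phi> y) (\<phi> x) \<le> e" using phi_lip[of y x] by (simp add: dist_real_def)
  qed (use K1 in auto)
qed

lemma prod_phi_le: "\<bar>\<Prod>i\<in>I. \<phi> (h i)\<bar> \<le> 1"
  unfolding abs_prod using phi_le by (intro prod_le_1) auto

lemma prod_phi_diff: "\<bar>(\<Prod>i\<in>I. \<phi> (h i)) - (\<Prod>i\<in>I. \<phi> (h' i))\<bar> \<le> (\<Sum>i\<in>I. \<bar>\<phi> (h i) - \<phi> (h' i)\<bar>)"
  using norm_prod_diff[of I "\<lambda>i. \<phi> (h i)" "\<lambda>i. \<phi> (h' i)"] phi_le by simp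

text \<open>The product looks back from time 0, so that lengthening the window does not move the
  reference lattice; stationarity relates it to the forward product.\<close>

definition past :: "real \<Rightarrow> nat \<Rightarrow> (real^2) set \<Rightarrow> real" where
  "past T b L = (\<Prod>i\<in>{1..b}. \<phi> (Xc (act (\<delta> (- real i)) L) / T))"

text \<open>The integral of this function is the decrease of the mean when one factor is added to a
  window of length \<open>b\<close>, see \<open>past_mean_Suc\<close>.\<close>

definition onset :: "real \<Rightarrow> nat \<Rightarrow> (real^2) set \<Rightarrow> real" where
  "onset T b L = past T b L * (1 - \<phi> (Xc L / T))"

text \<open>The contribution of an excursion caused by \<open>\<plusminus>w\<close>; the representative with \<open>snd w > 0\<close> is chosen.\<close>

definition Psi :: "nat \<Rightarrow> real \<times> real \<Rightarrow> real" where
  "Psi b w = (if snd w \<le> 0 then 0 else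
     (\<Prod>i\<in>{1..b}. \<phi> (1 / (norm (lact (\<delta> (- real i)) w))\<^sup>2)) * (1 - \<phi> (1 / (norm w)\<^sup>2)))"

lemma past_le: "\<bar>past T b L\<bar> \<le> 1" unfolding past_def by (rule prod_phi_le)

text \<open>The majorant \<open>onset T 0\<close> does not depend on the window, and its mean has
  the right order 1/T; all error terms are measured by it.\<close>

lemma onset_le: "\<bar>onset T b L\<bar> \<le> onset T 0 L" "0 \<le> onset T 0 L" "onset T 0 L \<le> 2"
proof -
  show 0: "0 \<le> onset T 0 L" using phi_le1 by (simp add: onset_def past_def)
  have "\<bar>onset T b L\<bar> = \<bar>past T b L\<bar> * onset T 0 L" using phi_le1 by (simp add: onset_def past_def abs_mult)
  also have "\<dots> \<le> 1 * onset T 0 L" by (intro mult_right_mono past_le 0)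
  finally show "\<bar>onset T b L\<bar> \<le> onset T 0 L" by simp
  show "onset T 0 L \<le> 2" using phi_le[of "Xc L / T"] by (simp add: onset_def past_def)
qed

text \<open>
  Two independent primitive vectors have \<open>\<bar>wedge v w\<bar> \<ge> 1\<close>, so at most one pair \<open>\<plusminus>v\<close> has norm below 1;
  it is also shortest in \<open>\<delta>\<^sub>-\<^sub>i L\<close> unless it became longer than 1 there, and then both factors are close to 1.
\<close>

lemma onset_approx:
  assumes L: "L \<in> unimodular_lattices" and hor: "\<forall>v\<in>prims L. snd v \<noteq> 0" and T: "T \<ge> 1"
  shows "\<bar>onset T b L - psum (\<lambda>v. if norm v < 1 then Psi b (sqrt T *\<^sub>R v) else 0) L\<bar>
    \<le> K / T\<^sup>2 + 2 * K\<^sup>2 * real b * exp (4 * real b) / T ^ 4"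
    (is "\<bar>_ - psum ?\<psi> L\<bar> \<le> _")
proof (cases "lattice_norm L \<ge> 1")
  \<comment> \<open>Without a vector of norm below 1 the sum is empty, and
    \<open>Xc L \<le> 1\<close> turns the quadratic bound into \<open>K / T\<^sup>2\<close>.\<close>
  case True
  have "psum ?\<psi> L = sum ?\<psi> {}"
    using lattice_norm_prims(2)[OF L] True by (intro psum_eq) (auto split: if_splits intro: order_trans simp del: split_paired_All, fastforce)
  moreover have "\<bar>onset T b L\<bar> \<le> K / T\<^sup>2"
  proof -
    have X: "0 \<le> Xc L" "Xc L \<le> 1" using True by (auto simp: Xc_def)
    have "\<bar>onset T b L\<bar> \<le> 1 - \<phi> (Xc L / T)" using onset_le(1)[of T b L] by (simp add: onset_def past_def)
    also have "\<dots> \<le> K * (Xc L / T)\<^sup>2" by (rule phi_sq)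
    also have "\<dots> \<le> K * (1 / T)\<^sup>2" using X T K1 by (intro mult_left_mono power_mono divide_right_mono) auto
    finally show ?thesis by (simp add: power_divide)
  qed
  moreover have "0 \<le> 2 * K\<^sup>2 * real b * exp (4 * real b) / T ^ 4" using T by auto
  ultimately show ?thesis by (simp only: sum.empty diff_zero)
next
  case False
  obtain v0 where v0: "v0 \<in> prims L" "norm v0 = lattice_norm L" using lattice_norm_prims(1)[OF L] by blast
  define v where "v = (if snd v0 > 0 then v0 else - v0)"
  have v: "v \<in> prims L" "norm v = lattice_norm L" "snd v > 0"
    using v0 prims_minus[OF L v0(1)] hor[rule_format, OF v0(1)] by (auto simp: v_def)
  have nv: "0 < norm v" "norm v < 1" using v(2) False lattice_norm_pos[OF L] by auto
  have "psum ?\<psi> L = sum ?\<psi> {v}"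
  proof (rule psum_eq)
    fix w assume w: "w \<in> prims L" "?\<psi> w \<noteq> 0"
    then have nw: "norm w < 1" by (auto split: if_splits)
    have "snd (sqrt T *\<^sub>R w) > 0" using w by (auto simp: Psi_def split: if_splits)
    then have sw: "snd w > 0" using T by (simp add: zero_less_mult_iff)
    show "w \<in> {v}"
    proof (rule ccontr)
      assume "w \<notin> {v}"
      then have "1 \<le> norm w * norm v" using sw v w by (intro prims_norm_mult[OF L]) auto
      moreover have "norm w * norm v \<le> 1 * norm v" using nw by (intro mult_right_mono) auto
      ultimately show False using nv by simp
    qed
  qed (use v in auto)
  also have "sum ?\<psi> {v} = Psi b (sqrt T *\<^sub>R v)" using nv by simp
  finally have ps: "psum ?\<psi> L = Psi b (sqrt T *\<^sub>R v)" .
  define n where "n i = norm (lact (\<delta> (- real i)) v)" for i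
  have X: "Xc L = 1 / (norm v)\<^sup>2" by (simp add: Xc_def v(2))
  have sc: "1 / (norm (sqrt T *\<^sub>R w))\<^sup>2 = 1 / (norm w)\<^sup>2 / T" for w :: "real \<times> real"
    using T by (simp add: power_mult_distrib)
  have P: "Psi b (sqrt T *\<^sub>R v) = (\<Prod>i\<in>{1..b}. \<phi> (1 / (n i)\<^sup>2 / T)) * (1 - \<phi> (Xc L / T))"
    using v(3) T unfolding Psi_def lact_scaleR sc X n_def by (simp add: mult_le_0_iff)
  \<comment> \<open>If another vector w is shorter in \<open>L'\<close>, then
    \<open>1 \<le> norm w * norm v'\<close> bounds both arguments by
    \<open>(norm v')\<^sup>2 / T\<close>, and \<open>v'\<close> is at most \<open>exp i\<close>
    times as long as \<open>v\<close>.\<close>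
  have each: "\<bar>\<phi> (Xc (act (\<delta> (- real i)) L) / T) - \<phi> (1 / (n i)\<^sup>2 / T)\<bar> \<le> 2 * K * exp (4 * real i) * norm v ^ 4 / T\<^sup>2" for i
  proof -
    define L' where "L' = act (\<delta> (- real i)) L"
    have L': "L' \<in> unimodular_lattices" unfolding L'_def by (rule act_in_lattices[OF delta_in L])
    define v' where "v' = lact (\<delta> (- real i)) v"
    have v': "v' \<in> prims L'" unfolding v'_def L'_def prims_act[OF delta_in L] using v by blast
    have nn: "n i = norm v'" by (simp add: n_def v'_def)
    have ne: "norm v' \<le> exp (real i) * norm v" unfolding v'_def using norm_delta_le[of "- real i" v] by simp
    show ?thesis
    proof (cases "lattice_norm L' = norm v'")
      case True
      then have "Xc L' = 1 / (n i)\<^sup>2" by (simp add: Xc_def nn)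
      moreover have "0 \<le> 2 * K * exp (4 * real i) * norm v ^ 4 / T\<^sup>2" using K1 by auto
      ultimately show ?thesis by (simp add: L'_def)
    next
      case False
      then have lt: "lattice_norm L' < norm v'" using lattice_norm_prims(2)[OF L' v'] by simp
      obtain w where w: "w \<in> prims L'" "norm w = lattice_norm L'" using lattice_norm_prims(1)[OF L'] by blast
      have "1 \<le> norm w * norm v'" using w False by (intro prims_norm_mult[OF L' w(1) v']) auto
      then have m: "1 \<le> lattice_norm L' * norm v'" by (simp add: w)
      have pos: "0 < lattice_norm L'" by (rule lattice_norm_pos[OF L'])
      have "1 \<le> norm v'"
      proof (rule ccontr)
        assume "\<not> 1 \<le> norm v'"
        then have "lattice_norm L' * norm v' < 1 * 1" using lt pos by (intro mult_strict_mono) auto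
        then show False using m by simp
      qed
      then have n1: "1 \<le> (norm v')\<^sup>2" by simp
      have "1\<^sup>2 \<le> (lattice_norm L' * norm v')\<^sup>2" using m by (intro power_mono) auto
      then have a: "Xc L' \<le> (norm v')\<^sup>2" using pos by (simp add: Xc_def field_simps power_mult_distrib)
      have "1 / (norm v')\<^sup>2 \<le> 1" using n1 by (simp add: divide_le_eq)
      then have b: "1 / (norm v')\<^sup>2 \<le> (norm v')\<^sup>2" using n1 by linarith
      have B: "1 - \<phi> (x / T) \<le> K * exp (4 * real i) * norm v ^ 4 / T\<^sup>2" if x: "0 \<le> x" "x \<le> (norm v')\<^sup>2" for x
      proof -
        have "1 - \<phi> (x / T) \<le> K * (x / T)\<^sup>2" by (rule phi_sq)
        also have "\<dots> \<le> K * ((exp (real i) * norm v)\<^sup>2 / T)\<^sup>2"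
        proof -
          have "x \<le> (exp (real i) * norm v)\<^sup>2" using x(2) power_mono[OF ne, of 2] by (metis norm_ge_zero order_trans)
          then show ?thesis using x T K1 by (intro mult_left_mono power_mono divide_right_mono) auto
        qed
        also have "((exp (real i) * norm v)\<^sup>2 / T)\<^sup>2 = exp (4 * real i) * norm v ^ 4 / T\<^sup>2"
          by (simp add: power_mult_distrib power_divide flip: power_mult exp_of_nat_mult)
        finally show ?thesis by simp
      qed
      have "\<bar>\<phi> x - \<phi> y\<bar> \<le> (1 - \<phi> x) + (1 - \<phi> y)" for x y using phi_le1[of x] phi_le1[of y] by linarith
      then have "\<bar>\<phi> (Xc L' / T) - \<phi> (1 / (n i)\<^sup>2 / T)\<bar> \<le> (1 - \<phi> (Xc L' / T)) + (1 - \<phi> (1 / (n i)\<^sup>2 / T))" .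
      also have "\<dots> \<le> K * exp (4 * real i) * norm v ^ 4 / T\<^sup>2 + K * exp (4 * real i) * norm v ^ 4 / T\<^sup>2"
        unfolding nn by (intro add_mono B a b Xc_nonneg) auto
      finally show ?thesis unfolding L'_def by (simp add: algebra_simps)
    qed
  qed
  have phiX: "0 \<le> 1 - \<phi> (Xc L / T)" "1 - \<phi> (Xc L / T) \<le> K * (1 / (norm v ^ 4 * T\<^sup>2))"
  proof -
    show "0 \<le> 1 - \<phi> (Xc L / T)" using phi_le1 by simp
    have "(Xc L / T)\<^sup>2 = 1 / (norm v ^ 4 * T\<^sup>2)" by (simp add: X power_divide power_mult_distrib flip: power_mult)
    then show "1 - \<phi> (Xc L / T) \<le> K * (1 / (norm v ^ 4 * T\<^sup>2))" using phi_sq[of "Xc L / T"] by simp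
  qed
  have "\<bar>onset T b L - psum ?\<psi> L\<bar> = \<bar>past T b L - (\<Prod>i\<in>{1..b}. \<phi> (1 / (n i)\<^sup>2 / T))\<bar> * (1 - \<phi> (Xc L / T))"
    unfolding ps P onset_def using phiX(1) by (simp flip: left_diff_distrib add: abs_mult)
  \<comment> \<open>The factor \<open>norm v ^ 4\<close> from each exchanged term cancels against
    the bound on \<open>1 - \<phi> (Xc L / T)\<close>, so the estimate does not depend on how short
    \<open>v\<close> is.\<close>
  also have "\<dots> \<le> (\<Sum>i\<in>{1..b}. 2 * K * exp (4 * real i) * norm v ^ 4 / T\<^sup>2) * (K * (1 / (norm v ^ 4 * T\<^sup>2)))"
  proof (intro mult_mono phiX)
    have "\<bar>past T b L - (\<Prod>i\<in>{1..b}. \<phi> (1 / (n i)\<^sup>2 / T))\<bar> \<le> (\<Sum>i\<in>{1..b}. \<bar>\<phi> (Xc (act (\<delta> (- real i)) L) / T) - \<phi> (1 / (n i)\<^sup>2 / T)\<bar>)"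
      unfolding past_def by (rule prod_phi_diff)
    also have "\<dots> \<le> (\<Sum>i\<in>{1..b}. 2 * K * exp (4 * real i) * norm v ^ 4 / T\<^sup>2)" by (intro sum_mono each)
    finally show "\<bar>past T b L - (\<Prod>i\<in>{1..b}. \<phi> (1 / (n i)\<^sup>2 / T))\<bar> \<le> (\<Sum>i\<in>{1..b}. 2 * K * exp (4 * real i) * norm v ^ 4 / T\<^sup>2)" .
    show "0 \<le> (\<Sum>i\<in>{1..b}. 2 * K * exp (4 * real i) * norm v ^ 4 / T\<^sup>2)" using K1 by (intro sum_nonneg) auto
  qed
  also have "\<dots> \<le> (\<Sum>i\<in>{1..b}. 2 * K * exp (4 * real b) * norm v ^ 4 / T\<^sup>2) * (K * (1 / (norm v ^ 4 * T\<^sup>2)))"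
    using K1 nv T by (intro mult_right_mono sum_mono divide_right_mono mult_left_mono) auto
  also have "\<dots> = 2 * K\<^sup>2 * real b * exp (4 * real b) / T ^ 4"
    using nv T by (simp add: field_simps power2_eq_square power4_eq_xxxx)
  finally have "\<bar>onset T b L - psum ?\<psi> L\<bar> \<le> 2 * K\<^sup>2 * real b * exp (4 * real b) / T ^ 4" .
  moreover have "0 \<le> K / T\<^sup>2" using K1 by simp
  ultimately show ?thesis by linarith
qed

lemma half_cont_Psi: "half_cont (Psi b)"
proof -
  have "continuous_on {v. 0 < snd v} (\<lambda>w. (\<Prod>i\<in>{1..b}. \<phi> (1 / (norm (lact (\<delta> (- real i)) w))\<^sup>2)) * (1 - \<phi> (1 / (norm w)\<^sup>2)))"
  proof -
    have 1: "continuous_on {v. 0 < snd v} (\<lambda>w. 1 / (norm (lact (\<delta> s) w))\<^sup>2)" for s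
      unfolding lact_delta by (intro continuous_intros) (auto simp: zero_prod_def)
    have 2: "continuous_on {v. 0 < snd v} (\<lambda>w::real \<times> real. 1 / (norm w)\<^sup>2)"
      by (intro continuous_intros) (auto simp: zero_prod_def)
    show ?thesis
      by (intro continuous_on_mult continuous_on_prod continuous_on_diff continuous_on_const
          continuous_on_UNIV_comp[OF continuous_phi 1] continuous_on_UNIV_comp[OF continuous_phi 2])
  qed
  then have "continuous_on {v. 0 < snd v} (Psi b)"
    by (rule continuous_on_eq) (auto simp: Psi_def)
  then show ?thesis by (simp add: half_cont_def Psi_def)
qed

text \<open>An integrable majorant independent of b. Up to a constant,
  \<open>1 / (1 + (norm w)\<^sup>2)\<^sup>2\<close> bounds the last factor of \<open>Psi\<close>;
  the product form reduces integrability to one variable.\<close>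

definition dom :: "real \<times> real \<Rightarrow> real" where
  "dom w = 8 * K * (inverse (1 + (fst w)\<^sup>2) * inverse (1 + (snd w)\<^sup>2))"

lemma Psi_le: "\<bar>Psi b w\<bar> \<le> dom w"
proof (cases "snd w \<le> 0")
  case True then show ?thesis using K1 by (simp add: Psi_def dom_def)
next
  case False
  define r where "r = (norm w)\<^sup>2"
  have r: "r = (fst w)\<^sup>2 + (snd w)\<^sup>2" by (cases w) (simp add: r_def norm_Pair)
  have r0: "r > 0" using False by (simp add: r add_nonneg_pos)
  have "\<bar>Psi b w\<bar> = \<bar>\<Prod>i\<in>{1..b}. \<phi> (1 / (norm (lact (\<delta> (- real i)) w))\<^sup>2)\<bar> * (1 - \<phi> (1 / r))"
    using False phi_le1[of "1 / r"] by (simp add: Psi_def r_def abs_mult)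
  also have "\<dots> \<le> 1 * (1 - \<phi> (1 / r))"
    using phi_le1[of "1 / r"] by (intro mult_right_mono prod_phi_le) auto
  \<comment> \<open>Near the origin the trivial bound 2 is used, and
    \<open>2 * 2\<^sup>2 = 8\<close>; farther out the quadratic bound gives
    \<open>K / r\<^sup>2\<close>.\<close>
  also have "\<dots> \<le> 8 * K / (1 + r)\<^sup>2"
  proof (cases "r \<le> 1")
    case True
    have "(1 + r)\<^sup>2 \<le> 2\<^sup>2" using True r0 by (intro power_mono) auto
    then have "2 * (1 + r)\<^sup>2 \<le> 8 * K" using K1 by (simp add: power2_eq_square)
    then have "2 \<le> 8 * K / (1 + r)\<^sup>2" using r0 by (simp add: field_simps)
    moreover have "1 * (1 - \<phi> (1 / r)) \<le> 2" using phi_le[of "1 / r"] by (simp add: abs_le_iff)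
    ultimately show ?thesis by (rule order_trans[rotated])
  next
    case F: False
    have "1 - \<phi> (1 / r) \<le> K * (1 / r)\<^sup>2" by (rule phi_sq)
    also have "\<dots> \<le> 8 * K / (1 + r)\<^sup>2"
    proof -
      have "(1 + r)\<^sup>2 \<le> (2 * r)\<^sup>2" using F by (intro power_mono) auto
      then have "(1 + r)\<^sup>2 \<le> 4 * r\<^sup>2" by (simp add: power_mult_distrib)
      moreover have "0 \<le> r\<^sup>2" by simp
      ultimately have "(1 + r)\<^sup>2 \<le> 8 * r\<^sup>2" by linarith
      then have "K * (1 + r)\<^sup>2 \<le> K * (8 * r\<^sup>2)" using K1 by (intro mult_left_mono) auto
      moreover have "(1 + r)\<^sup>2 > 0" using r0 by simp
      ultimately show ?thesis using r0 by (simp add: field_simps)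
    qed
    finally show ?thesis by simp
  qed
  also have "\<dots> \<le> dom w"
  proof -
    have "(1 + (fst w)\<^sup>2) * (1 + (snd w)\<^sup>2) \<le> (1 + r) * (1 + r)" by (intro mult_mono) (auto simp: r)
    then have "8 * K / ((1 + r) * (1 + r)) \<le> 8 * K / ((1 + (fst w)\<^sup>2) * (1 + (snd w)\<^sup>2))"
      using K1 r0 by (intro divide_left_mono) (auto intro!: mult_pos_pos add_pos_nonneg)
    then show ?thesis by (simp add: dom_def power2_eq_square divide_inverse)
  qed
  finally show ?thesis by simp
qed

lemma integrable_dom: "integrable lborel dom"
proof -
  define c where "c x = inverse (1 + x\<^sup>2)" for x :: real
  have [measurable]: "c \<in> borel_measurable borel" unfolding c_def by measurable
  have c0: "0 \<le> c x" for x by (simp add: c_def)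
  have "integrable lborel c"
    using integrable_inverse_1_plus_square by (simp add: set_integrable_def c_def[abs_def])
  then have fin: "(\<integral>\<^sup>+x. c x \<partial>lborel) < \<infinity>" using c0 by (simp add: integrable_iff_bounded)
  have "(\<integral>\<^sup>+w. ennreal (c (fst w) * c (snd w)) \<partial>lborel) = (\<integral>\<^sup>+x. \<integral>\<^sup>+y. ennreal (c x) * ennreal (c y) \<partial>lborel \<partial>lborel)"
    by (subst nn_integral_lborel_pair(1)) (auto simp: ennreal_mult c0)
  also have "\<dots> = (\<integral>\<^sup>+x. c x \<partial>lborel) * (\<integral>\<^sup>+x. c x \<partial>lborel)"
    by (simp add: nn_integral_cmult nn_integral_multc)
  also have "\<dots> < \<infinity>" using fin by (simp add: ennreal_mult_less_top)
  finally have "integrable lborel (\<lambda>w. c (fst w) * c (snd w))"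
    using c0 by (simp add: integrable_iff_bounded abs_mult)
  then show ?thesis unfolding dom_def c_def by (rule integrable_mult_right)
qed

lemma borel_Psi[measurable]: "Psi b \<in> borel_measurable borel"
  by (rule half_cont_borel[OF half_cont_Psi])

lemma integrable_Psi: "integrable lborel (Psi b)"
  by (rule Bochner_Integration.integrable_bound[OF integrable_dom])
    (use Psi_le in \<open>auto intro!: AE_I2 intro: order_trans[OF _ abs_ge_self] simp del: split_paired_All\<close>)

text \<open>Going back i steps multiplies the height by \<open>exp i\<close>, so the i-th factor
  differs from 1 by at most \<open>K / (exp i * snd w) ^ 4\<close>. The product over the whole past
  therefore converges on the upper half plane.\<close>

lemma Psi_tail:
  assumes w: "snd w > 0" and b: "b \<le> b'"
  shows "\<bar>Psi b' w - Psi b w\<bar> \<le> (\<Sum>i\<in>{b<..b'}. 2 * K / (snd w) ^ 4 * exp (- 4 * real i))"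
proof -
  define a where "a i = \<phi> (1 / (norm (lact (\<delta> (- real i)) w))\<^sup>2)" for i
  define c where "c = 1 - \<phi> (1 / (norm w)\<^sup>2)"
  have c: "0 \<le> c" "c \<le> 2" using phi_le[of "1 / (norm w)\<^sup>2"] by (auto simp: c_def)
  have a1: "\<bar>a i\<bar> \<le> 1" for i unfolding a_def by (rule phi_le)
  have "Psi b' w - Psi b w = (\<Prod>i\<in>{1..b}. a i) * ((\<Prod>i\<in>{b<..b'}. a i) - (\<Prod>i\<in>{b<..b'}. 1)) * c"
  proof -
    have "{1..b'} = {1..b} \<union> {b<..b'}" using b by auto
    then have "(\<Prod>i\<in>{1..b'}. a i) = (\<Prod>i\<in>{1..b}. a i) * (\<Prod>i\<in>{b<..b'}. a i)"
      by (simp only:) (subst prod.union_disjoint, auto)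
    then show ?thesis using w by (simp add: Psi_def a_def c_def algebra_simps)
  qed
  then have "\<bar>Psi b' w - Psi b w\<bar> = \<bar>\<Prod>i\<in>{1..b}. a i\<bar> * \<bar>(\<Prod>i\<in>{b<..b'}. a i) - (\<Prod>i\<in>{b<..b'}. 1)\<bar> * c"
    using c by (simp add: abs_mult)
  also have "\<dots> \<le> 1 * (\<Sum>i\<in>{b<..b'}. \<bar>a i - 1\<bar>) * 2"
    using c norm_prod_diff[of "{b<..b'}" a "\<lambda>_. 1"] a1 unfolding a_def
    by (intro mult_mono prod_phi_le mult_nonneg_nonneg sum_nonneg) auto
  also have "\<dots> = (\<Sum>i\<in>{b<..b'}. 2 * \<bar>a i - 1\<bar>)" by (simp add: sum_distrib_left mult.commute)
  also have "\<dots> \<le> (\<Sum>i\<in>{b<..b'}. 2 * K / (snd w) ^ 4 * exp (- 4 * real i))"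
  proof (intro sum_mono)
    fix i
    define m where "m = (norm (lact (\<delta> (- real i)) w))\<^sup>2"
    have "(exp (real i) * snd w)\<^sup>2 \<le> m"
      unfolding m_def lact_delta by (simp add: norm_Pair)
    then have m: "(exp (real i) * snd w)\<^sup>2 \<le> m" "0 < (exp (real i) * snd w)\<^sup>2" using w by auto
    have "\<bar>a i - 1\<bar> = 1 - \<phi> (1 / m)" using phi_le1[of "1 / m"] by (simp add: a_def m_def)
    also have "\<dots> \<le> K * (1 / m)\<^sup>2" by (rule phi_sq)
    also have "\<dots> \<le> K * (1 / (exp (real i) * snd w)\<^sup>2)\<^sup>2"
    proof -
      have mp: "m > 0" using m by linarith
      show ?thesis by (intro mult_left_mono power_mono divide_left_mono mult_pos_pos m mp) (use K1 mp in auto)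
    qed
    also have "(1 / (exp (real i) * snd w)\<^sup>2)\<^sup>2 = exp (- 4 * real i) / (snd w) ^ 4"
    proof -
      have "exp (- 4 * real i) = 1 / exp (real i) ^ 4" by (simp add: exp_minus divide_inverse flip: exp_of_nat_mult)
      then show ?thesis by (simp only: power_mult_distrib power_divide power_one divide_divide_eq_left flip: power_mult) simp
    qed
    finally show "2 * \<bar>a i - 1\<bar> \<le> 2 * K / (snd w) ^ 4 * exp (- 4 * real i)" by simp
  qed
  finally show ?thesis .
qed

definition Psi_lim :: "real \<times> real \<Rightarrow> real" where "Psi_lim w = lim (\<lambda>b. Psi b w)"

text \<open>The tails are dominated by those of a geometric series, so the sequence is Cauchy; for
  \<open>snd w \<le> 0\<close> it is constantly 0.\<close>

lemma Psi_tendsto: "(\<lambda>b. Psi b w) \<longlonglongrightarrow> Psi_lim w"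
proof (cases "snd w > 0")
  case True
  define h where "h i = 2 * K / (snd w) ^ 4 * exp (- 4 * real i)" for i :: nat
  have "summable h"
  proof -
    have "summable (\<lambda>i. exp (- 4) ^ i :: real)" by (rule summable_geometric) simp
    moreover have "exp (- 4) ^ i = exp (- 4 * real i)" for i :: nat by (metis exp_of_nat_mult mult.commute)
    ultimately show ?thesis unfolding h_def by (intro summable_mult) simp
  qed
  have "Cauchy (\<lambda>b. Psi b w)"
  proof (rule metric_CauchyI)
    fix e :: real assume e: "e > 0"
    obtain N where N: "\<And>m n. m \<ge> N \<Longrightarrow> norm (sum h {m..<n}) < e"
      using summable_Cauchy[of h] \<open>summable h\<close> e by blast
    have *: "\<bar>Psi b' w - Psi b w\<bar> < e" if "b \<ge> N" "b \<le> b'" for b b'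
    proof -
      have "\<bar>Psi b' w - Psi b w\<bar> \<le> sum h {b<..b'}" unfolding h_def by (rule Psi_tail[OF True that(2)])
      also have "{b<..b'} = {Suc b..<Suc b'}" by auto
      also have "sum h {Suc b..<Suc b'} < e" using N[of "Suc b" "Suc b'"] that by simp
      finally show ?thesis .
    qed
    have "dist (Psi m w) (Psi n w) < e" if "m \<ge> N" "n \<ge> N" for m n
      using *[of m n] *[of n m] that by (cases "m \<le> n") (auto simp: dist_real_def abs_minus_commute)
    then show "\<exists>M. \<forall>m\<ge>M. \<forall>n\<ge>M. dist (Psi m w) (Psi n w) < e" by blast
  qed
  then show ?thesis unfolding Psi_lim_def by (simp add: Cauchy_convergent_iff convergent_LIMSEQ_iff)
next
  case False
  then show ?thesis by (simp add: Psi_lim_def Psi_def)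
qed

lemma borel_Psi_lim[measurable]: "Psi_lim \<in> borel_measurable borel"
  by (rule borel_measurable_LIMSEQ_real[OF Psi_tendsto borel_Psi])

lemma Psi_lim_le: "\<bar>Psi_lim w\<bar> \<le> dom w"
  using tendsto_rabs[OF Psi_tendsto[of w]] by (rule LIMSEQ_le_const2) (use Psi_le in blast)

lemma integrable_Psi_lim: "integrable lborel Psi_lim"
  by (rule Bochner_Integration.integrable_bound[OF integrable_dom])
    (use Psi_lim_le in \<open>auto intro!: AE_I2 intro: order_trans[OF _ abs_ge_self] simp del: split_paired_All\<close>)

lemma Psi_L1: "(\<lambda>b. \<integral>w. \<bar>Psi b w - Psi_lim w\<bar> \<partial>lborel) \<longlonglongrightarrow> 0"
proof -
  have "(\<lambda>b. \<integral>w. \<bar>Psi b w - Psi_lim w\<bar> \<partial>lborel) \<longlonglongrightarrow> (\<integral>w. 0 \<partial>(lborel :: (real \<times> real) measure))"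
  proof (rule integral_dominated_convergence[where w="\<lambda>w. 2 * dom w"])
    show "integrable lborel (\<lambda>w. 2 * dom w)" by (intro integrable_mult_right integrable_dom)
    show "AE w in lborel. (\<lambda>b. \<bar>Psi b w - Psi_lim w\<bar>) \<longlonglongrightarrow> 0"
    proof (rule AE_I2)
      fix w from tendsto_rabs[OF tendsto_diff[OF Psi_tendsto[of w] tendsto_const[of "Psi_lim w"]]]
      show "(\<lambda>b. \<bar>Psi b w - Psi_lim w\<bar>) \<longlonglongrightarrow> 0" by simp
    qed
    show "AE w in lborel. norm \<bar>Psi b w - Psi_lim w\<bar> \<le> 2 * dom w" for b
    proof (rule AE_I2)
      fix w show "norm \<bar>Psi b w - Psi_lim w\<bar> \<le> 2 * dom w" using Psi_le[of b w] Psi_lim_le[of w] by simp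
    qed
  qed measurable
  then show ?thesis by simp
qed

definition kappa :: real where "kappa = czeta * (\<integral>w. Psi_lim w \<partial>lborel)"

text \<open>The analogue of \<open>kappa\<close> for the majorant: the mean of
  \<open>onset T 0\<close> is \<open>kappa0 / T\<close> up to o(1/T).\<close>

definition kappa0 :: real where "kappa0 = czeta * (\<integral>w. Psi 0 w \<partial>lborel)"

end

section \<open>The increments as sums over primitive vectors, in mean\<close>

locale haar_test = haar + test_fun
begin

lemma ucont_Xc: "ucont Xc"
  unfolding ucont_def
proof (intro conjI ballI)
  show "Xc \<in> borel_measurable \<mu>" unfolding Xc_def by measurable
  fix L assume L: "L \<in> unimodular_lattices"
  have "lattice_norm (act (ut y) L) \<noteq> 0" for y using lattice_norm_pos[OF act_in_lattices[OF ut_in L], of y] by simp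
  then show "continuous_on UNIV (\<lambda>y. Xc (act (ut y) L))"
    unfolding Xc_def by (intro continuous_intros continuous_lattice_norm_ut L) auto
qed

lemma ucont_phi_Xc: "ucont (\<lambda>L. \<phi> (Xc (act (\<delta> s) L) / T))"
proof -
  have "continuous_on UNIV (\<lambda>x. \<phi> (x / T))"
    unfolding divide_inverse by (rule continuous_on_UNIV_comp[OF continuous_phi, of UNIV "\<lambda>x. x * inverse T"]) (intro continuous_intros)
  from ucont_comp[OF ucont_act[OF ucont_Xc] this] show ?thesis .
qed

lemma ucont_past: "ucont (past T b)"
  unfolding past_def[abs_def] by (intro ucont_prod ucont_phi_Xc)

lemma ucont_onset: "ucont (onset T b)"
  unfolding onset_def[abs_def] using ucont_mult[OF ucont_past ucont_diff[OF ucont_const ucont_phi_Xc[of 0 T]]]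
  by (simp add: delta_0 act_mat1)

lemma onset_bound: "\<bar>onset T b L\<bar> \<le> 2"
  using onset_le(1)[of T b L] onset_le(3)[of T L] by linarith

lemma ucont_meas: "ucont F \<Longrightarrow> F \<in> borel_measurable \<mu>" by (simp add: ucont_def)

lemma ucont_abs_diff: "ucont F \<Longrightarrow> ucont G \<Longrightarrow> ucont (\<lambda>L. \<bar>F L - G L\<bar>)"
  using ucont_comp[OF ucont_diff, of F G abs] by (simp add: continuous_on_rabs)

text \<open>Outside a null set \<open>onset_approx\<close> turns the increment into a primitive sum
  of \<open>Psi b\<close>. The distance to the sum of \<open>\<Phi>\<close> is at most a primitive
  sum of the scaled \<open>\<bar>Psi b - \<Phi>\<bar>\<close>, whose mean is bounded by
  \<open>siegel_le\<close>; the scaling by \<open>sqrt T\<close> contributes the factor 1/T.\<close>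

lemma onset_psum_L1:
  assumes h: "hsupp R \<Phi>" and T: "T > 4 * R\<^sup>2"
  shows "(\<integral>L. \<bar>onset T b L - psum (\<lambda>v. \<Phi> (sqrt T *\<^sub>R v)) L\<bar> \<partial>\<mu>)
    \<le> (K / T\<^sup>2 + 2 * K\<^sup>2 * real b * exp (4 * real b) / T ^ 4) + czeta * ((\<integral>v. \<bar>Psi b v - \<Phi> v\<bar> \<partial>lborel) / T)"
proof -
  note [measurable] = hsupp_borel[OF h]
  have R: "R \<ge> 1" using h by (simp add: hsupp_def)
  have "1 * 1 \<le> R\<^sup>2" unfolding power2_eq_square using R by (intro mult_mono) auto
  then have T1: "T \<ge> 1" "T > 0" using T by auto
  \<comment> \<open>The support of the scaled \<open>\<Phi>\<close> has radius at most
    \<open>2 * R / sqrt T\<close>, hence lies inside the unit ball where the short vectors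
    are.\<close>
  have sT: "sqrt T > 2 * R" using T R by (intro real_less_rsqrt) (simp add: power_mult_distrib)
  define D where "D v = \<bar>Psi b v - \<Phi> v\<bar>" for v
  \<comment> \<open>The first factor is 1 on the unit ball and 0 outside radius 2: it gives the
    bounded support that \<open>siegel_le\<close> needs without disturbing continuity.\<close>
  define k where "k v = max 0 (min 1 (2 - norm v)) * D (sqrt T *\<^sub>R v)" for v :: "real \<times> real"
  define e where "e = K / T\<^sup>2 + 2 * K\<^sup>2 * real b * exp (4 * real b) / T ^ 4"
  have e0: "e \<ge> 0" unfolding e_def using K1 T1 by auto
  have D0: "D v \<ge> 0" for v by (simp add: D_def)
  have k0: "k v \<ge> 0" for v unfolding k_def by (intro mult_nonneg_nonneg D0) auto
  have kb: "bsupp 2 k" unfolding bsupp_def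
  proof (intro allI impI)
    fix v assume "k v \<noteq> 0" then show "norm v \<le> 2" by (cases "norm v \<le> 2") (auto simp: k_def)
  qed
  have Pz: "Psi b v = 0" "\<Phi> v = 0" if "snd v \<le> 0" for v
  proof -
    have "1 / R > 0" using R by simp
    then have "\<not> 1 / R \<le> snd v" using that by linarith
    then show "\<Phi> v = 0" by (intro hsupp_zero[OF h]) blast
  qed (use that in \<open>simp add: Psi_def\<close>)
  have kh: "half_cont k" unfolding half_cont_def
  proof (intro conjI allI impI)
    have cP: "continuous_on {v. 0 < snd v} (Psi b)" using half_cont_Psi by (simp add: half_cont_def)
    have cPhi: "continuous_on {v. 0 < snd v} \<Phi>" using h continuous_on_subset unfolding hsupp_def by blast
    have cs: "continuous_on {v. 0 < snd v} (\<lambda>v::real \<times> real. sqrt T *\<^sub>R v)" by (intro continuous_intros)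
    have sub: "(\<lambda>v::real \<times> real. sqrt T *\<^sub>R v) ` {v. 0 < snd v} \<subseteq> {v. 0 < snd v}" using T1 by auto
    show "continuous_on {v. 0 < snd v} k" unfolding k_def D_def
      by (intro continuous_intros continuous_on_compose2[OF cP cs sub] continuous_on_compose2[OF cPhi cs sub])
    fix v :: "real \<times> real" assume "snd v \<le> 0"
    then have "snd (sqrt T *\<^sub>R v) \<le> 0" using T1 by (simp add: mult_nonneg_nonpos)
    then show "k v = 0" using Pz[of "sqrt T *\<^sub>R v"] by (simp add: k_def D_def)
  qed
  have pm: "psum k \<in> borel_measurable \<mu>" by (rule siegel_le(1)[OF kh k0 kb])
  have key: "\<bar>onset T b L - psum (\<lambda>v. \<Phi> (sqrt T *\<^sub>R v)) L\<bar> \<le> e + psum k L"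
    if L: "L \<in> unimodular_lattices" and hor: "\<forall>v\<in>prims L. snd v \<noteq> 0" for L
  proof -
    define \<psi> where "\<psi> v = (if norm v < 1 then Psi b (sqrt T *\<^sub>R v) else 0)" for v
    have 1: "\<bar>onset T b L - psum \<psi> L\<bar> \<le> e" unfolding e_def \<psi>_def[abs_def] by (rule onset_approx[OF L hor T1(1)])
    have b1: "bsupp 2 \<psi>" unfolding bsupp_def \<psi>_def by auto
    have n2: "norm v < 1" if "\<Phi> (sqrt T *\<^sub>R v) \<noteq> 0" for v
    proof (rule ccontr)
      assume "\<not> norm v < 1"
      then have "sqrt T * 1 \<le> sqrt T * norm v" using T1 by (intro mult_left_mono) auto
      moreover have "norm (sqrt T *\<^sub>R v) \<le> 2 * R" using that hsupp_bsupp[OF h] unfolding bsupp_def by blast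
      moreover have "norm (sqrt T *\<^sub>R v) = sqrt T * norm v" using T1 by simp
      ultimately show False using sT by linarith
    qed
    have b2: "bsupp 2 (\<lambda>v. \<Phi> (sqrt T *\<^sub>R v))" unfolding bsupp_def
    proof (intro allI impI)
      fix v assume "\<Phi> (sqrt T *\<^sub>R v) \<noteq> 0" from n2[OF this] show "norm v \<le> 2" by simp
    qed
    have "\<bar>psum \<psi> L - psum (\<lambda>v. \<Phi> (sqrt T *\<^sub>R v)) L\<bar> \<le> psum k L"
      unfolding psum_ball[OF L b1] psum_ball[OF L b2] psum_ball[OF L kb] sum_subtractf[symmetric]
    proof (rule order_trans[OF sum_abs sum_mono])
      fix v
      show "\<bar>\<psi> v - \<Phi> (sqrt T *\<^sub>R v)\<bar> \<le> k v"
      proof (cases "norm v < 1")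
        case True then show ?thesis by (simp add: \<psi>_def k_def D_def)
      next
        case False
        then have "\<Phi> (sqrt T *\<^sub>R v) = 0" using n2[of v] by blast
        then show ?thesis using False k0[of v] by (simp add: \<psi>_def)
      qed
    qed
    then show ?thesis using 1 by linarith
  qed
  have um: "ucont (\<lambda>L. \<bar>onset T b L - psum (\<lambda>v. \<Phi> (sqrt T *\<^sub>R v)) L\<bar>)"
    by (intro ucont_abs_diff ucont_onset ucont_psum[OF hsupp_scaled[OF h T1(1)]])
  have "ennreal (\<integral>L. \<bar>onset T b L - psum (\<lambda>v. \<Phi> (sqrt T *\<^sub>R v)) L\<bar> \<partial>\<mu>)
      = (\<integral>\<^sup>+L. \<bar>onset T b L - psum (\<lambda>v. \<Phi> (sqrt T *\<^sub>R v)) L\<bar> \<partial>\<mu>)"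
  proof (intro nn_integral_eq_integral[symmetric])
    obtain B where B: "\<And>L. L \<in> unimodular_lattices \<Longrightarrow> \<bar>psum (\<lambda>v. \<Phi> (sqrt T *\<^sub>R v)) L\<bar> \<le> B"
      using hsupp_scaled_bound[OF h T1(1)] by blast
    have "\<bar>\<bar>onset T b L - psum (\<lambda>v. \<Phi> (sqrt T *\<^sub>R v)) L\<bar>\<bar> \<le> 2 + B" if "L \<in> unimodular_lattices" for L
      using onset_bound[of T b L] B[OF that] by linarith
    then show "integrable \<mu> (\<lambda>L. \<bar>onset T b L - psum (\<lambda>v. \<Phi> (sqrt T *\<^sub>R v)) L\<bar>)"
      by (rule integrable_bounded[OF ucont_meas[OF um]])
  qed simp
  also have "\<dots> \<le> (\<integral>\<^sup>+L. ennreal e + ennreal (psum k L) \<partial>\<mu>)"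
  proof (rule nn_integral_mono_AE)
    show "AE L in \<mu>. ennreal \<bar>onset T b L - psum (\<lambda>v. \<Phi> (sqrt T *\<^sub>R v)) L\<bar> \<le> ennreal e + ennreal (psum k L)"
      using AE_no_horizontal AE_space
    proof eventually_elim
      case (elim L)
      have "psum k L \<ge> 0" unfolding psum_def using k0 by (intro sum_nonneg) auto
      then show ?case using key[of L] elim e0 by (simp add: space_mu ennreal_leI flip: ennreal_plus)
    qed
  qed
  also have "\<dots> = ennreal e + (\<integral>\<^sup>+L. psum k L \<partial>\<mu>)"
    using pm by (subst nn_integral_add) (auto simp: emeasure_space_1)
  also have "\<dots> \<le> ennreal e + ennreal (czeta * ((\<integral>v. D v \<partial>lborel) / T))"
  proof (intro add_left_mono)
    have [measurable]: "D \<in> borel_measurable borel" unfolding D_def by measurable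
    have iD: "integrable lborel D" unfolding D_def
      by (intro integrable_abs Bochner_Integration.integrable_diff integrable_Psi h_integrable[OF h])
    have iDs: "integrable lborel (\<lambda>v. D (sqrt T *\<^sub>R v))" using integral_scale_plane(2)[of D "sqrt T"] iD T1 by simp
    have eq: "(\<integral>v. D (sqrt T *\<^sub>R v) \<partial>lborel) = (\<integral>v. D v \<partial>lborel) / T"
      using integral_scale_plane(1)[of D "sqrt T"] T1 by simp
    have "(\<integral>\<^sup>+L. psum k L \<partial>\<mu>) \<le> czeta * (\<integral>\<^sup>+v. k v \<partial>lborel)" by (rule siegel_le(2)[OF kh k0 kb])
    also have "\<dots> \<le> czeta * (\<integral>\<^sup>+v. D (sqrt T *\<^sub>R v) \<partial>lborel)"
    proof (intro mult_left_mono nn_integral_mono ennreal_leI)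
      fix v show "k v \<le> D (sqrt T *\<^sub>R v)" unfolding k_def using D0 by (intro mult_left_le_one_le) auto
    qed simp
    also have "(\<integral>\<^sup>+v. D (sqrt T *\<^sub>R v) \<partial>lborel) = ennreal (\<integral>v. D (sqrt T *\<^sub>R v) \<partial>lborel)"
      using D0 by (intro nn_integral_eq_integral iDs) auto
    finally show "(\<integral>\<^sup>+L. psum k L \<partial>\<mu>) \<le> ennreal (czeta * ((\<integral>v. D v \<partial>lborel) / T))"
      unfolding eq ennreal_mult'[OF less_imp_le[OF czeta_pos]] .
  qed
  also have "\<dots> = ennreal (e + czeta * ((\<integral>v. D v \<partial>lborel) / T))"
    using e0 czeta_pos T1 D0 by (intro ennreal_plus[symmetric]) auto
  finally show ?thesis
    using e0 czeta_pos T1 D0 by (subst (asm) ennreal_le_iff) (auto simp: e_def D_def[abs_def])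
qed

text \<open>\<open>Psi (b n)\<close> varies with n and need not have compact support, so it is
  replaced by one fixed cut-off function close to the limit \<open>F\<close> in L1. Averaging does
  not increase L1 norms over \<open>\<mu>\<close>, hence the replacement costs little, and
  \<open>equidistribution\<close> treats the fixed function.\<close>

theorem onset_equidistribution:
  fixes g b :: "nat \<Rightarrow> nat"
  assumes Q: "filterlim (\<lambda>n. exp (real (g n)) / sqrt (real n)) at_top sequentially"
    and err: "(\<lambda>n. real n * (K / (real n)\<^sup>2 + 2 * K\<^sup>2 * real (b n) * exp (4 * real (b n)) / real n ^ 4)) \<longlonglongrightarrow> 0"
    and F[measurable]: "F \<in> borel_measurable borel" and iF: "integrable lborel F"
    and lim: "(\<lambda>n. \<integral>v. \<bar>Psi (b n) v - F v\<bar> \<partial>lborel) \<longlonglongrightarrow> 0"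
  shows "(\<lambda>n. \<integral>L. \<bar>real n * avg (real (g n)) (onset (real n) (b n)) L - czeta * (\<integral>v. F v \<partial>lborel)\<bar> \<partial>\<mu>) \<longlonglongrightarrow> 0"
proof (rule LIMSEQ_I)
  fix \<epsilon>' :: real assume e': "\<epsilon>' > 0"
  \<comment> \<open>The errors collected below amount to
    \<open>2 * \<epsilon> + 3 * czeta * \<epsilon>\<close>.\<close>
  define \<epsilon> where "\<epsilon> = \<epsilon>' / (4 * (czeta + 1))"
  have e: "\<epsilon> > 0" "\<epsilon> * (4 * (czeta + 1)) = \<epsilon>'" using e' czeta_pos by (auto simp: \<epsilon>_def)
  \<comment> \<open>\<open>F\<close> is merely integrable, whereas \<open>cut_L1\<close> wants a
    \<open>half_cont\<close> function; so a member of the family near \<open>F\<close> is cut off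
    instead.\<close>
  define b0 where "b0 = b (SOME n. (\<integral>v. \<bar>Psi (b n) v - F v\<bar> \<partial>lborel) < \<epsilon> / 2)"
  have "\<exists>n. (\<integral>v. \<bar>Psi (b n) v - F v\<bar> \<partial>lborel) < \<epsilon> / 2"
    using order_tendstoD(2)[OF lim, of "\<epsilon> / 2"] e by (auto simp: eventually_sequentially)
  then have b0: "(\<integral>v. \<bar>Psi b0 v - F v\<bar> \<partial>lborel) < \<epsilon> / 2" unfolding b0_def by (rule someI_ex)
  obtain j where j: "(\<integral>v. \<bar>Psi b0 v - Psi b0 v * cut (real (Suc j)) v\<bar> \<partial>lborel) < \<epsilon> / 2"
    using order_tendstoD(2)[OF cut_L1[OF half_cont_Psi integrable_Psi[of b0]], of "\<epsilon> / 2"] e by (auto simp: eventually_sequentially)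
  define \<Phi> where "\<Phi> v = Psi b0 v * cut (real (Suc j)) v" for v
  define R where "R = real (Suc j) + 1"
  have h: "hsupp R \<Phi>" unfolding \<Phi>_def R_def using half_cont_Psi[of b0] by (intro hsupp_cut) (auto simp: half_cont_def)
  note [measurable] = hsupp_borel[OF h]
  have iP: "integrable lborel \<Phi>" by (rule h_integrable[OF h])
  have tri: "(\<integral>v. \<bar>A v - C v\<bar> \<partial>lborel) \<le> (\<integral>v. \<bar>A v - B v\<bar> \<partial>lborel) + (\<integral>v. \<bar>B v - C v\<bar> \<partial>lborel)"
    if "integrable lborel A" "integrable lborel B" "integrable lborel C" for A B C :: "real \<times> real \<Rightarrow> real"
  proof -
    have "(\<integral>v. \<bar>A v - C v\<bar> \<partial>lborel) \<le> (\<integral>v. \<bar>A v - B v\<bar> + \<bar>B v - C v\<bar> \<partial>lborel)"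
      using that by (intro integral_mono) auto
    also have "\<dots> = (\<integral>v. \<bar>A v - B v\<bar> \<partial>lborel) + (\<integral>v. \<bar>B v - C v\<bar> \<partial>lborel)"
      using that by (intro Bochner_Integration.integral_add) auto
    finally show ?thesis .
  qed
  have FP: "(\<integral>v. \<bar>F v - \<Phi> v\<bar> \<partial>lborel) < \<epsilon>"
    using tri[OF iF integrable_Psi[of b0] iP] b0 j by (simp add: \<Phi>_def abs_minus_commute)
  define c where "c = czeta * (\<integral>v. F v \<partial>lborel)"
  define c' where "c' = czeta * (\<integral>v. \<Phi> v \<partial>lborel)"
  have cc: "\<bar>c' - c\<bar> \<le> czeta * \<epsilon>"
  proof -
    have "c' - c = czeta * (\<integral>v. \<Phi> v - F v \<partial>lborel)" using iP iF by (simp add: c_def c'_def right_diff_distrib)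
    then have "\<bar>c' - c\<bar> = czeta * \<bar>\<integral>v. \<Phi> v - F v \<partial>lborel\<bar>" using czeta_pos by (simp add: abs_mult)
    also have "\<dots> \<le> czeta * (\<integral>v. \<bar>\<Phi> v - F v\<bar> \<partial>lborel)" using czeta_pos by (intro mult_left_mono integral_abs_bound) auto
    also have "\<dots> \<le> czeta * \<epsilon>" using FP czeta_pos by (intro mult_left_mono) (auto simp: abs_minus_commute)
    finally show ?thesis .
  qed
  define E where "E n = real n * (K / (real n)\<^sup>2 + 2 * K\<^sup>2 * real (b n) * exp (4 * real (b n)) / real n ^ 4)" for n
  define J where "J n L = real n * avg (real (g n)) (psum (\<lambda>v. \<Phi> (sqrt (real n) *\<^sub>R v))) L" for n L
  have Jlim: "(\<lambda>n. \<integral>L. \<bar>J n L - c'\<bar> \<partial>\<mu>) \<longlonglongrightarrow> 0"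
  proof -
    \<comment> \<open>\<open>equidistribution\<close> wants \<open>\<tau> \<ge> 1\<close> for every
      index, which fails at n = 0 only.\<close>
    have "filterlim (\<lambda>n. exp (real (g n)) / sqrt (max 1 (real n))) at_top sequentially"
      by (rule filterlim_mono_eventually[OF Q order_refl order_refl]) (auto simp: eventually_sequentially intro!: exI[of _ 1])
    from equidistribution[OF h _ _ this]
    have "(\<lambda>n. \<integral>L. \<bar>max 1 (real n) * avg (real (g n)) (psum (\<lambda>v. \<Phi> (sqrt (max 1 (real n)) *\<^sub>R v))) L - c'\<bar> \<partial>\<mu>) \<longlonglongrightarrow> 0"
      by (simp add: c'_def)
    then show ?thesis
    proof (rule Lim_transform_eventually)
      show "\<forall>\<^sub>F n in sequentially. (\<integral>L. \<bar>max 1 (real n) * avg (real (g n)) (psum (\<lambda>v. \<Phi> (sqrt (max 1 (real n)) *\<^sub>R v))) L - c'\<bar> \<partial>\<mu>) = (\<integral>L. \<bar>J n L - c'\<bar> \<partial>\<mu>)"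
        using eventually_ge_at_top[of 1] 
      proof eventually_elim
        case (elim n)
        then have "max 1 (real n) = real n" by simp
        then show ?case by (simp only: J_def)
      qed
    qed
  qed
  have big: "\<forall>\<^sub>F n in sequentially. real n > 4 * R\<^sup>2"
    using filterlim_real_sequentially by (simp add: filterlim_at_top_dense)
  have "\<forall>\<^sub>F n in sequentially. (\<integral>L. \<bar>real n * avg (real (g n)) (onset (real n) (b n)) L - c\<bar> \<partial>\<mu>) < \<epsilon>'"
    using big order_tendstoD(2)[OF Jlim e(1)] order_tendstoD(2)[OF lim e(1)] order_tendstoD(2)[OF err e(1)]
  proof eventually_elim
    case (elim n)
    define T where "T = real n"
    define f where "f = onset T (b n)"
    define p where "p = psum (\<lambda>v. \<Phi> (sqrt T *\<^sub>R v))"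
    have T: "T > 4 * R\<^sup>2" using elim by (simp add: T_def)
    have "0 \<le> R\<^sup>2" by simp
    then have "T > 0" using T by linarith
    then have T1: "T > 0" "T \<ge> 1" by (auto simp: T_def)
    have uf: "ucont f" and up: "ucont p" unfolding f_def p_def by (intro ucont_onset, intro ucont_psum[OF hsupp_scaled[OF h T1(2)]])
    obtain B where B: "\<And>L. L \<in> unimodular_lattices \<Longrightarrow> \<bar>p L\<bar> \<le> B"
      using hsupp_scaled_bound[OF h T1(2)] unfolding p_def by blast
    have fB: "\<bar>f L\<bar> \<le> 2" for L unfolding f_def by (rule onset_bound)
    have dB: "\<bar>\<bar>f L - p L\<bar>\<bar> \<le> 2 + B" if "L \<in> unimodular_lattices" for L using B[OF that] fB[of L] by linarith
    note im = integrable_bounded[OF borel_avg[OF uf] abs_avg_le[OF uf fB]]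
      integrable_bounded[OF borel_avg[OF up] abs_avg_le[OF up B]]
      integrable_bounded[OF borel_avg[OF ucont_abs_diff[OF uf up]] abs_avg_le[OF ucont_abs_diff[OF uf up] dB]]
    have "(\<integral>L. \<bar>T * avg (real (g n)) f L - c\<bar> \<partial>\<mu>)
       \<le> (\<integral>L. (T * avg (real (g n)) (\<lambda>L. \<bar>f L - p L\<bar>) L + \<bar>T * avg (real (g n)) p L - c'\<bar>) + \<bar>c' - c\<bar> \<partial>\<mu>)"
    proof (rule integral_mono)
      show "integrable \<mu> (\<lambda>L. \<bar>T * avg (real (g n)) f L - c\<bar>)" using im by simp
      show "integrable \<mu> (\<lambda>L. (T * avg (real (g n)) (\<lambda>L. \<bar>f L - p L\<bar>) L + \<bar>T * avg (real (g n)) p L - c'\<bar>) + \<bar>c' - c\<bar>)" using im by simp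
      fix L assume "L \<in> space \<mu>"
      then have L: "L \<in> unimodular_lattices" by (simp add: space_mu)
      have "\<bar>avg (real (g n)) f L - avg (real (g n)) p L\<bar> \<le> avg (real (g n)) (\<lambda>L. \<bar>f L - p L\<bar>) L"
        using avg_abs_le[of "real (g n)" "\<lambda>L. f L - p L" L] by (simp add: avg_diff[OF uf fB up B L])
      then have "\<bar>T * avg (real (g n)) f L - T * avg (real (g n)) p L\<bar> \<le> T * avg (real (g n)) (\<lambda>L. \<bar>f L - p L\<bar>) L"
        using T1 by (simp add: abs_mult flip: right_diff_distrib)
      then show "\<bar>T * avg (real (g n)) f L - c\<bar> \<le> (T * avg (real (g n)) (\<lambda>L. \<bar>f L - p L\<bar>) L + \<bar>T * avg (real (g n)) p L - c'\<bar>) + \<bar>c' - c\<bar>"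
        by linarith
    qed
    also have "\<dots> = T * (\<integral>L. \<bar>f L - p L\<bar> \<partial>\<mu>) + (\<integral>L. \<bar>T * avg (real (g n)) p L - c'\<bar> \<partial>\<mu>) + \<bar>c' - c\<bar>"
      using im by (simp add: prob_space integral_avg[OF ucont_abs_diff[OF uf up] dB])
    also have "(\<integral>L. \<bar>T * avg (real (g n)) p L - c'\<bar> \<partial>\<mu>) < \<epsilon>" using elim(2) by (simp add: J_def T_def p_def)
    also have "T * (\<integral>L. \<bar>f L - p L\<bar> \<partial>\<mu>) \<le> \<epsilon> + czeta * (\<epsilon> + \<epsilon>)"
    proof -
      have "T * (\<integral>L. \<bar>f L - p L\<bar> \<partial>\<mu>) \<le> T * ((K / T\<^sup>2 + 2 * K\<^sup>2 * real (b n) * exp (4 * real (b n)) / T ^ 4) + czeta * ((\<integral>v. \<bar>Psi (b n) v - \<Phi> v\<bar> \<partial>lborel) / T))"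
        unfolding f_def p_def using T1 by (intro mult_left_mono onset_psum_L1[OF h T]) auto
      also have "\<dots> = E n + czeta * (\<integral>v. \<bar>Psi (b n) v - \<Phi> v\<bar> \<partial>lborel)"
        using T1 by (simp add: E_def T_def[symmetric] distrib_left)
      also have "\<dots> \<le> \<epsilon> + czeta * (\<epsilon> + \<epsilon>)"
      proof (intro add_mono mult_left_mono)
        show "E n \<le> \<epsilon>" using elim(4) by (simp add: E_def)
        show "(\<integral>v. \<bar>Psi (b n) v - \<Phi> v\<bar> \<partial>lborel) \<le> \<epsilon> + \<epsilon>"
          using tri[OF integrable_Psi[of "b n"] iF iP] FP elim(3) by linarith
      qed (use czeta_pos in auto)
      finally show ?thesis .
    qed
    finally have "(\<integral>L. \<bar>T * avg (real (g n)) f L - c\<bar> \<partial>\<mu>) < \<epsilon> + czeta * (\<epsilon> + \<epsilon>) + \<epsilon> + \<bar>c' - c\<bar>" by simp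
    also have "\<dots> \<le> \<epsilon> + czeta * (\<epsilon> + \<epsilon>) + \<epsilon> + czeta * \<epsilon>" using cc by simp
    also have "\<dots> \<le> \<epsilon>'" unfolding e(2)[symmetric] using e mult_pos_pos[OF czeta_pos e(1)] by (simp add: algebra_simps)
    finally show ?case by (simp add: T_def f_def)
  qed
  then show "\<exists>n0. \<forall>n\<ge>n0. norm ((\<integral>L. \<bar>real n * avg (real (g n)) (onset (real n) (b n)) L - czeta * (\<integral>v. F v \<partial>lborel)\<bar> \<partial>\<mu>) - 0) < \<epsilon>'"
    unfolding eventually_sequentially c_def by simp
qed

end

section \<open>Integrability of the inverse of the lattice norm\<close>

context haar
begin

text \<open>The inverse of the norm is locally integrable in the plane. The shortest vector of the
  upper half plane gives \<open>1 / lattice_norm L \<le> 1 + psum k L\<close>, and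
  \<open>siegel_le\<close> bounds the mean of the sum. Subtracting 1 in \<open>k\<close> makes it
  vanish continuously at norm 1.\<close>

lemma integrable_inverse_norm: "integrable \<mu> (\<lambda>L. 1 / lattice_norm L)"
proof -
  define k where "k v = (if snd v \<le> 0 then 0 else max 0 (1 / norm v - 1))" for v :: "real \<times> real"
  have k0: "0 \<le> k v" for v by (simp add: k_def)
  have kb: "bsupp 1 k" unfolding bsupp_def
  proof (intro allI impI)
    fix v assume kv: "k v \<noteq> 0"
    show "norm v \<le> 1"
    proof (rule ccontr)
      assume "\<not> norm v \<le> 1"
      then have "1 / norm v \<le> 1" by (simp add: divide_le_eq)
      then show False using kv by (simp add: k_def split: if_splits)
    qed
  qed
  have kh: "half_cont k"
  proof -
    have "continuous_on {v. 0 < snd v} (\<lambda>v::real \<times> real. max 0 (1 / norm v - 1))"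
      by (intro continuous_intros) (auto simp: zero_prod_def)
    then have "continuous_on {v. 0 < snd v} k" by (rule continuous_on_eq) (auto simp: k_def)
    then show ?thesis by (simp add: half_cont_def k_def)
  qed
  \<comment> \<open>Each coordinate receives half of the singularity, the inverse square root, which
    is integrable at 0.\<close>
  define a where "a x = indicator {0..1} x * x powr (- 1 / 2)" for x :: real
  have past_mean[measurable]: "a \<in> borel_measurable borel" unfolding a_def by measurable
  have a0: "0 \<le> a x" for x by (simp add: a_def)
  have "(\<integral>\<^sup>+x. a x \<partial>lborel) = (1::real) powr (- 1 / 2 + 1) / (- 1 / 2 + 1)"
    unfolding a_def using nn_integral_has_integral_lebesgue[OF _ has_integral_powr_from_0[of "- 1 / 2" 1]] by simp
  then have afin: "(\<integral>\<^sup>+x. a x \<partial>lborel) < \<infinity>" by simp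
  define a2 where "a2 x = a x + a (- x)" for x
  have [measurable]: "a2 \<in> borel_measurable borel" unfolding a2_def by measurable
  have a20: "0 \<le> a2 x" for x using a0 by (simp add: a2_def)
  have "(\<integral>\<^sup>+x. a (- x) \<partial>lborel) = (\<integral>\<^sup>+x. a x \<partial>lborel)"
    using nn_integral_real_affine[of "\<lambda>x. ennreal (a x)" "- 1" 0] by simp
  then have a2fin: "(\<integral>\<^sup>+x. a2 x \<partial>lborel) < \<infinity>"
    unfolding a2_def using afin a0 by (simp add: nn_integral_add)
  have "(\<integral>\<^sup>+v. k v \<partial>lborel) \<le> (\<integral>\<^sup>+v. ennreal (a2 (fst v) * a2 (snd v)) \<partial>lborel)"
  proof (rule nn_integral_mono_AE)
    show "AE v in lborel. ennreal (k v) \<le> ennreal (a2 (fst v) * a2 (snd v))"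
      using AE_line[of 0]
    proof eventually_elim
      case (elim v)
      show ?case
      proof (cases "k v = 0")
        case True then show ?thesis by simp
      next
        case False
        define p q where "p = \<bar>fst v\<bar>" and "q = \<bar>snd v\<bar>"
        have v: "snd v > 0" "norm v \<le> 1" using False kb by (auto simp: k_def bsupp_def simp del: split_paired_All split: if_splits)
        have pq: "p > 0" "q > 0" "p \<le> 1" "q \<le> 1"
          using elim v abs_le_norm_Pair[of v] by (auto simp: p_def q_def)
        \<comment> \<open>The inequality of the means bounds the norm below by
          \<open>sqrt (p * q)\<close>, which splits the majorant into a product.\<close>
        have "2 * p * q \<le> p\<^sup>2 + q\<^sup>2" by (rule sum_squares_bound)
        then have "p * q \<le> p\<^sup>2 + q\<^sup>2" using pq mult_pos_pos[of p q] by linarith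
        then have "sqrt (p * q) \<le> norm v" by (cases v) (simp add: norm_Pair p_def q_def)
        moreover have "sqrt (p * q) > 0" using pq by simp
        ultimately have n: "1 / norm v \<le> 1 / sqrt (p * q)" by (intro divide_left_mono mult_pos_pos) auto
        have ps: "x powr (- 1 / 2) = 1 / sqrt x" if "x > 0" for x :: real
        proof -
          have "x powr (- 1 / 2) = x powr (- (1 / 2))" by simp
          also have "\<dots> = 1 / x powr (1 / 2)" by (rule powr_minus_divide)
          also have "\<dots> = 1 / sqrt x" using that by (simp only: powr_half_sqrt less_imp_le)
          finally show ?thesis .
        qed
        have 1: "1 / sqrt p \<le> a2 (fst v)" "1 / sqrt q \<le> a2 (snd v)"
        proof -
          have "a2 x = 1 / sqrt \<bar>x\<bar>" if "0 < \<bar>x\<bar>" "\<bar>x\<bar> \<le> 1" for x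
            using that ps[of x] ps[of "- x"] by (cases "x > 0") (auto simp: a2_def a_def)
          then show "1 / sqrt p \<le> a2 (fst v)" "1 / sqrt q \<le> a2 (snd v)" using pq by (simp_all add: p_def q_def)
        qed
        have "k v \<le> 1 / norm v" using v by (simp add: k_def)
        also have "\<dots> \<le> 1 / sqrt p * (1 / sqrt q)" using n by (simp add: real_sqrt_mult)
        also have "\<dots> \<le> a2 (fst v) * a2 (snd v)" using pq by (intro mult_mono 1 a20) auto
        finally show ?thesis by (rule ennreal_leI)
      qed
    qed
  qed
  also have "\<dots> = (\<integral>\<^sup>+x. \<integral>\<^sup>+y. ennreal (a2 x) * ennreal (a2 y) \<partial>lborel \<partial>lborel)"
    by (subst nn_integral_lborel_pair(1)) (auto simp: ennreal_mult a20)
  also have "\<dots> = (\<integral>\<^sup>+x. a2 x \<partial>lborel) * (\<integral>\<^sup>+x. a2 x \<partial>lborel)"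
    by (simp add: nn_integral_cmult nn_integral_multc)
  also have "\<dots> < \<infinity>" using a2fin by (simp add: ennreal_mult_less_top)
  finally have kfin: "(\<integral>\<^sup>+v. k v \<partial>lborel) < \<infinity>" .
  note ps = siegel_le[OF kh k0 kb]
  have "(\<integral>\<^sup>+L. 1 / lattice_norm L \<partial>\<mu>) \<le> (\<integral>\<^sup>+L. 1 + ennreal (psum k L) \<partial>\<mu>)"
  proof (rule nn_integral_mono_AE)
    show "AE L in \<mu>. ennreal (1 / lattice_norm L) \<le> 1 + ennreal (psum k L)"
      using AE_no_horizontal AE_space
    proof eventually_elim
      case (elim L)
      then have L: "L \<in> unimodular_lattices" by (simp add: space_mu)
      have p0: "psum k L \<ge> 0" unfolding psum_def using k0 by (intro sum_nonneg) auto
      obtain v0 where v0: "v0 \<in> prims L" "norm v0 = lattice_norm L" using lattice_norm_prims(1)[OF L] by blast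
      define v where "v = (if snd v0 > 0 then v0 else - v0)"
      have v: "v \<in> prims L" "norm v = lattice_norm L" "snd v > 0"
        using v0 prims_minus[OF L v0(1)] elim(1)[rule_format, OF v0(1)] by (auto simp: v_def)
      have "1 / lattice_norm L \<le> 1 + psum k L"
      proof (cases "norm v \<le> 1")
        case True
        have "k v = sum k {v}" by simp
        also have "\<dots> \<le> sum k {v \<in> prims L. norm v \<le> 1}" using v True k0 finite_prims[OF L] by (intro sum_mono2) auto
        also have "\<dots> = psum k L" by (rule psum_ball[OF L kb, symmetric])
        finally show ?thesis using v by (simp add: k_def)
      next
        case False
        then have "1 / norm v \<le> 1" by (simp add: divide_le_eq)
        then show ?thesis using v p0 by simp
      qed
      then show ?case using p0 by (metis ennreal_leI ennreal_plus ennreal_1 zero_le_one)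
    qed
  qed
  also have "\<dots> = 1 + (\<integral>\<^sup>+L. psum k L \<partial>\<mu>)" using ps(1) by (subst nn_integral_add) (auto simp: emeasure_space_1)
  also have "\<dots> < \<infinity>"
  proof -
    have "(\<integral>\<^sup>+L. psum k L \<partial>\<mu>) < \<infinity>"
      by (rule order_le_less_trans[OF ps(2)]) (use kfin in \<open>simp add: ennreal_mult_less_top\<close>)
    then show ?thesis by simp
  qed
  finally have fin: "(\<integral>\<^sup>+L. 1 / lattice_norm L \<partial>\<mu>) < \<infinity>" .
  have "(\<integral>\<^sup>+L. norm (1 / lattice_norm L) \<partial>\<mu>) = (\<integral>\<^sup>+L. 1 / lattice_norm L \<partial>\<mu>)"
    by (intro nn_integral_cong) (use lattice_norm_pos space_mu in force)
  then show ?thesis using fin by (simp add: integrable_iff_bounded)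
qed

end

section \<open>Decorrelation of the past from the increment\<close>

context haar_test
begin

text \<open>
  \<open>Xc\<close> is not integrable. Interpolating \<open>\<bar>\<phi> a - \<phi> b\<bar> \<le> min 2 (K * \<bar>a - b\<bar>)\<close> to \<open>sqrt (2 * K * \<bar>a - b\<bar>)\<close> leaves its
  square root, which is integrable.
\<close>

definition past_osc :: "real \<Rightarrow> nat \<Rightarrow> (real^2) set \<Rightarrow> real" where
  "past_osc T m L = sqrt (6 * K / T) * (\<Sum>i\<in>{1..m}. exp (- real i) * (1 / lattice_norm (act (\<delta> (- real i)) L)))"

text \<open>The i-th factor sees the shift only as \<open>ut \<xi>\<close> with
  \<open>\<xi> \<le> exp (- 2 * i)\<close>, which changes \<open>Xc\<close> by a relative amount of
  that order. After the square root this leaves the weights \<open>exp (- i)\<close> of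
  \<open>past_osc\<close>.\<close>

lemma past_diff:
  assumes L: "L \<in> unimodular_lattices" and y: "y \<in> {0..1}" and T: "T > 0"
  shows "\<bar>past T m (act (ut y) L) - past T m L\<bar> \<le> past_osc T m L"
proof -
  have "\<bar>past T m (act (ut y) L) - past T m L\<bar>
     \<le> (\<Sum>i\<in>{1..m}. \<bar>\<phi> (Xc (act (\<delta> (- real i)) (act (ut y) L)) / T) - \<phi> (Xc (act (\<delta> (- real i)) L) / T)\<bar>)"
    unfolding past_def by (rule prod_phi_diff)
  also have "\<dots> \<le> (\<Sum>i\<in>{1..m}. sqrt (6 * K / T) * (exp (- real i) * (1 / lattice_norm (act (\<delta> (- real i)) L))))"
  proof (intro sum_mono)
    fix i
    define M where "M = act (\<delta> (- real i)) L"
    have M: "M \<in> unimodular_lattices" unfolding M_def by (rule act_in_lattices[OF delta_in L])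
    define \<xi> where "\<xi> = exp (- (2 * real i)) * y"
    have xi: "0 \<le> \<xi>" "\<xi> \<le> 1" "\<xi> \<le> exp (- (2 * real i))"
    proof -
      show "0 \<le> \<xi>" using y by (simp add: \<xi>_def)
      show "\<xi> \<le> exp (- (2 * real i))" using y by (simp add: \<xi>_def mult_left_le)
      moreover have "exp (- (2 * real i)) \<le> 1" by simp
      ultimately show "\<xi> \<le> 1" by linarith
    qed
    define M' where "M' = act (ut \<xi>) M"
    have M': "M' \<in> unimodular_lattices" unfolding M'_def by (rule act_in_lattices[OF ut_in M])
    have eq: "act (\<delta> (- real i)) (act (ut y) L) = M'" by (simp add: act_delta_ut M'_def M_def \<xi>_def)
    have n: "lattice_norm M' \<le> (1 + \<xi>) * lattice_norm M" "lattice_norm M \<le> (1 + \<xi>) * lattice_norm M'"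
      using lattice_norm_ut[OF M, of \<xi>] xi by (auto simp: M'_def)
    have pos: "lattice_norm M > 0" "lattice_norm M' > 0" using M M' by (auto intro: lattice_norm_pos)
    have sq: "Xc B \<le> (1 + \<xi>)\<^sup>2 * Xc A" if "lattice_norm A \<le> (1 + \<xi>) * lattice_norm B" "lattice_norm A > 0" "lattice_norm B > 0" for A B
    proof -
      have gen: "1 / b \<le> c * (1 / a)" if "a \<le> c * b" "0 < a" "0 < b" for a b c :: real
        using that by (simp add: field_simps)
      have "(lattice_norm A)\<^sup>2 \<le> ((1 + \<xi>) * lattice_norm B)\<^sup>2" using that by (intro power_mono) auto
      then show ?thesis unfolding Xc_def using that by (intro gen) (simp_all only: power_mult_distrib zero_less_power)
    qed
    \<comment> \<open>With \<open>\<xi> \<le> 1\<close> the term \<open>\<xi>\<^sup>2\<close> is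
      absorbed; this is the 3 in the relative bound on \<open>Xc\<close>.\<close>
    have x2: "(1 + \<xi>)\<^sup>2 \<le> 1 + 3 * \<xi>" using xi mult_mono[of \<xi> 1 \<xi> \<xi>] by (simp add: power2_eq_square algebra_simps)
    have mono: "(1 + \<xi>)\<^sup>2 * Xc A \<le> Xc A + 3 * \<xi> * Xc A" for A
      using mult_right_mono[OF x2 Xc_nonneg[of A]] by (simp add: algebra_simps)
    have dX: "\<bar>Xc M' - Xc M\<bar> \<le> 3 * \<xi> * Xc M"
    proof (cases "Xc M' \<ge> Xc M")
      case True then show ?thesis using sq[OF n(2) pos] mono[of M] by linarith
    next
      case False
      have "3 * \<xi> * Xc M' \<le> 3 * \<xi> * Xc M" using False xi by (intro mult_left_mono) auto
      then show ?thesis using False sq[OF n(1) pos(2,1)] mono[of M'] by linarith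
    qed
    \<comment> \<open>The geometric mean of the bounds 2 and \<open>z\<close> is
      \<open>sqrt (2 * z)\<close>; the factor 2 and the 3 in \<open>z\<close> make the 6 of
      \<open>past_osc\<close>.\<close>
    define z where "z = K * (3 * \<xi> * Xc M / T)"
    have z0: "z \<ge> 0" unfolding z_def using K1 xi Xc_nonneg[of M] T by auto
    have d1: "\<bar>\<phi> (Xc M' / T) - \<phi> (Xc M / T)\<bar> \<le> z"
    proof -
      have "\<bar>\<phi> (Xc M' / T) - \<phi> (Xc M / T)\<bar> \<le> K * \<bar>Xc M' / T - Xc M / T\<bar>" by (rule phi_lip)
      also have "\<bar>Xc M' / T - Xc M / T\<bar> = \<bar>Xc M' - Xc M\<bar> / T" using T by (simp flip: diff_divide_distrib)
      also have "K * (\<bar>Xc M' - Xc M\<bar> / T) \<le> z" unfolding z_def using dX T K1 by (intro mult_left_mono divide_right_mono) auto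
      finally show ?thesis .
    qed
    have d2: "\<bar>\<phi> (Xc M' / T) - \<phi> (Xc M / T)\<bar> \<le> 2" using phi_le[of "Xc M' / T"] phi_le[of "Xc M / T"] by linarith
    have "(\<bar>\<phi> (Xc M' / T) - \<phi> (Xc M / T)\<bar>)\<^sup>2 \<le> 2 * z"
      unfolding power2_eq_square using d1 d2 by (intro mult_mono) auto
    then have "\<bar>\<phi> (Xc M' / T) - \<phi> (Xc M / T)\<bar> \<le> sqrt (2 * z)" by (rule real_le_rsqrt)
    also have "\<dots> \<le> sqrt ((6 * K / T) * (exp (- real i) * (1 / lattice_norm M))\<^sup>2)"
    proof (rule real_sqrt_le_mono)
      have "2 * z = (6 * K / T) * (\<xi> * Xc M)" by (simp add: z_def)
      also have "\<dots> \<le> (6 * K / T) * (exp (- (2 * real i)) * Xc M)"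
        using xi K1 T Xc_nonneg[of M] by (intro mult_left_mono mult_right_mono) auto
      also have "exp (- (2 * real i)) * Xc M = (exp (- real i) * (1 / lattice_norm M))\<^sup>2"
        by (simp add: Xc_def power_mult_distrib power_divide flip: exp_double)
      finally show "2 * z \<le> (6 * K / T) * (exp (- real i) * (1 / lattice_norm M))\<^sup>2" .
    qed
    also have "\<dots> = sqrt (6 * K / T) * (exp (- real i) * (1 / lattice_norm M))"
      using pos by (simp only: real_sqrt_mult real_sqrt_abs abs_mult) simp
    finally show "\<bar>\<phi> (Xc (act (\<delta> (- real i)) (act (ut y) L)) / T) - \<phi> (Xc (act (\<delta> (- real i)) L) / T)\<bar>
      \<le> sqrt (6 * K / T) * (exp (- real i) * (1 / lattice_norm (act (\<delta> (- real i)) L)))"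
      by (simp add: eq M_def)
  qed
  finally show ?thesis by (simp add: past_osc_def sum_distrib_left)
qed

definition mean_inverse_norm :: real where "mean_inverse_norm = (\<integral>L. 1 / lattice_norm L \<partial>\<mu>)"

text \<open>By invariance every term has the same mean, and the weights \<open>exp (- i)\<close> sum
  to at most 1, so the bound of order \<open>1 / sqrt T\<close> does not depend on the length m of
  the past.\<close>

lemma integral_past_osc:
  assumes T: "T > 0"
  shows "integrable \<mu> (past_osc T m)" "0 \<le> (\<integral>L. past_osc T m L \<partial>\<mu>)" "(\<integral>L. past_osc T m L \<partial>\<mu>) \<le> sqrt (6 * K / T) * mean_inverse_norm"
    "L \<in> unimodular_lattices \<Longrightarrow> 0 \<le> past_osc T m L"
proof -
  have mean_inverse_norm: "mean_inverse_norm \<ge> 0" unfolding mean_inverse_norm_def by (intro integral_nonneg_AE AE_I2) (auto simp: space_mu intro: less_imp_le[OF lattice_norm_pos])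
  have int: "integrable \<mu> (\<lambda>L. 1 / lattice_norm (act (\<delta> s) L))" and eq: "(\<integral>L. 1 / lattice_norm (act (\<delta> s) L) \<partial>\<mu>) = mean_inverse_norm" for s
  proof -
    have "integrable (distr \<mu> \<mu> (act (\<delta> s))) (\<lambda>L. 1 / lattice_norm L)" by (simp add: distr_act delta_in integrable_inverse_norm)
    then show "integrable \<mu> (\<lambda>L. 1 / lattice_norm (act (\<delta> s) L))"
      by (rule integrable_distr[rotated]) (rule act_measurable[OF delta_in])
    show "(\<integral>L. 1 / lattice_norm (act (\<delta> s) L) \<partial>\<mu>) = mean_inverse_norm" unfolding mean_inverse_norm_def by (rule integral_act[OF delta_in]) measurable
  qed
  show "integrable \<mu> (past_osc T m)" unfolding past_osc_def by (intro integrable_mult_right Bochner_Integration.integrable_sum int)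
  show nn: "0 \<le> past_osc T m L" if "L \<in> unimodular_lattices" for L
    unfolding past_osc_def using T K1 that
    by (intro mult_nonneg_nonneg sum_nonneg) (auto intro!: less_imp_le[OF lattice_norm_pos] act_in_lattices delta_in)
  show "0 \<le> (\<integral>L. past_osc T m L \<partial>\<mu>)" by (intro integral_nonneg_AE AE_I2 nn) (simp add: space_mu)
  have "(\<integral>L. past_osc T m L \<partial>\<mu>) = sqrt (6 * K / T) * (\<Sum>i\<in>{1..m}. exp (- real i) * mean_inverse_norm)"
    unfolding past_osc_def using int by (simp add: Bochner_Integration.integral_sum eq del: times_divide_eq_right mult_1_right)
  also have "\<dots> \<le> sqrt (6 * K / T) * (1 * mean_inverse_norm)"
  proof (intro mult_left_mono)
    have "(\<Sum>i\<in>{1..m}. exp (- real i)) \<le> (1::real)"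
    proof -
      have e2: "exp (- real i) \<le> (1 / 2) ^ i" for i :: nat
      proof -
        have "exp (- real i) = exp (- 1) ^ i" by (simp flip: exp_of_nat_mult)
        also have "\<dots> \<le> (1 / 2) ^ i"
        proof (intro power_mono)
          have "(2::real) \<le> exp 1" using exp_ge_add_one_self[of 1] by simp
          from le_imp_inverse_le[OF this] show "exp (- 1) \<le> (1 / 2 :: real)" by (simp add: exp_minus)
        qed simp
        finally show ?thesis .
      qed
      have "(\<Sum>i\<in>{1..m}. (1 / 2 :: real) ^ i) = 1 - (1 / 2) ^ m"
        by (induction m) auto
      then show ?thesis using sum_mono[of "{1..m}" "\<lambda>i. exp (- real i)" "\<lambda>i. (1 / 2) ^ i"] e2 by (simp add: order_trans[of _ "1 - (1 / 2) ^ m"])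
    qed
    then show "(\<Sum>i\<in>{1..m}. exp (- real i) * mean_inverse_norm) \<le> 1 * mean_inverse_norm"
      unfolding sum_distrib_right[symmetric] using mean_inverse_norm by (intro mult_right_mono)
  qed (use K1 T in auto)
  finally show "(\<integral>L. past_osc T m L \<partial>\<mu>) \<le> sqrt (6 * K / T) * mean_inverse_norm" by simp
qed

text \<open>Shifting L by \<open>ut y\<close> leaves the first integral unchanged; undoing the shift
  in the past alone costs at most \<open>past_osc\<close>, and averaging over y produces
  \<open>avg\<close>. The cost stays multiplied by \<open>onset T 0\<close>, which preserves the
  factor 1/T.\<close>

lemma decorrelation:
  assumes T: "T > 0"
  shows "\<bar>(\<integral>L. past T m L * onset T b (act (\<delta> s) L) \<partial>\<mu>) - (\<integral>L. past T m L * avg s (onset T b) L \<partial>\<mu>)\<bar>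
    \<le> (\<integral>L. min 2 (past_osc T m L) * avg s (onset T 0) L \<partial>\<mu>)"
proof -
  define f where "f = onset T b"
  define f0 where "f0 = onset T 0"
  have uf: "ucont f" "ucont f0" by (auto simp: f_def f0_def ucont_onset)
  have fB: "\<bar>f L\<bar> \<le> 2" "\<bar>f0 L\<bar> \<le> 2" for L by (auto simp: f_def f0_def onset_bound)
  have ff: "\<bar>f L\<bar> \<le> f0 L" for L unfolding f_def f0_def by (rule onset_le(1))
  \<comment> \<open>Two pasts never differ by more than 2. The cap will matter in
    \<open>past_mean_step\<close>, where \<open>h\<close> multiplies a quantity that is small only
    in L1.\<close>
  define h where "h L = max 0 (min 2 (past_osc T m L))" for L
  have hm: "h \<in> borel_measurable \<mu>" unfolding h_def using integral_past_osc(1)[OF T, of m] by measurable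
  have h_eq: "h L = min 2 (past_osc T m L)" if "L \<in> unimodular_lattices" for L using integral_past_osc(4)[OF T that, of m] by (simp add: h_def)
  have hB: "\<bar>h L\<bar> \<le> 2" for L by (auto simp: h_def)
  have pf: "\<bar>past T m M * f M'\<bar> \<le> 2" for M M'
    using mult_mono[OF past_le[of T m M] fB(1)[of M']] by (simp add: abs_mult)
  have hf: "\<bar>h M * f0 M'\<bar> \<le> 4" for M M'
    using mult_mono[OF hB[of M] fB(2)[of M']] by (simp add: abs_mult)
  have pm: "past T m \<in> borel_measurable \<mu>" by (rule ucont_meas[OF ucont_past])
  note W1 = integral_avg_weighted[OF uf(1), of "\<lambda>(y, L). past T m L" 2 1 s]
  note W2 = integral_avg_weighted[OF uf(2), of "\<lambda>(y, L). h L" 2 2 s]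
  have m1: "(\<lambda>(y, L). past T m L) \<in> borel_measurable (borel \<Otimes>\<^sub>M \<mu>)" "(\<lambda>(y, L). h L) \<in> borel_measurable (borel \<Otimes>\<^sub>M \<mu>)"
    using pm hm by (auto simp: case_prod_beta' intro: measurable_compose[OF measurable_snd])
  have W1: "(\<integral>L. past T m L * avg s f L \<partial>\<mu>) = (\<integral>y. (\<integral>L. past T m L * f (act (\<delta> s) (act (ut y) L)) \<partial>\<mu>) \<partial>nu)"
    "integrable nu (\<lambda>y. \<integral>L. past T m L * f (act (\<delta> s) (act (ut y) L)) \<partial>\<mu>)"
    using W1 m1 fB past_le by (auto simp: avg_def)
  have W2: "(\<integral>L. h L * avg s f0 L \<partial>\<mu>) = (\<integral>y. (\<integral>L. h L * f0 (act (\<delta> s) (act (ut y) L)) \<partial>\<mu>) \<partial>nu)"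
    "integrable nu (\<lambda>y. \<integral>L. h L * f0 (act (\<delta> s) (act (ut y) L)) \<partial>\<mu>)"
    using W2 m1 fB hB by (auto simp: avg_def)
  define c where "c = (\<integral>L. past T m L * f (act (\<delta> s) L) \<partial>\<mu>)"
  define I where "I y = (\<integral>L. past T m L * f (act (\<delta> s) (act (ut y) L)) \<partial>\<mu>)" for y
  have cI: "\<bar>c - I y\<bar> \<le> (\<integral>L. h L * f0 (act (\<delta> s) (act (ut y) L)) \<partial>\<mu>)" if y: "y \<in> {0..1}" for y
  proof -
    have mf: "(\<lambda>L. F (act (\<delta> s) (act (ut y) L))) \<in> borel_measurable \<mu>" if "ucont F" for F
      using measurable_compose[OF act_measurable[OF ut_in[of y]] ucont_meas[OF ucont_act[OF that, of s]]] .
    have mp: "(\<lambda>L. past T m (act (ut y) L)) \<in> borel_measurable \<mu>"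
      by (rule measurable_compose[OF act_measurable[OF ut_in[of y]] pm])
    have "c = (\<integral>L. past T m (act (ut y) L) * f (act (\<delta> s) (act (ut y) L)) \<partial>\<mu>)" unfolding c_def
      by (rule integral_act[symmetric, OF ut_in]) (intro borel_measurable_times pm ucont_meas[OF ucont_act[OF uf(1)]])
    moreover have "integrable \<mu> (\<lambda>L. past T m (act (ut y) L) * f (act (\<delta> s) (act (ut y) L)))"
      using mf[OF uf(1)] mp by (intro integrable_bounded[of _ 2] pf) auto
    moreover have "integrable \<mu> (\<lambda>L. past T m L * f (act (\<delta> s) (act (ut y) L)))"
      using mf[OF uf(1)] pm by (intro integrable_bounded[of _ 2] pf) auto
    ultimately have "c - I y = (\<integral>L. (past T m (act (ut y) L) - past T m L) * f (act (\<delta> s) (act (ut y) L)) \<partial>\<mu>)"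
      by (simp add: I_def left_diff_distrib)
    then have "\<bar>c - I y\<bar> \<le> (\<integral>L. \<bar>(past T m (act (ut y) L) - past T m L) * f (act (\<delta> s) (act (ut y) L))\<bar> \<partial>\<mu>)"
      by (simp add: integral_abs_bound)
    also have "\<dots> \<le> (\<integral>L. h L * f0 (act (\<delta> s) (act (ut y) L)) \<partial>\<mu>)"
    proof (rule integral_mono')
      show "integrable \<mu> (\<lambda>L. h L * f0 (act (\<delta> s) (act (ut y) L)))"
        using mf[OF uf(2)] hm by (intro integrable_bounded[of _ 4] hf) auto
      fix L assume "L \<in> space \<mu>"
      then have L: "L \<in> unimodular_lattices" by (simp add: space_mu)
      have "\<bar>past T m (act (ut y) L) - past T m L\<bar> \<le> h L"
        unfolding h_eq[OF L] using past_diff[OF L y T, of m] past_le[of T m L] past_le[of T m "act (ut y) L"] by auto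
      then show "\<bar>(past T m (act (ut y) L) - past T m L) * f (act (\<delta> s) (act (ut y) L))\<bar> \<le> h L * f0 (act (\<delta> s) (act (ut y) L))"
        unfolding abs_mult by (intro mult_mono ff) (auto simp: h_def)
      show "0 \<le> h L * f0 (act (\<delta> s) (act (ut y) L))" using ff order_trans[OF abs_ge_zero ff] by (intro mult_nonneg_nonneg) (auto simp: h_def)
    qed
    finally show ?thesis .
  qed
  have "c - (\<integral>L. past T m L * avg s f L \<partial>\<mu>) = (\<integral>y. c - I y \<partial>nu)"
    using W1(2) nu.prob_space by (simp add: W1(1) I_def[abs_def] space_nu)
  then have "\<bar>c - (\<integral>L. past T m L * avg s f L \<partial>\<mu>)\<bar> \<le> (\<integral>y. \<bar>c - I y\<bar> \<partial>nu)" by (simp add: integral_abs_bound)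
  also have "\<dots> \<le> (\<integral>y. (\<integral>L. h L * f0 (act (\<delta> s) (act (ut y) L)) \<partial>\<mu>) \<partial>nu)"
  proof (rule integral_mono_AE)
    show "integrable nu (\<lambda>y. \<bar>c - I y\<bar>)" using W1(2) by (simp add: I_def[abs_def])
    show "AE y in nu. \<bar>c - I y\<bar> \<le> (\<integral>L. h L * f0 (act (\<delta> s) (act (ut y) L)) \<partial>\<mu>)"
      using AE_nu by eventually_elim (rule cI)
  qed (rule W2(2))
  also have "\<dots> = (\<integral>L. min 2 (past_osc T m L) * avg s f0 L \<partial>\<mu>)"
    unfolding W2(1)[symmetric] by (intro Bochner_Integration.integral_cong refl) (simp add: h_eq space_mu)
  finally show ?thesis by (simp add: c_def f_def f0_def)
qed

end

section \<open>The recursion for the means\<close>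

context haar_test
begin

definition past_mean :: "real \<Rightarrow> nat \<Rightarrow> real" where "past_mean T n = (\<integral>L. past T n L \<partial>\<mu>)"

lemma past_meas[measurable]: "past T m \<in> borel_measurable \<mu>" "onset T m \<in> borel_measurable \<mu>"
  by (auto intro: ucont_meas ucont_past ucont_onset)

lemma past_split: "past T (g + m) L = past T g L * past T m (act (\<delta> (- real g)) L)"
proof -
  have "(\<Prod>i\<in>{1..g + m}. \<phi> (Xc (act (\<delta> (- real i)) L) / T))
      = (\<Prod>i\<in>{1..g}. \<phi> (Xc (act (\<delta> (- real i)) L) / T)) * (\<Prod>i\<in>{g + 1..g + m}. \<phi> (Xc (act (\<delta> (- real i)) L) / T))"
    by (rule prod.ub_add_nat) simp
  also have "(\<Prod>i\<in>{g + 1..g + m}. \<phi> (Xc (act (\<delta> (- real i)) L) / T))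
      = (\<Prod>i\<in>{1..m}. \<phi> (Xc (act (\<delta> (- real (i + g))) L) / T))"
    using prod.shift_bounds_cl_nat_ivl[of "\<lambda>i. \<phi> (Xc (act (\<delta> (- real i)) L) / T)" 1 g m] by (simp add: add.commute)
  also have "\<dots> = past T m (act (\<delta> (- real g)) L)"
    unfolding past_def by (simp add: delta_add flip: act_mult)
  finally show ?thesis by (simp add: past_def)
qed

text \<open>Moving the reference by one step with \<open>\<delta> 1\<close> turns the most recent of
  n + 1 past factors into the factor at time 0.\<close>

lemma past_mean_Suc: "past_mean T n - past_mean T (Suc n) = (\<integral>L. onset T n L \<partial>\<mu>)"
proof -
  have shift: "past T (Suc n) (act (\<delta> 1) L) = past T n L * \<phi> (Xc L / T)" for L
  proof -
    have "past T (1 + n) (act (\<delta> 1) L) = past T 1 (act (\<delta> 1) L) * past T n (act (\<delta> (- real 1)) (act (\<delta> 1) L))"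
      by (rule past_split)
    then show ?thesis by (simp add: past_def delta_add delta_0 act_mat1 flip: act_mult)
  qed
  have "past_mean T (Suc n) = (\<integral>L. past T n L * \<phi> (Xc L / T) \<partial>\<mu>)"
    unfolding past_mean_def shift[symmetric] by (rule integral_act[symmetric, OF delta_in]) measurable
  moreover have "integrable \<mu> (past T n)" by (rule integrable_bounded[OF _ past_le]) measurable
  moreover have "integrable \<mu> (\<lambda>L. past T n L * \<phi> (Xc L / T))"
  proof -
    have "integrable \<mu> (onset T n)" by (rule integrable_bounded[OF _ onset_bound]) measurable
    from Bochner_Integration.integrable_diff[OF \<open>integrable \<mu> (past T n)\<close> this]
    show ?thesis by (simp add: onset_def algebra_simps)
  qed
  ultimately show ?thesis unfolding past_mean_def onset_def by (simp add: right_diff_distrib)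
qed

text \<open>The reference is moved back by g steps: the g recent factors are then seen from
  \<open>act (\<delta> g) L\<close>, and the remaining m form the past of L itself.\<close>

lemma integral_onset_split: "(\<integral>L. onset T (g + m) L \<partial>\<mu>) = (\<integral>L. past T m L * onset T g (act (\<delta> (real g)) L) \<partial>\<mu>)"
proof -
  have "(\<integral>L. onset T (g + m) L \<partial>\<mu>) = (\<integral>L. onset T (g + m) (act (\<delta> (real g)) L) \<partial>\<mu>)"
    by (rule integral_act[symmetric, OF delta_in]) measurable
  also have "\<dots> = (\<integral>L. past T m L * onset T g (act (\<delta> (real g)) L) \<partial>\<mu>)"
    unfolding onset_def past_split by (simp add: delta_add delta_0 act_mat1 mult_ac flip: act_mult)
  finally show ?thesis .
qed

text \<open>After \<open>decorrelation\<close> the average of the increment is replaced by the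
  constant \<open>kappa / T\<close>, which costs \<open>E1 / T\<close> since the past is bounded by
  1. In the decorrelation error the average of the majorant is likewise replaced by
  \<open>kappa0 / T\<close>.\<close>

lemma past_mean_step:
  fixes g m :: nat
  assumes T: "T > 0" and k0: "kappa0 \<ge> 0"
  defines "E1 \<equiv> (\<integral>L. \<bar>T * avg (real g) (onset T g) L - kappa\<bar> \<partial>\<mu>)"
    and "E0 \<equiv> (\<integral>L. \<bar>T * avg (real g) (onset T 0) L - kappa0\<bar> \<partial>\<mu>)"
  shows "\<bar>(\<integral>L. onset T (g + m) L \<partial>\<mu>) - past_mean T m * kappa / T\<bar> \<le> (E1 + kappa0 * (sqrt (6 * K / T) * mean_inverse_norm) + 2 * E0) / T"
proof -
  have av[measurable]: "avg (real g) (onset T b) \<in> borel_measurable \<mu>" for b by (rule borel_avg[OF ucont_onset])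
  have avB: "\<bar>avg (real g) (onset T b) L\<bar> \<le> 2" if "L \<in> unimodular_lattices" for b L by (rule abs_avg_le[OF ucont_onset onset_bound that])
  have iav: "integrable \<mu> (avg (real g) (onset T b))" for b by (rule integrable_bounded[OF av avB])
  have ip: "integrable \<mu> (past T m)" by (rule integrable_bounded[OF _ past_le]) measurable
  have ipa: "integrable \<mu> (\<lambda>L. past T m L * avg (real g) (onset T g) L)"
  proof (rule integrable_bounded)
    fix L assume "L \<in> unimodular_lattices"
    from mult_mono[OF past_le[of T m L] avB[OF this, of g]] show "\<bar>past T m L * avg (real g) (onset T g) L\<bar> \<le> 2" by (simp add: abs_mult)
  qed measurable
  define A where "A = (\<integral>L. past T m L * avg (real g) (onset T g) L \<partial>\<mu>)"
  have 1: "\<bar>A - past_mean T m * kappa / T\<bar> \<le> E1 / T"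
  proof -
    have "A - past_mean T m * kappa / T = (\<integral>L. past T m L * avg (real g) (onset T g) L - past T m L * (kappa / T) \<partial>\<mu>)"
      using ip ipa unfolding A_def past_mean_def by (subst Bochner_Integration.integral_diff) auto
    then have "\<bar>A - past_mean T m * kappa / T\<bar> \<le> (\<integral>L. \<bar>past T m L * avg (real g) (onset T g) L - past T m L * (kappa / T)\<bar> \<partial>\<mu>)"
      by (simp add: integral_abs_bound)
    also have "\<dots> \<le> (\<integral>L. \<bar>T * avg (real g) (onset T g) L - kappa\<bar> / T \<partial>\<mu>)"
    proof (rule integral_mono)
      show "integrable \<mu> (\<lambda>L. \<bar>past T m L * avg (real g) (onset T g) L - past T m L * (kappa / T)\<bar>)"
        using ip ipa by (intro integrable_abs Bochner_Integration.integrable_diff integrable_mult_left) auto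
      show "integrable \<mu> (\<lambda>L. \<bar>T * avg (real g) (onset T g) L - kappa\<bar> / T)" using iav by simp
      fix L
      have "\<bar>past T m L * avg (real g) (onset T g) L - past T m L * (kappa / T)\<bar> = \<bar>past T m L\<bar> * \<bar>avg (real g) (onset T g) L - kappa / T\<bar>"
        by (simp only: abs_mult flip: right_diff_distrib)
      also have "\<dots> \<le> 1 * \<bar>avg (real g) (onset T g) L - kappa / T\<bar>" by (intro mult_right_mono past_le) auto
      also have "\<dots> = \<bar>T * avg (real g) (onset T g) L - kappa\<bar> / T"
      proof -
        have "avg (real g) (onset T g) L - kappa / T = (T * avg (real g) (onset T g) L - kappa) / T" using T by (simp add: diff_divide_distrib)
        then show ?thesis using T by (simp add: abs_divide)
      qed
      finally show "\<bar>past T m L * avg (real g) (onset T g) L - past T m L * (kappa / T)\<bar> \<le> \<bar>T * avg (real g) (onset T g) L - kappa\<bar> / T" .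
    qed
    finally show ?thesis by (simp add: E1_def)
  qed
  have 2: "(\<integral>L. min 2 (past_osc T m L) * avg (real g) (onset T 0) L \<partial>\<mu>) \<le> (kappa0 * (sqrt (6 * K / T) * mean_inverse_norm) + 2 * E0) / T"
  proof -
    note HHi = integral_past_osc(1)[OF T, of m]
    have "(\<integral>L. min 2 (past_osc T m L) * avg (real g) (onset T 0) L \<partial>\<mu>) \<le> (\<integral>L. (kappa0 * past_osc T m L + 2 * \<bar>T * avg (real g) (onset T 0) L - kappa0\<bar>) / T \<partial>\<mu>)"
    proof (rule integral_mono)
      show "integrable \<mu> (\<lambda>L. min 2 (past_osc T m L) * avg (real g) (onset T 0) L)"
      proof (rule integrable_bounded)
        show "(\<lambda>L. min 2 (past_osc T m L) * avg (real g) (onset T 0) L) \<in> borel_measurable \<mu>" using HHi by measurable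
        fix L assume L: "L \<in> unimodular_lattices"
        have "\<bar>min 2 (past_osc T m L)\<bar> \<le> 2" using integral_past_osc(4)[OF T L, of m] by auto
        from mult_mono[OF this avB[OF L, of 0]] show "\<bar>min 2 (past_osc T m L) * avg (real g) (onset T 0) L\<bar> \<le> 4" by (simp add: abs_mult)
      qed
      show "integrable \<mu> (\<lambda>L. (kappa0 * past_osc T m L + 2 * \<bar>T * avg (real g) (onset T 0) L - kappa0\<bar>) / T)" using HHi iav by simp
      fix L assume "L \<in> space \<mu>"
      then have L: "L \<in> unimodular_lattices" by (simp add: space_mu)
      define a where "a = T * avg (real g) (onset T 0) L"
      define h where "h = min 2 (past_osc T m L)"
      have h: "0 \<le> h" "h \<le> 2" "h \<le> past_osc T m L" using integral_past_osc(4)[OF T L, of m] by (auto simp: h_def)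
      \<comment> \<open>The constant part meets the mean of \<open>past_osc\<close>; the deviation,
        small in L1 only, meets the bound \<open>h \<le> 2\<close>.\<close>
      have "h * a = h * kappa0 + h * (a - kappa0)" by (simp add: algebra_simps)
      also have "\<dots> \<le> past_osc T m L * kappa0 + 2 * \<bar>a - kappa0\<bar>"
      proof (intro add_mono mult_right_mono h k0)
        have "h * (a - kappa0) \<le> h * \<bar>a - kappa0\<bar>" using h by (intro mult_left_mono) auto
        also have "\<dots> \<le> 2 * \<bar>a - kappa0\<bar>" using h by (intro mult_right_mono) auto
        finally show "h * (a - kappa0) \<le> 2 * \<bar>a - kappa0\<bar>" .
      qed
      finally have "h * a / T \<le> (past_osc T m L * kappa0 + 2 * \<bar>a - kappa0\<bar>) / T" using T by (intro divide_right_mono) auto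
      then show "min 2 (past_osc T m L) * avg (real g) (onset T 0) L \<le> (kappa0 * past_osc T m L + 2 * \<bar>T * avg (real g) (onset T 0) L - kappa0\<bar>) / T"
        using T by (simp add: a_def h_def mult.commute)
    qed
    also have "\<dots> = (kappa0 * (\<integral>L. past_osc T m L \<partial>\<mu>) + 2 * E0) / T" using HHi iav by (simp add: E0_def)
    also have "\<dots> \<le> (kappa0 * (sqrt (6 * K / T) * mean_inverse_norm) + 2 * E0) / T"
      using integral_past_osc(3)[OF T, of m] k0 T by (intro divide_right_mono add_mono mult_left_mono) auto
    finally show ?thesis .
  qed
  have "\<bar>(\<integral>L. onset T (g + m) L \<partial>\<mu>) - A\<bar> \<le> (kappa0 * (sqrt (6 * K / T) * mean_inverse_norm) + 2 * E0) / T"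
    unfolding integral_onset_split A_def using decorrelation[OF T, of m g "real g"] 2 by linarith
  then have "\<bar>(\<integral>L. onset T (g + m) L \<partial>\<mu>) - past_mean T m * kappa / T\<bar> \<le> E1 / T + (kappa0 * (sqrt (6 * K / T) * mean_inverse_norm) + 2 * E0) / T"
    using 1 by linarith
  then show ?thesis by (simp add: add_divide_distrib)
qed

end

text \<open>A discrete Gronwall estimate: at most T errors of size \<open>\<epsilon> / T\<close>,
  each amplified by no more than \<open>exp (\<bar>\<kappa>\<bar> / T)\<close> per step.\<close>

lemma recursion_bound:
  fixes a :: "nat \<Rightarrow> real"
  assumes T: "T > 0" and \<epsilon>: "\<epsilon> \<ge> 0"
    and step: "\<And>t. g \<le> t \<Longrightarrow> t < n \<Longrightarrow> \<bar>a (Suc t) - (1 - \<kappa> / T) * a t\<bar> \<le> \<epsilon> / T"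
    and n: "real n \<le> T" "g \<le> n"
  shows "\<bar>a n - (1 - \<kappa> / T) ^ (n - g) * a g\<bar> \<le> \<epsilon> * exp \<bar>\<kappa>\<bar>"
proof -
  define r where "r = 1 - \<kappa> / T"
  define R where "R = exp (\<bar>\<kappa>\<bar> / T)"
  have R1: "R \<ge> 1" using T by (simp add: R_def)
  have rR: "\<bar>r\<bar> \<le> R"
  proof -
    have "\<bar>r\<bar> \<le> 1 + \<bar>\<kappa> / T\<bar>" unfolding r_def by linarith
    also have "\<dots> \<le> R" unfolding R_def using T exp_ge_add_one_self[of "\<bar>\<kappa>\<bar> / T"] by (simp add: abs_divide)
    finally show ?thesis .
  qed
  have "\<bar>a (g + j) - r ^ j * a g\<bar> \<le> real j * (\<epsilon> / T) * R ^ j" if "g + j \<le> n" for j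
    using that
  proof (induction j)
    case (Suc j)
    have "a (g + Suc j) - r ^ Suc j * a g = (a (Suc (g + j)) - r * a (g + j)) + r * (a (g + j) - r ^ j * a g)" by (simp add: algebra_simps)
    then have "\<bar>a (g + Suc j) - r ^ Suc j * a g\<bar> \<le> \<bar>a (Suc (g + j)) - r * a (g + j)\<bar> + \<bar>r\<bar> * \<bar>a (g + j) - r ^ j * a g\<bar>"
      by (metis abs_mult abs_triangle_ineq)
    also have "\<dots> \<le> \<epsilon> / T + R * (real j * (\<epsilon> / T) * R ^ j)"
      using step[of "g + j"] Suc rR R1 unfolding r_def[symmetric] by (intro add_mono mult_mono) auto
    also have "\<dots> \<le> (\<epsilon> / T) * R ^ Suc j + R * (real j * (\<epsilon> / T) * R ^ j)"
      using R1 \<epsilon> T one_le_power[OF R1, of "Suc j"] mult_left_mono[of 1 "R ^ Suc j" "\<epsilon> / T"] by (intro add_right_mono) auto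
    also have "\<dots> = real (Suc j) * (\<epsilon> / T) * R ^ Suc j" by (simp add: algebra_simps)
    finally show ?case .
  qed simp
  from this[of "n - g"] have "\<bar>a n - r ^ (n - g) * a g\<bar> \<le> real (n - g) * (\<epsilon> / T) * R ^ (n - g)" using n by simp
  also have "\<dots> \<le> (T * (\<epsilon> / T)) * exp \<bar>\<kappa>\<bar>"
  proof (intro mult_mono)
    show "real (n - g) \<le> T" using n by linarith
    have "R ^ (n - g) = exp (real (n - g) * (\<bar>\<kappa>\<bar> / T))" unfolding R_def by (simp only: exp_of_nat_mult)
    also have "\<dots> \<le> exp (T * (\<bar>\<kappa>\<bar> / T))" using T n by (subst exp_le_cancel_iff, intro mult_right_mono) auto
    finally show "R ^ (n - g) \<le> exp \<bar>\<kappa>\<bar>" using T by simp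
  qed (use \<epsilon> T R1 in auto)
  finally show ?thesis using T by (simp add: r_def)
qed

text \<open>
  Equidistribution needs a factor above 1/2 in front of \<open>ln n\<close>, so that \<open>exp (gap n) / sqrt n\<close> diverges, and
  \<open>onset_approx\<close> one below 3/4, so that \<open>exp (4 * gap n) / n ^ 3\<close> vanishes.
\<close>

definition gap :: "nat \<Rightarrow> nat" where "gap n = nat \<lfloor>5 / 8 * ln (real n)\<rfloor>"

lemma gap_bounds:
  assumes "n \<ge> 1" shows "5 / 8 * ln (real n) - 1 \<le> real (gap n)" "real (gap n) \<le> 5 / 8 * ln (real n)"
proof -
  have "0 \<le> ln (real n)" using assms by simp
  then have "0 \<le> \<lfloor>5 / 8 * ln (real n)\<rfloor>" by simp
  then have "real (gap n) = of_int \<lfloor>5 / 8 * ln (real n)\<rfloor>" by (simp add: gap_def)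
  then show "5 / 8 * ln (real n) - 1 \<le> real (gap n)" "real (gap n) \<le> 5 / 8 * ln (real n)" by linarith+
qed

lemma gap_growth: "filterlim (\<lambda>n. exp (real (gap n)) / sqrt (real n)) at_top sequentially"
proof (rule filterlim_at_top_mono)
  show "filterlim (\<lambda>n. exp (5 / 8 * ln (real n) - 1) / sqrt (real n)) at_top sequentially" by real_asymp
  show "\<forall>\<^sub>F n in sequentially. exp (5 / 8 * ln (real n) - 1) / sqrt (real n) \<le> exp (real (gap n)) / sqrt (real n)"
    using eventually_ge_at_top[of 1] by eventually_elim (use gap_bounds in \<open>auto intro!: divide_right_mono\<close>)
qed

lemma gap_div: "(\<lambda>n. real (gap n) / real n) \<longlonglongrightarrow> 0"
proof (rule tendsto_sandwich[of "\<lambda>_. 0"])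
  show "(\<lambda>n. 5 / 8 * ln (real n) / real n) \<longlonglongrightarrow> 0" by real_asymp
  show "\<forall>\<^sub>F n in sequentially. real (gap n) / real n \<le> 5 / 8 * ln (real n) / real n"
    using eventually_ge_at_top[of 1] by eventually_elim (intro divide_right_mono gap_bounds; simp)
qed auto

lemma gap_err: "(\<lambda>n. real n * (K / (real n)\<^sup>2 + 2 * K\<^sup>2 * real (gap n) * exp (4 * real (gap n)) / real n ^ 4)) \<longlonglongrightarrow> 0"
proof -
  have "(\<lambda>n. real n * (real (gap n) * exp (4 * real (gap n)) / real n ^ 4)) \<longlonglongrightarrow> 0"
  proof (rule tendsto_sandwich[of "\<lambda>_. 0"])
    \<comment> \<open>The exponential is n to the power 5/2, so the whole is of order ln n / sqrt
      n.\<close>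
    show "(\<lambda>n. real n * (5 / 8 * ln (real n) * exp (4 * (5 / 8 * ln (real n))) / real n ^ 4)) \<longlonglongrightarrow> 0" by real_asymp
    show "\<forall>\<^sub>F n in sequentially. real n * (real (gap n) * exp (4 * real (gap n)) / real n ^ 4)
        \<le> real n * (5 / 8 * ln (real n) * exp (4 * (5 / 8 * ln (real n))) / real n ^ 4)"
      using eventually_ge_at_top[of 1]
    proof eventually_elim
      case (elim n)
      then show ?case using gap_bounds[OF elim] by (intro mult_left_mono divide_right_mono mult_mono) auto
    qed
  qed auto
  moreover have "(\<lambda>n. real n * (1 / (real n)\<^sup>2)) \<longlonglongrightarrow> 0" by real_asymp
  ultimately have "(\<lambda>n. K * (real n * (1 / (real n)\<^sup>2)) + 2 * K\<^sup>2 * (real n * (real (gap n) * exp (4 * real (gap n)) / real n ^ 4))) \<longlonglongrightarrow> K * 0 + 2 * K\<^sup>2 * 0"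
    by (intro tendsto_intros)
  then show ?thesis by (simp add: algebra_simps)
qed

text \<open>The missing \<open>gap n\<close> factors differ from 1 by O(1/n) and number o(n), so
  their product tends to 1: Bernoulli's inequality from below, the exponential from above.\<close>

lemma power_gap_tendsto: "(\<lambda>n. (1 - \<kappa> / real n) ^ (n - gap n)) \<longlonglongrightarrow> exp (- \<kappa>)"
proof -
  have 1: "(\<lambda>n. (1 + (- \<kappa>) / real n) ^ n) \<longlonglongrightarrow> exp (- \<kappa>)" by (rule tendsto_exp_limit_sequentially)
  have big: "\<forall>\<^sub>F n in sequentially. real n > \<bar>\<kappa>\<bar> + 1"
    using filterlim_real_sequentially by (simp add: filterlim_at_top_dense)
  have x: "- \<kappa> / real n > - 1" if "real n > \<bar>\<kappa>\<bar> + 1" for n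
  proof -
    have "\<kappa> < real n" "0 < real n" using that abs_ge_self[of \<kappa>] by linarith+
    then have "\<kappa> / real n < 1" by (simp add: divide_less_eq)
    then show ?thesis by simp
  qed
  have 2: "(\<lambda>n. (1 + (- \<kappa>) / real n) ^ gap n) \<longlonglongrightarrow> 1"
  proof (rule tendsto_sandwich)
    show "\<forall>\<^sub>F n in sequentially. 1 + (- \<kappa>) * (real (gap n) / real n) \<le> (1 + (- \<kappa>) / real n) ^ gap n"
      using big
    proof eventually_elim
      case (elim n)
      show ?case using Bernoulli_inequality[of "- \<kappa> / real n" "gap n"] x[OF elim] by (simp add: mult.commute)
    qed
    show "\<forall>\<^sub>F n in sequentially. (1 + (- \<kappa>) / real n) ^ gap n \<le> exp ((- \<kappa>) * (real (gap n) / real n))"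
      using big
    proof eventually_elim
      case (elim n)
      have "(1 + (- \<kappa>) / real n) ^ gap n \<le> exp (- \<kappa> / real n) ^ gap n"
        using x[OF elim] exp_ge_add_one_self[of "- \<kappa> / real n"] by (intro power_mono) auto
      then show ?case by (simp add: mult.commute flip: exp_of_nat_mult)
    qed
    show "(\<lambda>n. 1 + (- \<kappa>) * (real (gap n) / real n)) \<longlonglongrightarrow> 1"
      using tendsto_add[OF tendsto_const tendsto_mult[OF tendsto_const gap_div], of 1 "- \<kappa>"] by simp
    show "(\<lambda>n. exp ((- \<kappa>) * (real (gap n) / real n))) \<longlonglongrightarrow> 1"
      using tendsto_exp[OF tendsto_mult[OF tendsto_const gap_div, of "- \<kappa>"]] by simp
  qed
  have "(\<lambda>n. (1 + (- \<kappa>) / real n) ^ n / (1 + (- \<kappa>) / real n) ^ gap n) \<longlonglongrightarrow> exp (- \<kappa>) / 1"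
    by (intro tendsto_divide 1 2) simp
  then have "(\<lambda>n. (1 + (- \<kappa>) / real n) ^ n / (1 + (- \<kappa>) / real n) ^ gap n) \<longlonglongrightarrow> exp (- \<kappa>)" by simp
  moreover have "\<forall>\<^sub>F n in sequentially. (1 + (- \<kappa>) / real n) ^ n / (1 + (- \<kappa>) / real n) ^ gap n = (1 - \<kappa> / real n) ^ (n - gap n)"
    using big order_tendstoD(2)[OF gap_div zero_less_one]
  proof eventually_elim
    case (elim n)
    then have "gap n \<le> n" by (simp add: divide_less_eq split: if_splits)
    moreover have "1 - \<kappa> / real n \<noteq> 0" using x[OF elim(1)] by linarith
    ultimately show ?case using power_diff[of "1 - \<kappa> / real n" "gap n" n] by simp
  qed
  ultimately show ?thesis by (rule Lim_transform_eventually)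
qed

context haar_test
begin

lemma kappa0_nonneg: "kappa0 \<ge> 0"
proof -
  have "0 \<le> Psi 0 w" for w using phi_le1 by (simp add: Psi_def)
  then show ?thesis unfolding kappa0_def using czeta_pos by (intro mult_nonneg_nonneg integral_nonneg_AE) auto
qed

theorem char_limit:
  "(\<lambda>n. \<integral>L. (\<Prod>t<n. \<phi> (Xc (act (\<delta> (real t)) L) / real n)) \<partial>\<mu>) \<longlonglongrightarrow> exp (- kappa)"
proof -
  define a where "a n t = past_mean (real n) t" for n t :: nat
  have shift: "(\<integral>L. (\<Prod>t<n. \<phi> (Xc (act (\<delta> (real t)) L) / T)) \<partial>\<mu>) = past_mean T n" for T n
  proof -
    \<comment> \<open>Seen from \<open>act (\<delta> n) L\<close>, i steps back is time t = n - i;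
      so i in {1..n} covers t in {0..n-1}.\<close>
    have eq: "past T n (act (\<delta> (real n)) L) = (\<Prod>t<n. \<phi> (Xc (act (\<delta> (real t)) L) / T))" for L
    proof -
      have "past T n (act (\<delta> (real n)) L) = (\<Prod>i\<in>{1..n}. \<phi> (Xc (act (\<delta> (real n - real i)) L) / T))"
        unfolding past_def by (simp add: delta_add add.commute[of "- _"] flip: act_mult)
      also have "\<dots> = (\<Prod>t<n. \<phi> (Xc (act (\<delta> (real t)) L) / T))"
        by (rule prod.reindex_bij_witness[of _ "\<lambda>t. n - t" "\<lambda>i. n - i"]) (auto simp: of_nat_diff)
      finally show ?thesis .
    qed
    have "past_mean T n = (\<integral>L. past T n (act (\<delta> (real n)) L) \<partial>\<mu>)"
      unfolding past_mean_def by (rule integral_act[symmetric, OF delta_in]) measurable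
    then show ?thesis unfolding eq by simp
  qed
  define E1 where "E1 n = (\<integral>L. \<bar>real n * avg (real (gap n)) (onset (real n) (gap n)) L - kappa\<bar> \<partial>\<mu>)" for n
  define E0 where "E0 n = (\<integral>L. \<bar>real n * avg (real (gap n)) (onset (real n) 0) L - kappa0\<bar> \<partial>\<mu>)" for n
  have gl: "filterlim gap at_top sequentially"
  proof -
    have "filterlim (\<lambda>n. real (gap n)) at_top sequentially"
    proof (rule filterlim_at_top_mono)
      show "filterlim (\<lambda>n. 5 / 8 * ln (real n) - 1) at_top sequentially" by real_asymp
      show "\<forall>\<^sub>F n in sequentially. 5 / 8 * ln (real n) - 1 \<le> real (gap n)"
        using eventually_ge_at_top[of 1] by eventually_elim (rule gap_bounds)
    qed
    then show ?thesis by (simp add: filterlim_sequentially_iff_filterlim_real)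
  qed
  have E1: "E1 \<longlonglongrightarrow> 0" unfolding E1_def[abs_def] kappa_def
    by (rule onset_equidistribution[OF gap_growth gap_err borel_Psi_lim integrable_Psi_lim filterlim_compose[OF Psi_L1 gl]])
  have E0: "E0 \<longlonglongrightarrow> 0" unfolding E0_def[abs_def] kappa0_def
  proof (rule onset_equidistribution[OF gap_growth _ borel_Psi integrable_Psi])
    have "(\<lambda>n. K * (real n * (1 / (real n)\<^sup>2))) \<longlonglongrightarrow> K * 0" by (intro tendsto_intros) real_asymp
    then show "(\<lambda>n. real n * (K / (real n)\<^sup>2 + 2 * K\<^sup>2 * real 0 * exp (4 * real 0) / real n ^ 4)) \<longlonglongrightarrow> 0"
      by (simp add: mult.commute)
  qed simp
  \<comment> \<open>The last term pays for replacing the mean at time \<open>t - gap n\<close> by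
    the one at time t: \<open>gap n\<close> increments, each at most
    \<open>(kappa0 + E0 n) / n\<close>.\<close>
  define \<epsilon> where "\<epsilon> n = E1 n + kappa0 * (sqrt (6 * K / real n) * mean_inverse_norm) + 2 * E0 n + \<bar>kappa\<bar> * (real (gap n) / real n * (kappa0 + E0 n))" for n
  have eps: "\<epsilon> \<longlonglongrightarrow> 0"
  proof -
    have "(\<lambda>n. sqrt (6 * K / real n)) \<longlonglongrightarrow> sqrt 0"
      by (intro tendsto_real_sqrt tendsto_divide_0[OF tendsto_const] filterlim_at_top_imp_at_infinity filterlim_real_sequentially)
    then have "\<epsilon> \<longlonglongrightarrow> 0 + kappa0 * (sqrt 0 * mean_inverse_norm) + 2 * 0 + \<bar>kappa\<bar> * (0 * (kappa0 + 0))"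
      unfolding \<epsilon>_def[abs_def] by (intro tendsto_intros E1 E0 gap_div)
    then show ?thesis by simp
  qed
  \<comment> \<open>Averaging preserves the mean, so the L1 limit of the averages controls the mean
    of the majorant and thereby every increment.\<close>
  have f0: "(\<integral>L. onset (real n) 0 L \<partial>\<mu>) \<le> (kappa0 + E0 n) / real n" if "n \<ge> 1" for n
  proof -
    have i: "integrable \<mu> (avg (real (gap n)) (onset (real n) 0))"
      by (rule integrable_bounded[OF borel_avg[OF ucont_onset] abs_avg_le[OF ucont_onset onset_bound]])
    have "real n * (\<integral>L. onset (real n) 0 L \<partial>\<mu>) = (\<integral>L. real n * avg (real (gap n)) (onset (real n) 0) L \<partial>\<mu>)"
      using i by (simp add: integral_avg[OF ucont_onset onset_bound])
    also have "\<dots> \<le> (\<integral>L. kappa0 + \<bar>real n * avg (real (gap n)) (onset (real n) 0) L - kappa0\<bar> \<partial>\<mu>)"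
      using i by (intro integral_mono) auto
    also have "\<dots> = kappa0 + E0 n" using i by (simp add: E0_def prob_space)
    finally show ?thesis using that by (simp add: field_simps)
  qed
  have d1: "\<bar>a n t - a n (Suc t)\<bar> \<le> (kappa0 + E0 n) / real n" if "n \<ge> 1" for n t
  proof -
    have "\<bar>a n t - a n (Suc t)\<bar> \<le> (\<integral>L. \<bar>onset (real n) t L\<bar> \<partial>\<mu>)" unfolding a_def past_mean_Suc by (rule integral_abs_bound)
    also have "\<dots> \<le> (\<integral>L. onset (real n) 0 L \<partial>\<mu>)"
      using past_meas(2) by (intro integral_mono onset_le integrable_abs integrable_bounded[OF _ onset_bound])
    finally show ?thesis using f0[OF that] by linarith
  qed
  have dj: "\<bar>a n t - a n (t + j)\<bar> \<le> real j * ((kappa0 + E0 n) / real n)" if "n \<ge> 1" for n t j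
  proof (induction j)
    case (Suc j)
    have "\<bar>a n t - a n (t + Suc j)\<bar> \<le> \<bar>a n t - a n (t + j)\<bar> + \<bar>a n (t + j) - a n (Suc (t + j))\<bar>" by simp
    also have "\<dots> \<le> real j * ((kappa0 + E0 n) / real n) + (kappa0 + E0 n) / real n" by (intro add_mono Suc d1 that)
    finally show ?case by (simp only: of_nat_Suc distrib_right mult_1)
  qed simp
  have a1: "\<bar>a n t\<bar> \<le> 1" for n t
  proof -
    have "\<bar>a n t\<bar> \<le> (\<integral>L. \<bar>past (real n) t L\<bar> \<partial>\<mu>)" unfolding a_def past_mean_def by (rule integral_abs_bound)
    also have "\<dots> \<le> (\<integral>L. 1 \<partial>\<mu>)"
      using past_meas(1) by (intro integral_mono integrable_abs integrable_bounded[OF _ past_le] past_le) auto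
    finally show ?thesis by (simp add: prob_space)
  qed
  have E0n: "E0 n \<ge> 0" "E1 n \<ge> 0" for n by (auto simp: E0_def E1_def)
  have step: "\<bar>a n (Suc t) - (1 - kappa / real n) * a n t\<bar> \<le> \<epsilon> n / real n" if n: "n \<ge> 1" and t: "gap n \<le> t" for n t
  proof -
    define m where "m = t - gap n"
    have tm: "t = gap n + m" using t by (simp add: m_def)
    have n0: "real n > 0" using n by simp
    have 1: "\<bar>(a n t - a n (Suc t)) - a n m * kappa / real n\<bar> \<le> (E1 n + kappa0 * (sqrt (6 * K / real n) * mean_inverse_norm) + 2 * E0 n) / real n"
      using past_mean_step[OF n0 kappa0_nonneg, of "gap n" m] unfolding a_def past_mean_Suc E1_def E0_def tm by simp
    have "\<bar>a n m * kappa / real n - a n t * kappa / real n\<bar> = \<bar>kappa\<bar> / real n * \<bar>a n m - a n t\<bar>"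
      using n0 by (simp add: abs_mult abs_divide flip: left_diff_distrib diff_divide_distrib)
    also have "\<dots> \<le> \<bar>kappa\<bar> / real n * (real (gap n) * ((kappa0 + E0 n) / real n))"
      using dj[OF n, of m "gap n"] n0 by (intro mult_left_mono) (auto simp: tm add.commute)
    also have "\<dots> = \<bar>kappa\<bar> * (real (gap n) / real n * (kappa0 + E0 n)) / real n" by simp
    finally have 2: "\<bar>a n m * kappa / real n - a n t * kappa / real n\<bar> \<le> \<bar>kappa\<bar> * (real (gap n) / real n * (kappa0 + E0 n)) / real n" .
    have "a n (Suc t) - (1 - kappa / real n) * a n t = - ((a n t - a n (Suc t)) - a n m * kappa / real n) - (a n m * kappa / real n - a n t * kappa / real n)"
      by (simp add: algebra_simps)
    then have "\<bar>a n (Suc t) - (1 - kappa / real n) * a n t\<bar> \<le> \<bar>(a n t - a n (Suc t)) - a n m * kappa / real n\<bar> + \<bar>a n m * kappa / real n - a n t * kappa / real n\<bar>"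
      using abs_triangle_ineq4[of "- ((a n t - a n (Suc t)) - a n m * kappa / real n)" "a n m * kappa / real n - a n t * kappa / real n"] by (simp only: abs_minus_cancel)
    also have "\<dots> \<le> \<epsilon> n / real n" using add_mono[OF 1 2] by (simp only: \<epsilon>_def add_divide_distrib)
    finally show ?thesis .
  qed
  have e0: "\<epsilon> n \<ge> 0" if n: "n \<ge> 1" for n
  proof -
    \<comment> \<open>Nonnegativity is read off an instance of \<open>step\<close>, which bounds an
      absolute value.\<close>
    have "0 \<le> \<epsilon> n / real n" using step[OF n, of "gap n"] by linarith
    then show ?thesis using n by (simp add: zero_le_divide_iff)
  qed
  \<comment> \<open>The recursion starts at t = \<open>gap n\<close>; by then the mean has moved by
    only O(\<open>gap n\<close> / n) from its initial value 1.\<close>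
  have lim1: "(\<lambda>n. a n (gap n)) \<longlonglongrightarrow> 1"
  proof -
    have a0: "a n 0 = 1" for n by (simp add: a_def past_mean_def past_def prob_space)
    have "(\<lambda>n. a n (gap n) - 1) \<longlonglongrightarrow> 0"
    proof (rule Lim_null_comparison)
      show "\<forall>\<^sub>F n in sequentially. norm (a n (gap n) - 1) \<le> real (gap n) / real n * (kappa0 + E0 n)"
        using eventually_ge_at_top[of 1]
      proof eventually_elim
        case (elim n)
        show ?case using dj[OF elim, of 0 "gap n"] by (simp add: a0 abs_minus_commute)
      qed
      have "(\<lambda>n. real (gap n) / real n * (kappa0 + E0 n)) \<longlonglongrightarrow> 0 * (kappa0 + 0)" by (intro tendsto_intros gap_div E0)
      then show "(\<lambda>n. real (gap n) / real n * (kappa0 + E0 n)) \<longlonglongrightarrow> 0" by simp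
    qed
    then show ?thesis by (rule LIM_zero_cancel)
  qed
  have "(\<lambda>n. a n n - (1 - kappa / real n) ^ (n - gap n) * a n (gap n)) \<longlonglongrightarrow> 0"
  proof (rule Lim_null_comparison)
    show "\<forall>\<^sub>F n in sequentially. norm (a n n - (1 - kappa / real n) ^ (n - gap n) * a n (gap n)) \<le> \<epsilon> n * exp \<bar>kappa\<bar>"
      using eventually_ge_at_top[of 1] order_tendstoD(2)[OF gap_div zero_less_one]
    proof eventually_elim
      case (elim n)
      then have g: "gap n \<le> n" by (simp add: divide_less_eq split: if_splits)
      show ?case unfolding real_norm_def
        using recursion_bound[of "real n" "\<epsilon> n" "gap n" n "a n" kappa] e0[OF elim(1)] step[OF elim(1)] elim g by simp
    qed
    show "(\<lambda>n. \<epsilon> n * exp \<bar>kappa\<bar>) \<longlonglongrightarrow> 0" using tendsto_mult[OF eps tendsto_const] by simp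
  qed
  from tendsto_add[OF this tendsto_mult[OF power_gap_tendsto[of kappa] lim1]] have "(\<lambda>n. a n n) \<longlonglongrightarrow> exp (- kappa)" by simp
  then show ?thesis unfolding shift a_def .
qed

end

section \<open>Scaling and positivity of the exponent\<close>

context test_fun
begin

text \<open>The scaled quadratic and Lipschitz bounds carry the factors \<open>u\<^sup>2\<close> and
  \<open>u\<close>; the sum with 1 dominates both and keeps the constant at least 1.\<close>

lemma test_fun_scale:
  assumes u: "u > 0" shows "test_fun (\<lambda>s. \<phi> (u * s)) (K * (1 + u + u\<^sup>2))"
proof
  show "\<bar>\<phi> (u * s)\<bar> \<le> 1" for s by (rule phi_le)
  show "1 - \<phi> (u * s) \<le> K * (1 + u + u\<^sup>2) * s\<^sup>2" for s
  proof -
    have "1 - \<phi> (u * s) \<le> K * (u * s)\<^sup>2" by (rule phi_sq)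
    also have "\<dots> = K * u\<^sup>2 * s\<^sup>2" by (simp add: power_mult_distrib)
    also have "\<dots> \<le> K * (1 + u + u\<^sup>2) * s\<^sup>2" using u K1 by (intro mult_right_mono mult_left_mono) auto
    finally show ?thesis .
  qed
  show "\<bar>\<phi> (u * s) - \<phi> (u * t)\<bar> \<le> K * (1 + u + u\<^sup>2) * \<bar>s - t\<bar>" for s t
  proof -
    have "\<bar>\<phi> (u * s) - \<phi> (u * t)\<bar> \<le> K * \<bar>u * s - u * t\<bar>" by (rule phi_lip)
    also have "\<bar>u * s - u * t\<bar> = u * \<bar>s - t\<bar>" using u by (simp add: abs_mult flip: right_diff_distrib)
    also have "K * (u * \<bar>s - t\<bar>) = K * u * \<bar>s - t\<bar>" by simp
    also have "\<dots> \<le> K * (1 + u + u\<^sup>2) * \<bar>s - t\<bar>" using u K1 by (intro mult_right_mono mult_left_mono) auto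
    finally show ?thesis .
  qed
  have "K * 1 \<le> K * (1 + u + u\<^sup>2)" using u K1 by (intro mult_left_mono) auto
  then show "1 \<le> K * (1 + u + u\<^sup>2)" using K1 by linarith
qed

lemma test_fun_square: "test_fun (\<lambda>s. (\<phi> s)\<^sup>2) (2 * K)"
proof
  show "\<bar>(\<phi> s)\<^sup>2\<bar> \<le> 1" for s using power_mono[OF phi_le[of s], of 2] by simp
  show "1 - (\<phi> s)\<^sup>2 \<le> 2 * K * s\<^sup>2" for s
  proof -
    have "1 - (\<phi> s)\<^sup>2 = (1 - \<phi> s) * (1 + \<phi> s)" by (simp add: power2_eq_square algebra_simps)
    also have "\<dots> \<le> (K * s\<^sup>2) * 2" using phi_le[of s] phi_sq[of s] K1 by (intro mult_mono) auto
    finally show ?thesis by simp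
  qed
  show "\<bar>(\<phi> s)\<^sup>2 - (\<phi> t)\<^sup>2\<bar> \<le> 2 * K * \<bar>s - t\<bar>" for s t
  proof -
    have "(\<phi> s)\<^sup>2 - (\<phi> t)\<^sup>2 = (\<phi> s - \<phi> t) * (\<phi> s + \<phi> t)" by (simp add: power2_eq_square algebra_simps)
    then have "\<bar>(\<phi> s)\<^sup>2 - (\<phi> t)\<^sup>2\<bar> = \<bar>\<phi> s - \<phi> t\<bar> * \<bar>\<phi> s + \<phi> t\<bar>" by (simp add: abs_mult)
    also have "\<dots> \<le> (K * \<bar>s - t\<bar>) * 2" using phi_le[of s] phi_le[of t] phi_lip[of s t] K1 by (intro mult_mono) auto
    finally show ?thesis by simp
  qed
  show "1 \<le> 2 * K" using K1 by simp
qed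

text \<open>All arguments of \<open>\<phi>\<close> are inverse squared lengths, so a factor u is a
  dilation of the plane by \<open>1 / sqrt u\<close>, and areas scale as squared lengths.\<close>

lemma kappa_scale:
  assumes u: "u > 0" shows "test_fun.kappa (\<lambda>s. \<phi> (u * s)) = u * kappa"
proof -
  interpret u: test_fun "\<lambda>s. \<phi> (u * s)" "K * (1 + u + u\<^sup>2)" by (rule test_fun_scale[OF u])
  have n: "1 / (norm ((1 / sqrt u) *\<^sub>R w))\<^sup>2 = u * (1 / (norm w)\<^sup>2)" for w :: "real \<times> real"
    using u by (simp add: power_divide)
  have "u.Psi b w = Psi b ((1 / sqrt u) *\<^sub>R w)" for b w
    unfolding u.Psi_def Psi_def lact_scaleR n using u by (simp add: divide_le_0_iff)
  then have "u.Psi_lim w = Psi_lim ((1 / sqrt u) *\<^sub>R w)" for w by (simp add: u.Psi_lim_def Psi_lim_def)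
  then have "u.kappa = czeta * (\<integral>w. Psi_lim ((1 / sqrt u) *\<^sub>R w) \<partial>lborel)" by (simp add: u.kappa_def)
  also have "(\<integral>w. Psi_lim ((1 / sqrt u) *\<^sub>R w) \<partial>lborel) = u * (\<integral>w. Psi_lim w \<partial>lborel)"
    using integral_scale_plane(1)[OF borel_Psi_lim, of "1 / sqrt u"] u by (simp add: power_divide)
  finally show ?thesis by (simp add: kappa_def)
qed

text \<open>The integrand is nonnegative. At great height the past factors are so close to 1 that
  their product is at least 1/2, while the last factor is positive because
  \<open>1 / (norm w)\<^sup>2\<close> lies below \<open>s0\<close>.\<close>

lemma kappa_pos_nonneg:
  assumes nn: "\<And>s. 0 \<le> \<phi> s" and s0: "s0 > 0" "\<And>s. 0 < s \<Longrightarrow> s < s0 \<Longrightarrow> \<phi> s < 1"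
  shows "kappa > 0"
proof -
  have P0: "0 \<le> Psi_lim w" for w
  proof (rule LIMSEQ_le_const[OF Psi_tendsto])
    have "0 \<le> Psi b w" for b using phi_le1 nn by (auto simp: Psi_def intro!: mult_nonneg_nonneg prod_nonneg)
    then show "\<exists>N. \<forall>n\<ge>N. 0 \<le> Psi n w" by blast
  qed
  \<comment> \<open>\<open>2 * K\<close> makes the deviations of the past factors sum to at most
    1/2, \<open>1 / s0\<close> keeps the argument of the last factor below \<open>s0\<close>, and 1
    ensures that squaring does not shrink heights.\<close>
  define w0 where "w0 = 2 * K + 1 / s0 + 1"
  have w0: "w0 \<ge> 1" "w0 \<ge> 2 * K" "w0 > 1 / s0" using K1 s0 by (auto simp: w0_def add_nonneg_pos)
  have pos: "Psi_lim w > 0" if w: "snd w > w0" for w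
  proof -
    have sw: "snd w > 0" "snd w \<ge> 1" using w w0 by auto
    have nw: "(norm w)\<^sup>2 \<ge> (snd w)\<^sup>2" using abs_le_norm_Pair(2)[of w] sw by (intro power_mono) auto
    have s1: "snd w * 1 \<le> (snd w)\<^sup>2" unfolding power2_eq_square using sw by (intro mult_left_mono) auto
    have n1: "(norm w)\<^sup>2 > 1 / s0" "(norm w)\<^sup>2 > 0" using nw s1 w w0 sw by linarith+
    have "1 / (norm w)\<^sup>2 < s0" using n1 s0 by (simp add: field_simps)
    then have d: "1 - \<phi> (1 / (norm w)\<^sup>2) > 0" using s0(2)[of "1 / (norm w)\<^sup>2"] n1 by simp
    have "(1 / 2) * (1 - \<phi> (1 / (norm w)\<^sup>2)) \<le> Psi b w" for b
    proof -
      define a where "a i = \<phi> (1 / (norm (lact (\<delta> (- real i)) w))\<^sup>2)" for i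
      have ai: "\<bar>a i - 1\<bar> \<le> (1 / 2) * (1 / 2) ^ i" for i
      proof -
        define m where "m = (norm (lact (\<delta> (- real i)) w))\<^sup>2"
        have "(exp (real i) * snd w)\<^sup>2 \<le> m" unfolding m_def lact_delta by (simp add: norm_Pair)
        moreover have e1: "1 \<le> exp (real i)" by simp
        have "exp (real i) * snd w \<le> (exp (real i) * snd w)\<^sup>2"
          unfolding power2_eq_square using sw mult_mono[OF e1 sw(2)] mult_left_mono[of 1 "exp (real i) * snd w" "exp (real i) * snd w"] by simp
        ultimately have m: "exp (real i) * snd w \<le> m" by linarith
        have m1: "2 ^ i \<le> exp (real i)"
        proof -
          have "(2::real) ^ i \<le> exp 1 ^ i" using exp_ge_add_one_self[of 1] by (intro power_mono) auto
          then show ?thesis by (simp flip: exp_of_nat_mult)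
        qed
        have "2 ^ i * (2 * K) \<le> exp (real i) * snd w" using m1 w w0 K1 by (intro mult_mono) auto
        then have m2: "2 ^ i * (2 * K) \<le> m" using m by linarith
        have "1 * 1 \<le> exp (real i) * snd w" using sw by (intro mult_mono) auto
        then have m3: "m \<ge> 1" using m by linarith
        have "\<bar>a i - 1\<bar> = 1 - \<phi> (1 / m)" using phi_le1[of "1 / m"] by (simp add: a_def m_def)
        also have "\<dots> \<le> K * (1 / m)\<^sup>2" by (rule phi_sq)
        also have "\<dots> \<le> K * (1 / m)"
        proof (intro mult_left_mono)
          have "1 / m \<le> 1" using m3 by simp
          then show "(1 / m)\<^sup>2 \<le> 1 / m" unfolding power2_eq_square using m3 mult_right_mono[of "1 / m" 1 "1 / m"] by simp
        qed (use K1 in auto)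
        also have "\<dots> \<le> K * (1 / (2 ^ i * (2 * K)))"
          using K1 m2 m3 by (intro mult_left_mono divide_left_mono) auto
        also have "\<dots> = (1 / 2) * (1 / 2) ^ i" using K1 by (simp add: power_divide)
        finally show ?thesis .
      qed
      have "\<bar>(\<Prod>i\<in>{1..b}. a i) - (\<Prod>i\<in>{1..b}. 1)\<bar> \<le> (\<Sum>i\<in>{1..b}. \<bar>a i - 1\<bar>)"
        using norm_prod_diff[of "{1..b}" a "\<lambda>_. 1"] phi_le by (simp add: a_def)
      also have "\<dots> \<le> (\<Sum>i\<in>{1..b}. (1 / 2) * (1 / 2) ^ i)" by (intro sum_mono ai)
      also have "\<dots> = (1 / 2) * (\<Sum>i\<in>{1..b}. (1 / 2) ^ i)" by (simp add: sum_distrib_left)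
      also have "(\<Sum>i\<in>{1..b}. (1 / 2 :: real) ^ i) = 1 - (1 / 2) ^ b" by (induction b) auto
      finally have "\<bar>(\<Prod>i\<in>{1..b}. a i) - 1\<bar> \<le> (1 / 2) * (1 - (1 / 2) ^ b)" by simp
      moreover have "(1 / 2) * (1 - (1 / 2) ^ b) \<le> (1 / 2 :: real)" by simp
      ultimately have "\<bar>(\<Prod>i\<in>{1..b}. a i) - 1\<bar> \<le> 1 / 2" by (rule order_trans)
      then have "1 / 2 \<le> (\<Prod>i\<in>{1..b}. a i)" by linarith
      then have "(1 / 2) * (1 - \<phi> (1 / (norm w)\<^sup>2)) \<le> (\<Prod>i\<in>{1..b}. a i) * (1 - \<phi> (1 / (norm w)\<^sup>2))"
        using d by (intro mult_right_mono) auto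
      then show ?thesis using sw by (simp add: Psi_def a_def)
    qed
    then have "(1 / 2) * (1 - \<phi> (1 / (norm w)\<^sup>2)) \<le> Psi_lim w"
      using LIMSEQ_le_const[OF Psi_tendsto] by blast
    moreover have "0 < (1 / 2) * (1 - \<phi> (1 / (norm w)\<^sup>2))" using d by simp
    ultimately show ?thesis by (rule order_less_le_trans[rotated])
  qed
  have "(\<integral>w. Psi_lim w \<partial>lborel) \<noteq> 0"
  proof
    assume "(\<integral>w. Psi_lim w \<partial>lborel) = 0"
    then have "AE w in lborel. Psi_lim w = 0"
      using integral_nonneg_eq_0_iff_AE[OF integrable_Psi_lim] P0 by auto
    \<comment> \<open>A unit square above height \<open>w0\<close> would then be a null set.\<close>
    then have "AE w in lborel. w \<notin> {0..1::real} \<times> {w0 + 1..w0 + 2}"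
    proof eventually_elim
      case (elim w)
      then have "\<not> snd w > w0" using pos[of w] by auto
      then show ?case by auto
    qed
    moreover have "{0..1::real} \<times> {w0 + 1..w0 + 2} \<in> sets (lborel :: (real \<times> real) measure)"
      by (simp, intro borel_Times) auto
    ultimately have "emeasure lborel ({0..1::real} \<times> {w0 + 1..w0 + 2}) = 0"
      by (simp add: AE_iff_measurable[OF _ refl])
    moreover have "emeasure lborel ({0..1::real} \<times> {w0 + 1..w0 + 2}) = 1"
      unfolding lborel_prod[symmetric] by (subst lborel.emeasure_pair_measure_Times) auto
    ultimately show False by simp
  qed
  moreover have "(\<integral>w. Psi_lim w \<partial>lborel) \<ge> 0" by (intro integral_nonneg_AE) (use P0 in auto)
  ultimately show ?thesis unfolding kappa_def using czeta_pos by (intro mult_pos_pos) auto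
qed

end

context haar_test
begin

lemma integrable_prod_phi: "integrable \<mu> (\<lambda>L. \<Prod>t<n. \<phi> (Xc (act (\<delta> (real t)) L) / T))"
proof (rule integrable_bounded)
  show "(\<lambda>L. \<Prod>t<n. \<phi> (Xc (act (\<delta> (real t)) L) / T)) \<in> borel_measurable \<mu>"
    by (intro ucont_meas ucont_prod ucont_phi_Xc)
  show "\<bar>\<Prod>t<n. \<phi> (Xc (act (\<delta> (real t)) L) / T)\<bar> \<le> 1" for L by (rule prod_phi_le)
qed

text \<open>The means are at most 1, hence so is their limit \<open>exp (- kappa)\<close>. This
  avoids the sign of \<open>Psi_lim\<close>, which is unclear when \<open>\<phi>\<close> changes
  sign.\<close>

lemma kappa_nonneg: "kappa \<ge> 0"
proof -
  have "(\<integral>L. (\<Prod>t<n. \<phi> (Xc (act (\<delta> (real t)) L) / real n)) \<partial>\<mu>) \<le> (\<integral>L. 1 \<partial>\<mu>)" for n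
  proof (rule integral_mono[OF integrable_prod_phi])
    show "(\<Prod>t<n. \<phi> (Xc (act (\<delta> (real t)) L) / real n)) \<le> 1" for L
      by (rule order_trans[OF abs_ge_self prod_phi_le])
  qed simp
  then have "exp (- kappa) \<le> (\<integral>L. 1 \<partial>\<mu>)" by (intro LIMSEQ_le_const2[OF char_limit]) blast
  then have "exp (- kappa) \<le> 1" by (simp add: prob_space)
  then show ?thesis by simp
qed

text \<open>As \<open>\<phi>\<close> may change sign, positivity is read off the functional of \<open>\<phi>\<^sup>2\<close>, whose integrand is nonnegative.\<close>

lemma kappa_pos:
  assumes s0: "s0 > 0" "\<And>s. 0 < s \<Longrightarrow> s < s0 \<Longrightarrow> \<bar>\<phi> s\<bar> < 1"
  shows "kappa > 0"
proof (rule ccontr)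
  assume "\<not> kappa > 0"
  then have k0: "kappa = 0" using kappa_nonneg by simp
  interpret q: test_fun "\<lambda>s. (\<phi> s)\<^sup>2" "2 * K" by (rule test_fun_square)
  interpret q: haar_test \<mu> "\<lambda>s. (\<phi> s)\<^sup>2" "2 * K" ..
  have "(\<phi> s)\<^sup>2 < 1" if "0 < s" "s < s0" for s using s0(2)[OF that] by (simp add: abs_square_less_1)
  then have q0: "q.kappa > 0" using s0(1) by (intro q.kappa_pos_nonneg[of s0]) auto
  define G where "G n L = (\<Prod>t<n. \<phi> (Xc (act (\<delta> (real t)) L) / real n))" for n L
  have iG: "integrable \<mu> (G n)" for n unfolding G_def by (rule integrable_prod_phi)
  have G2: "(\<Prod>t<n. (\<phi> (Xc (act (\<delta> (real t)) L) / real n))\<^sup>2) = (G n L)\<^sup>2" for n L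
    by (simp add: G_def prod_power_distrib)
  have iG2: "integrable \<mu> (\<lambda>L. (G n L)\<^sup>2)" for n using q.integrable_prod_phi[of "real n" n] unfolding G2 .
  have l1: "(\<lambda>n. \<integral>L. G n L \<partial>\<mu>) \<longlonglongrightarrow> 1" using char_limit by (simp add: k0 G_def)
  have l2: "(\<lambda>n. \<integral>L. (G n L)\<^sup>2 \<partial>\<mu>) \<longlonglongrightarrow> exp (- q.kappa)" using q.char_limit unfolding G2 .
  \<comment> \<open>From \<open>(G - 1)\<^sup>2 \<ge> 0\<close>: if the means of G tend to 1, those
    of its square cannot tend to the smaller value \<open>exp (- q.kappa)\<close>.\<close>
  have "2 * (\<integral>L. G n L \<partial>\<mu>) - 1 \<le> (\<integral>L. (G n L)\<^sup>2 \<partial>\<mu>)" for n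
  proof -
    have "2 * (\<integral>L. G n L \<partial>\<mu>) - 1 = (\<integral>L. 2 * G n L - 1 \<partial>\<mu>)" using iG by (simp add: prob_space)
    also have "\<dots> \<le> (\<integral>L. (G n L)\<^sup>2 \<partial>\<mu>)"
    proof (intro integral_mono iG2)
      show "integrable \<mu> (\<lambda>L. 2 * G n L - 1)" using iG by simp
      fix L have "0 \<le> (G n L - 1)\<^sup>2" by simp
      then show "2 * G n L - 1 \<le> (G n L)\<^sup>2" by (simp add: power2_eq_square algebra_simps)
    qed
    finally show ?thesis .
  qed
  then have "2 * 1 - 1 \<le> exp (- q.kappa)"
    by (intro LIMSEQ_le[OF tendsto_diff[OF tendsto_mult[OF tendsto_const l1] tendsto_const] l2]) auto
  then show False using q0 by simp
qed

end

section \<open>The characteristic function of the Cauchy law\<close>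

lemma exp_cos_integral:
  fixes t :: real
  shows "integrable lborel (\<lambda>x. indicator {0..} x * (exp (- x) * cos (t * x)))"
    and "(\<integral>x. indicator {0..} x * (exp (- x) * cos (t * x)) \<partial>lborel) = 1 / (1 + t\<^sup>2)"
proof -
  \<comment> \<open>Adding 1 to the cosine makes the integrand nonnegative, as the fundamental
    theorem for nonnegative integrals wants it; the added part is the case t = 0 up to a factor
    2.\<close>
  have *: "integrable lborel (\<lambda>x. indicator {0..} x * (exp (- x) * (1 + cos (t * x))))
    \<and> (\<integral>x. indicator {0..} x * (exp (- x) * (1 + cos (t * x))) \<partial>lborel) = 1 + 1 / (1 + t\<^sup>2)" for t :: real
  proof -
    have t1: "1 + t\<^sup>2 > 0" by (simp add: add_pos_nonneg)
    define c where "c = 1 / (1 + t\<^sup>2)"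
    have c: "c > 0" "c * (1 + t\<^sup>2) = 1" using t1 by (auto simp: c_def)
    define F where "F x = - exp (- x) + c * (exp (- x) * (t * sin (t * x) - cos (t * x)))" for x
    have nn: "0 \<le> exp (- x) * (1 + cos (t * x))" for x
    proof -
      have "0 \<le> 1 + cos (t * x)" using cos_ge_minus_one[of "t * x"] by linarith
      then show ?thesis by simp
    qed
    have "(\<integral>\<^sup>+x. ennreal (exp (- x) * (1 + cos (t * x))) * indicator {0..} x \<partial>lborel) = ennreal (0 - F 0)"
    proof (rule nn_integral_FTC_atLeast)
      show "(\<lambda>x. exp (- x) * (1 + cos (t * x))) \<in> borel_measurable borel" by measurable
      show "(F has_real_derivative exp (- x) * (1 + cos (t * x))) (at x)" for x
      proof -
        have "(F has_real_derivative exp (- x) + c * (exp (- x) * (t * (cos (t * x) * t) + sin (t * x) * t) - exp (- x) * (t * sin (t * x) - cos (t * x)))) (at x)"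
          unfolding F_def by (auto intro!: derivative_eq_intros simp: algebra_simps)
        moreover have "exp (- x) + c * (exp (- x) * (t * (cos (t * x) * t) + sin (t * x) * t) - exp (- x) * (t * sin (t * x) - cos (t * x)))
            = exp (- x) + exp (- x) * cos (t * x) * (c * (1 + t\<^sup>2))"
          by (simp add: algebra_simps power2_eq_square)
        moreover have "\<dots> = exp (- x) * (1 + cos (t * x))" unfolding c(2) by (simp add: algebra_simps)
        ultimately show ?thesis by simp
      qed
      show "(F \<longlongrightarrow> 0) at_top"
      proof (rule Lim_null_comparison)
        show "\<forall>\<^sub>F x in at_top. norm (F x) \<le> (1 + c * (\<bar>t\<bar> + 1)) * exp (- x)"
        proof (intro always_eventually allI)
          fix x
          have "\<bar>t * sin (t * x) - cos (t * x)\<bar> \<le> \<bar>t * sin (t * x)\<bar> + \<bar>cos (t * x)\<bar>" by (rule abs_triangle_ineq4)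
          also have "\<dots> \<le> \<bar>t\<bar> * 1 + 1" unfolding abs_mult by (intro add_mono mult_left_mono) auto
          finally have "c * (exp (- x) * \<bar>t * sin (t * x) - cos (t * x)\<bar>) \<le> c * (exp (- x) * (\<bar>t\<bar> + 1))"
            using c by (intro mult_left_mono) auto
          moreover have "\<bar>F x\<bar> \<le> exp (- x) + c * (exp (- x) * \<bar>t * sin (t * x) - cos (t * x)\<bar>)"
            unfolding F_def by (rule order_trans[OF abs_triangle_ineq]) (use c in \<open>simp add: abs_mult\<close>)
          ultimately show "norm (F x) \<le> (1 + c * (\<bar>t\<bar> + 1)) * exp (- x)" by (simp add: algebra_simps)
        qed
        have "((\<lambda>x::real. exp (- x)) \<longlongrightarrow> 0) at_top" by real_asymp
        from tendsto_mult[OF tendsto_const this] show "((\<lambda>x. (1 + c * (\<bar>t\<bar> + 1)) * exp (- x)) \<longlongrightarrow> 0) at_top" by simp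
      qed
    qed (rule nn)
    also have "0 - F 0 = 1 + 1 / (1 + t\<^sup>2)" by (simp add: F_def c_def)
    finally have e: "(\<integral>\<^sup>+x. ennreal (indicator {0..} x * (exp (- x) * (1 + cos (t * x)))) \<partial>lborel) = ennreal (1 + 1 / (1 + t\<^sup>2))"
      by (simp add: ennreal_mult' mult.commute ennreal_indicator nn)
    have "has_bochner_integral lborel (\<lambda>x. indicator {0..} x * (exp (- x) * (1 + cos (t * x)))) (1 + 1 / (1 + t\<^sup>2))"
      by (rule has_bochner_integral_nn_integral[OF _ _ _ e]) (use t1 nn in auto)
    then show ?thesis by (simp add: has_bochner_integral_iff)
  qed
  have i: "integrable lborel (\<lambda>x::real. indicator {0..} x * exp (- x))" "(\<integral>x. indicator {0..} x * exp (- x) \<partial>(lborel :: real measure)) = 1"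
    using *[of 0] by (auto simp: mult.assoc[symmetric])
  have eq: "indicator {0..} x * (exp (- x) * cos (t * x)) = indicator {0..} x * (exp (- x) * (1 + cos (t * x))) - indicator {0..} x * exp (- x)" for x
    by (simp add: algebra_simps)
  show "integrable lborel (\<lambda>x. indicator {0..} x * (exp (- x) * cos (t * x)))" unfolding eq using *[of t] i by simp
  show "(\<integral>x. indicator {0..} x * (exp (- x) * cos (t * x)) \<partial>lborel) = 1 / (1 + t\<^sup>2)"
    unfolding eq using *[of t] i by simp
qed

text \<open>The Laplace density has the Cauchy density as Fourier transform; Levy inversion swaps the two.\<close>

definition laplace :: "real measure" where
  "laplace = density lborel (\<lambda>x. ennreal (exp (- \<bar>x\<bar>) / 2))"

lemma even_integral:
  fixes f :: "real \<Rightarrow> real"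
  assumes [measurable]: "f \<in> borel_measurable borel" and ev: "\<And>x. f (- x) = f x"
    and i: "integrable lborel (\<lambda>x. indicator {0..} x * f x)"
  shows "integrable lborel f" "(\<integral>x. f x \<partial>lborel) = 2 * (\<integral>x. indicator {0..} x * f x \<partial>lborel)"
proof -
  define g where "g x = indicator {0..} x * f x" for x
  have ig: "integrable lborel g" using i by (simp add: g_def[abs_def])
  have ig': "integrable lborel (\<lambda>x. g (- x))" using lborel_integrable_real_affine[OF ig, of "- 1" 0] by simp
  have e': "(\<integral>x. g (- x) \<partial>lborel) = (\<integral>x. g x \<partial>lborel)" using lborel_integral_real_affine[of "- 1" g 0] by simp
  have ae: "AE x in lborel. g x + g (- x) = f x"
  proof -
    have "AE x in lborel. x \<noteq> (0::real)" by (rule AE_lborel_singleton)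
    then show ?thesis by eventually_elim (auto simp: g_def ev split: split_indicator)
  qed
  have [measurable]: "g \<in> borel_measurable borel" unfolding g_def by measurable
  have "integrable lborel (\<lambda>x. g x + g (- x))" using ig ig' by simp
  then show "integrable lborel f" by (subst integrable_cong_AE[OF _ _ AE_symmetric[OF ae]]) auto
  have "(\<integral>x. f x \<partial>lborel) = (\<integral>x. g x + g (- x) \<partial>lborel)" by (rule integral_cong_AE) (use ae in auto)
  also have "\<dots> = 2 * (\<integral>x. g x \<partial>lborel)" using ig ig' e' by simp
  finally show "(\<integral>x. f x \<partial>lborel) = 2 * (\<integral>x. indicator {0..} x * f x \<partial>lborel)" by (simp add: g_def)
qed

lemma laplace_cos:
  fixes t :: real
  shows "integrable lborel (\<lambda>x. exp (- \<bar>x\<bar>) / 2 * cos (t * x))" "(\<integral>x. exp (- \<bar>x\<bar>) / 2 * cos (t * x) \<partial>lborel) = 1 / (1 + t\<^sup>2)"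
proof -
  have eq: "indicator {0..} x * (exp (- \<bar>x\<bar>) / 2 * cos (t * x)) = (1 / 2) * (indicator {0..} x * (exp (- x) * cos (t * x)))" for x :: real
    by (auto split: split_indicator)
  have i: "integrable lborel (\<lambda>x. indicator {0..} x * (exp (- \<bar>x\<bar>) / 2 * cos (t * x)))"
    unfolding eq by (intro integrable_mult_right exp_cos_integral)
  show "integrable lborel (\<lambda>x. exp (- \<bar>x\<bar>) / 2 * cos (t * x))" by (rule even_integral(1)[OF _ _ i]) auto
  have "(\<integral>x. exp (- \<bar>x\<bar>) / 2 * cos (t * x) \<partial>lborel) = 2 * (\<integral>x. indicator {0..} x * (exp (- \<bar>x\<bar>) / 2 * cos (t * x)) \<partial>lborel)"
    by (rule even_integral(2)[OF _ _ i]) auto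
  then show "(\<integral>x. exp (- \<bar>x\<bar>) / 2 * cos (t * x) \<partial>lborel) = 1 / (1 + t\<^sup>2)" unfolding eq by (simp only: integral_mult_right_zero exp_cos_integral)
qed

lemma odd_integral:
  fixes f :: "real \<Rightarrow> real" assumes "\<And>x. f (- x) = - f x" shows "(\<integral>x. f x \<partial>lborel) = 0"
  using lborel_integral_real_affine[of "- 1" f 0] assms by simp

lemma integral_iexp:
  fixes f :: "real \<Rightarrow> real"
  assumes [measurable]: "f \<in> borel_measurable borel" and i: "integrable lborel f" and ev: "\<And>x. f (- x) = f x"
  shows "(CLBINT x. iexp (t * x) * f x) = complex_of_real (\<integral>x. f x * cos (t * x) \<partial>lborel)"
proof -
  have ic: "integrable lborel (\<lambda>x. f x * cos (t * x))" "integrable lborel (\<lambda>x. f x * sin (t * x))"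
    by (rule Bochner_Integration.integrable_bound[OF i]; auto intro!: AE_I2 simp: abs_mult mult_left_le)+
  have "(CLBINT x. iexp (t * x) * f x) = (CLBINT x. complex_of_real (f x * cos (t * x)) + \<i> * complex_of_real (f x * sin (t * x)))"
    by (intro Bochner_Integration.integral_cong refl) (simp add: complex_eq_iff Re_exp Im_exp)
  also have "\<dots> = complex_of_real (\<integral>x. f x * cos (t * x) \<partial>lborel) + \<i> * complex_of_real (\<integral>x. f x * sin (t * x) \<partial>lborel)"
  proof -
    have i1: "complex_integrable lborel (\<lambda>x. complex_of_real (f x * cos (t * x)))"
      and i2: "complex_integrable lborel (\<lambda>x. \<i> * complex_of_real (f x * sin (t * x)))"
      using ic by (intro integrable_of_real integrable_mult_right; simp)+
    show ?thesis by (simp only: Bochner_Integration.integral_add[OF i1 i2] integral_mult_right_zero integral_complex_of_real)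
  qed
  also have "(\<integral>x. f x * sin (t * x) \<partial>lborel) = 0" by (rule odd_integral) (simp add: ev)
  finally show ?thesis by simp
qed

lemma real_distribution_density:
  assumes [measurable]: "f \<in> borel_measurable borel" and "\<And>x. 0 \<le> f x" "integrable lborel f" "(\<integral>x. f x \<partial>lborel) = 1"
  shows "real_distribution (density lborel (\<lambda>x. ennreal (f x)))"
proof -
  have "prob_space (density lborel (\<lambda>x. ennreal (f x)))"
    by (rule prob_spaceI) (simp add: emeasure_density nn_integral_eq_integral assms)
  then show ?thesis by (simp add: real_distribution_def real_distribution_axioms_def)
qed

lemma laplace_integrable: "integrable lborel (\<lambda>x::real. exp (- \<bar>x\<bar>) / 2)"
  using laplace_cos(1)[of 0] by simp

interpretation laplace: real_distribution laplace
  unfolding laplace_def by (rule real_distribution_density) (use laplace_integrable laplace_cos(2)[of 0] in auto)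

lemma char_laplace: "char laplace t = complex_of_real (1 / (1 + t\<^sup>2))"
proof -
  have "char laplace t = (CLBINT x. (exp (- \<bar>x\<bar>) / 2) *\<^sub>R iexp (t * x))"
    unfolding char_def laplace_def by (rule integral_density) auto
  also have "\<dots> = (CLBINT x. iexp (t * x) * complex_of_real (exp (- \<bar>x\<bar>) / 2))"
    by (simp add: scaleR_conv_of_real mult.commute)
  also have "\<dots> = complex_of_real (\<integral>x. exp (- \<bar>x\<bar>) / 2 * cos (t * x) \<partial>lborel)"
    by (rule integral_iexp[OF _ laplace_integrable]) auto
  finally show ?thesis by (simp only: laplace_cos)
qed

lemma laplace_Ioc:
  assumes "0 \<le> a" "a \<le> b" shows "measure laplace {a<..b} = (exp (- a) - exp (- b)) / 2"
proof -
  have "emeasure laplace {a<..b} = (\<integral>\<^sup>+x. ennreal (exp (- \<bar>x\<bar>) / 2) * indicator {a<..b} x \<partial>lborel)"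
    unfolding laplace_def by (rule emeasure_density) auto
  also have "\<dots> = (\<integral>\<^sup>+x. ennreal (exp (- x) / 2) * indicator {a..b} x \<partial>lborel)"
  proof (rule nn_integral_cong_AE)
    have "AE x in lborel. x \<noteq> a" by (rule AE_lborel_singleton)
    then show "AE x in lborel. ennreal (exp (- \<bar>x\<bar>) / 2) * indicator {a<..b} x = ennreal (exp (- x) / 2) * indicator {a..b} x"
      by eventually_elim (use assms in \<open>auto split: split_indicator\<close>)
  qed
  also have "\<dots> = ennreal ((- exp (- b) / 2) - (- exp (- a) / 2))"
    using assms by (intro nn_integral_FTC_Icc[of _ a b "\<lambda>x. - exp (- x) / 2"]) (auto intro!: derivative_eq_intros simp flip: has_real_derivative_iff_has_vector_derivative)
  finally have "emeasure laplace {a<..b} = ennreal ((exp (- a) - exp (- b)) / 2)" by (simp add: diff_divide_distrib)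
  then show ?thesis using assms by (simp add: measure_def)
qed

lemma laplace_point: "measure laplace {a} = 0"
proof -
  have "emeasure laplace {a} = (\<integral>\<^sup>+x. ennreal (exp (- \<bar>x\<bar>) / 2) * indicator {a} x \<partial>lborel)"
    unfolding laplace_def by (rule emeasure_density) auto
  also have "\<dots> = 0" by simp
  finally show ?thesis by (simp add: measure_def)
qed

lemma inverse_quadratic_integrable: "integrable lborel (\<lambda>t::real. 1 / (1 + t\<^sup>2))"
  using integrable_inverse_1_plus_square by (simp add: set_integrable_def divide_inverse)

text \<open>The kernel of Levy inversion is bounded by the interval length because
  \<open>iexp\<close> is 1-Lipschitz; at t = 0 the quotient is 0 by the convention for
  division.\<close>

lemma iexp_diff_bound: "cmod ((iexp (- (t * a)) - iexp (- (t * b))) / (\<i> * t)) \<le> \<bar>b - a\<bar>"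
proof (cases "t = 0")
  case False
  have "iexp (- (t * a)) - iexp (- (t * b)) = iexp (- (t * b)) * (iexp (t * (b - a)) - 1)"
    by (simp add: algebra_simps flip: exp_add)
  then have "cmod (iexp (- (t * a)) - iexp (- (t * b))) = cmod (iexp (t * (b - a)) - 1)" by (simp add: norm_mult)
  also have "\<dots> \<le> \<bar>t * (b - a)\<bar>" using iexp_approx1[of "t * (b - a)" 0] by simp
  finally show ?thesis using False by (simp add: norm_divide norm_mult abs_mult divide_le_eq mult.commute)
qed simp

text \<open>Levy inversion gives the Laplace mass of the interval from a to a + h; dividing by h and
  letting h tend to 0 recovers the density at a.\<close>

lemma cos_inverse_quadratic:
  assumes a: "0 \<le> a"
  shows "(\<integral>x. 1 / (1 + x\<^sup>2) * cos (a * x) \<partial>lborel) = pi * exp (- a)"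
proof -
  define h where "h n = 1 / real (Suc n)" for n
  have h: "h n > 0" for n by (simp add: h_def)
  define F where "F n t = (iexp (- (t * a)) - iexp (- (t * (a + h n)))) / (\<i> * complex_of_real t) * char laplace t" for n t
  have Fm[measurable]: "F n \<in> borel_measurable borel" for n unfolding F_def by measurable
  have Fb: "cmod (F n t) \<le> h n * (1 / (1 + t\<^sup>2))" for n t
  proof -
    have "1 + t\<^sup>2 > 0" by (simp add: add_pos_nonneg)
    then have c: "cmod (char laplace t) = 1 / (1 + t\<^sup>2)" unfolding char_laplace norm_of_real by simp
    show ?thesis unfolding F_def norm_mult c using iexp_diff_bound[of t a "a + h n"] h[of n] by (intro mult_right_mono) auto
  qed
  have int: "(1 / (2 * pi)) * (CLBINT t. F n t) = complex_of_real ((exp (- a) - exp (- (a + h n))) / 2)" for n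
  proof -
    \<comment> \<open>The characteristic function is integrable, so the truncated integrals of Levy
      inversion converge to a genuine Lebesgue integral.\<close>
    have "(\<lambda>T::nat. CLBINT t. indicator {- real T<..<real T} t *\<^sub>R F n t) \<longlonglongrightarrow> (CLBINT t. F n t)"
    proof (rule integral_dominated_convergence[where w="\<lambda>t. h n * (1 / (1 + t\<^sup>2))"])
      show "integrable lborel (\<lambda>t. h n * (1 / (1 + t\<^sup>2)))" by (intro integrable_mult_right inverse_quadratic_integrable)
      show "AE t in lborel. (\<lambda>T. indicator {- real T<..<real T} t *\<^sub>R F n t) \<longlonglongrightarrow> F n t"
      proof (intro AE_I2 tendsto_eventually)
        fix t :: real
        obtain N where N: "\<bar>t\<bar> < real N" using reals_Archimedean2 by blast
        show "\<forall>\<^sub>F T in sequentially. indicator {- real T<..<real T} t *\<^sub>R F n t = F n t"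
          using eventually_ge_at_top[of N] by eventually_elim (use N in \<open>auto split: split_indicator\<close>)
      qed
      show "AE t in lborel. norm (indicator {- real T<..<real T} t *\<^sub>R F n t) \<le> h n * (1 / (1 + t\<^sup>2))" for T :: nat
        using Fb h[of n] by (intro AE_I2) (auto split: split_indicator intro: add_nonneg_nonneg)
    qed measurable
    moreover have "(CLBINT t=- real T..real T. F n t) = (CLBINT t. indicator {- real T<..<real T} t *\<^sub>R F n t)" for T :: nat
      by (simp add: interval_lebesgue_integral_le_eq set_lebesgue_integral_def einterval_eq)
    ultimately have "(\<lambda>T::nat. (1 / (2 * pi)) * (CLBINT t=- real T..real T. F n t)) \<longlonglongrightarrow> (1 / (2 * pi)) * (CLBINT t. F n t)"
      by (intro tendsto_mult tendsto_const) simp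
    moreover have "(\<lambda>T::nat. (1 / (2 * pi)) * (CLBINT t=- real T..real T. F n t)) \<longlonglongrightarrow> complex_of_real (measure laplace {a<..a + h n})"
      using laplace.Levy_Inversion[of a "a + h n"] h[of n] unfolding F_def by (simp add: laplace_point)
    ultimately show ?thesis using a h[of n] by (simp only: laplace_Ioc LIMSEQ_unique)
  qed
  have L1: "(\<lambda>n. CLBINT t. complex_of_real (real (Suc n)) * F n t) \<longlonglongrightarrow> (CLBINT t. iexp (- a * t) * complex_of_real (1 / (1 + t\<^sup>2)))"
  proof (rule integral_dominated_convergence[OF _ _ inverse_quadratic_integrable])
    show "AE t in lborel. (\<lambda>n. complex_of_real (real (Suc n)) * F n t) \<longlonglongrightarrow> iexp (- a * t) * complex_of_real (1 / (1 + t\<^sup>2))"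
    proof -
      have "AE t in lborel. t \<noteq> (0::real)" by (rule AE_lborel_singleton)
      then show ?thesis
      proof eventually_elim
        case (elim t)
        \<comment> \<open>The scaled kernel is a difference quotient of the exponential at 0 with
          increment \<open>z n\<close>.\<close>
        define z where "z n = - (\<i> * complex_of_real (t * h n))" for n
        have z0: "z n \<noteq> 0" for n using elim h[of n] by (simp add: z_def)
        have "h \<longlonglongrightarrow> 0" unfolding h_def using LIMSEQ_inverse_real_of_nat by (simp add: inverse_eq_divide)
        then have "z \<longlonglongrightarrow> - (\<i> * complex_of_real (t * 0))" unfolding z_def by (intro tendsto_intros)
        then have "filterlim z (at 0) sequentially" using z0 by (simp add: filterlim_at)
        from filterlim_compose[OF lim_exp_minus_1 this] have zl: "(\<lambda>n. (exp (z n) - 1) / z n) \<longlonglongrightarrow> 1" .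
        have eq: "complex_of_real (real (Suc n)) * F n t = iexp (- a * t) * ((exp (z n) - 1) / z n) * complex_of_real (1 / (1 + t\<^sup>2))" for n
        proof -
          have "iexp (- (t * (a + h n))) = iexp (- (t * a)) * exp (z n)" by (simp add: z_def algebra_simps flip: exp_add)
          then have "F n t = iexp (- (t * a)) * ((1 - exp (z n)) / (\<i> * complex_of_real t)) * complex_of_real (1 / (1 + t\<^sup>2))"
            unfolding F_def char_laplace by (simp add: algebra_simps diff_divide_distrib)
          then have "complex_of_real (real (Suc n)) * F n t
              = iexp (- (t * a)) * ((1 - exp (z n)) / (\<i> * complex_of_real t) * complex_of_real (real (Suc n))) * complex_of_real (1 / (1 + t\<^sup>2))"
            by (simp only: mult_ac)
          also have "(1 - exp (z n)) / (\<i> * complex_of_real t) * complex_of_real (real (Suc n)) = (exp (z n) - 1) / z n"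
            using elim z0[of n] unfolding z_def h_def by (simp add: field_simps del: of_nat_Suc)
          also have "- (t * a) = - a * t" by simp
          finally show ?thesis .
        qed
        show ?case unfolding eq
          using tendsto_mult[OF tendsto_mult[OF tendsto_const zl] tendsto_const, of "iexp (- a * t)" "complex_of_real (1 / (1 + t\<^sup>2))"]
          by (simp only: mult_1_right)
      qed
    qed
    show "AE t in lborel. norm (complex_of_real (real (Suc n)) * F n t) \<le> 1 / (1 + t\<^sup>2)" for n
    proof (rule AE_I2)
      fix t
      have "norm (complex_of_real (real (Suc n)) * F n t) \<le> real (Suc n) * (h n * (1 / (1 + t\<^sup>2)))"
        unfolding norm_mult norm_of_real using Fb[of n t] by (intro mult_mono) auto
      then show "norm (complex_of_real (real (Suc n)) * F n t) \<le> 1 / (1 + t\<^sup>2)" by (simp add: h_def del: of_nat_Suc)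
    qed
  qed measurable
  have L2: "(CLBINT t. complex_of_real (real (Suc n)) * F n t) = complex_of_real (real (Suc n) * (pi * (exp (- a) - exp (- (a + h n)))))" for n
  proof -
    have "(CLBINT t. F n t) = complex_of_real (pi * (exp (- a) - exp (- (a + h n))))"
      using int[of n] by (simp add: field_simps)
    then show ?thesis by (simp only: integral_mult_right_zero of_real_mult)
  qed
  have L3: "(\<lambda>n. real (Suc n) * (pi * (exp (- a) - exp (- (a + h n))))) \<longlonglongrightarrow> pi * exp (- a)"
    unfolding h_def by real_asymp
  have "(CLBINT t. iexp (- a * t) * complex_of_real (1 / (1 + t\<^sup>2))) = complex_of_real (pi * exp (- a))"
    by (rule LIMSEQ_unique[OF L1[unfolded L2] tendsto_of_real[OF L3]])
  moreover have "(CLBINT t. iexp (- a * t) * complex_of_real (1 / (1 + t\<^sup>2))) = complex_of_real (\<integral>t. 1 / (1 + t\<^sup>2) * cos (- a * t) \<partial>lborel)"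
    by (rule integral_iexp[OF _ inverse_quadratic_integrable]) auto
  ultimately have "complex_of_real (\<integral>t. 1 / (1 + t\<^sup>2) * cos (- a * t) \<partial>lborel) = complex_of_real (pi * exp (- a))" by metis
  then show ?thesis by (simp only: of_real_eq_iff mult_minus_left cos_minus)
qed

text \<open>The substitution \<open>x = c * y\<close> reduces to c = 1, and as the cosine is even, u
  may be replaced by its absolute value.\<close>

lemma cauchy:
  assumes c: "c > 0"
  defines "f \<equiv> \<lambda>x. c / (pi * (c\<^sup>2 + x\<^sup>2))"
  shows "real_distribution (density lborel (\<lambda>x. ennreal (f x)))"
    "char (density lborel (\<lambda>x. ennreal (f x))) u = complex_of_real (exp (- c * \<bar>u\<bar>))"
proof -
  have fm[measurable]: "f \<in> borel_measurable borel" unfolding f_def by measurable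
  have f0: "0 \<le> f x" for x using c by (simp add: f_def)
  have sc: "c * f (c * y) = 1 / pi * (1 / (1 + y\<^sup>2))" for y
  proof -
    have "c\<^sup>2 + (c * y)\<^sup>2 = c\<^sup>2 * (1 + y\<^sup>2)" by (simp add: algebra_simps power_mult_distrib)
    then have "f (c * y) = c / (pi * (c\<^sup>2 * (1 + y\<^sup>2)))" by (simp add: f_def)
    then show ?thesis using c by (simp add: power2_eq_square)
  qed
  have fi: "integrable lborel f"
  proof -
    have "integrable lborel (\<lambda>y. (1 / c) * (c * f (c * y)))" unfolding sc by (intro integrable_mult_right inverse_quadratic_integrable)
    then have "integrable lborel (\<lambda>y. f (0 + c * y))" using c by simp
    then show ?thesis using lborel_integrable_real_affine_iff[of c f 0] c by simp
  qed
  have co: "(\<integral>x. f x * cos (u * x) \<partial>lborel) = exp (- c * \<bar>u\<bar>)" for u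
  proof -
    have "(\<integral>x. f x * cos (u * x) \<partial>lborel) = c * (\<integral>y. f (c * y) * cos (u * (c * y)) \<partial>lborel)"
      using lborel_integral_real_affine[of c "\<lambda>x. f x * cos (u * x)" 0] c by simp
    also have "\<dots> = (\<integral>y. (c * f (c * y)) * cos (u * (c * y)) \<partial>lborel)" by (simp add: mult.assoc)
    also have "\<dots> = (\<integral>y. 1 / pi * (1 / (1 + y\<^sup>2) * cos ((c * \<bar>u\<bar>) * y)) \<partial>lborel)"
    proof (intro Bochner_Integration.integral_cong refl)
      fix y
      have "cos (u * (c * y)) = cos ((c * \<bar>u\<bar>) * y)" by (cases "u \<ge> 0") (simp_all add: mult_ac)
      then show "(c * f (c * y)) * cos (u * (c * y)) = 1 / pi * (1 / (1 + y\<^sup>2) * cos ((c * \<bar>u\<bar>) * y))" unfolding sc by simp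
    qed
    also have "\<dots> = 1 / pi * (pi * exp (- (c * \<bar>u\<bar>)))"
      using c by (subst integral_mult_right_zero, subst cos_inverse_quadratic) auto
    finally show ?thesis by simp
  qed
  show "real_distribution (density lborel (\<lambda>x. ennreal (f x)))"
    using co[of 0] by (intro real_distribution_density f0 fi fm) simp
  have "char (density lborel (\<lambda>x. ennreal (f x))) u = (CLBINT x. f x *\<^sub>R iexp (u * x))"
    unfolding char_def by (rule integral_density) (auto simp: f0)
  also have "\<dots> = (CLBINT x. iexp (u * x) * complex_of_real (f x))" by (simp add: scaleR_conv_of_real mult.commute)
  also have "\<dots> = complex_of_real (\<integral>x. f x * cos (u * x) \<partial>lborel)" by (rule integral_iexp[OF fm fi]) (simp add: f_def)
  finally show "char (density lborel (\<lambda>x. ennreal (f x))) u = complex_of_real (exp (- c * \<bar>u\<bar>))" by (simp only: co)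
qed

lemma centered_cauchy_char:
  assumes "c \<ge> 0"
  shows "real_distribution (centered_cauchy c)" "char (centered_cauchy c) u = complex_of_real (exp (- c * \<bar>u\<bar>))"
proof -
  have "real_distribution (return borel (0::real))"
    by (simp add: real_distribution_def real_distribution_axioms_def prob_space_return)
  moreover have "char (return borel (0::real)) u = 1"
    unfolding char_def by (subst integral_return) auto
  ultimately show "real_distribution (centered_cauchy c)" "char (centered_cauchy c) u = complex_of_real (exp (- c * \<bar>u\<bar>))"
    using assms cauchy[of c] by (auto simp: centered_cauchy_def)
qed

section \<open>The random averages\<close>

lemma abs_cos_diff_le: "\<bar>cos a - cos b\<bar> \<le> \<bar>a - b\<bar>" for a b :: real
proof -
  have "\<bar>cos a - cos b\<bar> = 2 * (\<bar>sin ((a + b) / 2)\<bar> * \<bar>sin ((b - a) / 2)\<bar>)"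
    by (simp add: cos_diff_cos abs_mult)
  also have "\<dots> \<le> 2 * (1 * \<bar>(b - a) / 2\<bar>)" by (intro mult_left_mono mult_mono abs_sin_x_le_abs_x) auto
  finally show ?thesis by simp
qed

lemma one_minus_cos: "1 - cos x = 2 * (sin (x / 2))\<^sup>2" for x :: real
  using cos_double_sin[of "x / 2"] by simp

lemma one_minus_cos_le: "1 - cos x \<le> x\<^sup>2" for x :: real
proof -
  have "(sin (x / 2))\<^sup>2 \<le> (x / 2)\<^sup>2" using abs_sin_x_le_abs_x[of "x / 2"] by (rule abs_le_square_iff[THEN iffD1])
  then have "1 - cos x \<le> x\<^sup>2 / 2" unfolding one_minus_cos[of x] by (simp add: power_divide)
  moreover have "x\<^sup>2 / 2 \<le> x\<^sup>2" by simp
  ultimately show ?thesis by (rule order_trans)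
qed

text \<open>The complement of the support is the union of all open null sets. By Lindelof countably
  many of them suffice, so the law is carried by its support, which is bounded.\<close>

lemma compact_support_bounded:
  assumes X: "X \<in> borel_measurable P" and c: "compact_support_rv P X"
  obtains M where "M \<ge> 0" "AE \<omega> in P. \<bar>X \<omega>\<bar> \<le> M"
proof -
  define D where "D = distr P borel X"
  define \<F> where "\<F> = {U. open U \<and> emeasure D U = 0}"
  obtain \<F>' where F: "\<F>' \<subseteq> \<F>" "countable \<F>'" "\<Union>\<F>' = \<Union>\<F>"
    using Lindelof_openin[of \<F> UNIV] by (auto simp: \<F>_def)
  have "(\<Union>U\<in>\<F>'. U) \<in> null_sets D"
    using F by (intro null_sets_UN') (auto simp: \<F>_def D_def null_sets_def)
  then have "\<Union>\<F> \<in> null_sets D" using F by simp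
  then have "AE x in D. x \<notin> \<Union>\<F>" by (rule AE_not_in)
  moreover have "x \<in> measure_support D" if "x \<notin> \<Union>\<F>" for x
    using that unfolding measure_support_def \<F>_def by (auto simp: zero_less_iff_neq_zero)
  ultimately have ae: "AE x in D. x \<in> measure_support D" by (auto elim: eventually_mono)
  have "bounded (measure_support D)" using c by (simp add: compact_support_rv_def D_def compact_imp_bounded)
  then obtain M where M: "\<And>x. x \<in> measure_support D \<Longrightarrow> \<bar>x\<bar> \<le> M" by (auto simp: bounded_iff)
  have "AE x in D. \<bar>x\<bar> \<le> \<bar>M\<bar>" using ae by eventually_elim (use M in force)
  then have "AE \<omega> in P. \<bar>X \<omega>\<bar> \<le> \<bar>M\<bar>" unfolding D_def by (rule AE_distrD[OF X])
  then show ?thesis using that[of "\<bar>M\<bar>"] by simp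
qed

context prob_space
begin

text \<open>The real part of the characteristic function; for symmetric \<open>X\<close> it is all
  of it, by \<open>char_symmetric\<close>.\<close>

definition cosf :: "('a \<Rightarrow> real) \<Rightarrow> real \<Rightarrow> real" where "cosf X s = expectation (\<lambda>\<omega>. cos (s * X \<omega>))"

lemma integrable_cos: "X \<in> borel_measurable M \<Longrightarrow> integrable M (\<lambda>\<omega>. cos (s * X \<omega>))" for s :: real
  by (rule integrable_const_bound[of _ 1]) auto

lemma test_fun_cosf:
  assumes X[measurable]: "X \<in> borel_measurable M" and B: "B \<ge> 0" "AE \<omega> in M. \<bar>X \<omega>\<bar> \<le> B"
  shows "test_fun (cosf X) (1 + B + B\<^sup>2)"
proof
  show "\<bar>cosf X s\<bar> \<le> 1" for s
  proof -
    have "\<bar>cosf X s\<bar> \<le> expectation (\<lambda>\<omega>. \<bar>cos (s * X \<omega>)\<bar>)" unfolding cosf_def by (rule integral_abs_bound)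
    also have "\<dots> \<le> expectation (\<lambda>\<omega>. 1)" by (intro integral_mono integrable_abs integrable_cos) auto
    finally show ?thesis by (simp add: prob_space)
  qed
  show "1 - cosf X s \<le> (1 + B + B\<^sup>2) * s\<^sup>2" for s
  proof -
    have "1 - cosf X s = expectation (\<lambda>\<omega>. 1 - cos (s * X \<omega>))"
      unfolding cosf_def using integrable_cos[OF X] by (simp add: prob_space)
    also have "\<dots> \<le> expectation (\<lambda>\<omega>. (1 + B + B\<^sup>2) * s\<^sup>2)"
    proof (rule integral_mono_AE)
      show "AE \<omega> in M. 1 - cos (s * X \<omega>) \<le> (1 + B + B\<^sup>2) * s\<^sup>2" using B(2)
      proof eventually_elim
        case (elim \<omega>)
        have "1 - cos (s * X \<omega>) \<le> (X \<omega>)\<^sup>2 * s\<^sup>2" using one_minus_cos_le[of "s * X \<omega>"] by (simp add: power_mult_distrib mult.commute)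
        also have "(X \<omega>)\<^sup>2 \<le> B\<^sup>2" using power_mono[OF elim, of 2] by simp
        then have "(X \<omega>)\<^sup>2 * s\<^sup>2 \<le> (1 + B + B\<^sup>2) * s\<^sup>2" using B by (intro mult_right_mono) auto
        finally show ?case .
      qed
    qed (use integrable_cos[OF X] in auto)
    finally show ?thesis by (simp add: prob_space)
  qed
  show "\<bar>cosf X s - cosf X t\<bar> \<le> (1 + B + B\<^sup>2) * \<bar>s - t\<bar>" for s t
  proof -
    have "cosf X s - cosf X t = expectation (\<lambda>\<omega>. cos (s * X \<omega>) - cos (t * X \<omega>))"
      unfolding cosf_def using integrable_cos[OF X] by simp
    then have "\<bar>cosf X s - cosf X t\<bar> \<le> expectation (\<lambda>\<omega>. \<bar>cos (s * X \<omega>) - cos (t * X \<omega>)\<bar>)" by (simp add: integral_abs_bound)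
    also have "\<dots> \<le> expectation (\<lambda>\<omega>. (1 + B + B\<^sup>2) * \<bar>s - t\<bar>)"
    proof (rule integral_mono_AE)
      show "AE \<omega> in M. \<bar>cos (s * X \<omega>) - cos (t * X \<omega>)\<bar> \<le> (1 + B + B\<^sup>2) * \<bar>s - t\<bar>" using B(2)
      proof eventually_elim
        case (elim \<omega>)
        have "\<bar>cos (s * X \<omega>) - cos (t * X \<omega>)\<bar> \<le> \<bar>s * X \<omega> - t * X \<omega>\<bar>" by (rule abs_cos_diff_le)
        also have "\<dots> = \<bar>X \<omega>\<bar> * \<bar>s - t\<bar>" by (simp add: abs_mult mult.commute flip: left_diff_distrib)
        also have "\<dots> \<le> (1 + B + B\<^sup>2) * \<bar>s - t\<bar>" using elim zero_le_power2[of B] by (intro mult_right_mono order_trans[OF elim]) auto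
        finally show ?case .
      qed
    qed (use integrable_cos[OF X] in auto)
    finally show ?thesis by (simp add: prob_space)
  qed
  show "1 \<le> 1 + B + B\<^sup>2" using B by simp
qed

lemma char_symmetric:
  assumes X[measurable]: "X \<in> borel_measurable M" and sym: "symmetric_rv M X"
  shows "char (distr M borel X) s = complex_of_real (cosf X s)"
proof -
  have isin: "integrable M (\<lambda>\<omega>. sin (s * X \<omega>))" by (rule integrable_const_bound[of _ 1]) auto
  have "expectation (\<lambda>\<omega>. sin (s * X \<omega>)) = (\<integral>x. sin (s * x) \<partial>distr M borel X)" by (simp add: integral_distr)
  also have "\<dots> = (\<integral>x. sin (s * x) \<partial>distr M borel (\<lambda>\<omega>. - X \<omega>))" using sym by (simp add: symmetric_rv_def)
  also have "\<dots> = - expectation (\<lambda>\<omega>. sin (s * X \<omega>))" by (simp add: integral_distr)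
  finally have z: "expectation (\<lambda>\<omega>. sin (s * X \<omega>)) = 0" by simp
  have "char (distr M borel X) s = (CLINT \<omega>|M. iexp (s * X \<omega>))" unfolding char_def by (subst integral_distr) auto
  also have "\<dots> = (CLINT \<omega>|M. complex_of_real (cos (s * X \<omega>)) + \<i> * complex_of_real (sin (s * X \<omega>)))"
    by (intro Bochner_Integration.integral_cong refl) (simp add: complex_eq_iff Re_exp Im_exp)
  also have "\<dots> = complex_of_real (cosf X s) + \<i> * complex_of_real (expectation (\<lambda>\<omega>. sin (s * X \<omega>)))"
  proof -
    have i1: "complex_integrable M (\<lambda>\<omega>. complex_of_real (cos (s * X \<omega>)))"
      and i2: "complex_integrable M (\<lambda>\<omega>. \<i> * complex_of_real (sin (s * X \<omega>)))"
      using isin integrable_cos[OF X] by (intro integrable_of_real integrable_mult_right; simp)+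
    show ?thesis
      by (simp only: Bochner_Integration.integral_add[OF i1 i2] integral_mult_right_zero integral_complex_of_real cosf_def)
  qed
  finally show ?thesis by (simp add: z)
qed

lemma cosf_degenerate:
  assumes "AE \<omega> in M. X \<omega> = 0" "X \<in> borel_measurable M" shows "cosf X s = 1"
proof -
  have "cosf X s = expectation (\<lambda>\<omega>. 1)" unfolding cosf_def
    using assms by (intro integral_cong_AE) (auto elim: eventually_mono)
  then show ?thesis by (simp add: prob_space)
qed

text \<open>For such s the variable \<open>s * X\<close> stays in [-1, 1], where the cosine is
  nonnegative and equals 1 only at 0. For larger s the absolute value can return to 1: signs with
  equal probability give \<open>cos s\<close>.\<close>

lemma cosf_lt_1:
  assumes X[measurable]: "X \<in> borel_measurable M" and B: "B \<ge> 0" "AE \<omega> in M. \<bar>X \<omega>\<bar> \<le> B"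
    and nd: "\<not> (AE \<omega> in M. X \<omega> = 0)" and s: "0 < s" "s < 1 / (B + 1)"
  shows "\<bar>cosf X s\<bar> < 1"
proof -
  have small: "AE \<omega> in M. \<bar>s * X \<omega>\<bar> \<le> 1" using B(2)
  proof eventually_elim
    case (elim \<omega>)
    have "\<bar>s * X \<omega>\<bar> = s * \<bar>X \<omega>\<bar>" using s by (simp add: abs_mult)
    also have "\<dots> \<le> (1 / (B + 1)) * (B + 1)" using s elim B by (intro mult_mono) auto
    finally show ?case using B by simp
  qed
  have ic: "integrable M (\<lambda>\<omega>. 1 - cos (s * X \<omega>))" using integrable_cos[OF X] by simp
  have eq: "1 - cosf X s = expectation (\<lambda>\<omega>. 1 - cos (s * X \<omega>))"
    unfolding cosf_def using integrable_cos[OF X] by (simp add: prob_space)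
  have "0 \<le> cosf X s" unfolding cosf_def
  proof (rule integral_nonneg_AE)
    show "AE \<omega> in M. 0 \<le> cos (s * X \<omega>)" using small
    proof eventually_elim
      case (elim \<omega>)
      then show ?case using pi_gt3 by (intro cos_ge_zero) auto
    qed
  qed
  moreover have "cosf X s \<noteq> 1"
  proof
    assume "cosf X s = 1"
    then have "expectation (\<lambda>\<omega>. 1 - cos (s * X \<omega>)) = 0" using eq by simp
    then have "AE \<omega> in M. 1 - cos (s * X \<omega>) = 0" using integral_nonneg_eq_0_iff_AE[OF ic] by simp
    then have "AE \<omega> in M. X \<omega> = 0" using small
    proof eventually_elim
      case (elim \<omega>)
      then have "sin (s * X \<omega> / 2) = 0" using one_minus_cos[of "s * X \<omega>"] by simp
      moreover have "- pi < s * X \<omega> / 2" "s * X \<omega> / 2 < pi" using elim(2) pi_gt3 by linarith+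
      ultimately have "s * X \<omega> / 2 = 0" using sin_eq_0_pi by blast
      then show ?case using s by simp
    qed
    then show False using nd by simp
  qed
  moreover have "cosf X s \<le> 1"
  proof -
    have "0 \<le> 1 - cosf X s" unfolding eq by (intro integral_nonneg_AE AE_I2) simp
    then show ?thesis by simp
  qed
  ultimately show ?thesis by simp
qed

end

text \<open>For fixed L the average is a linear combination of independent variables with nonrandom
  coefficients; Fubini integrates over \<open>\<omega>\<close> first.\<close>

lemma char_S:
  fixes P :: "'a measure" and \<theta> :: "nat \<Rightarrow> 'a \<Rightarrow> real"
  assumes P: "prob_space P" and haar: "haar \<mu>"
    and meas: "\<And>t. \<theta> t \<in> borel_measurable P"
    and char: "\<And>t s. char (distr P borel (\<theta> t)) s = complex_of_real (\<phi> s)"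
    and ind: "prob_space.indep_vars P (\<lambda>_. borel) \<theta> UNIV"
  shows "real_distribution (distr (P \<Otimes>\<^sub>M \<mu>) borel (\<lambda>(\<omega>, L). S \<theta> \<omega> L T))"
    "char (distr (P \<Otimes>\<^sub>M \<mu>) borel (\<lambda>(\<omega>, L). S \<theta> \<omega> L T)) u
      = complex_of_real (\<integral>L. (\<Prod>t<T. \<phi> (u * (Xc (act (\<delta> (real t)) L) / real T))) \<partial>\<mu>)"
proof -
  interpret Q: prob_space P by (rule P)
  interpret haar \<mu> by (rule haar)
  interpret pair_prob_space P \<mu> ..
  note meas[measurable]
  have [measurable]: "(\<lambda>L. lattice_norm (act (\<delta> t) L)) \<in> borel_measurable \<mu>" for t
    by (rule measurable_compose[OF act_measurable[OF delta_in] measurable_lattice_norm])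
  have Sm[measurable]: "(\<lambda>(\<omega>, L). S \<theta> \<omega> L T) \<in> borel_measurable (P \<Otimes>\<^sub>M \<mu>)"
    unfolding S_def by measurable
  have "prob_space (distr (P \<Otimes>\<^sub>M \<mu>) borel (\<lambda>(\<omega>, L). S \<theta> \<omega> L T))" by (rule prob_space_distr[OF Sm])
  then show "real_distribution (distr (P \<Otimes>\<^sub>M \<mu>) borel (\<lambda>(\<omega>, L). S \<theta> \<omega> L T))"
    by (simp add: real_distribution_def real_distribution_axioms_def)
  define c where "c L t = Xc (act (\<delta> (real t)) L) / real T" for L t
  have S_eq: "S \<theta> \<omega> L T = (\<Sum>t<T. c L t * \<theta> t \<omega>)" for \<omega> L
    by (simp add: S_def c_def Xc_def sum_distrib_left mult.commute)
  have inner: "(CLINT \<omega>|P. iexp (u * S \<theta> \<omega> L T)) = complex_of_real (\<Prod>t<T. \<phi> (u * c L t))" for L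
  proof -
    have "Q.indep_vars (\<lambda>_. borel) \<theta> {..<T}" by (rule Q.indep_vars_subset[OF ind]) simp
    then have iv: "Q.indep_vars (\<lambda>_. borel) (\<lambda>t \<omega>. c L t * \<theta> t \<omega>) {..<T}"
      by (rule Q.indep_vars_compose2[where Y="\<lambda>t x. c L t * x"]) simp
    have "(CLINT \<omega>|P. iexp (u * S \<theta> \<omega> L T)) = char (distr P borel (\<lambda>\<omega>. \<Sum>t<T. c L t * \<theta> t \<omega>)) u"
      unfolding char_def S_eq by (subst integral_distr) auto
    also have "\<dots> = (\<Prod>t<T. char (distr P borel (\<lambda>\<omega>. c L t * \<theta> t \<omega>)) u)" by (rule Q.char_distr_sum[OF iv])
    also have "\<dots> = (\<Prod>t<T. complex_of_real (\<phi> (u * c L t)))"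
    proof (intro prod.cong refl)
      fix t
      have "char (distr P borel (\<lambda>\<omega>. c L t * \<theta> t \<omega>)) u = char (distr P borel (\<theta> t)) (u * c L t)"
        unfolding char_def by (subst (1 2) integral_distr) (auto simp: mult.assoc)
      then show "char (distr P borel (\<lambda>\<omega>. c L t * \<theta> t \<omega>)) u = complex_of_real (\<phi> (u * c L t))" by (simp only: char)
    qed
    finally show ?thesis by simp
  qed
  have m: "(\<lambda>(\<omega>, L). iexp (u * S \<theta> \<omega> L T)) \<in> borel_measurable (P \<Otimes>\<^sub>M \<mu>)"
    using Sm unfolding case_prod_beta' by measurable
  have int: "complex_integrable (P \<Otimes>\<^sub>M \<mu>) (\<lambda>(\<omega>, L). iexp (u * S \<theta> \<omega> L T))"
    by (rule P.integrable_const_bound[of _ 1, OF _ m]) auto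
  have "char (distr (P \<Otimes>\<^sub>M \<mu>) borel (\<lambda>(\<omega>, L). S \<theta> \<omega> L T)) u = (CLINT x|(P \<Otimes>\<^sub>M \<mu>). (\<lambda>(\<omega>, L). iexp (u * S \<theta> \<omega> L T)) x)"
    unfolding char_def using Sm by (subst integral_distr) (auto simp: case_prod_beta')
  also have "\<dots> = (CLINT L|\<mu>. (CLINT \<omega>|P. iexp (u * S \<theta> \<omega> L T)))"
    using integral_snd[OF int] by simp
  also have "\<dots> = complex_of_real (\<integral>L. (\<Prod>t<T. \<phi> (u * c L t)) \<partial>\<mu>)"
    unfolding inner by (rule integral_complex_of_real)
  finally show "char (distr (P \<Otimes>\<^sub>M \<mu>) borel (\<lambda>(\<omega>, L). S \<theta> \<omega> L T)) u
      = complex_of_real (\<integral>L. (\<Prod>t<T. \<phi> (u * (Xc (act (\<delta> (real t)) L) / real T))) \<partial>\<mu>)" by (simp only: c_def)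
qed

theorem mainTheorem2:
  fixes P :: "'a measure" and \<mu> :: "(real^2) set measure"
    and \<theta> :: "nat \<Rightarrow> 'a \<Rightarrow> real"
  assumes "prob_space P"
    and "is_haar_prob \<mu>"
    and "\<And>t. compact_support_rv P (\<theta> t)"
    and "\<And>t. symmetric_rv P (\<theta> t)"
    and "\<And>t. distr P borel (\<theta> t) = distr P borel (\<theta> 0)"
    and "prob_space.indep_vars P (\<lambda>_. borel) \<theta> UNIV"
  shows "\<exists>c\<ge>0. (c = 0 \<longleftrightarrow> (AE \<omega> in P. \<theta> 0 \<omega> = 0)) \<and>
           weak_conv_m
             (\<lambda>T. distr (P \<Otimes>\<^sub>M \<mu>) borel (\<lambda>(\<omega>, L). S \<theta> \<omega> L T))
             (centered_cauchy c)"
proof -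
  interpret P: prob_space P by fact
  have h: "haar \<mu>" by standard fact
  have meas[measurable]: "\<theta> t \<in> borel_measurable P" for t using assms(6) by (auto simp: P.indep_vars_def)
  obtain B where B: "B \<ge> 0" "AE \<omega> in P. \<bar>\<theta> 0 \<omega>\<bar> \<le> B"
    using compact_support_bounded[OF meas assms(3)] by blast
  define \<phi> where "\<phi> = P.cosf (\<theta> 0)"
  define K where "K = 1 + B + B\<^sup>2"
  have tf: "test_fun \<phi> K" unfolding \<phi>_def K_def by (rule P.test_fun_cosf[OF meas B])
  then interpret test_fun \<phi> K .
  interpret haar_test \<mu> \<phi> K using h tf by (rule haar_test.intro)
  have char: "char (distr P borel (\<theta> t)) s = complex_of_real (\<phi> s)" for t s
    using P.char_symmetric[OF meas assms(4), of 0 s] assms(5)[of t] by (simp add: \<phi>_def)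
  define D where "D T = distr (P \<Otimes>\<^sub>M \<mu>) borel (\<lambda>(\<omega>, L). S \<theta> \<omega> L T)" for T
  \<comment> \<open>\<open>kappa_scale\<close> covers positive factors only; evenness reduces u to
    its absolute value.\<close>
  have ev: "\<phi> (- s) = \<phi> s" for s by (simp add: \<phi>_def P.cosf_def)
  have lim: "(\<lambda>T. char (D T) u) \<longlonglongrightarrow> complex_of_real (exp (- kappa * \<bar>u\<bar>))" for u
  proof -
    have eq: "char (D T) u = complex_of_real (\<integral>L. (\<Prod>t<T. \<phi> (\<bar>u\<bar> * (Xc (act (\<delta> (real t)) L) / real T))) \<partial>\<mu>)" for T
    proof -
      have "\<phi> (u * x) = \<phi> (\<bar>u\<bar> * x)" for x using ev[of "u * x"] by (cases "u \<ge> 0") auto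
      then show ?thesis unfolding D_def char_S(2)[OF assms(1) h meas char assms(6)] by (simp only:)
    qed
    have "(\<lambda>T. \<integral>L. (\<Prod>t<T. \<phi> (\<bar>u\<bar> * (Xc (act (\<delta> (real t)) L) / real T))) \<partial>\<mu>) \<longlonglongrightarrow> exp (- kappa * \<bar>u\<bar>)"
    proof (cases "u = 0")
      case True
      have "\<phi> 0 = 1" by (simp add: \<phi>_def P.cosf_def P.prob_space)
      then show ?thesis using True by (simp add: prob_space)
    next
      case False
      then have u: "\<bar>u\<bar> > 0" by simp
      interpret u: haar_test \<mu> "\<lambda>s. \<phi> (\<bar>u\<bar> * s)" "K * (1 + \<bar>u\<bar> + \<bar>u\<bar>\<^sup>2)"
        using h test_fun_scale[OF u] by (rule haar_test.intro)
      show ?thesis using u.char_limit unfolding kappa_scale[OF u] by (simp add: mult.commute)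
    qed
    then show ?thesis unfolding eq by (rule tendsto_of_real)
  qed
  have "weak_conv_m D (centered_cauchy kappa)"
  proof (rule levy_continuity)
    show "real_distribution (D T)" for T unfolding D_def by (rule char_S(1)[OF assms(1) h meas char assms(6)])
    show "real_distribution (centered_cauchy kappa)" by (rule centered_cauchy_char(1)[OF kappa_nonneg])
    show "(\<lambda>T. char (D T) u) \<longlonglongrightarrow> char (centered_cauchy kappa) u" for u
      unfolding centered_cauchy_char(2)[OF kappa_nonneg] by (rule lim)
  qed
  moreover have "kappa = 0 \<longleftrightarrow> (AE \<omega> in P. \<theta> 0 \<omega> = 0)"
  proof
    assume "AE \<omega> in P. \<theta> 0 \<omega> = 0"
    then have "\<phi> s = 1" for s unfolding \<phi>_def by (rule P.cosf_degenerate[OF _ meas])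
    then have "Psi b w = 0" for b w by (simp add: Psi_def)
    then show "kappa = 0" by (simp add: kappa_def Psi_lim_def)
  next
    assume k: "kappa = 0"
    show "AE \<omega> in P. \<theta> 0 \<omega> = 0"
    proof (rule ccontr)
      assume nd: "\<not> (AE \<omega> in P. \<theta> 0 \<omega> = 0)"
      \<comment> \<open>The bound \<open>1 / (B + 1)\<close> is the range of s on which
        \<open>cosf_lt_1\<close> applies.\<close>
      have "kappa > 0"
        by (rule kappa_pos[of "1 / (B + 1)"]) (use B(1) P.cosf_lt_1[OF meas B nd] in \<open>auto simp: \<phi>_def\<close>)
      then show False using k by simp
    qed
  qed
  ultimately show ?thesis using kappa_nonneg unfolding D_def by blast
qed

end
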